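(* Let $\Omega\subseteq\mathbb{R}^n$ be a smooth bounded open set, let $\Lambda>0$ and $f\in L^1(\Omega)$. For $\delta>0$ and $u\in L^1(\Omega)$ let $$K_\delta(u,\Omega)=\delta^{n-1}\sup_{\mathcal G_\delta}\sum_{Q'\in\mathcal G_\delta}⨍_{Q'}\Big|u(x)-⨍_{Q'}u\Big|\,dx,\qquad F_\delta(u,\Omega)=K_\delta(u,\Omega)+\Lambda\int_\Omega|f-u|\,dx,$$ where $⨍$ denotes the integral average and the supremum is over all families $\mathcal G_\delta$ of pairwise disjoint cubes $Q'\subset\Omega$ of side length $\delta$ with arbitrary orientation. For $u\in L^1(\Omega)\cap BV(\Omega)$ let $$F(u,\Omega)=\frac14|Du|(\Omega)+\Lambda\int_\Omega|f-u|\,dx.$$ Let $\{\delta_\varepsilon\}$ and $\{\tau_\varepsilon\}$ be two positive sequences converging to $0$ as $\varepsilon\to0$, and let $\{u_\varepsilon\}\subset L^1(\Omega)$ be equi-bounded in $L^1(\Omega)$ and such that $$F_{\delta_\varepsilon}(u_\varepsilon,\Omega)\le\inf_{u\in L^1(\Omega)}F_{\delta_\varepsilon}(u,\Omega)+\tau_\varepsilon .$$ Then there exists a subsequence $\{u_{\varepsilon_k}\}$ of $\{u_\varepsilon\}$ such that $u_{\varepsilon_k}$ converges in $L^1(\Omega)$ to some $u_0$, where $u_0$ is a minimizer of the functional $F(\cdot,\Omega)$ on $L^1(\Omega)\cap BV(\Omega)$.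
   Context: $BV(\Omega)$ is the space of $u\in L^1(\Omega)$ with finite total variation $|Du|(\Omega)$. The functionals $K_\delta$ and $F_\delta$ take values in $[0,+\infty]$; the supremum over families is $0$ if no cube of side $\delta$ is contained in $\Omega$. A subsequence means $\varepsilon_k\to0$ as $k\to\infty$. *)

theory Defs
  imports "HOL-Analysis.Analysis"
begin

text \<open>
  Functions on \<open>\<Omega>\<close> are represented by total functions on \<open>real ^ 'n\<close> whose values
  outside \<open>\<Omega>\<close> are irrelevant; elements of \<open>L\<^sup>1\<close> are not identified almost everywhere,
  but all functionals below depend only on the a.e. class on \<open>\<Omega>\<close>.
\<close>

definition L1 :: "(real ^ 'n) set \<Rightarrow> (real ^ 'n \<Rightarrow> real) set"
  where "L1 \<Omega> = {u. u absolutely_integrable_on \<Omega>}"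

definition L1_dist :: "(real ^ 'n) set \<Rightarrow> (real ^ 'n \<Rightarrow> real) \<Rightarrow> (real ^ 'n \<Rightarrow> real) \<Rightarrow> real"
  where "L1_dist \<Omega> u v = (LINT x:\<Omega>|lebesgue. \<bar>u x - v x\<bar>)"

text \<open>\<open>Ck_on k S f\<close>: \<open>f\<close> is of class \<open>C\<^sup>k\<close> on the open set \<open>S\<close>.\<close>

fun Ck_on :: "nat \<Rightarrow> 'a::euclidean_space set \<Rightarrow> ('a \<Rightarrow> 'b::real_normed_vector) \<Rightarrow> bool"
  where
    "Ck_on 0 S f \<longleftrightarrow> continuous_on S f"
  | "Ck_on (Suc k) S f \<longleftrightarrow>
       (\<forall>x\<in>S. f differentiable (at x)) \<and>
       (\<forall>v. Ck_on k S (\<lambda>x. frechet_derivative f (at x) v))"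

text \<open>
  Near each boundary point, after a rotation taking \<open>\<nu>\<close> to the last coordinate vector,
  \<open>\<Omega>\<close> is the region on one side of the graph of a \<open>C\<^sup>\<infinity>\<close> function of the remaining
  \<open>n - 1\<close> coordinates. As there is no type \<open>real ^ ('n - 1)\<close>, the graph function is taken
  to be smooth on the whole space and is evaluated only at the orthogonal projection of the
  point onto the hyperplane \<open>\<nu>\<^sup>\<bottom>\<close>.
\<close>

definition smooth_boundary :: "(real ^ 'n) set \<Rightarrow> bool"
  where "smooth_boundary \<Omega> \<longleftrightarrow>
    (\<forall>p\<in>frontier \<Omega>. \<exists>r>0. \<exists>\<nu>. \<exists>\<gamma> :: real ^ 'n \<Rightarrow> real.
       norm \<nu> = 1 \<and> (\<forall>k. Ck_on k UNIV \<gamma>) \<and>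
       \<Omega> \<inter> ball p r = {x \<in> ball p r. \<gamma> (x - (x \<bullet> \<nu>) *\<^sub>R \<nu>) < x \<bullet> \<nu>})"

text \<open>Open cubes of side \<open>\<delta>\<close> with arbitrary position and orientation.\<close>

definition cubes :: "real \<Rightarrow> (real ^ 'n) set set"
  where "cubes \<delta> =
    {(\<lambda>x. a + T x) ` box 0 (\<chi> i. \<delta>)
     | a (T :: real ^ 'n \<Rightarrow> real ^ 'n). orthogonal_transformation T}"

definition cube_families :: "real \<Rightarrow> (real ^ 'n) set \<Rightarrow> (real ^ 'n) set set set"
  where "cube_families \<delta> \<Omega> =
    {G. G \<subseteq> cubes \<delta> \<and> (\<forall>Q\<in>G. Q \<subseteq> \<Omega>) \<and> pairwise disjnt G}"

definition avg :: "(real ^ 'n) set \<Rightarrow> (real ^ 'n \<Rightarrow> real) \<Rightarrow> real"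
  where "avg Q u = (LINT x:Q|lebesgue. u x) / measure lebesgue Q"

definition K :: "real \<Rightarrow> (real ^ 'n) set \<Rightarrow> (real ^ 'n \<Rightarrow> real) \<Rightarrow> ennreal"
  where "K \<delta> \<Omega> u = ennreal (\<delta> ^ (CARD('n) - 1)) *
    (SUP G\<in>cube_families \<delta> \<Omega>. \<Sum>\<^sub>\<infinity>Q\<in>G. ennreal (avg Q (\<lambda>x. \<bar>u x - avg Q u\<bar>)))"

definition F\<^sub>\<delta> ::
  "real \<Rightarrow> (real ^ 'n \<Rightarrow> real) \<Rightarrow> real \<Rightarrow> (real ^ 'n) set \<Rightarrow> (real ^ 'n \<Rightarrow> real) \<Rightarrow> ennreal"
  where "F\<^sub>\<delta> \<Lambda> f \<delta> \<Omega> u = K \<delta> \<Omega> u + ennreal (\<Lambda> * L1_dist \<Omega> f u)"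

definition divergence :: "(real ^ 'n \<Rightarrow> real ^ 'n) \<Rightarrow> real ^ 'n \<Rightarrow> real"
  where "divergence \<phi> x = (\<Sum>i\<in>UNIV. frechet_derivative \<phi> (at x) (axis i 1) $ i)"

definition test_fields :: "(real ^ 'n) set \<Rightarrow> (real ^ 'n \<Rightarrow> real ^ 'n) set"
  where "test_fields \<Omega> =
    {\<phi>. Ck_on 1 UNIV \<phi> \<and> compact (closure {x. \<phi> x \<noteq> 0}) \<and>
        closure {x. \<phi> x \<noteq> 0} \<subseteq> \<Omega> \<and> (\<forall>x. norm (\<phi> x) \<le> 1)}"

text \<open>
  The truncation of negative reals to \<open>0\<close> by \<^const>\<open>ennreal\<close> does not affect the supremum,
  since the zero field is a test field.
\<close>

definition total_variation :: "(real ^ 'n) set \<Rightarrow> (real ^ 'n \<Rightarrow> real) \<Rightarrow> ennreal"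
  where "total_variation \<Omega> u =
    (SUP \<phi>\<in>test_fields \<Omega>. ennreal (LINT x:\<Omega>|lebesgue. u x * divergence \<phi> x))"

definition BV :: "(real ^ 'n) set \<Rightarrow> (real ^ 'n \<Rightarrow> real) set"
  where "BV \<Omega> = {u \<in> L1 \<Omega>. total_variation \<Omega> u < \<infinity>}"

definition F ::
  "real \<Rightarrow> (real ^ 'n \<Rightarrow> real) \<Rightarrow> (real ^ 'n) set \<Rightarrow> (real ^ 'n \<Rightarrow> real) \<Rightarrow> ennreal"
  where "F \<Lambda> f \<Omega> u = total_variation \<Omega> u / 4 + ennreal (\<Lambda> * L1_dist \<Omega> f u)"

end

theory Submission
  imports Defs "HOL-Library.Diagonal_Subsequence"
begin

text \<open>
  Averaging over the position of a lattice of cubes bounds \<open>\<integral>\<bar>u (x + h) - u x\<bar> dx\<close> on compact subsets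
  of \<open>\<Omega>\<close> by a multiple of \<open>\<bar>h\<bar> * K \<delta> \<Omega> u\<close> for \<open>\<bar>h\<bar> \<ge> \<delta>\<close>. Hence near-minimizers, which have bounded
  \<open>K\<close>, are locally compact in \<open>L\<^sup>1\<close>. The mean of \<open>\<bar>\<xi> \<bullet> (x - c)\<bar>\<close> over a cube of side \<open>\<delta>\<close> centred at
  \<open>c\<close> is at most \<open>\<delta> * \<bar>\<xi>\<bar> / 4\<close>, with equality if \<open>\<xi>\<close> is parallel to an edge. Since \<open>K\<close> does not
  increase under mollification (on a smaller domain), choosing on each cell of a fine grid the orientation of the mollified
  gradient gives the lower bound; mollifying a \<open>BV\<close> function away from the boundary gives the
  upper bound.

  The fidelity term upgrades local to global convergence: the two bounds force
  \<open>\<integral>\<bar>f - u\<bar>\<close> to converge along the sequence to its value at the limit, and with pointwise convergence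
  Scheffe's lemma applies, so no mass concentrates at the boundary.
\<close>

section \<open>Rigid motions and cubes\<close>

text \<open>\<open>K \<delta>\<close> sees a function only at scale \<delta> and above, and the
  near-minimizers need not have bounded variation, so \<open>BV\<close> compactness does not apply
  to them. Hence a mollification scale \<eta> is held fixed while \<delta> tends to 0. Distances
  carry the weight \<open>infdist x (- \<Omega>)\<close>: one integral then expresses convergence on
  all compact subsets and tolerates the missing control at the boundary.

  The factor 1/4 is a maximum over directions. It is found by integrating out the coordinates of the
  cube one at a time and comparing the absolute value with a quadratic whose integral is the claimed
  bound. The comparison fails pointwise but survives averaging over symmetric windows.

  A constant recovery sequence fails in general: a cube halved by a jump of height 1 has mean
  oscillation 1/2, so a flat jump costs about 1/2 per unit area and not 1/4. Smoothing at a scale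
  that stays fixed as \<delta> shrinks removes this, but a mollification needs room and cannot reach
  the boundary; the unsmoothed function has to be kept there, at a cost made small by a thin
  layer.\<close>

lemma nn_integral_lborel_translate:
  fixes g :: "'a::euclidean_space \<Rightarrow> ennreal"
  assumes [measurable]: "g \<in> borel_measurable borel"
  shows "(\<integral>\<^sup>+x. g (a + x) \<partial>lborel) = (\<integral>\<^sup>+x. g x \<partial>lborel)"
proof -
  have "(\<integral>\<^sup>+x. g x \<partial>lborel) = (\<integral>\<^sup>+x. g x \<partial>distr lborel borel ((+) a))"
    by (simp add: lborel_distr_plus)
  then show ?thesis by (simp add: nn_integral_distr)
qed

lemma nn_integral_lborel_reflect:
  fixes g :: "'a::euclidean_space \<Rightarrow> ennreal"
  assumes [measurable]: "g \<in> borel_measurable borel"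
  shows "(\<integral>\<^sup>+x. g (a - x) \<partial>lborel) = (\<integral>\<^sup>+x. g x \<partial>lborel)"
proof -
  have "(\<integral>\<^sup>+x. g x \<partial>lborel) = (\<integral>\<^sup>+x. g (a - x) \<partial>lborel)"
    by (subst lborel_affine[of "-1" a]) (simp_all add: nn_integral_density nn_integral_distr)
  then show ?thesis by simp
qed

text \<open>Uniqueness of Haar measure, tested against the rotation invariant unit ball.\<close>

lemma distr_lborel_orthogonal:
  fixes T :: "'a::euclidean_space \<Rightarrow> 'a"
  assumes T: "orthogonal_transformation T"
  shows "distr lborel borel T = lborel"
proof -
  have lin: "linear T" using T by (rule orthogonal_transformation_linear)
  have m[measurable]: "T \<in> borel_measurable borel"
    using lin by (simp add: borel_measurable_continuous_onI linear_continuous_on linear_conv_bounded_linear)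
  define \<mu> where "\<mu> = distr lborel borel T"
  have [simp, measurable_cong]: "sets \<mu> = sets borel" by (simp add: \<mu>_def)
  have surj: "surj T" by (rule orthogonal_transformation_surj[OF T])
  have vim: "T -` ball 0 r = ball 0 r" for r
    by (auto simp: orthogonal_transformation_norm[OF T])
  have ball: "emeasure \<mu> (ball 0 r) = emeasure lborel (ball (0::'a) r)" for r
    unfolding \<mu>_def by (subst emeasure_distr) (auto simp: vim)
  \<comment> \<open>Needed for exchanging integrals with \<open>lborel\<close>. Balls about 0
    exhaust the space and are mapped onto themselves by \<open>T\<close>.\<close>
  have "sigma_finite_measure \<mu>"
  proof
    show "\<exists>A. countable A \<and> A \<subseteq> sets \<mu> \<and> \<Union> A = space \<mu> \<and> (\<forall>a\<in>A. emeasure \<mu> a \<noteq> \<infinity>)"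
    proof (intro exI conjI)
      show "countable (range (\<lambda>n::nat. ball (0::'a) (real n)))" by simp
      show "\<Union> (range (\<lambda>n::nat. ball (0::'a) (real n))) = space \<mu>"
        by (auto simp: \<mu>_def reals_Archimedean2)
    qed (auto simp: ball emeasure_ball)
  qed
  then interpret \<mu>: sigma_finite_measure \<mu> .
  interpret P: pair_sigma_finite lborel \<mu> ..
  have trans: "(\<integral>\<^sup>+y. g (a + y) \<partial>\<mu>) = (\<integral>\<^sup>+y. g y \<partial>\<mu>)"
    if [measurable]: "g \<in> borel_measurable borel" for g :: "'a \<Rightarrow> ennreal" and a
  proof -
    \<comment> \<open>Translating by \<open>T b\<close> after \<open>T\<close> is the same as
      applying \<open>T\<close> after translating by \<open>b\<close>, so \<mu> inherits the
      translation invariance of \<open>lborel\<close>.\<close>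
    obtain b where b: "a = T b" using surj by auto
    have "(\<integral>\<^sup>+y. g (a + y) \<partial>\<mu>) = (\<integral>\<^sup>+y. g (T (b + y)) \<partial>lborel)"
      unfolding \<mu>_def b by (subst nn_integral_distr) (auto simp: linear_add[OF lin])
    also have "\<dots> = (\<integral>\<^sup>+y. g (T y) \<partial>lborel)"
      by (rule nn_integral_lborel_translate) measurable
    also have "\<dots> = (\<integral>\<^sup>+y. g y \<partial>\<mu>)"
      unfolding \<mu>_def by (subst nn_integral_distr) auto
    finally show ?thesis .
  qed
  define B where "B = ball (0::'a) 1"
  have [measurable]: "B \<in> sets borel" by (simp add: B_def)
  have sym: "indicator B (y - x) = (indicator B (x - y) :: ennreal)" for x y
    by (auto simp: indicator_def B_def norm_minus_commute)
  show ?thesis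
  proof (rule measure_eqI)
    fix A :: "'a set" assume "A \<in> sets (distr lborel borel T)"
    then have [measurable]: "A \<in> sets borel" by simp
    \<comment> \<open>Shifting \<open>x\<close> by \<open>y\<close>, exchanging the integrals,
      shifting \<open>y\<close> back by \<open>x\<close> and finally reflecting \<open>x\<close>
      swaps the measures attached to \<open>A\<close> and \<open>B\<close>. Both measures agree on
      the ball \<open>B\<close>, whose measure is positive and finite and can be cancelled.\<close>
    have "emeasure lborel A * emeasure \<mu> B = (\<integral>\<^sup>+y. (\<integral>\<^sup>+x. indicator A x * indicator B y \<partial>lborel) \<partial>\<mu>)"
      by (simp add: nn_integral_multc nn_integral_cmult_indicator)
    also have "\<dots> = (\<integral>\<^sup>+y. (\<integral>\<^sup>+x. indicator A (y + x) * indicator B y \<partial>lborel) \<partial>\<mu>)"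
    proof (rule nn_integral_cong)
      fix y :: 'a
      show "(\<integral>\<^sup>+x. indicator A x * indicator B y \<partial>lborel) = (\<integral>\<^sup>+x. indicator A (y + x) * indicator B y \<partial>lborel)"
        using nn_integral_lborel_translate[of "\<lambda>x. indicator A x * indicator B y" y] by simp
    qed
    also have "\<dots> = (\<integral>\<^sup>+x. (\<integral>\<^sup>+y. indicator A (y + x) * indicator B y \<partial>\<mu>) \<partial>lborel)"
      by (rule P.Fubini') measurable
    also have "\<dots> = (\<integral>\<^sup>+x. (\<integral>\<^sup>+y. indicator A y * indicator B (y - x) \<partial>\<mu>) \<partial>lborel)"
    proof (rule nn_integral_cong)
      fix x :: 'a
      show "(\<integral>\<^sup>+y. indicator A (y + x) * indicator B y \<partial>\<mu>) = (\<integral>\<^sup>+y. indicator A y * indicator B (y - x) \<partial>\<mu>)"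
        using trans[of "\<lambda>y. indicator A y * indicator B (y - x)" x] by (simp add: add.commute)
    qed
    also have "\<dots> = (\<integral>\<^sup>+y. (\<integral>\<^sup>+x. indicator A y * indicator B (y - x) \<partial>lborel) \<partial>\<mu>)"
      by (rule P.Fubini'[symmetric]) measurable
    also have "\<dots> = (\<integral>\<^sup>+y. (\<integral>\<^sup>+x. indicator A y * indicator B x \<partial>lborel) \<partial>\<mu>)"
    proof (rule nn_integral_cong)
      fix y :: 'a
      show "(\<integral>\<^sup>+x. indicator A y * indicator B (y - x) \<partial>lborel) = (\<integral>\<^sup>+x. indicator A y * indicator B x \<partial>lborel)"
        using nn_integral_lborel_reflect[of "\<lambda>x. indicator A y * indicator B x" y] by simp
    qed
    also have "\<dots> = emeasure \<mu> A * emeasure lborel B"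
      by (simp add: nn_integral_cmult nn_integral_multc)
    finally have "emeasure lborel A * emeasure lborel B = emeasure \<mu> A * emeasure lborel B"
      by (simp add: ball B_def)
    moreover have "emeasure lborel B \<noteq> 0" "emeasure lborel B \<noteq> top"
      using unit_ball_vol_pos[of "real DIM('a)"] by (auto simp: B_def emeasure_ball simp del: unit_ball_vol_pos)
    ultimately show "emeasure (distr lborel borel T) A = emeasure lborel A"
      using ennreal_mult_cancel_left[of "emeasure lborel B" "emeasure lborel A" "emeasure \<mu> A"]
      by (auto simp: \<mu>_def[symmetric] mult.commute)
  qed simp
qed

lemma distr_lborel_rigid:
  fixes T :: "'a::euclidean_space \<Rightarrow> 'a"
  assumes T: "orthogonal_transformation T"
  shows "distr lborel borel (\<lambda>x. a + T x) = lborel"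
proof -
  have [measurable]: "T \<in> borel_measurable borel"
    using orthogonal_transformation_linear[OF T]
    by (simp add: borel_measurable_continuous_onI linear_continuous_on linear_conv_bounded_linear)
  have "distr (distr lborel borel T) borel ((+) a) = distr lborel borel (\<lambda>x. a + T x)"
    by (subst distr_distr) (auto simp: comp_def)
  then show ?thesis by (simp add: distr_lborel_orthogonal[OF T] lborel_distr_plus)
qed

lemma borel_measurable_rigid:
  fixes T :: "'a::euclidean_space \<Rightarrow> 'a"
  assumes T: "orthogonal_transformation T"
  shows "T \<in> borel_measurable borel"
  using orthogonal_transformation_linear[OF T]
  by (simp add: borel_measurable_continuous_onI linear_continuous_on linear_conv_bounded_linear)

lemma nn_integral_rigid:
  fixes g :: "'a::euclidean_space \<Rightarrow> ennreal" and T :: "'a \<Rightarrow> 'a"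
  assumes [measurable]: "g \<in> borel_measurable borel" and T: "orthogonal_transformation T"
  shows "(\<integral>\<^sup>+x. g (a + T x) \<partial>lborel) = (\<integral>\<^sup>+x. g x \<partial>lborel)"
proof -
  note [measurable] = borel_measurable_rigid[OF T]
  have "(\<integral>\<^sup>+x. g x \<partial>lborel) = (\<integral>\<^sup>+x. g x \<partial>distr lborel borel (\<lambda>x. a + T x))"
    by (simp add: distr_lborel_rigid[OF T])
  then show ?thesis by (simp add: nn_integral_distr)
qed

lemma integral_rigid:
  fixes g :: "'a::euclidean_space \<Rightarrow> 'b::{banach, second_countable_topology}" and T :: "'a \<Rightarrow> 'a"
  assumes [measurable]: "g \<in> borel_measurable borel" and T: "orthogonal_transformation T"
  shows "(\<integral>x. g (a + T x) \<partial>lborel) = (\<integral>x. g x \<partial>lborel)"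
proof -
  note [measurable] = borel_measurable_rigid[OF T]
  have "(\<integral>x. g x \<partial>lborel) = (\<integral>x. g x \<partial>distr lborel borel (\<lambda>x. a + T x))"
    by (simp add: distr_lborel_rigid[OF T])
  then show ?thesis by (simp add: integral_distr)
qed

lemma integrable_rigid:
  fixes g :: "'a::euclidean_space \<Rightarrow> 'b::{banach, second_countable_topology}" and T :: "'a \<Rightarrow> 'a"
  assumes "integrable lborel g" and T: "orthogonal_transformation T"
  shows "integrable lborel (\<lambda>x. g (a + T x))"
proof -
  note [measurable] = borel_measurable_rigid[OF T]
  have "integrable (distr lborel borel (\<lambda>x. a + T x)) g"
    using assms(1) by (simp add: distr_lborel_rigid[OF T])
  moreover have "g \<in> borel_measurable borel" using assms(1) by simp
  ultimately show ?thesis by (subst (asm) integrable_distr_eq) auto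
qed

text \<open>Naming a cube by its corner \<open>a\<close> and its frame \<open>T\<close> gives access
  to the sliding families of cubes, with \<open>T\<close> fixed and \<open>a\<close> variable, over
  which all averages are taken.\<close>

definition ocube :: "real ^ 'n \<Rightarrow> (real ^ 'n \<Rightarrow> real ^ 'n) \<Rightarrow> real \<Rightarrow> (real ^ 'n) set"
  where "ocube a T \<delta> = (\<lambda>x. a + T x) ` box 0 (\<chi> i. \<delta>)"

lemma cubes_ocube: "cubes \<delta> = {ocube a T \<delta> | a T. orthogonal_transformation T}"
  by (simp add: cubes_def ocube_def)

lemma mem_box_cube: "(x :: real ^ 'n) \<in> box 0 (\<chi> i. \<delta>) \<longleftrightarrow> (\<forall>i. 0 < x $ i \<and> x $ i < \<delta>)"
  by (auto simp: mem_box_cart)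

lemma ocube_iff:
  assumes T: "orthogonal_transformation T"
  shows "a + T x \<in> ocube a T \<delta> \<longleftrightarrow> x \<in> box 0 (\<chi> i. \<delta>)"
  using orthogonal_transformation_inj[OF T] by (auto simp: ocube_def inj_eq)

lemma ocube_vimage:
  assumes T: "orthogonal_transformation T"
  shows "ocube a T \<delta> = (\<lambda>x. inv T (x - a)) -` box 0 (\<chi> i. \<delta>)"
proof -
  have "bij T" by (rule orthogonal_transformation_bij[OF T])
  then have "x \<in> ocube a T \<delta> \<longleftrightarrow> inv T (x - a) \<in> box 0 (\<chi> i. \<delta>)" for x
    using ocube_iff[OF T, of a "inv T (x - a)" \<delta>] by (simp add: bij_is_surj surj_f_inv_f)
  then show ?thesis by auto
qed

lemma open_ocube:
  assumes T: "orthogonal_transformation T"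
  shows "open (ocube a T \<delta>)"
proof -
  have "linear (inv T)"
    using orthogonal_transformation_inv[OF T] by (rule orthogonal_transformation_linear)
  then have "continuous_on UNIV (\<lambda>x. inv T (x - a))"
    by (intro continuous_on_compose2[OF linear_continuous_on[of "inv T" UNIV]] continuous_intros)
       (auto simp: linear_conv_bounded_linear)
  then show ?thesis
    unfolding ocube_vimage[OF T] by (intro open_vimage) auto
qed

lemma ocube_borel [measurable]: "orthogonal_transformation T \<Longrightarrow> ocube a T \<delta> \<in> sets borel"
  using open_ocube by (intro borel_open)

lemma convex_ocube:
  assumes T: "orthogonal_transformation T"
  shows "convex (ocube a T \<delta>)"
proof -
  have "ocube a T \<delta> = (+) a ` (T ` box 0 (\<chi> i. \<delta>))" by (auto simp: ocube_def)
  then show ?thesis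
    using orthogonal_transformation_linear[OF T]
    by (simp add: convex_linear_image convex_translation del: image_image)
qed

lemma norm_vec_le_sqrt:
  fixes x :: "real ^ 'n"
  assumes "\<And>i. \<bar>x $ i\<bar> \<le> c"
  shows "norm x \<le> sqrt CARD('n) * c"
proof -
  have c: "0 \<le> c" using assms[of undefined] by linarith
  have "norm x = sqrt (\<Sum>i\<in>UNIV. (x $ i)\<^sup>2)" by (simp add: norm_vec_def L2_set_def)
  also have "\<dots> \<le> sqrt (\<Sum>i\<in>(UNIV::'n set). c\<^sup>2)"
    using assms c by (intro real_sqrt_le_mono sum_mono) (metis abs_le_square_iff abs_of_nonneg)
  also have "\<dots> = sqrt CARD('n) * c" using c by (simp add: real_sqrt_mult)
  finally show ?thesis .
qed

lemma ocube_diam: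
  fixes a :: "real ^ 'n"
  assumes T: "orthogonal_transformation T" and "x \<in> ocube a T \<delta>" "y \<in> ocube a T \<delta>"
  shows "norm (x - y) \<le> sqrt CARD('n) * \<delta>"
proof -
  obtain p q where p: "p \<in> box 0 (\<chi> i. \<delta>)" "x = a + T p" and q: "q \<in> box 0 (\<chi> i. \<delta>)" "y = a + T q"
    using assms by (auto simp: ocube_def)
  have "norm (x - y) = norm (p - q)"
    using p q orthogonal_transformation_linear[OF T]
    by (simp add: linear_diff[symmetric] orthogonal_transformation_norm[OF T])
  also have "\<dots> \<le> sqrt CARD('n) * \<delta>"
  proof (rule norm_vec_le_sqrt)
    fix i
    have "0 < p $ i" "p $ i < \<delta>" "0 < q $ i" "q $ i < \<delta>" using p q by (auto simp: mem_box_cube)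
    then show "\<bar>(p - q) $ i\<bar> \<le> \<delta>" by simp
  qed
  finally show ?thesis .
qed

text \<open>The corner \<open>a\<close> is not a point of the open cube, so
  \<open>ocube_diam\<close> does not cover this case.\<close>

lemma ocube_near:
  fixes a :: "real ^ 'n"
  assumes T: "orthogonal_transformation T" and "x \<in> ocube a T \<delta>"
  shows "norm (x - a) \<le> sqrt CARD('n) * \<delta>"
proof -
  obtain p where p: "p \<in> box 0 (\<chi> i. \<delta>)" "x = a + T p"
    using assms by (auto simp: ocube_def)
  have "norm (x - a) = norm p"
    using p by (simp add: orthogonal_transformation_norm[OF T])
  also have "\<dots> \<le> sqrt CARD('n) * \<delta>"
    using p by (intro norm_vec_le_sqrt) (auto simp: mem_box_cube abs_of_pos intro: less_imp_le)
  finally show ?thesis .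
qed

lemma emeasure_cube_box:
  assumes "\<delta> > 0"
  shows "emeasure lborel (box 0 (\<chi> i. \<delta>) :: (real ^ 'n) set) = ennreal (\<delta> ^ CARD('n))"
proof -
  have "emeasure lborel (box 0 (\<chi> i. \<delta>) :: (real ^ 'n) set) = (\<Prod>b\<in>Basis. ((\<chi> i. \<delta>) - (0 :: real ^ 'n)) \<bullet> b)"
    using assms by (intro emeasure_lborel_box) (auto simp: Basis_vec_def inner_axis)
  also have "(\<Prod>b\<in>Basis. ((\<chi> i. \<delta>) - (0 :: real ^ 'n)) \<bullet> b) = (\<Prod>b\<in>(Basis :: (real ^ 'n) set). \<delta>)"
    by (rule prod.cong) (auto simp: Basis_vec_def inner_axis)
  finally show ?thesis by simp
qed

lemma emeasure_ocube:
  assumes T: "orthogonal_transformation T" and "\<delta> > 0"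
  shows "emeasure lborel (ocube a T \<delta> :: (real ^ 'n) set) = ennreal (\<delta> ^ CARD('n))"
proof -
  have "emeasure lborel (ocube a T \<delta>) = (\<integral>\<^sup>+x. indicator (ocube a T \<delta>) x \<partial>lborel)"
    using T by (simp add: ocube_borel)
  also have "\<dots> = (\<integral>\<^sup>+x. indicator (ocube a T \<delta>) (a + T x) \<partial>lborel)"
    using T by (intro nn_integral_rigid[symmetric]) (auto simp: ocube_borel)
  also have "\<dots> = (\<integral>\<^sup>+x. indicator (box 0 (\<chi> i. \<delta>)) (x :: real ^ 'n) \<partial>lborel)"
    by (intro nn_integral_cong) (simp add: indicator_def ocube_iff[OF T])
  finally show ?thesis using assms by (simp add: emeasure_cube_box)
qed

lemma measure_ocube:
  assumes T: "orthogonal_transformation T" and "\<delta> > 0"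
  shows "measure lborel (ocube a T \<delta> :: (real ^ 'n) set) = \<delta> ^ CARD('n)"
  using emeasure_ocube[OF assms, of a] assms by (simp add: measure_def)

text \<open>\<open>avg\<close> is defined with Lebesgue measure, while Fubini and changes of
  variables run over \<open>lborel\<close>. For Borel data the completion changes nothing.\<close>

lemma avg_borel:
  assumes [measurable]: "Q \<in> sets borel" "U \<in> borel_measurable borel"
  shows "avg Q U = (LINT x:Q|lborel. U x) / measure lborel Q"
proof -
  have "(\<integral>x. indicator Q x *\<^sub>R U x \<partial>lebesgue) = (\<integral>x. indicator Q x *\<^sub>R U x \<partial>lborel)"
    by (rule integral_completion) measurable
  moreover have "measure lebesgue Q = measure lborel Q" by (rule measure_completion) simp
  ultimately show ?thesis by (simp only: avg_def set_lebesgue_integral_def)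
qed

lemma set_integral_ocube:
  fixes U :: "real ^ 'n \<Rightarrow> real"
  assumes T: "orthogonal_transformation T" and [measurable]: "U \<in> borel_measurable borel"
  shows "(LINT x:ocube a T \<delta>|lborel. U x) = (LINT x:box 0 (\<chi> i. \<delta>)|lborel. U (a + T x))"
proof -
  note [measurable] = ocube_borel[OF T]
  have "(LINT x:ocube a T \<delta>|lborel. U x) = (\<integral>x. indicator (ocube a T \<delta>) (a + T x) *\<^sub>R U (a + T x) \<partial>lborel)"
    using integral_rigid[OF _ T, of "\<lambda>x. indicator (ocube a T \<delta>) x *\<^sub>R U x" a]
    by (simp add: set_lebesgue_integral_def)
  moreover have "indicator (ocube a T \<delta>) (a + T x) = (indicator (box 0 (\<chi> i. \<delta>)) x :: real)" for x
    by (simp add: indicator_def ocube_iff[OF T])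
  ultimately show ?thesis
    by (simp only: set_lebesgue_integral_def)
qed

lemma set_nn_integral_ocube:
  fixes U :: "real ^ 'n \<Rightarrow> ennreal"
  assumes T: "orthogonal_transformation T" and [measurable]: "U \<in> borel_measurable borel"
  shows "(\<integral>\<^sup>+x\<in>ocube a T \<delta>. U x \<partial>lborel) = (\<integral>\<^sup>+x\<in>box 0 (\<chi> i. \<delta>). U (a + T x) \<partial>lborel)"
proof -
  note [measurable] = ocube_borel[OF T]
  have "(\<integral>\<^sup>+x\<in>ocube a T \<delta>. U x \<partial>lborel) = (\<integral>\<^sup>+x. U (a + T x) * indicator (ocube a T \<delta>) (a + T x) \<partial>lborel)"
    using nn_integral_rigid[OF _ T, of "\<lambda>x. U x * indicator (ocube a T \<delta>) x" a] by simp
  moreover have "indicator (ocube a T \<delta>) (a + T x) = (indicator (box 0 (\<chi> i. \<delta>)) x :: ennreal)" for x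
    by (simp add: indicator_def ocube_iff[OF T])
  ultimately show ?thesis by simp
qed

lemma avg_ocube:
  fixes U :: "real ^ 'n \<Rightarrow> real"
  assumes T: "orthogonal_transformation T" and [measurable]: "U \<in> borel_measurable borel" and "\<delta> > 0"
  shows "avg (ocube a T \<delta>) U = (LINT x:box 0 (\<chi> i. \<delta>)|lborel. U (a + T x)) / \<delta> ^ CARD('n)"
  by (simp add: avg_borel ocube_borel[OF T] set_integral_ocube[OF T] measure_ocube[OF T] assms)

section \<open>Mean oscillation\<close>

definition osc :: "(real ^ 'n) set \<Rightarrow> (real ^ 'n \<Rightarrow> real) \<Rightarrow> real"
  where "osc Q U = avg Q (\<lambda>x. \<bar>U x - avg Q U\<bar>)"

lemma K_osc: "K \<delta> \<Omega> (u :: real ^ 'n \<Rightarrow> real) = ennreal (\<delta> ^ (CARD('n) - 1)) *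
    (SUP G\<in>cube_families \<delta> \<Omega>. \<Sum>\<^sub>\<infinity>Q\<in>G. ennreal (osc Q u))"
  by (simp add: K_def osc_def)

lemma avg_nonneg: "(\<And>x. 0 \<le> f x) \<Longrightarrow> 0 \<le> avg Q f"
  unfolding avg_def set_lebesgue_integral_def
  by (intro divide_nonneg_nonneg integral_nonneg_AE) auto

lemma osc_nonneg: "0 \<le> osc Q U"
  by (simp add: osc_def avg_nonneg)

text \<open>Collects what the elementary estimates use about a cube: it is a Borel set of finite
  positive measure.\<close>

locale avg_domain =
  fixes Q :: "(real ^ 'n) set" and m :: real
  assumes Q_borel [measurable]: "Q \<in> sets borel"
    and emeasure_Q: "emeasure lborel Q = ennreal m" and m_pos: "m > 0"
begin

lemma measure_Q: "measure lborel Q = m"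
  using emeasure_Q m_pos by (simp add: measure_def)

lemma avg_eq: "U \<in> borel_measurable borel \<Longrightarrow> avg Q U = (LINT x:Q|lborel. U x) / m"
  by (simp add: avg_borel measure_Q)

lemma set_integrable_const: "set_integrable lborel Q (\<lambda>x. c::real)"
  unfolding set_integrable_def using emeasure_Q by (simp add: integrable_real_indicator)

lemma avg_const: "avg Q (\<lambda>x. c) = c"
  using m_pos by (simp add: avg_eq set_lebesgue_integral_def measure_Q)

lemma avg_mono:
  assumes [measurable]: "U \<in> borel_measurable borel" "V \<in> borel_measurable borel"
    and "set_integrable lborel Q U" "set_integrable lborel Q V" "\<And>x. x \<in> Q \<Longrightarrow> U x \<le> V x"
  shows "avg Q U \<le> avg Q V"
  using assms m_pos by (simp add: avg_eq divide_right_mono set_integral_mono)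

lemma avg_add:
  assumes [measurable]: "U \<in> borel_measurable borel" "V \<in> borel_measurable borel"
    and "set_integrable lborel Q U" "set_integrable lborel Q V"
  shows "avg Q (\<lambda>x. U x + V x) = avg Q U + avg Q V"
  using assms by (simp add: avg_eq set_integral_add add_divide_distrib)

lemma avg_diff:
  assumes [measurable]: "U \<in> borel_measurable borel" "V \<in> borel_measurable borel"
    and "set_integrable lborel Q U" "set_integrable lborel Q V"
  shows "avg Q (\<lambda>x. U x - V x) = avg Q U - avg Q V"
  using assms by (simp add: avg_eq set_integral_diff diff_divide_distrib)

lemma abs_avg_le:
  assumes [measurable]: "U \<in> borel_measurable borel"
  shows "\<bar>avg Q U\<bar> \<le> avg Q (\<lambda>x. \<bar>U x\<bar>)"
proof -
  have "\<bar>LINT x:Q|lborel. U x\<bar> \<le> (LINT x:Q|lborel. \<bar>U x\<bar>)"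
    using integral_norm_bound[of lborel "\<lambda>x. indicator Q x *\<^sub>R U x"]
    by (simp add: set_lebesgue_integral_def abs_mult)
  then show ?thesis using m_pos by (simp add: avg_eq divide_right_mono)
qed

lemma set_integrable_abs_minus:
  fixes U V :: "real ^ 'n \<Rightarrow> real"
  assumes "set_integrable lborel Q U" "set_integrable lborel Q V"
  shows "set_integrable lborel Q (\<lambda>x. \<bar>U x - V x\<bar>)"
  using set_integral_diff(1)[OF assms] by (rule set_integrable_abs)

text \<open>Replacing \<open>U\<close> by \<open>V\<close> in the integrand costs the mean of the
  difference, and replacing the mean of \<open>U\<close> by that of \<open>V\<close> costs the same
  again; hence the factor 2.\<close>

lemma osc_le_osc_plus:
  assumes [measurable]: "U \<in> borel_measurable borel" "V \<in> borel_measurable borel"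
    and i: "set_integrable lborel Q U" "set_integrable lborel Q V"
  shows "osc Q U \<le> osc Q V + 2 * avg Q (\<lambda>x. \<bar>U x - V x\<bar>)"
proof -
  let ?a = "avg Q U" and ?b = "avg Q V"
  let ?W = "\<lambda>x. \<bar>U x - V x\<bar>"
  have iW: "set_integrable lborel Q ?W" by (rule set_integrable_abs_minus[OF i])
  have iV: "set_integrable lborel Q (\<lambda>x. \<bar>V x - ?b\<bar>)"
    by (rule set_integrable_abs_minus[OF i(2) set_integrable_const])
  have iU: "set_integrable lborel Q (\<lambda>x. \<bar>U x - ?a\<bar>)"
    by (rule set_integrable_abs_minus[OF i(1) set_integrable_const])
  have ab: "\<bar>?a - ?b\<bar> \<le> avg Q ?W"
    using abs_avg_le[of "\<lambda>x. U x - V x"] i by (simp add: avg_diff)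
  have "osc Q U \<le> avg Q (\<lambda>x. (\<bar>V x - ?b\<bar> + ?W x) + avg Q ?W)"
    unfolding osc_def
    by (rule avg_mono) (use iU iV iW ab set_integrable_const in \<open>auto intro!: set_integral_add\<close>)
  also have "\<dots> = avg Q (\<lambda>x. \<bar>V x - ?b\<bar> + ?W x) + avg Q (\<lambda>x. avg Q ?W)"
    by (rule avg_add) (use iV iW set_integrable_const in \<open>auto intro!: set_integral_add\<close>)
  also have "avg Q (\<lambda>x. \<bar>V x - ?b\<bar> + ?W x) = avg Q (\<lambda>x. \<bar>V x - ?b\<bar>) + avg Q ?W"
    by (rule avg_add) (use iV iW in auto)
  finally show ?thesis by (simp add: avg_const osc_def)
qed

lemma nn_avg:
  assumes [measurable]: "U \<in> borel_measurable borel" and i: "set_integrable lborel Q U" and "\<And>x. 0 \<le> U x"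
  shows "ennreal m * ennreal (avg Q U) = (\<integral>\<^sup>+x\<in>Q. ennreal (U x) \<partial>lborel)"
proof -
  have "ennreal m * ennreal (avg Q U) = ennreal (LINT x:Q|lborel. U x)"
    using m_pos avg_nonneg[of U Q] assms by (subst ennreal_mult[symmetric]) (auto simp: avg_eq)
  also have "\<dots> = (\<integral>\<^sup>+x. ennreal (indicator Q x *\<^sub>R U x) \<partial>lborel)"
    unfolding set_lebesgue_integral_def
    by (rule nn_integral_eq_integral[symmetric]) (use i assms in \<open>auto simp: set_integrable_def\<close>)
  also have "\<dots> = (\<integral>\<^sup>+x\<in>Q. ennreal (U x) \<partial>lborel)"
    by (intro nn_integral_cong) (auto simp: indicator_def)
  finally show ?thesis .
qed

lemma nn_osc:
  assumes [measurable]: "U \<in> borel_measurable borel" and i: "set_integrable lborel Q U"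
  shows "ennreal m * ennreal (osc Q U) = (\<integral>\<^sup>+x\<in>Q. ennreal \<bar>U x - avg Q U\<bar> \<partial>lborel)"
  unfolding osc_def
  by (rule nn_avg) (use set_integrable_abs_minus[OF i set_integrable_const] in auto)

text \<open>The deviation of \<open>U x\<close> from the mean is at most the mean of the differences
  \<open>U y - U x\<close> over \<open>y\<close>. The double integral is the form in which
  translation estimates enter the Poincare inequality.\<close>

lemma osc_le_double:
  assumes [measurable]: "U \<in> borel_measurable borel" and i: "set_integrable lborel Q U"
  shows "ennreal (m\<^sup>2) * ennreal (osc Q U) \<le> (\<integral>\<^sup>+x\<in>Q. (\<integral>\<^sup>+y\<in>Q. ennreal \<bar>U y - U x\<bar> \<partial>lborel) \<partial>lborel)"
proof -
  have "ennreal (m\<^sup>2) * ennreal (osc Q U) = ennreal m * (\<integral>\<^sup>+x\<in>Q. ennreal \<bar>U x - avg Q U\<bar> \<partial>lborel)"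
    using m_pos by (simp add: nn_osc[OF assms, symmetric] power2_eq_square ennreal_mult mult.assoc)
  also have "\<dots> = (\<integral>\<^sup>+x\<in>Q. ennreal m * ennreal \<bar>U x - avg Q U\<bar> \<partial>lborel)"
    by (subst nn_integral_cmult[symmetric]) (auto simp: mult.assoc)
  also have "\<dots> \<le> (\<integral>\<^sup>+x\<in>Q. (\<integral>\<^sup>+y\<in>Q. ennreal \<bar>U y - U x\<bar> \<partial>lborel) \<partial>lborel)"
  proof (rule nn_integral_mono)
    fix x
    have i2: "set_integrable lborel Q (\<lambda>y. \<bar>U y - U x\<bar>)"
      by (rule set_integrable_abs_minus[OF i set_integrable_const])
    have "\<bar>U x - avg Q U\<bar> = \<bar>avg Q (\<lambda>y. U y - U x)\<bar>"
      using i set_integrable_const by (subst avg_diff) (auto simp: avg_const)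
    also have "\<dots> \<le> avg Q (\<lambda>y. \<bar>U y - U x\<bar>)" by (rule abs_avg_le) measurable
    finally have "ennreal m * ennreal \<bar>U x - avg Q U\<bar> \<le> ennreal m * ennreal (avg Q (\<lambda>y. \<bar>U y - U x\<bar>))"
      by (intro mult_left_mono ennreal_leI) auto
    also have "\<dots> = (\<integral>\<^sup>+y\<in>Q. ennreal \<bar>U y - U x\<bar> \<partial>lborel)"
      by (rule nn_avg[OF _ i2]) auto
    finally show "ennreal m * ennreal \<bar>U x - avg Q U\<bar> * indicator Q x
        \<le> (\<integral>\<^sup>+y\<in>Q. ennreal \<bar>U y - U x\<bar> \<partial>lborel) * indicator Q x"
      by (rule mult_right_mono) simp
  qed
  finally show ?thesis .
qed

text \<open>Insert the mean between \<open>U (h + x)\<close> and \<open>U x\<close>; each half is an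
  integral of the deviation over \<open>Q\<close>, after a translation for the first. This is how a
  bound on \<open>K\<close> turns into a bound on translations.\<close>

lemma shift_le_osc:
  assumes [measurable]: "U \<in> borel_measurable borel" and i: "set_integrable lborel Q U"
  shows "(\<integral>\<^sup>+x. ennreal \<bar>U (h + x) - U x\<bar> * (indicator Q x * indicator Q (h + x)) \<partial>lborel)
    \<le> 2 * (ennreal m * ennreal (osc Q U))"
proof -
  let ?f = "\<lambda>x. ennreal \<bar>U x - avg Q U\<bar> * indicator Q x"
  have "(\<integral>\<^sup>+x. ennreal \<bar>U (h + x) - U x\<bar> * (indicator Q x * indicator Q (h + x)) \<partial>lborel)
     \<le> (\<integral>\<^sup>+x. ?f (h + x) + ?f x \<partial>lborel)"
    by (intro nn_integral_mono)
       (auto simp: indicator_def ennreal_plus[symmetric] simp del: ennreal_plus intro!: ennreal_leI)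
  also have "\<dots> = (\<integral>\<^sup>+x. ?f (h + x) \<partial>lborel) + (\<integral>\<^sup>+x. ?f x \<partial>lborel)"
    by (rule nn_integral_add) auto
  also have "(\<integral>\<^sup>+x. ?f (h + x) \<partial>lborel) = (\<integral>\<^sup>+x. ?f x \<partial>lborel)"
    by (rule nn_integral_lborel_translate) measurable
  finally show ?thesis by (simp add: nn_osc[OF assms] mult_2)
qed

end

lemma avg_domain_ocube:
  assumes "orthogonal_transformation T" "\<delta> > 0"
  shows "avg_domain (ocube a T \<delta> :: (real ^ 'n) set) (\<delta> ^ CARD('n))"
  using assms by unfold_locales (auto simp: emeasure_ocube ocube_borel)

lemma integrable_imp_set_integrable:
  fixes U :: "'a \<Rightarrow> real"
  shows "integrable M U \<Longrightarrow> Q \<in> sets M \<Longrightarrow> set_integrable M Q U"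
  unfolding set_integrable_def by (rule integrable_mult_indicator) auto

section \<open>Comparing \<open>K\<close> with finite families of cubes\<close>

lemma ocube_nonempty:
  assumes "orthogonal_transformation T" "\<delta> > 0"
  shows "ocube a T \<delta> \<noteq> {}"
  using emeasure_ocube[OF assms, of a] assms by auto

text \<open>Families arise as translated or indexed copies, so the bound is stated for an indexed
  family. Disjoint nonempty cubes are distinct, hence the indexing is injective and the sum over
  indices is a sum over the family.\<close>

lemma K_ge_family:
  fixes Q :: "'i \<Rightarrow> (real ^ 'n) set"
  assumes "finite I" and "\<delta> > 0" and Q: "\<And>i. i \<in> I \<Longrightarrow> Q i \<in> cubes \<delta>" "\<And>i. i \<in> I \<Longrightarrow> Q i \<subseteq> A"
    and disj: "\<And>i j. i \<in> I \<Longrightarrow> j \<in> I \<Longrightarrow> i \<noteq> j \<Longrightarrow> Q i \<inter> Q j = {}"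
  shows "ennreal (\<delta> ^ (CARD('n) - 1)) * (\<Sum>i\<in>I. ennreal (osc (Q i) u)) \<le> K \<delta> A u"
proof -
  have ne: "Q i \<noteq> {}" if i: "i \<in> I" for i
  proof -
    obtain a T where "Q i = ocube a T \<delta>" "orthogonal_transformation T"
      using Q(1)[OF i] by (auto simp: cubes_ocube)
    then show ?thesis using ocube_nonempty[of T \<delta> a] assms(2) by simp
  qed
  have inj: "inj_on Q I" using ne disj by (fastforce simp: inj_on_def)
  have fam: "Q ` I \<in> cube_families \<delta> A"
    unfolding cube_families_def
    using Q disj by (auto simp: disjnt_def simp del: disjnt_iff intro!: pairwise_imageI)
  have "(\<Sum>i\<in>I. ennreal (osc (Q i) u)) = (\<Sum>\<^sub>\<infinity>Q\<in>Q ` I. ennreal (osc Q u))"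
    using assms(1) by (simp add: sum.reindex[OF inj])
  also have "\<dots> \<le> (SUP G\<in>cube_families \<delta> A. \<Sum>\<^sub>\<infinity>Q\<in>G. ennreal (osc Q u))"
    by (rule SUP_upper[OF fam])
  finally show ?thesis unfolding K_osc by (rule mult_left_mono) simp
qed

text \<open>The sum over an infinite family is the supremum of its finite partial sums, and every
  subfamily is again admissible.\<close>

lemma K_le:
  fixes u :: "real ^ 'n \<Rightarrow> real"
  assumes "\<And>G. finite G \<Longrightarrow> G \<in> cube_families \<delta> A \<Longrightarrow>
    ennreal (\<delta> ^ (CARD('n) - 1)) * (\<Sum>Q\<in>G. ennreal (osc Q u)) \<le> C"
  shows "K \<delta> A u \<le> C"
  unfolding K_osc SUP_mult_left_ennreal
proof (rule SUP_least)
  fix G :: "(real ^ 'n) set set" assume G: "G \<in> cube_families \<delta> A"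
  have "ennreal (\<delta> ^ (CARD('n) - 1)) * (\<Sum>\<^sub>\<infinity>Q\<in>G. ennreal (osc Q u))
     = (SUP F\<in>{F. finite F \<and> F \<subseteq> G}. ennreal (\<delta> ^ (CARD('n) - 1)) * (\<Sum>Q\<in>F. ennreal (osc Q u)))"
    by (subst nonneg_infsum_complete) (auto simp: SUP_mult_left_ennreal)
  also have "\<dots> \<le> C"
    using G by (intro SUP_least assms) (auto simp: cube_families_def elim: pairwise_subset)
  finally show "ennreal (\<delta> ^ (CARD('n) - 1)) * (\<Sum>\<^sub>\<infinity>Q\<in>G. ennreal (osc Q u)) \<le> C" .
qed

text \<open>Near-optimal families for disjoint sets can be merged.\<close>

lemma K_superadditive:
  fixes A :: "'i \<Rightarrow> (real ^ 'n) set"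
  assumes "finite I" "\<delta> > 0" and sub: "\<And>i. i \<in> I \<Longrightarrow> A i \<subseteq> B"
    and disj: "\<And>i j. i \<in> I \<Longrightarrow> j \<in> I \<Longrightarrow> i \<noteq> j \<Longrightarrow> A i \<inter> A j = {}"
  shows "(\<Sum>i\<in>I. K \<delta> (A i) u) \<le> K \<delta> B u"
proof -
  let ?c = "ennreal (\<delta> ^ (CARD('n) - 1))"
  \<comment> \<open>The spare family \<open>G\<close>, disjoint from the sets still to be treated,
    is what makes the induction run: each step merges a family inside \<open>A i\<close> into it
    before the supremum for \<open>A i\<close> is taken.\<close>
  have "(\<Sum>i\<in>J. K \<delta> (A i) u) + ?c * (\<Sum>Q\<in>G. ennreal (osc Q u)) \<le> K \<delta> B u"
    if "J \<subseteq> I" "finite G" "G \<in> cube_families \<delta> B" "\<forall>Q\<in>G. \<forall>i\<in>J. Q \<inter> A i = {}" for J G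
    using finite_subset[OF \<open>J \<subseteq> I\<close> \<open>finite I\<close>] that
  proof (induction J arbitrary: G)
    case empty
    then show ?case
      using K_ge_family[of G \<delta> "\<lambda>Q. Q" B u] \<open>\<delta> > 0\<close>
      by (auto simp: cube_families_def pairwise_def disjnt_def)
  next
    case (insert i J)
    let ?R = "(\<Sum>i\<in>J. K \<delta> (A i) u) + ?c * (\<Sum>Q\<in>G. ennreal (osc Q u))"
    have fin: "?c * (\<Sum>Q\<in>H. ennreal (osc Q u)) + ?R \<le> K \<delta> B u"
      if "finite H" "H \<in> cube_families \<delta> (A i)" for H
    proof -
      have sep: "Q \<inter> Q' = {}" if "Q \<in> H" "Q' \<in> G" for Q Q'
        using that insert.prems \<open>H \<in> _\<close> by (fastforce simp: cube_families_def)
      have ne: "Q \<noteq> {}" if "Q \<in> H" for Q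
        using that \<open>H \<in> _\<close> ocube_nonempty assms(2) by (fastforce simp: cube_families_def cubes_ocube)
      have HG: "H \<inter> G = {}" using sep ne by blast
      have fam: "H \<union> G \<in> cube_families \<delta> B"
      proof -
        have 1: "H \<subseteq> cubes \<delta>" "\<And>Q. Q \<in> H \<Longrightarrow> Q \<subseteq> A i" "pairwise disjnt H"
          using that by (simp_all add: cube_families_def)
        have 2: "G \<subseteq> cubes \<delta>" "\<And>Q. Q \<in> G \<Longrightarrow> Q \<subseteq> B" "pairwise disjnt G"
          using insert.prems by (simp_all add: cube_families_def)
        have "A i \<subseteq> B" using sub[of i] insert.prems by simp
        then have "\<forall>Q\<in>H \<union> G. Q \<subseteq> B" using 1(2) 2(2) by (meson UnE subset_trans)
        moreover have "pairwise disjnt (H \<union> G)"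
          unfolding pairwise_def
        proof (intro ballI impI)
          fix Q Q' assume "Q \<in> H \<union> G" "Q' \<in> H \<union> G" "Q \<noteq> Q'"
          then show "disjnt Q Q'"
            using pairwiseD[OF 1(3), of Q Q'] pairwiseD[OF 2(3), of Q Q'] sep[of Q Q'] sep[of Q' Q]
            by (auto simp: disjnt_def Int_commute)
        qed
        ultimately show ?thesis using 1(1) 2(1) by (simp add: cube_families_def)
      qed
      have "Q \<inter> A j = {}" if "Q \<in> H \<union> G" "j \<in> J" for Q j
      proof (cases "Q \<in> G")
        case True
        then show ?thesis using insert.prems that by auto
      next
        case False
        then have "Q \<subseteq> A i" using that \<open>H \<in> _\<close> by (auto simp: cube_families_def)
        then show ?thesis using disj[of i j] insert.hyps insert.prems that by blast
      qed
      then have "(\<Sum>i\<in>J. K \<delta> (A i) u) + ?c * (\<Sum>Q\<in>H \<union> G. ennreal (osc Q u)) \<le> K \<delta> B u"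
        using insert.prems that fam by (intro insert.IH) auto
      then show ?thesis
        using HG that insert.prems by (simp add: sum.union_disjoint distrib_left algebra_simps)
    qed
    show ?case
    \<comment> \<open>To take the supremum over \<open>H\<close>, the term \<open>?R\<close> is
      moved to the other side, which is possible in \<open>ennreal\<close> only when it is
      finite.\<close>
    proof (cases "?R = top")
      case True
      have "?R \<le> K \<delta> B u" using fin[of "{}"] by (simp add: cube_families_def)
      then have "K \<delta> B u = top" unfolding True by (simp add: top_unique)
      then show ?thesis by simp
    next
      case False
      have "K \<delta> (A i) u \<le> K \<delta> B u - ?R"
        by (rule K_le) (use fin False in \<open>simp add: ennreal_le_minus_iff add.commute\<close>)
      moreover have "?R \<le> K \<delta> B u" using fin[of "{}"] by (simp add: cube_families_def)
      ultimately have "K \<delta> (A i) u + ?R \<le> K \<delta> B u - ?R + ?R" by (intro add_right_mono)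
      also have "\<dots> = K \<delta> B u"
        using \<open>?R \<le> K \<delta> B u\<close> by (rule diff_add_cancel_ennreal)
      finally show ?thesis using insert.hyps by (simp add: add.assoc)
    qed
  qed
  from this[of I "{}"] show ?thesis by (simp add: cube_families_def)
qed

section \<open>Lattice tilings and averages over positions\<close>

definition cell :: "real \<Rightarrow> int ^ 'n \<Rightarrow> (real ^ 'n) set"
  where "cell \<delta> z = {x. \<forall>i. \<delta> * of_int (z $ i) \<le> x $ i \<and> x $ i < \<delta> * of_int (z $ i) + \<delta>}"

definition lattice_point :: "real \<Rightarrow> int ^ 'n \<Rightarrow> real ^ 'n"
  where "lattice_point \<delta> z = (\<chi> i. \<delta> * of_int (z $ i))"

lemma cell_translate: "lattice_point \<delta> z + x \<in> cell \<delta> z \<longleftrightarrow> x \<in> cell \<delta> 0"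
  by (auto simp: cell_def lattice_point_def)

lemma cell_borel [measurable]: "cell \<delta> z \<in> sets borel"
proof -
  have "cell \<delta> z = (\<Inter>i. {x. \<delta> * of_int (z $ i) \<le> x $ i} \<inter> {x. x $ i < \<delta> * of_int (z $ i) + \<delta>})"
    by (auto simp: cell_def)
  also have "\<dots> \<in> sets borel"
    by (intro sets.countable_INT' sets.Int borel_closed borel_open closed_Collect_le open_Collect_less
        continuous_intros countableI_type) auto
  finally show ?thesis .
qed

text \<open>Being half-open, the cells partition the space exactly, which open cubes do only up to a
  null set.\<close>

lemma cell_unique:
  assumes "\<delta> > 0"
  shows "x \<in> cell \<delta> z \<longleftrightarrow> z = (\<chi> i. \<lfloor>x $ i / \<delta>\<rfloor>)"
proof -
  have "\<delta> * of_int (z $ i) \<le> x $ i \<and> x $ i < \<delta> * of_int (z $ i) + \<delta> \<longleftrightarrow> z $ i = \<lfloor>x $ i / \<delta>\<rfloor>" for i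
    using assms floor_eq_iff[of "x $ i / \<delta>" "z $ i"] by (auto simp: field_simps)
  then show ?thesis by (simp add: cell_def vec_eq_iff)
qed

lemma emeasure_cell:
  assumes "\<delta> > 0"
  shows "emeasure lborel (cell \<delta> 0 :: (real ^ 'n) set) = ennreal (\<delta> ^ CARD('n))"
proof (rule antisym)
  let ?u = "(\<chi> i. \<delta>) :: real ^ 'n"
  have "emeasure lborel (cbox 0 ?u) = (\<Prod>b\<in>Basis. (?u - 0) \<bullet> b)"
    using assms by (intro emeasure_lborel_cbox) (auto simp: Basis_vec_def inner_axis)
  also have "(\<Prod>b\<in>Basis. (?u - 0) \<bullet> b) = (\<Prod>b\<in>(Basis :: (real ^ 'n) set). \<delta>)"
    by (rule prod.cong) (auto simp: Basis_vec_def inner_axis)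
  finally have c: "emeasure lborel (cbox 0 ?u) = ennreal (\<delta> ^ CARD('n))" by simp
  have "cell \<delta> 0 \<subseteq> cbox 0 ?u" by (auto simp: cell_def mem_box_cart less_imp_le)
  then show "emeasure lborel (cell \<delta> 0 :: (real ^ 'n) set) \<le> ennreal (\<delta> ^ CARD('n))"
    unfolding c[symmetric] by (rule emeasure_mono) simp
  have "box 0 ?u \<subseteq> cell \<delta> 0" by (auto simp: cell_def mem_box_cube less_imp_le)
  then show "ennreal (\<delta> ^ CARD('n)) \<le> emeasure lborel (cell \<delta> 0 :: (real ^ 'n) set)"
    unfolding emeasure_cube_box[OF assms, symmetric] by (rule emeasure_mono) simp
qed

text \<open>The integral is folded onto the fundamental cell: it equals the integral over that cell
  of the sum of all lattice translates of \<open>g\<close>. A bound on finite partial sums bounds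
  the full sum, and the cell contributes its volume.\<close>

lemma nn_integral_tiling_le:
  fixes g :: "real ^ 'n \<Rightarrow> ennreal"
  assumes [measurable]: "g \<in> borel_measurable borel" and "\<delta> > 0"
    and le: "\<And>x Z. finite Z \<Longrightarrow> (\<Sum>z\<in>Z. g (lattice_point \<delta> z + x)) \<le> C"
  shows "(\<integral>\<^sup>+x. g x \<partial>lborel) \<le> C * ennreal (\<delta> ^ CARD('n))"
proof -
  \<comment> \<open>An enumeration of the lattice: \<open>Z k\<close> holds the index with number
    \<open>k\<close>, or nothing if there is none. The sum over the lattice becomes a series over
    \<open>nat\<close>, to which \<open>nn_integral_suminf\<close> applies.\<close>
  define Z where "Z k = (if k \<in> range (to_nat :: int ^ 'n \<Rightarrow> nat) then {from_nat k} else {} :: (int ^ 'n) set)" for k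
  have Z_iff: "z \<in> Z k \<longleftrightarrow> k = to_nat z" for z k
    by (auto simp: Z_def)
  have fin: "finite (Z k)" for k by (simp add: Z_def)
  have "(\<integral>\<^sup>+x. g x \<partial>lborel) = (\<integral>\<^sup>+x. (\<Sum>k. \<Sum>z\<in>Z k. g x * indicator (cell \<delta> z) x) \<partial>lborel)"
  proof (rule nn_integral_cong)
    fix x
    let ?z = "(\<chi> i. \<lfloor>x $ i / \<delta>\<rfloor>) :: int ^ 'n"
    have "(\<Sum>z\<in>Z k. g x * indicator (cell \<delta> z) x) = (if k = to_nat ?z then g x else 0)" for k
    proof -
      have "(\<Sum>z\<in>Z k. g x * indicator (cell \<delta> z) x) = (\<Sum>z\<in>Z k. if z = ?z then g x else 0)"
        by (intro sum.cong refl) (simp add: cell_unique[OF \<open>\<delta> > 0\<close>] indicator_def)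
      then show ?thesis using fin[of k] by (simp add: Z_iff)
    qed
    then have "(\<Sum>k. \<Sum>z\<in>Z k. g x * indicator (cell \<delta> z) x) = (\<Sum>k\<in>{to_nat ?z}. g x)"
      by (subst suminf_finite[of "{to_nat ?z}"]) auto
    then show "g x = (\<Sum>k. \<Sum>z\<in>Z k. g x * indicator (cell \<delta> z) x)" by simp
  qed
  also have "\<dots> = (\<Sum>k. \<integral>\<^sup>+x. (\<Sum>z\<in>Z k. g x * indicator (cell \<delta> z) x) \<partial>lborel)"
    by (rule nn_integral_suminf) measurable
  also have "\<dots> = (\<Sum>k. \<Sum>z\<in>Z k. \<integral>\<^sup>+x. g x * indicator (cell \<delta> z) x \<partial>lborel)"
    by (subst nn_integral_sum) auto
  also have "\<dots> = (\<Sum>k. \<Sum>z\<in>Z k. \<integral>\<^sup>+x. g (lattice_point \<delta> z + x) * indicator (cell \<delta> 0) x \<partial>lborel)"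
  proof (intro suminf_cong sum.cong refl)
    fix z :: "int ^ 'n"
    have "(\<integral>\<^sup>+x. g x * indicator (cell \<delta> z) x \<partial>lborel)
       = (\<integral>\<^sup>+x. g (lattice_point \<delta> z + x) * indicator (cell \<delta> z) (lattice_point \<delta> z + x) \<partial>lborel)"
      using nn_integral_lborel_translate[of "\<lambda>x. g x * indicator (cell \<delta> z) x" "lattice_point \<delta> z"] by simp
    moreover have "indicator (cell \<delta> z) (lattice_point \<delta> z + x) = (indicator (cell \<delta> 0) x :: ennreal)" for x
      by (simp add: indicator_def cell_translate)
    ultimately show "(\<integral>\<^sup>+x. g x * indicator (cell \<delta> z) x \<partial>lborel)
       = (\<integral>\<^sup>+x. g (lattice_point \<delta> z + x) * indicator (cell \<delta> 0) x \<partial>lborel)" by simp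
  qed
  also have "\<dots> = (\<Sum>k. \<integral>\<^sup>+x. (\<Sum>z\<in>Z k. g (lattice_point \<delta> z + x) * indicator (cell \<delta> 0) x) \<partial>lborel)"
    by (subst nn_integral_sum) auto
  also have "\<dots> = (\<integral>\<^sup>+x. (\<Sum>k. \<Sum>z\<in>Z k. g (lattice_point \<delta> z + x) * indicator (cell \<delta> 0) x) \<partial>lborel)"
    by (rule nn_integral_suminf[symmetric]) measurable
  also have "\<dots> \<le> (\<integral>\<^sup>+x. C * indicator (cell \<delta> 0) (x :: real ^ 'n) \<partial>lborel)"
  proof (rule nn_integral_mono)
    fix x :: "real ^ 'n"
    have "(\<Sum>k. \<Sum>z\<in>Z k. g (lattice_point \<delta> z + x)) \<le> C"
      unfolding suminf_eq_SUP
    proof (rule SUP_least)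
      fix N
      have "(\<Sum>k<N. \<Sum>z\<in>Z k. g (lattice_point \<delta> z + x)) = (\<Sum>z\<in>(\<Union>k<N. Z k). g (lattice_point \<delta> z + x))"
        by (rule sum.UNION_disjoint[symmetric]) (auto simp: fin Z_iff)
      also have "\<dots> \<le> C" by (rule le) (auto simp: fin)
      finally show "(\<Sum>k<N. \<Sum>z\<in>Z k. g (lattice_point \<delta> z + x)) \<le> C" .
    qed
    then show "(\<Sum>k. \<Sum>z\<in>Z k. g (lattice_point \<delta> z + x) * indicator (cell \<delta> 0) x) \<le> C * indicator (cell \<delta> 0) x"
      by (simp add: indicator_def)
  qed
  also have "\<dots> = C * ennreal (\<delta> ^ CARD('n))"
    by (simp add: nn_integral_cmult_indicator emeasure_cell[OF \<open>\<delta> > 0\<close>])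
  finally show ?thesis .
qed

text \<open>Once the cube is parametrised by its corner, the domain of integration is a fixed box,
  and both the mean and the oscillation are parameter integrals in \<open>y\<close>.\<close>

lemma borel_measurable_osc:
  fixes U :: "real ^ 'n \<Rightarrow> real"
  assumes T: "orthogonal_transformation T" and [measurable]: "U \<in> borel_measurable borel" and "\<delta> > 0"
  shows "(\<lambda>y. osc (ocube y T \<delta>) U) \<in> borel_measurable borel"
proof -
  note [measurable] = borel_measurable_rigid[OF T]
  define B :: "(real ^ 'n) set" where "B = box 0 (\<chi> i. \<delta>)"
  have [measurable]: "B \<in> sets borel" by (simp add: B_def)
  define a where "a y = (\<integral>x. indicator B x * U (y + T x) \<partial>lborel) / \<delta> ^ CARD('n)" for y
  have [measurable]: "a \<in> borel_measurable borel" unfolding a_def by measurable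
  have "avg (ocube y T \<delta>) U = a y" for y
    by (subst avg_ocube) (use assms in \<open>auto simp: a_def B_def set_lebesgue_integral_def\<close>)
  then have "osc (ocube y T \<delta>) U = (\<integral>x. indicator B x * \<bar>U (y + T x) - a y\<bar> \<partial>lborel) / \<delta> ^ CARD('n)" for y
    unfolding osc_def
    by (subst avg_ocube) (use assms in \<open>auto simp: B_def set_lebesgue_integral_def\<close>)
  then show ?thesis by simp
qed

text \<open>The corners are \<open>T\<close> applied to points of a shifted lattice, so the cubes
  are the image under \<open>T\<close> of the open cells of a shifted grid.\<close>

lemma ocube_lattice_disjoint:
  assumes T: "orthogonal_transformation T" and "\<delta> > 0" and "z \<noteq> z'"
  shows "ocube (T (lattice_point \<delta> z + x)) T \<delta> \<inter> ocube (T (lattice_point \<delta> z' + x)) T \<delta> = {}"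
proof (rule ccontr)
  assume "\<not> ?thesis"
  then obtain p q where p: "p \<in> box 0 (\<chi> i. \<delta>)" and q: "q \<in> box 0 (\<chi> i. \<delta>)"
    and "T (lattice_point \<delta> z + x) + T p = T (lattice_point \<delta> z' + x) + T q"
    by (auto simp: ocube_def)
  then have "T (lattice_point \<delta> z + x + p) = T (lattice_point \<delta> z' + x + q)"
    using orthogonal_transformation_linear[OF T] by (simp add: linear_add)
  then have eq: "lattice_point \<delta> z + p = lattice_point \<delta> z' + q"
    using orthogonal_transformation_inj[OF T] by (simp add: inj_eq algebra_simps)
  have "z $ i = z' $ i" for i
  proof -
    have "\<delta> * of_int (z $ i) + p $ i = \<delta> * of_int (z' $ i) + q $ i"
      using arg_cong[OF eq, of "\<lambda>v. v $ i"] by (simp add: lattice_point_def)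
    then have "q $ i - p $ i = \<delta> * (of_int (z $ i - z' $ i))" by (simp add: algebra_simps)
    moreover have "\<bar>q $ i - p $ i\<bar> < \<delta> * 1" using p q by (auto simp: mem_box_cube abs_less_iff) (smt (verit))+
    ultimately have "\<delta> * \<bar>of_int (z $ i - z' $ i)\<bar> < \<delta> * 1" using \<open>\<delta> > 0\<close> by (simp add: abs_mult)
    then have "\<bar>real_of_int (z $ i - z' $ i)\<bar> < 1" using \<open>\<delta> > 0\<close> by (simp only: mult_less_cancel_left_pos)
    then show ?thesis by linarith
  qed
  then show False using \<open>z \<noteq> z'\<close> by (simp add: vec_eq_iff)
qed

text \<open>Averaging the lattice families of cubes with orientation \<open>T\<close> over all translations.\<close>

lemma nn_integral_osc_le_K:
  fixes U :: "real ^ 'n \<Rightarrow> real"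
  assumes T: "orthogonal_transformation T" and [measurable]: "U \<in> borel_measurable borel" and "\<delta> > 0"
    and [measurable]: "Y \<in> sets borel" and Y: "\<And>y. y \<in> Y \<Longrightarrow> ocube y T \<delta> \<subseteq> A"
  shows "(\<integral>\<^sup>+y\<in>Y. ennreal (osc (ocube y T \<delta>) U) \<partial>lborel) \<le> ennreal \<delta> * K \<delta> A U"
proof -
  note [measurable] = borel_measurable_rigid[OF T] borel_measurable_osc[OF T _ \<open>\<delta> > 0\<close>]
  let ?c = "ennreal (\<delta> ^ (CARD('n) - 1))"
  let ?g = "\<lambda>y. ?c * (ennreal (osc (ocube y T \<delta>) U) * indicator Y y)"
  have "?c * (\<integral>\<^sup>+y\<in>Y. ennreal (osc (ocube y T \<delta>) U) \<partial>lborel) = (\<integral>\<^sup>+y. ?g y \<partial>lborel)"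
    by (simp add: nn_integral_cmult)
  \<comment> \<open>Passing to coordinates in the frame \<open>T\<close>, where the cubes with this
    orientation sit on the standard lattice.\<close>
  also have "\<dots> = (\<integral>\<^sup>+x. ?g (T x) \<partial>lborel)"
    using nn_integral_rigid[OF _ T, of ?g 0] by simp
  also have "\<dots> \<le> K \<delta> A U * ennreal (\<delta> ^ CARD('n))"
  proof (rule nn_integral_tiling_le[OF _ \<open>\<delta> > 0\<close>])
    fix x :: "real ^ 'n" and Z :: "(int ^ 'n) set" assume "finite Z"
    \<comment> \<open>Only corners in \<open>Y\<close> are kept. The others contribute 0, and their
      cubes might leave \<open>A\<close>; those in \<open>Z'\<close> form an admissible
      family.\<close>
    define Z' where "Z' = {z\<in>Z. T (lattice_point \<delta> z + x) \<in> Y}"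
    have "(\<Sum>z\<in>Z. ?g (T (lattice_point \<delta> z + x)))
      = (\<Sum>z\<in>Z'. ?c * ennreal (osc (ocube (T (lattice_point \<delta> z + x)) T \<delta>) U))"
      unfolding Z'_def by (rule sum.mono_neutral_cong_right) (use \<open>finite Z\<close> in auto)
    also have "\<dots> = ?c * (\<Sum>z\<in>Z'. ennreal (osc (ocube (T (lattice_point \<delta> z + x)) T \<delta>) U))"
      by (simp add: sum_distrib_left)
    also have "\<dots> \<le> K \<delta> A U"
      by (rule K_ge_family)
        (use \<open>finite Z\<close> \<open>\<delta> > 0\<close> T Y ocube_lattice_disjoint[OF T \<open>\<delta> > 0\<close>] in \<open>auto simp: Z'_def cubes_ocube\<close>)
    finally show "(\<Sum>z\<in>Z. ?g (T (lattice_point \<delta> z + x))) \<le> K \<delta> A U" .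
  qed measurable
  also have "K \<delta> A U * ennreal (\<delta> ^ CARD('n)) = ?c * (ennreal \<delta> * K \<delta> A U)"
  proof -
    have "CARD('n) = Suc (CARD('n) - 1)" by (simp add: Suc_diff_1)
    then have "\<delta> ^ CARD('n) = \<delta> ^ (CARD('n) - 1) * \<delta>" by (metis power_Suc2)
    then show ?thesis using \<open>\<delta> > 0\<close> by (simp add: ennreal_mult ac_simps)
  qed
  finally show ?thesis
    using \<open>\<delta> > 0\<close> by (subst (asm) ennreal_mult_le_mult_iff) auto
qed

section \<open>Mollification\<close>

lemma L1_translate_indicator:
  fixes A :: "'a::euclidean_space set"
  assumes A[measurable]: "A \<in> sets borel" and fin: "emeasure lborel A < \<infinity>" and "e > 0"
  shows "\<exists>d>0. \<forall>h. norm h < d \<longrightarrow> (\<integral>\<^sup>+x. ennreal \<bar>indicator A (h + x) - indicator A x\<bar> \<partial>lborel) \<le> ennreal e"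
proof -
  \<comment> \<open>The set is caught between a compact \<open>C k\<close> and an open
    \<open>U\<close>. A shift shorter than the gap between \<open>C k\<close> and the complement of
    \<open>U\<close> changes the indicator only where \<open>x\<close> or \<open>h + x\<close> lies
    in \<open>U - C k\<close>. That set has measure at most \<open>e / 3\<close>, made of two errors
    \<open>e / 6\<close>, and is counted twice.\<close>
  have e4: "e / 6 > 0" using \<open>e > 0\<close> by simp
  have Al: "A \<in> sets lebesgue" by simp
  obtain U where U: "open U" "A \<subseteq> U" "emeasure lebesgue (U - A) < ennreal (e / 6)"
    using sets_lebesgue_outer_open[OF Al e4] by metis
  obtain C0 where C0: "closed C0" "C0 \<subseteq> A" "emeasure lebesgue (A - C0) < ennreal (e / 6)"
    using sets_lebesgue_inner_closed[OF Al e4] by metis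
  have [measurable]: "U \<in> sets borel" "C0 \<in> sets borel" using U C0 by auto
  \<comment> \<open>Truncation makes the closed set compact. Since \<open>A\<close> has finite
    measure, the loss tends to that of \<open>C0\<close> for large \<open>k\<close>.\<close>
  define C where "C k = C0 \<inter> cball 0 (real k)" for k
  have [measurable]: "C k \<in> sets borel" for k by (simp add: C_def)
  have "(\<lambda>k. emeasure lborel (A - C k)) \<longlonglongrightarrow> emeasure lborel (\<Inter>k. A - C k)"
  proof (rule Lim_emeasure_decseq)
    show "decseq (\<lambda>k. A - C k)" by (auto simp: decseq_def C_def)
    fix k
    have "emeasure lborel (A - C k) \<le> emeasure lborel A" by (rule emeasure_mono) auto
    then show "emeasure lborel (A - C k) \<noteq> \<infinity>" using fin by (auto simp: top_unique)
  qed auto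
  also have "(\<Inter>k. A - C k) = A - C0"
    by (auto simp: C_def real_arch_simple)
  finally have lim: "(\<lambda>k. emeasure lborel (A - C k)) \<longlonglongrightarrow> emeasure lborel (A - C0)" .
  have "emeasure lborel (A - C0) < ennreal (e / 6)" using C0(3) by simp
  then have "\<forall>\<^sub>F k in sequentially. emeasure lborel (A - C k) < ennreal (e / 6)"
    using lim by (rule order_tendstoD(2)[rotated])
  then obtain k where k: "emeasure lborel (A - C k) < ennreal (e / 6)"
    by (auto simp: eventually_sequentially)
  have cpt: "compact (C k)" unfolding C_def by (intro closed_Int_compact C0 compact_cball)
  have CU: "C k \<subseteq> U" using U C0 by (auto simp: C_def)
  obtain d where d: "d > 0" "(\<Union>x\<in>C k. ball x d) \<subseteq> U"
    using compact_subset_open_imp_ball_epsilon_subset[OF cpt U(1) CU] .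
  have "emeasure lborel (U - C k) \<le> emeasure lborel ((U - A) \<union> (A - C k))"
    by (rule emeasure_mono) auto
  also have "\<dots> \<le> emeasure lborel (U - A) + emeasure lborel (A - C k)"
    by (rule emeasure_subadditive) auto
  also have "\<dots> \<le> ennreal (e / 6) + ennreal (e / 6)"
    using U(3) k by (intro add_mono) (auto intro: less_imp_le)
  finally have UC: "emeasure lborel (U - C k) \<le> ennreal (e / 3)"
    using \<open>e > 0\<close> by (simp add: ennreal_plus[symmetric] del: ennreal_plus)
  show ?thesis
  proof (intro exI[of _ d] conjI allI impI d(1))
    fix h :: 'a assume h: "norm h < d"
    let ?f = "\<lambda>x. indicator (U - C k) x :: ennreal"
    have "(\<integral>\<^sup>+x. ennreal \<bar>indicator A (h + x) - indicator A x\<bar> \<partial>lborel) \<le> (\<integral>\<^sup>+x. ?f (h + x) + ?f x \<partial>lborel)"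
    proof (rule nn_integral_mono)
      fix x
      have "h + x \<in> C k \<Longrightarrow> x \<in> U"
        using d(2) h by (force simp: dist_norm)
      moreover have "x \<in> C k \<Longrightarrow> h + x \<in> U"
        using d(2) h by (force simp: dist_norm)
      ultimately show "ennreal \<bar>indicator A (h + x) - indicator A x\<bar> \<le> ?f (h + x) + ?f x"
        using U(2) C0(2) by (auto simp: indicator_def C_def)
    qed
    also have "\<dots> = (\<integral>\<^sup>+x. ?f (h + x) \<partial>lborel) + (\<integral>\<^sup>+x. ?f x \<partial>lborel)"
      by (rule nn_integral_add) auto
    also have "(\<integral>\<^sup>+x. ?f (h + x) \<partial>lborel) = (\<integral>\<^sup>+x. ?f x \<partial>lborel)"
      by (rule nn_integral_lborel_translate) measurable
    also have "(\<integral>\<^sup>+x. ?f x \<partial>lborel) = emeasure lborel (U - C k)" by simp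
    also have "emeasure lborel (U - C k) + emeasure lborel (U - C k) \<le> ennreal (e / 3) + ennreal (e / 3)"
      using UC by (intro add_mono)
    also have "\<dots> \<le> ennreal e" using \<open>e > 0\<close> by (simp add: ennreal_plus[symmetric] del: ennreal_plus)
    finally show "(\<integral>\<^sup>+x. ennreal \<bar>indicator A (h + x) - indicator A x\<bar> \<partial>lborel) \<le> ennreal e" .
  qed
qed

text \<open>Induction over integrable functions: the property holds for indicators, is kept by sums,
  and passes to dominated limits because a translation preserves the distance to the approximating
  function.\<close>

lemma L1_translate:
  fixes V :: "'a::euclidean_space \<Rightarrow> real"
  assumes "integrable lborel V" and "e > 0"
  shows "\<exists>d>0. \<forall>h. norm h < d \<longrightarrow> (\<integral>\<^sup>+x. ennreal \<bar>V (h + x) - V x\<bar> \<partial>lborel) \<le> ennreal e"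
  using assms
proof (induction arbitrary: e rule: integrable_induct)
  case (base A c)
  then have A: "A \<in> sets borel" "emeasure lborel A < \<infinity>" by auto
  have "e / (\<bar>c\<bar> + 1) > 0" using base by simp
  from L1_translate_indicator[OF A this] obtain d where d: "d > 0"
    "\<And>h. norm h < d \<Longrightarrow> (\<integral>\<^sup>+x. ennreal \<bar>indicator A (h + x) - indicator A x\<bar> \<partial>lborel) \<le> ennreal (e / (\<bar>c\<bar> + 1))"
    by blast
  show ?case
  proof (intro exI[of _ d] conjI allI impI d(1))
    fix h :: 'a assume "norm h < d"
    have [measurable]: "A \<in> sets borel" by fact
    have "(\<integral>\<^sup>+x. ennreal \<bar>indicator A (h + x) *\<^sub>R c - indicator A x *\<^sub>R c\<bar> \<partial>lborel)
      = (\<integral>\<^sup>+x. ennreal \<bar>c\<bar> * ennreal \<bar>indicator A (h + x) - indicator A x\<bar> \<partial>lborel)"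
      by (intro nn_integral_cong) (simp add: ennreal_mult[symmetric] abs_mult[symmetric] algebra_simps)
    also have "\<dots> = ennreal \<bar>c\<bar> * (\<integral>\<^sup>+x. ennreal \<bar>indicator A (h + x) - indicator A x\<bar> \<partial>lborel)"
      by (rule nn_integral_cmult) measurable
    also have "\<dots> \<le> ennreal \<bar>c\<bar> * ennreal (e / (\<bar>c\<bar> + 1))"
      using d(2)[OF \<open>norm h < d\<close>] by (intro mult_left_mono) auto
    also have "\<dots> \<le> ennreal e"
      using base by (simp add: ennreal_mult[symmetric] field_simps del: ennreal_mult ennreal_mult')
    finally show "(\<integral>\<^sup>+x. ennreal \<bar>indicator A (h + x) *\<^sub>R c - indicator A x *\<^sub>R c\<bar> \<partial>lborel) \<le> ennreal e" .
  qed
next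
  case (add f g)
  have e2: "e / 2 > 0" using add by simp
  obtain d1 where d1: "d1 > 0" "\<And>h. norm h < d1 \<Longrightarrow> (\<integral>\<^sup>+x. ennreal \<bar>f (h + x) - f x\<bar> \<partial>lborel) \<le> ennreal (e / 2)"
    using add.IH(1)[OF e2] by blast
  obtain d2 where d2: "d2 > 0" "\<And>h. norm h < d2 \<Longrightarrow> (\<integral>\<^sup>+x. ennreal \<bar>g (h + x) - g x\<bar> \<partial>lborel) \<le> ennreal (e / 2)"
    using add.IH(2)[OF e2] by blast
  have [measurable]: "f \<in> borel_measurable borel" "g \<in> borel_measurable borel"
    using borel_measurable_integrable[OF add.hyps(1)] borel_measurable_integrable[OF add.hyps(2)] by simp_all
  show ?case
  proof (intro exI[of _ "min d1 d2"] conjI allI impI)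
    show "min d1 d2 > 0" using d1 d2 by simp
    fix h :: 'a assume h: "norm h < min d1 d2"
    have "(\<integral>\<^sup>+x. ennreal \<bar>f (h + x) + g (h + x) - (f x + g x)\<bar> \<partial>lborel)
       \<le> (\<integral>\<^sup>+x. ennreal \<bar>f (h + x) - f x\<bar> + ennreal \<bar>g (h + x) - g x\<bar> \<partial>lborel)"
      by (intro nn_integral_mono) (simp add: ennreal_plus[symmetric] del: ennreal_plus)
    also have "\<dots> = (\<integral>\<^sup>+x. ennreal \<bar>f (h + x) - f x\<bar> \<partial>lborel) + (\<integral>\<^sup>+x. ennreal \<bar>g (h + x) - g x\<bar> \<partial>lborel)"
      by (rule nn_integral_add) measurable
    also have "\<dots> \<le> ennreal (e / 2) + ennreal (e / 2)"
      using h by (intro add_mono d1 d2) auto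
    also have "\<dots> = ennreal e" using add by (simp add: ennreal_plus[symmetric] del: ennreal_plus)
    finally show "(\<integral>\<^sup>+x. ennreal \<bar>f (h + x) + g (h + x) - (f x + g x)\<bar> \<partial>lborel) \<le> ennreal e" .
  qed
next
  case (lim f s)
  have [measurable]: "f \<in> borel_measurable borel" "\<And>i. s i \<in> borel_measurable borel"
    using borel_measurable_integrable[OF lim.hyps(4)] borel_measurable_integrable[OF lim.hyps(1)] by simp_all
  have "(\<lambda>i. \<integral>\<^sup>+x. norm (f x - s i x) \<partial>lborel) \<longlonglongrightarrow> 0"
  proof (rule nn_integral_dominated_convergence_norm[where w = "\<lambda>x. 2 * norm (f x)"])
    show "(\<integral>\<^sup>+x. ennreal (2 * norm (f x)) \<partial>lborel) < \<infinity>"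
      using lim.hyps(4) by (simp add: ennreal_mult nn_integral_cmult integrable_iff_bounded ennreal_mult_less_top)
  qed (use lim.hyps in auto)
  moreover have "(0::ennreal) < ennreal (e / 3)" using lim by simp
  ultimately have "\<forall>\<^sub>F i in sequentially. (\<integral>\<^sup>+x. norm (f x - s i x) \<partial>lborel) < ennreal (e / 3)"
    by (rule order_tendstoD(2))
  then obtain i where i: "(\<integral>\<^sup>+x. norm (f x - s i x) \<partial>lborel) < ennreal (e / 3)"
    by (auto simp: eventually_sequentially)
  have e3: "e / 3 > 0" using lim by simp
  obtain d where d: "d > 0" "\<And>h. norm h < d \<Longrightarrow> (\<integral>\<^sup>+x. ennreal \<bar>s i (h + x) - s i x\<bar> \<partial>lborel) \<le> ennreal (e / 3)"
    using lim.IH[OF e3, of i] by blast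
  show ?case
  proof (intro exI[of _ d] conjI allI impI d(1))
    fix h :: 'a assume h: "norm h < d"
    let ?r = "\<lambda>x. ennreal (norm (f x - s i x))"
    have "(\<integral>\<^sup>+x. ennreal \<bar>f (h + x) - f x\<bar> \<partial>lborel)
       \<le> (\<integral>\<^sup>+x. (?r (h + x) + ennreal \<bar>s i (h + x) - s i x\<bar>) + ?r x \<partial>lborel)"
      by (intro nn_integral_mono) (simp add: ennreal_plus[symmetric] del: ennreal_plus)
    also have "\<dots> = (\<integral>\<^sup>+x. ?r (h + x) \<partial>lborel) + (\<integral>\<^sup>+x. ennreal \<bar>s i (h + x) - s i x\<bar> \<partial>lborel) + (\<integral>\<^sup>+x. ?r x \<partial>lborel)"
      by (subst nn_integral_add, measurable)+
    also have "(\<integral>\<^sup>+x. ?r (h + x) \<partial>lborel) = (\<integral>\<^sup>+x. ?r x \<partial>lborel)"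
      by (rule nn_integral_lborel_translate) measurable
    also have "(\<integral>\<^sup>+x. ?r x \<partial>lborel) + (\<integral>\<^sup>+x. ennreal \<bar>s i (h + x) - s i x\<bar> \<partial>lborel) + (\<integral>\<^sup>+x. ?r x \<partial>lborel)
      \<le> ennreal (e / 3) + ennreal (e / 3) + ennreal (e / 3)"
      using h i by (intro add_mono d) (auto intro: less_imp_le)
    also have "\<dots> = ennreal e" using lim by (simp add: ennreal_plus[symmetric] del: ennreal_plus)
    finally show "(\<integral>\<^sup>+x. ennreal \<bar>f (h + x) - f x\<bar> \<partial>lborel) \<le> ennreal e" .
  qed
qed

section \<open>Convolution with kernels of compact support\<close>

lemma uniformly_continuous_compact_support:
  fixes f :: "'a::euclidean_space \<Rightarrow> 'b::real_normed_vector"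
  assumes cont: "continuous_on UNIV f" and supp: "\<And>x. norm x \<ge> R \<Longrightarrow> f x = 0" and "e > 0"
  shows "\<exists>d>0. \<forall>x y. norm (x - y) < d \<longrightarrow> norm (f x - f y) < e"
proof -
  have "uniformly_continuous_on (cball 0 (R + 1)) f"
    by (rule compact_uniformly_continuous) (auto intro: continuous_on_subset[OF cont])
  then obtain d where d: "d > 0"
    "\<And>x y. x \<in> cball 0 (R + 1) \<Longrightarrow> y \<in> cball 0 (R + 1) \<Longrightarrow> dist x y < d \<Longrightarrow> dist (f x) (f y) < e"
    using \<open>e > 0\<close> unfolding uniformly_continuous_on_def by metis
  show ?thesis
  \<comment> \<open>With distance below 1, two points either both lie in the ball of radius
    \<open>R + 1\<close>, where uniform continuity applies, or both have norm at least
    \<open>R\<close>, where \<open>f\<close> vanishes.\<close>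
  proof (intro exI[of _ "min d 1"] conjI allI impI)
    fix x y :: 'a assume xy: "norm (x - y) < min d 1"
    show "norm (f x - f y) < e"
    proof (cases "norm x \<le> R + 1 \<and> norm y \<le> R + 1")
      case True
      then show ?thesis using d(2)[of x y] xy by (simp add: dist_norm)
    next
      case False
      have "norm x \<le> norm y + norm (x - y)" "norm y \<le> norm x + norm (x - y)"
        using norm_triangle_sub[of x y] norm_triangle_sub[of y x] by (auto simp: norm_minus_commute)
      then have "norm x \<ge> R" "norm y \<ge> R" using False xy by auto
      then show ?thesis using supp \<open>e > 0\<close> by simp
    qed
  qed (use d in auto)
qed

lemma bounded_compact_support:
  fixes f :: "'a::euclidean_space \<Rightarrow> 'b::real_normed_vector"
  assumes cont: "continuous_on UNIV f" and supp: "\<And>x. norm x \<ge> R \<Longrightarrow> f x = 0"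
  obtains B where "B > 0" "\<And>x. norm (f x) \<le> B"
proof -
  have "compact (f ` cball 0 R)"
    by (intro compact_continuous_image continuous_on_subset[OF cont]) auto
  then obtain B where B: "B > 0" "\<And>x. x \<in> cball 0 R \<Longrightarrow> norm (f x) \<le> B"
    using compact_imp_bounded bounded_pos by (metis image_eqI)
  then have "norm (f x) \<le> B" for x
    using supp[of x] by (cases "norm x \<le> R") auto
  then show thesis using B that by blast
qed

text \<open>Vector values are allowed because vector fields are mollified as well as functions. The
  kernel is arbitrary so that derivatives of a mollification are again of this form.\<close>

definition cnv :: "('a::euclidean_space \<Rightarrow> real) \<Rightarrow> ('a \<Rightarrow> 'b::euclidean_space) \<Rightarrow> 'a \<Rightarrow> 'b"
  where "cnv \<kappa> \<psi> x = (\<integral>y. \<kappa> (x - y) *\<^sub>R \<psi> y \<partial>lborel)"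

lemma cnv_integrable:
  fixes \<psi> :: "'a::euclidean_space \<Rightarrow> 'b::euclidean_space"
  assumes [measurable]: "\<kappa> \<in> borel_measurable borel" and b: "\<And>x. \<bar>\<kappa> x\<bar> \<le> B" and i: "integrable lborel \<psi>"
  shows "integrable lborel (\<lambda>y. \<kappa> (x - y) *\<^sub>R \<psi> y)"
proof (rule Bochner_Integration.integrable_bound)
  show "integrable lborel (\<lambda>y. B *\<^sub>R \<psi> y)" using i by simp
  have [measurable]: "\<psi> \<in> borel_measurable borel" using i by auto
  show "(\<lambda>y. \<kappa> (x - y) *\<^sub>R \<psi> y) \<in> borel_measurable lborel" by measurable
  have "0 \<le> B" using b[of 0] by linarith
  then show "AE y in lborel. norm (\<kappa> (x - y) *\<^sub>R \<psi> y) \<le> norm (B *\<^sub>R \<psi> y)"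
    using b by (auto intro!: mult_right_mono)
qed

lemma cnv_continuous:
  fixes \<psi> :: "'a::euclidean_space \<Rightarrow> 'b::euclidean_space"
  assumes cont: "continuous_on UNIV \<kappa>" and supp: "\<And>x. norm x \<ge> R \<Longrightarrow> \<kappa> x = 0" and i: "integrable lborel \<psi>"
  shows "continuous_on UNIV (cnv \<kappa> \<psi>)"
proof (rule continuous_on_iff[THEN iffD2], intro ballI allI impI)
  fix x :: 'a and e :: real assume "e > 0"
  have [measurable]: "\<kappa> \<in> borel_measurable borel" by (rule borel_measurable_continuous_onI[OF cont])
  obtain B where B: "\<And>x. norm (\<kappa> x) \<le> B" using bounded_compact_support[OF cont supp] by metis
  \<comment> \<open>The summand 1 keeps \<open>M\<close> positive when \<psi> vanishes and makes the
    final estimate strict.\<close>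
  define M where "M = (\<integral>y. norm (\<psi> y) \<partial>lborel) + 1"
  have "M > 0" unfolding M_def by (intro add_nonneg_pos) auto
  then have "e / M > 0" using \<open>e > 0\<close> by simp
  from uniformly_continuous_compact_support[OF cont supp this] obtain d where d: "d > 0"
    "\<And>x y. norm (x - y) < d \<Longrightarrow> norm (\<kappa> x - \<kappa> y) < e / M" by blast
  note int = cnv_integrable[OF \<open>\<kappa> \<in> _\<close> _ i, of B]
  show "\<exists>d>0. \<forall>x'\<in>UNIV. dist x' x < d \<longrightarrow> dist (cnv \<kappa> \<psi> x') (cnv \<kappa> \<psi> x) < e"
  proof (intro exI[of _ d] conjI ballI impI d(1))
    fix x' assume x': "dist x' x < d"
    have eq: "cnv \<kappa> \<psi> x' - cnv \<kappa> \<psi> x = (\<integral>y. (\<kappa> (x' - y) - \<kappa> (x - y)) *\<^sub>R \<psi> y \<partial>lborel)"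
      unfolding cnv_def using int B by (subst Bochner_Integration.integral_diff[symmetric]) (auto simp: scaleR_diff_left)
    have "norm (cnv \<kappa> \<psi> x' - cnv \<kappa> \<psi> x) \<le> (\<integral>y. norm ((\<kappa> (x' - y) - \<kappa> (x - y)) *\<^sub>R \<psi> y) \<partial>lborel)"
      unfolding eq by (rule integral_norm_bound)
    also have "\<dots> \<le> (\<integral>y. (e / M) * norm (\<psi> y) \<partial>lborel)"
    proof (rule integral_mono)
      show "integrable lborel (\<lambda>y. norm ((\<kappa> (x' - y) - \<kappa> (x - y)) *\<^sub>R \<psi> y))"
        using int[of x'] int[of x] B
        by (intro integrable_norm) (simp add: scaleR_diff_left Bochner_Integration.integrable_diff)
      show "integrable lborel (\<lambda>y. (e / M) * norm (\<psi> y))" using i by simp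
      fix y
      have "norm (\<kappa> (x' - y) - \<kappa> (x - y)) < e / M"
        using d(2)[of "x' - y" "x - y"] x' by (simp add: dist_norm)
      then show "norm ((\<kappa> (x' - y) - \<kappa> (x - y)) *\<^sub>R \<psi> y) \<le> (e / M) * norm (\<psi> y)"
        unfolding norm_scaleR by (intro mult_right_mono) auto
    qed
    also have "\<dots> = (e / M) * (M - 1)" by (simp add: M_def)
    also have "\<dots> < (e / M) * M" using \<open>e / M > 0\<close> by (intro mult_strict_left_mono) auto
    also have "\<dots> = e" using \<open>M > 0\<close> by simp
    finally show "dist (cnv \<kappa> \<psi> x') (cnv \<kappa> \<psi> x) < e" by (simp add: dist_norm)
  qed
qed

text \<open>The derivative is continuous with bounded support, hence uniformly continuous, so the
  first-order remainder is small uniformly in \<open>x\<close>. This uniformity is what permits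
  differentiation under the integral.\<close>

lemma kernel_taylor:
  fixes \<kappa> :: "'a::euclidean_space \<Rightarrow> real"
  assumes der: "\<And>x. (\<kappa> has_derivative (\<lambda>h. d\<kappa> x \<bullet> h)) (at x)"
    and cont: "continuous_on UNIV d\<kappa>" and supp: "\<And>x. norm x \<ge> R \<Longrightarrow> d\<kappa> x = 0" and "e > 0"
  shows "\<exists>d>0. \<forall>x h. norm h < d \<longrightarrow> \<bar>\<kappa> (x + h) - \<kappa> x - d\<kappa> x \<bullet> h\<bar> \<le> e * norm h"
proof -
  obtain d where d: "d > 0" "\<And>x y. norm (x - y) < d \<Longrightarrow> norm (d\<kappa> x - d\<kappa> y) < e"
    using uniformly_continuous_compact_support[OF cont supp \<open>e > 0\<close>] by blast
  have "\<bar>\<kappa> (x + h) - \<kappa> x - d\<kappa> x \<bullet> h\<bar> \<le> e * norm h" if h: "norm h < d" for x h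
  proof -
    have "norm (\<kappa> (x + h) - \<kappa> x - d\<kappa> x \<bullet> (x + h - x)) \<le> norm (x + h - x) * e"
    proof (rule differentiable_bound_linearization[where S = "ball x d" and f' = "\<lambda>x h. d\<kappa> x \<bullet> h"])
      fix t :: real assume "t \<in> {0..1}"
      then have "norm (t *\<^sub>R h) \<le> norm h" by (simp add: mult_left_le_one_le)
      then show "x + t *\<^sub>R (x + h - x) \<in> ball x d" using h by (simp add: dist_norm)
    next
      fix y assume "y \<in> ball x d"
      then have "norm (d\<kappa> y - d\<kappa> x) < e" using d(2)[of y x] by (simp add: dist_norm norm_minus_commute)
      moreover have "(\<lambda>h. d\<kappa> y \<bullet> h) - (\<lambda>h. d\<kappa> x \<bullet> h) = (\<lambda>h. (d\<kappa> y - d\<kappa> x) \<bullet> h)"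
        by (auto simp: inner_diff_left)
      ultimately show "onorm ((\<lambda>h. d\<kappa> y \<bullet> h) - (\<lambda>h. d\<kappa> x \<bullet> h)) \<le> e"
        using onorm_inner_right[OF bounded_linear_ident, of "d\<kappa> y - d\<kappa> x"] by (simp add: onorm_id)
    qed (use der d in \<open>auto intro: has_derivative_at_withinI\<close>)
    then show ?thesis by (simp add: mult.commute)
  qed
  then show ?thesis using d(1) by blast
qed

text \<open>The uniform Taylor remainder of the kernel is integrated against the norm of \<psi>,
  which gives the remainder of the convolution at once.\<close>

lemma cnv_has_derivative:
  fixes \<psi> :: "'a::euclidean_space \<Rightarrow> 'b::euclidean_space"
  assumes der: "\<And>x. (\<kappa> has_derivative (\<lambda>h. d\<kappa> x \<bullet> h)) (at x)"
    and cont: "continuous_on UNIV d\<kappa>" and supp: "\<And>x. norm x \<ge> R \<Longrightarrow> d\<kappa> x = 0"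
    and supp0: "\<And>x. norm x \<ge> R \<Longrightarrow> \<kappa> x = 0" and i: "integrable lborel \<psi>"
  shows "(cnv \<kappa> \<psi> has_derivative (\<lambda>h. cnv (\<lambda>z. d\<kappa> z \<bullet> h) \<psi> x)) (at x)"
proof -
  have cont0: "continuous_on UNIV \<kappa>"
    using der by (meson continuous_at_imp_continuous_on has_derivative_continuous)
  have [measurable]: "\<kappa> \<in> borel_measurable borel" "d\<kappa> \<in> borel_measurable borel"
    using cont0 cont by (auto intro: borel_measurable_continuous_onI)
  obtain B where B: "\<And>x. norm (\<kappa> x) \<le> B" using bounded_compact_support[OF cont0 supp0] by metis
  obtain B' where B': "\<And>x. norm (d\<kappa> x) \<le> B'" using bounded_compact_support[OF cont supp] by metis
  have bd: "\<bar>d\<kappa> z \<bullet> h\<bar> \<le> B' * norm h" for z h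
    using Cauchy_Schwarz_ineq2[of "d\<kappa> z" h] mult_right_mono[OF B'[of z], of "norm h"] by simp
  have int: "integrable lborel (\<lambda>y. \<kappa> (x - y) *\<^sub>R \<psi> y)" for x
    by (rule cnv_integrable[OF _ _ i, of _ B]) (use B in auto)
  have int': "integrable lborel (\<lambda>y. (d\<kappa> (x - y) \<bullet> h) *\<^sub>R \<psi> y)" for x h
    by (rule cnv_integrable[OF _ _ i, of "\<lambda>z. d\<kappa> z \<bullet> h" "B' * norm h"]) (use bd in auto)
  define D where "D h = cnv (\<lambda>z. d\<kappa> z \<bullet> h) \<psi> x" for h
  have bl: "bounded_linear D"
  proof (rule bounded_linear_intro)
    show "D (h + k) = D h + D k" for h k
      unfolding D_def cnv_def
      by (subst Bochner_Integration.integral_add[symmetric, OF int' int']) (simp add: inner_add_right scaleR_add_left)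
    show "D (r *\<^sub>R h) = r *\<^sub>R D h" for r h
      unfolding D_def cnv_def by (subst integral_scaleR_right[symmetric]) (simp add: mult.assoc)
    fix h
    have "norm (D h) \<le> (\<integral>y. norm ((d\<kappa> (x - y) \<bullet> h) *\<^sub>R \<psi> y) \<partial>lborel)"
      unfolding D_def cnv_def by (rule integral_norm_bound)
    also have "\<dots> \<le> (\<integral>y. (B' * norm h) * norm (\<psi> y) \<partial>lborel)"
    proof (rule integral_mono)
      show "integrable lborel (\<lambda>y. norm ((d\<kappa> (x - y) \<bullet> h) *\<^sub>R \<psi> y))"
        by (rule integrable_norm[OF int'])
      show "integrable lborel (\<lambda>y. (B' * norm h) * norm (\<psi> y))" using i by simp
      show "norm ((d\<kappa> (x - y) \<bullet> h) *\<^sub>R \<psi> y) \<le> (B' * norm h) * norm (\<psi> y)" for y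
        unfolding norm_scaleR using bd by (intro mult_right_mono) auto
    qed
    finally show "norm (D h) \<le> norm h * (B' * (\<integral>y. norm (\<psi> y) \<partial>lborel))" by (simp add: ac_simps)
  qed
  define M where "M = (\<integral>y. norm (\<psi> y) \<partial>lborel) + 1"
  have "M > 0" unfolding M_def by (intro add_nonneg_pos) auto
  have "(cnv \<kappa> \<psi> has_derivative D) (at x)"
    unfolding has_derivative_at_alt
  proof (intro conjI allI impI bl)
    fix e :: real assume "e > 0"
    then have "e / M > 0" using \<open>M > 0\<close> by simp
    from kernel_taylor[OF der cont supp this] obtain d where d: "d > 0"
      "\<And>x h. norm h < d \<Longrightarrow> \<bar>\<kappa> (x + h) - \<kappa> x - d\<kappa> x \<bullet> h\<bar> \<le> e / M * norm h" by blast
    show "\<exists>d>0. \<forall>y. norm (y - x) < d \<longrightarrow> norm (cnv \<kappa> \<psi> y - cnv \<kappa> \<psi> x - D (y - x)) \<le> e * norm (y - x)"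
    proof (intro exI[of _ d] conjI allI impI d(1))
      fix x' assume x': "norm (x' - x) < d"
      let ?k = "\<lambda>y. \<kappa> (x' - y) - \<kappa> (x - y) - d\<kappa> (x - y) \<bullet> (x' - x)"
      have ik: "integrable lborel (\<lambda>y. ?k y *\<^sub>R \<psi> y)"
        unfolding scaleR_diff_left by (intro Bochner_Integration.integrable_diff int int')
      have eq: "cnv \<kappa> \<psi> x' - cnv \<kappa> \<psi> x - D (x' - x) = (\<integral>y. ?k y *\<^sub>R \<psi> y \<partial>lborel)"
        unfolding cnv_def D_def scaleR_diff_left
        by (simp add: Bochner_Integration.integral_diff int int' Bochner_Integration.integrable_diff)
      have "norm (cnv \<kappa> \<psi> x' - cnv \<kappa> \<psi> x - D (x' - x)) \<le> (\<integral>y. norm (?k y *\<^sub>R \<psi> y) \<partial>lborel)"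
        unfolding eq by (rule integral_norm_bound)
      also have "\<dots> \<le> (\<integral>y. (e / M * norm (x' - x)) * norm (\<psi> y) \<partial>lborel)"
      proof (rule integral_mono)
        fix y
        have "\<bar>?k y\<bar> \<le> e / M * norm (x' - x)"
          using d(2)[OF x', of "x - y"] by simp
        then show "norm (?k y *\<^sub>R \<psi> y) \<le> (e / M * norm (x' - x)) * norm (\<psi> y)"
          unfolding norm_scaleR by (intro mult_right_mono) auto
      qed (use i integrable_norm[OF ik] in auto)
      also have "\<dots> = e * norm (x' - x) * ((M - 1) / M)" by (simp add: M_def)
      also have "\<dots> \<le> e * norm (x' - x) * 1"
        using \<open>M > 0\<close> \<open>e > 0\<close> by (intro mult_left_mono) auto
      finally show "norm (cnv \<kappa> \<psi> x' - cnv \<kappa> \<psi> x - D (x' - x)) \<le> e * norm (x' - x)" by simp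
    qed
  qed
  then show ?thesis by (simp add: D_def[abs_def])
qed

lemma has_real_derivative_pos_part_sq:
  "((\<lambda>t::real. (max 0 t)\<^sup>2) has_derivative (\<lambda>h. 2 * max 0 t * h)) (at t)"
  unfolding has_derivative_at_alt
proof (intro conjI allI impI)
  show "bounded_linear (\<lambda>h. 2 * max 0 t * h)" by (rule bounded_linear_mult_right)
  \<comment> \<open>The remainder is at most quadratic in every combination of signs, so
    \<open>d = e\<close> serves below.\<close>
  have le: "\<bar>(max 0 (t + h))\<^sup>2 - (max 0 t)\<^sup>2 - 2 * max 0 t * h\<bar> \<le> h\<^sup>2" for h
  proof -
    consider "t \<ge> 0" "t + h \<ge> 0" | "t \<ge> 0" "t + h < 0" | "t < 0" "t + h \<ge> 0" | "t < 0" "t + h < 0" by linarith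
    then show ?thesis
    proof cases
      case 1
      then show ?thesis by (simp add: max_def power2_eq_square algebra_simps)
    next
      case 2
      have "- (t\<^sup>2) - 2 * t * h = h\<^sup>2 - (t + h)\<^sup>2" by (simp add: power2_eq_square algebra_simps)
      moreover have "t\<^sup>2 + 2 * t * h \<le> 0"
      proof -
        have "t * (t + 2 * h) \<le> 0" using 2 by (intro mult_nonneg_nonpos) auto
        then show ?thesis by (simp add: power2_eq_square algebra_simps)
      qed
      ultimately show ?thesis using 2 by (simp add: max_def)
    next
      case 3
      then have "(t + h)\<^sup>2 \<le> h\<^sup>2" by (intro power_mono) auto
      then show ?thesis using 3 by (simp add: max_def)
    next
      case 4
      then show ?thesis by (simp add: max_def)
    qed
  qed
  fix e :: real assume "e > 0"
  show "\<exists>d>0. \<forall>y. norm (y - t) < d \<longrightarrow>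
    norm ((max 0 y)\<^sup>2 - (max 0 t)\<^sup>2 - 2 * max 0 t * (y - t)) \<le> e * norm (y - t)"
  proof (intro exI[of _ e] conjI allI impI \<open>e > 0\<close>)
    fix y assume "norm (y - t) < e"
    have "norm ((max 0 y)\<^sup>2 - (max 0 t)\<^sup>2 - 2 * max 0 t * (y - t)) \<le> norm (y - t) * norm (y - t)"
      using le[of "y - t"] by (simp add: power2_eq_square)
    also have "\<dots> \<le> e * norm (y - t)" using \<open>norm (y - t) < e\<close> by (intro mult_right_mono) auto
    finally show "norm ((max 0 y)\<^sup>2 - (max 0 t)\<^sup>2 - 2 * max 0 t * (y - t)) \<le> e * norm (y - t)" .
  qed
qed

section \<open>An explicit mollifier\<close>

definition bump :: "real \<Rightarrow> 'a::euclidean_space \<Rightarrow> real"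
  where "bump \<eta> x = (max 0 (\<eta>\<^sup>2 - x \<bullet> x))\<^sup>2"

text \<open>The normalising constant depends on the dimension, which the radius alone does not
  reveal; the \<open>itself\<close> argument carries it.\<close>

definition mass :: "'a::euclidean_space itself \<Rightarrow> real \<Rightarrow> real"
  where "mass _ \<eta> = (\<integral>x. bump \<eta> (x :: 'a) \<partial>lborel)"

text \<open>The kernel is only of class C1. This is enough because test fields are required to
  satisfy \<open>Ck_on 1\<close>, and the squared positive part has an elementary gradient.\<close>

definition mol :: "real \<Rightarrow> 'a::euclidean_space \<Rightarrow> real"
  where "mol \<eta> x = bump \<eta> x / mass TYPE('a) \<eta>"

text \<open>The gradient of \<open>mol \<eta>\<close>; see
  \<open>mol_has_derivative\<close>.\<close>

definition dmol :: "real \<Rightarrow> 'a::euclidean_space \<Rightarrow> 'a"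
  where "dmol \<eta> x = (- 4 * max 0 (\<eta>\<^sup>2 - x \<bullet> x) / mass TYPE('a) \<eta>) *\<^sub>R x"

lemma bump_nonneg: "0 \<le> bump \<eta> x" by (simp add: bump_def)

lemma sq_le_inner: "\<eta> \<ge> 0 \<Longrightarrow> norm x \<ge> \<eta> \<Longrightarrow> \<eta>\<^sup>2 \<le> x \<bullet> x"
  by (simp add: power_mono dot_square_norm)

lemma bump_zero: "\<eta> > 0 \<Longrightarrow> norm x \<ge> \<eta> \<Longrightarrow> bump \<eta> x = 0"
  using sq_le_inner[of \<eta> x] by (simp add: bump_def max_def)

lemma bump_continuous: "continuous_on UNIV (bump \<eta>)"
  unfolding bump_def[abs_def] by (intro continuous_intros)

lemma bump_le: "bump \<eta> x \<le> (\<eta>\<^sup>2)\<^sup>2"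
  unfolding bump_def by (rule power_mono) auto

lemma bump_borel [measurable]: "bump \<eta> \<in> borel_measurable borel"
  using bump_continuous by (rule borel_measurable_continuous_onI)

lemma bump_integrable: "\<eta> > 0 \<Longrightarrow> integrable lborel (bump \<eta> :: 'a::euclidean_space \<Rightarrow> real)"
proof (rule Bochner_Integration.integrable_bound)
  show "integrable lborel (\<lambda>x::'a. (\<eta>\<^sup>2)\<^sup>2 * indicator (cball 0 \<eta>) x)"
    using emeasure_lborel_cball_finite[of "0::'a" \<eta>]
    by (intro integrable_mult_right integrable_real_indicator) (simp_all add: less_top)
  assume "\<eta> > 0"
  show "AE x::'a in lborel. norm (bump \<eta> x) \<le> norm ((\<eta>\<^sup>2)\<^sup>2 * indicator (cball 0 \<eta>) x :: real)"
  proof (rule AE_I2)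
    fix x :: 'a
    show "norm (bump \<eta> x) \<le> norm ((\<eta>\<^sup>2)\<^sup>2 * indicator (cball 0 \<eta>) x :: real)"
      using bump_le[of \<eta> x] bump_nonneg[of \<eta> x] bump_zero[OF \<open>\<eta> > 0\<close>, of x]
      by (cases "norm x \<le> \<eta>") (auto simp: indicator_def)
  qed
qed simp

lemma mass_pos: assumes "\<eta> > 0" shows "mass TYPE('a::euclidean_space) \<eta> > 0"
proof -
  \<comment> \<open>On the ball of half the radius, \<open>\<eta>\<^sup>2 - x \<bullet> x\<close> is
    at least \<open>3 / 4\<close> of \<open>\<eta>\<^sup>2\<close>, so \<open>?c\<close> bounds the
    bump from below there.\<close>
  let ?c = "(\<eta>\<^sup>2 / 2)\<^sup>2"
  have "0 < ?c * measure lborel (ball (0::'a) (\<eta> / 2))"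
    using assms by (simp add: content_ball_pos)
  also have "\<dots> = (\<integral>x. ?c * indicator (ball (0::'a) (\<eta> / 2)) x \<partial>lborel)"
    by simp
  also have "\<dots> \<le> mass TYPE('a) \<eta>"
    unfolding mass_def
  proof (rule integral_mono)
    show "integrable lborel (\<lambda>x::'a. ?c * indicator (ball 0 (\<eta> / 2)) x)"
      using emeasure_lborel_ball_finite[of "0::'a" "\<eta> / 2"]
      by (intro integrable_mult_right integrable_real_indicator) (simp_all add: less_top)
    show "integrable lborel (bump \<eta> :: 'a \<Rightarrow> real)" by (rule bump_integrable[OF assms])
    fix x :: 'a
    show "?c * indicator (ball 0 (\<eta> / 2)) x \<le> bump \<eta> x"
    proof (cases "x \<in> ball 0 (\<eta> / 2)")
      case True
      then have "(norm x)\<^sup>2 \<le> (\<eta> / 2)\<^sup>2" by (intro power_mono) auto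
      then have "(norm x)\<^sup>2 \<le> \<eta>\<^sup>2 / 4" by (simp add: power_divide)
      moreover have "0 \<le> \<eta>\<^sup>2" by simp
      ultimately have "\<eta>\<^sup>2 / 2 \<le> \<eta>\<^sup>2 - x \<bullet> x"
        unfolding dot_square_norm by linarith
      then have "?c \<le> bump \<eta> x" unfolding bump_def by (intro power_mono max.coboundedI2) auto
      then show ?thesis using True by simp
    qed (simp add: bump_nonneg)
  qed
  finally show ?thesis .
qed

context
  fixes \<eta> :: real assumes \<eta>: "\<eta> > 0"
begin

lemma mol_nonneg: "0 \<le> mol \<eta> (x :: 'a::euclidean_space)"
  using mass_pos[OF \<eta>, where 'a='a] by (simp add: mol_def bump_nonneg less_imp_le)

lemma mol_zero: "norm x \<ge> \<eta> \<Longrightarrow> mol \<eta> x = 0"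
  using \<eta> by (simp add: mol_def bump_zero)

lemma mol_even: "mol \<eta> (- x) = mol \<eta> x" by (simp add: mol_def bump_def)

lemma mol_continuous: "continuous_on UNIV (mol \<eta> :: 'a::euclidean_space \<Rightarrow> real)"
  unfolding mol_def[abs_def] using mass_pos[OF \<eta>, where 'a='a] bump_continuous
  by (intro continuous_intros) auto

lemma mol_borel [measurable]: "mol \<eta> \<in> borel_measurable borel"
  by (rule borel_measurable_continuous_onI[OF mol_continuous])

lemma mol_integrable: "integrable lborel (mol \<eta> :: 'a::euclidean_space \<Rightarrow> real)"
  unfolding mol_def[abs_def] using bump_integrable[OF \<eta>, where 'a='a] by simp

lemma integral_mol: "(\<integral>x. mol \<eta> (x::'a::euclidean_space) \<partial>lborel) = 1"
  unfolding mol_def[abs_def] using mass_pos[OF \<eta>, where 'a='a] by (simp add: mass_def)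

lemma nn_integral_mol: "(\<integral>\<^sup>+x. ennreal (mol \<eta> (x::'a::euclidean_space)) \<partial>lborel) = 1"
  using nn_integral_eq_integral[OF mol_integrable[where 'a='a]] integral_mol[where 'a='a] by (simp add: mol_nonneg)

lemma dmol_zero: "norm x \<ge> \<eta> \<Longrightarrow> dmol \<eta> x = 0"
  using sq_le_inner[of \<eta> x] \<eta> by (simp add: dmol_def max_def)

lemma dmol_odd: "dmol \<eta> (- x) = - dmol \<eta> x" by (simp add: dmol_def)

lemma dmol_continuous: "continuous_on UNIV (dmol \<eta> :: 'a::euclidean_space \<Rightarrow> 'a)"
  unfolding dmol_def[abs_def] using mass_pos[OF \<eta>, where 'a='a]
  by (intro continuous_intros) auto

lemma dmol_borel [measurable]: "dmol \<eta> \<in> borel_measurable borel"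
  by (rule borel_measurable_continuous_onI[OF dmol_continuous])

lemma mol_has_derivative:
  "(mol \<eta> has_derivative (\<lambda>h. dmol \<eta> (x::'a::euclidean_space) \<bullet> h)) (at x)"
proof -
  let ?I = "mass TYPE('a) \<eta>"
  have 1: "((\<lambda>x::'a. \<eta>\<^sup>2 - x \<bullet> x) has_derivative (\<lambda>h. - 2 * (x \<bullet> h))) (at x)"
    by (auto intro!: derivative_eq_intros simp: inner_commute)
  have "((\<lambda>x. (max 0 (\<eta>\<^sup>2 - x \<bullet> x))\<^sup>2) has_derivative
     (\<lambda>h. 2 * max 0 (\<eta>\<^sup>2 - x \<bullet> x) * (- 2 * (x \<bullet> h)))) (at x)"
    by (rule has_derivative_compose[OF 1 has_real_derivative_pos_part_sq])
  then have "((\<lambda>x. (max 0 (\<eta>\<^sup>2 - x \<bullet> x))\<^sup>2 / ?I) has_derivative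
     (\<lambda>h. 2 * max 0 (\<eta>\<^sup>2 - x \<bullet> x) * (- 2 * (x \<bullet> h)) / ?I)) (at x)"
    by (rule bounded_linear.has_derivative[OF bounded_linear_divide])
  then show ?thesis
    by (simp add: mol_def[abs_def] bump_def[abs_def] dmol_def mult.assoc)
qed

lemma mol_bound: obtains B where "B > 0" "\<And>x::'a::euclidean_space. \<bar>mol \<eta> x\<bar> \<le> B"
  using bounded_compact_support[OF mol_continuous[where 'a='a] mol_zero] by (metis real_norm_def)

lemma dmol_bound: obtains B where "B > 0" "\<And>x::'a::euclidean_space. norm (dmol \<eta> x) \<le> B"
  using bounded_compact_support[OF dmol_continuous[where 'a='a] dmol_zero] by metis

text \<open>The gradient of \<open>cnv (mol \<eta>) V\<close>. With the derivative on the kernel it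
  makes sense for merely integrable \<open>V\<close> and depends continuously on \<open>V\<close> in
  the mean.\<close>

definition grd :: "('a::euclidean_space \<Rightarrow> real) \<Rightarrow> 'a \<Rightarrow> 'a"
  where "grd V x = (\<integral>y. V y *\<^sub>R dmol \<eta> (x - y) \<partial>lborel)"

lemma grd_integrable:
  assumes i: "integrable lborel (V :: 'a::euclidean_space \<Rightarrow> real)"
  shows "integrable lborel (\<lambda>y. V y *\<^sub>R dmol \<eta> (x - y))"
proof -
  obtain B where B: "B > 0" "\<And>x::'a. norm (dmol \<eta> x) \<le> B"
    using dmol_bound[where 'a='a] by metis
  have [measurable]: "V \<in> borel_measurable borel" using i by auto
  show ?thesis
  proof (rule Bochner_Integration.integrable_bound)
    show "integrable lborel (\<lambda>y. B * V y)" using i by simp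
    show "AE y in lborel. norm (V y *\<^sub>R dmol \<eta> (x - y)) \<le> norm (B * V y)"
    proof (rule AE_I2)
      fix y
      show "norm (V y *\<^sub>R dmol \<eta> (x - y)) \<le> norm (B * V y)"
        using B(1) mult_left_mono[OF B(2)[of "x - y"], of "\<bar>V y\<bar>"] by (simp add: abs_mult mult.commute)
    qed
  qed measurable
qed

lemma cnv_dmol_inner:
  assumes i: "integrable lborel (V :: 'a::euclidean_space \<Rightarrow> real)"
  shows "cnv (\<lambda>z. dmol \<eta> z \<bullet> h) V x = grd V x \<bullet> h"
  unfolding grd_def cnv_def
  by (subst integral_inner_left[symmetric, OF grd_integrable[OF i]]) (simp add: mult.commute)

lemma cnv_mol_derivative:
  assumes i: "integrable lborel (V :: 'a::euclidean_space \<Rightarrow> real)"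
  shows "(cnv (mol \<eta>) V has_derivative (\<lambda>h. grd V x \<bullet> h)) (at x)"
  using cnv_has_derivative[OF mol_has_derivative dmol_continuous dmol_zero mol_zero i, where x = x]
  by (simp add: cnv_dmol_inner[OF i])

lemma dmol_inner_continuous: "continuous_on UNIV (\<lambda>z::'a::euclidean_space. dmol \<eta> z \<bullet> h)"
  by (intro continuous_intros dmol_continuous)

lemma grd_continuous:
  assumes i: "integrable lborel (V :: 'a::euclidean_space \<Rightarrow> real)"
  shows "continuous_on UNIV (grd V)"
proof -
  have "continuous_on UNIV (\<lambda>x. grd V x \<bullet> b)" for b
    using cnv_continuous[OF dmol_inner_continuous[of b] _ i, where R = \<eta>]
    by (simp add: dmol_zero cnv_dmol_inner[OF i, abs_def])
  then have "continuous_on UNIV (\<lambda>x. \<Sum>b\<in>Basis. (grd V x \<bullet> b) *\<^sub>R b)"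
    by (intro continuous_on_sum continuous_on_scaleR continuous_on_const)
  moreover have "(\<lambda>x. \<Sum>b\<in>Basis. (grd V x \<bullet> b) *\<^sub>R b) = grd V"
    by (rule ext) (rule euclidean_representation)
  ultimately show ?thesis by (simp only:)
qed

text \<open>\<open>dmol \<eta>\<close> vanishes outside radius \<eta>, so the gradient at
  \<open>x\<close> sees only the ball of radius \<eta> about \<open>x\<close>. In this way
  convergence in the mean on compact subsets becomes uniform convergence of mollified
  gradients.\<close>

lemma grd_diff_le:
  fixes V W :: "'a::euclidean_space \<Rightarrow> real"
  assumes V: "integrable lborel V" and W: "integrable lborel W" and B: "\<And>x::'a. norm (dmol \<eta> x) \<le> B"
  shows "norm (grd V x - grd W x) \<le> B * (\<integral>y. indicator (ball x \<eta>) y * \<bar>V y - W y\<bar> \<partial>lborel)"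
proof -
  have eq: "grd V x - grd W x = (\<integral>y. (V y - W y) *\<^sub>R dmol \<eta> (x - y) \<partial>lborel)"
    unfolding grd_def scaleR_diff_left
    by (rule Bochner_Integration.integral_diff[symmetric]) (rule grd_integrable V W)+
  have "norm (grd V x - grd W x) \<le> (\<integral>y. norm ((V y - W y) *\<^sub>R dmol \<eta> (x - y)) \<partial>lborel)"
    unfolding eq by (rule integral_norm_bound)
  also have "\<dots> \<le> (\<integral>y. B * (indicator (ball x \<eta>) y * \<bar>V y - W y\<bar>) \<partial>lborel)"
  proof (rule integral_mono)
    show "integrable lborel (\<lambda>y. norm ((V y - W y) *\<^sub>R dmol \<eta> (x - y)))"
      by (intro integrable_norm grd_integrable Bochner_Integration.integrable_diff V W)
    show "integrable lborel (\<lambda>y. B * (indicator (ball x \<eta>) y * \<bar>V y - W y\<bar>))"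
      using integrable_mult_indicator[of "ball x \<eta>" lborel "\<lambda>y. \<bar>V y - W y\<bar>"] V W by simp
    show "norm ((V y - W y) *\<^sub>R dmol \<eta> (x - y)) \<le> B * (indicator (ball x \<eta>) y * \<bar>V y - W y\<bar>)" for y
      using dmol_zero[of "x - y"] B[of "x - y"]
      by (auto simp: indicator_def dist_norm mult.commute[of B] not_less intro: mult_left_mono)
  qed
  finally show ?thesis by simp
qed

lemma Ck1_cnv_mol:
  fixes \<psi> :: "'a::euclidean_space \<Rightarrow> 'b::euclidean_space"
  assumes i: "integrable lborel \<psi>"
  shows "Ck_on 1 UNIV (cnv (mol \<eta>) \<psi>)"
    and "frechet_derivative (cnv (mol \<eta>) \<psi>) (at x) = (\<lambda>h. cnv (\<lambda>z. dmol \<eta> z \<bullet> h) \<psi> x)"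
proof -
  note d = cnv_has_derivative[OF mol_has_derivative dmol_continuous dmol_zero mol_zero i]
  have fd: "frechet_derivative (cnv (mol \<eta>) \<psi>) (at x) = (\<lambda>h. cnv (\<lambda>z. dmol \<eta> z \<bullet> h) \<psi> x)" for x
    using frechet_derivative_at[OF d] by (rule sym)
  then show "frechet_derivative (cnv (mol \<eta>) \<psi>) (at x) = (\<lambda>h. cnv (\<lambda>z. dmol \<eta> z \<bullet> h) \<psi> x)" .
  have "continuous_on UNIV (\<lambda>x. frechet_derivative (cnv (mol \<eta>) \<psi>) (at x) v)" for v
    unfolding fd by (rule cnv_continuous[OF dmol_inner_continuous _ i, where R = \<eta>]) (simp add: dmol_zero)
  then show "Ck_on 1 UNIV (cnv (mol \<eta>) \<psi>)"
    using d by (auto simp: differentiable_def)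
qed

lemma divergence_cnv_mol:
  fixes \<psi> :: "real ^ 'n \<Rightarrow> real ^ 'n"
  assumes i: "integrable lborel \<psi>"
  shows "divergence (cnv (mol \<eta>) \<psi>) x = (\<integral>y. dmol \<eta> (x - y) \<bullet> \<psi> y \<partial>lborel)"
proof -
  obtain B where B: "B > 0" "\<And>x::real^'n. norm (dmol \<eta> x) \<le> B"
    using dmol_bound[where 'a="real^'n"] by metis
  have bd: "\<bar>dmol \<eta> z \<bullet> axis j 1\<bar> \<le> B" for z :: "real ^ 'n" and j
    using Cauchy_Schwarz_ineq2[of "dmol \<eta> z" "axis j 1"] B(2)[of z] by simp
  have int: "integrable lborel (\<lambda>y. (dmol \<eta> (x - y) \<bullet> axis j 1) *\<^sub>R \<psi> y)" for j
    by (rule cnv_integrable[OF _ _ i, of "\<lambda>z. dmol \<eta> z \<bullet> axis j 1" B]) (use bd in auto)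
  have "divergence (cnv (mol \<eta>) \<psi>) x = (\<Sum>j\<in>UNIV. (\<integral>y. (dmol \<eta> (x - y) \<bullet> axis j 1) *\<^sub>R \<psi> y \<partial>lborel) \<bullet> axis j 1)"
    unfolding divergence_def Ck1_cnv_mol(2)[OF i] cnv_def by (simp add: inner_axis)
  also have "\<dots> = (\<Sum>j\<in>UNIV. \<integral>y. ((dmol \<eta> (x - y) \<bullet> axis j 1) *\<^sub>R \<psi> y) \<bullet> axis j 1 \<partial>lborel)"
    by (simp only: integral_inner_left[OF int])
  also have "\<dots> = (\<integral>y. (\<Sum>j\<in>UNIV. ((dmol \<eta> (x - y) \<bullet> axis j 1) *\<^sub>R \<psi> y) \<bullet> axis j 1) \<partial>lborel)"
    by (rule Bochner_Integration.integral_sum[symmetric]) (rule integrable_inner_left[OF int])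
  also have "\<dots> = (\<integral>y. dmol \<eta> (x - y) \<bullet> \<psi> y \<partial>lborel)"
    by (intro Bochner_Integration.integral_cong refl) (simp add: inner_vec_def[of "dmol _ _" "\<psi> _"] inner_axis)
  finally show ?thesis .
qed

text \<open>Fubini moves the mollifier from \<open>V\<close> to \<psi>; the sign comes from the
  oddness of \<open>dmol \<eta>\<close>. The right side tests \<open>V\<close> with the divergence
  of a field, the form that total variation bounds.\<close>

lemma integral_grd_inner:
  fixes \<psi> :: "real ^ 'n \<Rightarrow> real ^ 'n"
  assumes i: "integrable lborel \<psi>" and V: "integrable lborel V"
  shows "(\<integral>x. \<psi> x \<bullet> grd V x \<partial>lborel) = - (\<integral>y. V y * divergence (cnv (mol \<eta>) \<psi>) y \<partial>lborel)"
proof -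
  obtain B where B: "B > 0" "\<And>x::real^'n. norm (dmol \<eta> x) \<le> B"
    using dmol_bound[where 'a="real^'n"] by metis
  have [measurable]: "\<psi> \<in> borel_measurable borel" "V \<in> borel_measurable borel" using i V by auto
  let ?f = "\<lambda>x y. V y * (\<psi> x \<bullet> dmol \<eta> (x - y))"
  have int: "integrable (lborel \<Otimes>\<^sub>M lborel) (\<lambda>(x, y). ?f x y)"
  proof (rule integrableI_bounded)
    have "(\<integral>\<^sup>+z. ennreal (norm (case z of (x, y) \<Rightarrow> ?f x y)) \<partial>(lborel \<Otimes>\<^sub>M lborel))
       = (\<integral>\<^sup>+x. (\<integral>\<^sup>+y. ennreal \<bar>?f x y\<bar> \<partial>lborel) \<partial>lborel)"
      by (subst lborel.nn_integral_fst[symmetric]) auto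
    also have "\<dots> \<le> (\<integral>\<^sup>+x. (\<integral>\<^sup>+y. ennreal (B * norm (\<psi> x)) * ennreal \<bar>V y\<bar> \<partial>lborel) \<partial>lborel)"
    proof (intro nn_integral_mono)
      fix x y
      have "\<bar>\<psi> x \<bullet> dmol \<eta> (x - y)\<bar> \<le> norm (\<psi> x) * norm (dmol \<eta> (x - y))" by (rule Cauchy_Schwarz_ineq2)
      also have "\<dots> \<le> norm (\<psi> x) * B" using B by (intro mult_left_mono) auto
      finally have "\<bar>?f x y\<bar> \<le> B * norm (\<psi> x) * \<bar>V y\<bar>"
        using mult_left_mono[of "\<bar>\<psi> x \<bullet> dmol \<eta> (x - y)\<bar>" "norm (\<psi> x) * B" "\<bar>V y\<bar>"]
        by (simp add: abs_mult ac_simps)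
      then show "ennreal \<bar>?f x y\<bar> \<le> ennreal (B * norm (\<psi> x)) * ennreal \<bar>V y\<bar>"
        using B by (simp add: ennreal_mult[symmetric] ennreal_leI)
    qed
    also have "\<dots> = (\<integral>\<^sup>+x. ennreal (B * norm (\<psi> x)) * (\<integral>\<^sup>+y. ennreal \<bar>V y\<bar> \<partial>lborel) \<partial>lborel)"
      by (simp add: nn_integral_cmult)
    also have "\<dots> = (\<integral>\<^sup>+x. ennreal (B * norm (\<psi> x)) \<partial>lborel) * (\<integral>\<^sup>+y. ennreal \<bar>V y\<bar> \<partial>lborel)"
      by (simp add: nn_integral_multc)
    also have "\<dots> < \<infinity>"
    proof -
      have "(\<integral>\<^sup>+x. ennreal (B * norm (\<psi> x)) \<partial>lborel) < \<infinity>" "(\<integral>\<^sup>+y. ennreal \<bar>V y\<bar> \<partial>lborel) < \<infinity>"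
        using i V B(1) by (auto simp: integrable_iff_bounded ennreal_mult nn_integral_cmult ennreal_mult_less_top)
      then show ?thesis by (simp add: ennreal_mult_less_top)
    qed
    finally show "(\<integral>\<^sup>+z. ennreal (norm (case z of (x, y) \<Rightarrow> ?f x y)) \<partial>(lborel \<Otimes>\<^sub>M lborel)) < \<infinity>" .
  qed measurable
  have "(\<integral>x. \<psi> x \<bullet> grd V x \<partial>lborel) = (\<integral>x. (\<integral>y. ?f x y \<partial>lborel) \<partial>lborel)"
    unfolding grd_def
    by (intro Bochner_Integration.integral_cong refl) (simp add: integral_inner_right[OF grd_integrable[OF V], symmetric])
  also have "\<dots> = (\<integral>y. (\<integral>x. ?f x y \<partial>lborel) \<partial>lborel)"
    by (rule lborel_pair.Fubini_integral[symmetric, OF int])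
  also have "\<dots> = (\<integral>y. - (V y * divergence (cnv (mol \<eta>) \<psi>) y) \<partial>lborel)"
  proof (intro Bochner_Integration.integral_cong refl)
    fix y
    have "(\<integral>x. ?f x y \<partial>lborel) = (\<integral>x. - (V y * (dmol \<eta> (y - x) \<bullet> \<psi> x)) \<partial>lborel)"
    proof (intro Bochner_Integration.integral_cong refl)
      fix x
      have "dmol \<eta> (x - y) = - dmol \<eta> (y - x)" using dmol_odd[of "y - x"] by simp
      then show "?f x y = - (V y * (dmol \<eta> (y - x) \<bullet> \<psi> x))" by (simp add: inner_commute)
    qed
    then show "(\<integral>x. ?f x y \<partial>lborel) = - (V y * divergence (cnv (mol \<eta>) \<psi>) y)"
      by (simp add: divergence_cnv_mol[OF i])
  qed
  finally show ?thesis by simp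
qed

section \<open>Bounds and approximation for mollifications\<close>

lemma mol_kernel_integrable:
  fixes \<psi> :: "'a::euclidean_space \<Rightarrow> 'b::euclidean_space"
  assumes i: "integrable lborel \<psi>"
  shows "integrable lborel (\<lambda>y. mol \<eta> (x - y) *\<^sub>R \<psi> y)"
proof -
  obtain B where B: "B > 0" "\<And>x::'a. \<bar>mol \<eta> x\<bar> \<le> B"
    using mol_bound[where 'a='a] by metis
  show ?thesis by (rule cnv_integrable[OF mol_borel B(2) i])
qed

lemma integral_mol_reflect: "(\<integral>y. mol \<eta> (x - y :: 'a::euclidean_space) \<partial>lborel) = 1"
  and mol_reflect_integrable: "integrable lborel (\<lambda>y. mol \<eta> (x - y :: 'a::euclidean_space))"
proof -
  have d: "distr lborel borel (\<lambda>y. x - y) = (lborel :: 'a measure)"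
    using lborel_affine[of "-1" x] by (simp add: density_1)
  have "integrable (distr lborel borel (\<lambda>y. x - y)) (mol \<eta>)" unfolding d by (rule mol_integrable)
  then show "integrable lborel (\<lambda>y. mol \<eta> (x - y))" by (subst (asm) integrable_distr_eq) auto
  have "(\<integral>y. mol \<eta> y \<partial>distr lborel borel (\<lambda>y. x - y)) = 1" unfolding d by (rule integral_mol)
  then show "(\<integral>y. mol \<eta> (x - y) \<partial>lborel) = 1" by (subst (asm) integral_distr) auto
qed

lemma cnv_mol_norm_le:
  fixes \<psi> :: "'a::euclidean_space \<Rightarrow> 'b::euclidean_space"
  assumes i: "integrable lborel \<psi>" and b: "\<And>x. norm (\<psi> x) \<le> b"
  shows "norm (cnv (mol \<eta>) \<psi> x) \<le> b"
proof -
  have "norm (cnv (mol \<eta>) \<psi> x) \<le> (\<integral>y. norm (mol \<eta> (x - y) *\<^sub>R \<psi> y) \<partial>lborel)"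
    unfolding cnv_def by (rule integral_norm_bound)
  also have "\<dots> \<le> (\<integral>y. mol \<eta> (x - y) * b \<partial>lborel)"
  proof (rule integral_mono[OF integrable_norm[OF mol_kernel_integrable[OF i]]])
    show "integrable lborel (\<lambda>y. mol \<eta> (x - y) * b)" using mol_reflect_integrable[of x] by simp
    show "norm (mol \<eta> (x - y) *\<^sub>R \<psi> y) \<le> mol \<eta> (x - y) * b" for y
      using mol_nonneg[of "x - y"] b[of y] by (simp add: mult_left_mono)
  qed
  also have "\<dots> = b" by (simp add: integral_mol_reflect)
  finally show ?thesis .
qed

lemma cnv_mol_supp:
  fixes \<psi> :: "'a::euclidean_space \<Rightarrow> 'b::euclidean_space"
  assumes "cnv (mol \<eta>) \<psi> x \<noteq> 0"
  obtains y where "\<psi> y \<noteq> 0" "norm (x - y) < \<eta>"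
proof -
  have "\<exists>y. \<psi> y \<noteq> 0 \<and> norm (x - y) < \<eta>"
  proof (rule ccontr)
    assume "\<not> ?thesis"
    then have "(\<lambda>y. mol \<eta> (x - y) *\<^sub>R \<psi> y) = (\<lambda>y. 0)" using mol_zero by (intro ext) force
    then show False using assms by (simp add: cnv_def)
  qed
  then show thesis using that by blast
qed

lemma cnv_mol_borel [measurable]:
  fixes V :: "'a::euclidean_space \<Rightarrow> 'b::euclidean_space"
  assumes "integrable lborel V"
  shows "cnv (mol \<eta>) V \<in> borel_measurable borel"
  by (rule borel_measurable_continuous_onI[OF cnv_continuous[OF mol_continuous mol_zero assms]])

text \<open>The error of mollification is a kernel-weighted mean of the differences
  \<open>V (h + x) - V x\<close>. After exchanging integrals, a common bound for all shifts shorter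
  than \<eta> is inherited, because longer shifts carry no weight.\<close>

lemma cnv_mol_L1_local:
  fixes V :: "'a::euclidean_space \<Rightarrow> real"
  assumes i: "integrable lborel V" and [measurable]: "S \<in> sets borel"
    and C: "\<And>h. norm h < \<eta> \<Longrightarrow> (\<integral>\<^sup>+x\<in>S. ennreal \<bar>V (h + x) - V x\<bar> \<partial>lborel) \<le> C"
  shows "(\<integral>\<^sup>+x\<in>S. ennreal \<bar>cnv (mol \<eta>) V x - V x\<bar> \<partial>lborel) \<le> C"
proof -
  have [measurable]: "V \<in> borel_measurable borel" using i by auto
  let ?m = "\<lambda>h. ennreal (mol \<eta> h)"
  have pt: "ennreal \<bar>cnv (mol \<eta>) V x - V x\<bar> \<le> (\<integral>\<^sup>+h. ?m h * ennreal \<bar>V (h + x) - V x\<bar> \<partial>lborel)" for x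
  proof -
    \<comment> \<open>Since the kernel has integral 1, the value \<open>V x\<close> may be moved
      under the integral.\<close>
    have eq: "cnv (mol \<eta>) V x - V x = (\<integral>y. mol \<eta> (x - y) *\<^sub>R (V y - V x) \<partial>lborel)"
      using Bochner_Integration.integral_diff[OF mol_kernel_integrable[OF i, of x]
          integrable_mult_left[OF mol_reflect_integrable, of x "V x"]]
      by (simp add: cnv_def integral_mol_reflect right_diff_distrib)
    have int: "integrable lborel (\<lambda>y. mol \<eta> (x - y) *\<^sub>R (V y - V x))"
      using Bochner_Integration.integrable_diff[OF mol_kernel_integrable[OF i, of x]
          integrable_mult_left[OF mol_reflect_integrable, of x "V x"]]
      by (simp add: right_diff_distrib)
    have "ennreal \<bar>cnv (mol \<eta>) V x - V x\<bar> \<le> (\<integral>\<^sup>+y. ennreal (norm (mol \<eta> (x - y) *\<^sub>R (V y - V x))) \<partial>lborel)"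
      unfolding eq using integral_norm_bound_ennreal[OF int] by simp
    also have "\<dots> = (\<integral>\<^sup>+y. ?m (y - x) * ennreal \<bar>V y - V x\<bar> \<partial>lborel)"
    proof (intro nn_integral_cong)
      fix y
      have "mol \<eta> (x - y) = mol \<eta> (y - x)" using mol_even[of "y - x"] by simp
      then show "ennreal (norm (mol \<eta> (x - y) *\<^sub>R (V y - V x))) = ?m (y - x) * ennreal \<bar>V y - V x\<bar>"
        by (simp add: abs_mult mol_nonneg ennreal_mult)
    qed
    also have "\<dots> = (\<integral>\<^sup>+h. ?m h * ennreal \<bar>V (h + x) - V x\<bar> \<partial>lborel)"
      using nn_integral_lborel_translate[of "\<lambda>y. ?m (y - x) * ennreal \<bar>V y - V x\<bar>" x]
      by (simp add: add.commute)
    finally show ?thesis .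
  qed
  have "(\<integral>\<^sup>+x\<in>S. ennreal \<bar>cnv (mol \<eta>) V x - V x\<bar> \<partial>lborel)
     \<le> (\<integral>\<^sup>+x. (\<integral>\<^sup>+h. ?m h * (ennreal \<bar>V (h + x) - V x\<bar> * indicator S x) \<partial>lborel) \<partial>lborel)"
  proof (intro nn_integral_mono)
    fix x
    have "ennreal \<bar>cnv (mol \<eta>) V x - V x\<bar> * indicator S x
       \<le> (\<integral>\<^sup>+h. ?m h * ennreal \<bar>V (h + x) - V x\<bar> \<partial>lborel) * indicator S x"
      by (intro mult_right_mono pt) auto
    also have "\<dots> = (\<integral>\<^sup>+h. ?m h * (ennreal \<bar>V (h + x) - V x\<bar> * indicator S x) \<partial>lborel)"
      by (subst nn_integral_multc[symmetric]) (auto simp: mult.assoc)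
    finally show "ennreal \<bar>cnv (mol \<eta>) V x - V x\<bar> * indicator S x
       \<le> (\<integral>\<^sup>+h. ?m h * (ennreal \<bar>V (h + x) - V x\<bar> * indicator S x) \<partial>lborel)" .
  qed
  also have "\<dots> = (\<integral>\<^sup>+h. (\<integral>\<^sup>+x. ?m h * (ennreal \<bar>V (h + x) - V x\<bar> * indicator S x) \<partial>lborel) \<partial>lborel)"
    by (rule lborel_pair.Fubini') measurable
  also have "\<dots> = (\<integral>\<^sup>+h. ?m h * (\<integral>\<^sup>+x\<in>S. ennreal \<bar>V (h + x) - V x\<bar> \<partial>lborel) \<partial>lborel)"
    by (simp add: nn_integral_cmult)
  also have "\<dots> \<le> (\<integral>\<^sup>+h. ?m (h :: 'a) * C \<partial>lborel)"
  proof (intro nn_integral_mono)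
    fix h :: 'a
    show "?m h * (\<integral>\<^sup>+x\<in>S. ennreal \<bar>V (h + x) - V x\<bar> \<partial>lborel) \<le> ?m h * C"
      using C[of h] mol_zero[of h] by (cases "norm h < \<eta>") (auto intro: mult_left_mono)
  qed
  also have "\<dots> = C" by (simp add: nn_integral_multc nn_integral_mol)
  finally show ?thesis .
qed

end

lemma cnv_mol_L1:
  fixes V :: "'a::euclidean_space \<Rightarrow> real"
  assumes i: "integrable lborel V" and "e > 0"
  shows "\<exists>d>0. \<forall>\<eta>. 0 < \<eta> \<longrightarrow> \<eta> < d \<longrightarrow> (\<integral>\<^sup>+x. ennreal \<bar>cnv (mol \<eta>) V x - V x\<bar> \<partial>lborel) \<le> ennreal e"
proof -
  obtain d where d: "d > 0" "\<And>h. norm h < d \<Longrightarrow> (\<integral>\<^sup>+x. ennreal \<bar>V (h + x) - V x\<bar> \<partial>lborel) \<le> ennreal e"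
    using L1_translate[OF assms] by blast
  show ?thesis
  proof (intro exI[of _ d] conjI allI impI d(1))
    fix \<eta> :: real assume "0 < \<eta>" "\<eta> < d"
    then show "(\<integral>\<^sup>+x. ennreal \<bar>cnv (mol \<eta>) V x - V x\<bar> \<partial>lborel) \<le> ennreal e"
      using cnv_mol_L1_local[OF \<open>0 < \<eta>\<close> i, of UNIV "ennreal e"] d(2) by simp
  qed
qed

section \<open>Oscillation of affine functions on cubes\<close>

interpretation lborel_prod: product_sigma_finite "\<lambda>_::'i. lborel :: real measure"
  by unfold_locales

text \<open>The integral of \<open>h\<close> of a linear form with coefficients \<open>c\<close>
  over the centred cube of half side \<open>a\<close>. Writing it over a product measure with
  variable index set \<open>I\<close> prepares the induction over coordinates.\<close>

definition cubeint :: "real \<Rightarrow> ('i \<Rightarrow> real) \<Rightarrow> 'i set \<Rightarrow> (real \<Rightarrow> real) \<Rightarrow> real"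
  where "cubeint a c I h =
    (\<integral>f. (\<Prod>b\<in>I. indicator {-a<..<a} (f b)) * h (\<Sum>b\<in>I. c b * f b) \<partial>(\<Pi>\<^sub>M b\<in>I. lborel))"

lemma prod_indicator_eq:
  fixes f :: "'i \<Rightarrow> real"
  assumes "finite I"
  shows "(\<Prod>b\<in>I. indicator {-a<..<a} (f b)) = (if \<forall>b\<in>I. \<bar>f b\<bar> < a then 1 else 0 :: real)"
  using assms
proof (induction I)
  case (insert b I)
  have "indicator {-a<..<a} (f b) = (if \<bar>f b\<bar> < a then 1 else 0 :: real)"
    by (auto simp: indicator_def abs_less_iff)
  then show ?case using insert by simp
qed simp

lemma cubeint_integrable:
  fixes c :: "'i \<Rightarrow> real" and h :: "real \<Rightarrow> real"
  assumes "finite I" "a > 0" and cont: "continuous_on UNIV h"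
  shows "integrable (\<Pi>\<^sub>M b\<in>I. lborel) (\<lambda>f. (\<Prod>b\<in>I. indicator {-a<..<a} (f b)) * h (\<Sum>b\<in>I. c b * f b))"
proof -
  let ?R = "(\<Sum>b\<in>I. \<bar>c b\<bar> * a)"
  have [measurable]: "h \<in> borel_measurable borel" by (rule borel_measurable_continuous_onI[OF cont])
  have "compact (h ` {-?R..?R})" by (intro compact_continuous_image continuous_on_subset[OF cont]) auto
  then obtain B where B: "\<And>x. x \<in> {-?R..?R} \<Longrightarrow> \<bar>h x\<bar> \<le> B"
    using compact_imp_bounded bounded_iff by (metis image_eqI real_norm_def)
  show ?thesis
  proof (rule Bochner_Integration.integrable_bound)
    show "integrable (\<Pi>\<^sub>M b\<in>I. lborel) (\<lambda>f. B * (\<Prod>b\<in>I. indicator {-a<..<a} (f b)) :: real)"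
      using assms by (intro integrable_mult_right lborel_prod.product_integrable_prod) auto
    show "AE f in (\<Pi>\<^sub>M b\<in>I. lborel). norm ((\<Prod>b\<in>I. indicator {-a<..<a} (f b)) * h (\<Sum>b\<in>I. c b * f b))
       \<le> norm (B * (\<Prod>b\<in>I. indicator {-a<..<a} (f b)) :: real)"
    proof (rule AE_I2)
      fix f :: "'i \<Rightarrow> real"
      show "norm ((\<Prod>b\<in>I. indicator {-a<..<a} (f b)) * h (\<Sum>b\<in>I. c b * f b))
       \<le> norm (B * (\<Prod>b\<in>I. indicator {-a<..<a} (f b)) :: real)"
      proof (cases "\<forall>b\<in>I. \<bar>f b\<bar> < a")
        case True
        have "\<bar>\<Sum>b\<in>I. c b * f b\<bar> \<le> (\<Sum>b\<in>I. \<bar>c b * f b\<bar>)" by (rule sum_abs)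
        also have "\<dots> \<le> ?R" using True by (intro sum_mono) (auto simp: abs_mult less_imp_le intro!: mult_left_mono)
        finally have "\<bar>h (\<Sum>b\<in>I. c b * f b)\<bar> \<le> B" by (intro B) (simp add: abs_le_iff)
        then show ?thesis using True assms(1) by (simp add: prod_indicator_eq)
      next
        case False
        then show ?thesis using assms(1) by (simp only: prod_indicator_eq if_False) simp
      qed
    qed
  qed measurable
qed

text \<open>Integrating out one coordinate replaces \<open>h\<close> by its integral over a sliding
  window, so the dimension is lowered while \<open>h\<close> stays a function of one
  variable.\<close>

lemma cubeint_insert:
  fixes c :: "'i \<Rightarrow> real"
  assumes "finite I" "b \<notin> I" "a > 0" and cont: "continuous_on UNIV h"
  shows "cubeint a c (insert b I) h = cubeint a c I (\<lambda>s. \<integral>y. indicator {-a<..<a} y * h (s + c b * y) \<partial>lborel)"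
proof -
  have int: "integrable (\<Pi>\<^sub>M b\<in>insert b I. lborel)
      (\<lambda>f. (\<Prod>b\<in>insert b I. indicator {-a<..<a} (f b)) * h (\<Sum>b\<in>insert b I. c b * f b))"
    using assms by (intro cubeint_integrable) auto
  have "cubeint a c (insert b I) h = (\<integral>f. (\<integral>y. (\<Prod>b'\<in>insert b I. indicator {-a<..<a} ((f(b := y)) b')) *
      h (\<Sum>b'\<in>insert b I. c b' * (f(b := y)) b') \<partial>lborel) \<partial>(\<Pi>\<^sub>M b\<in>I. lborel))"
    unfolding cubeint_def by (rule lborel_prod.product_integral_insert[OF assms(1,2) int])
  also have "\<dots> = (\<integral>f. (\<Prod>b\<in>I. indicator {-a<..<a} (f b)) *
      (\<integral>y. indicator {-a<..<a} y * h ((\<Sum>b\<in>I. c b * f b) + c b * y) \<partial>lborel) \<partial>(\<Pi>\<^sub>M b\<in>I. lborel))"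
  proof (intro Bochner_Integration.integral_cong refl)
    fix f :: "'i \<Rightarrow> real"
    have 1: "(\<Prod>b'\<in>insert b I. indicator {-a<..<a} ((f(b := y)) b'))
       = (\<Prod>b\<in>I. indicator {-a<..<a} (f b)) * (indicator {-a<..<a} y :: real)" for y
    proof -
      have "(\<Prod>b'\<in>I. indicator {-a<..<a} ((f(b := y)) b')) = (\<Prod>b\<in>I. indicator {-a<..<a} (f b) :: real)"
        using assms(2) by (intro prod.cong) auto
      then show ?thesis using assms(1,2) by (simp add: mult.commute)
    qed
    have 2: "(\<Sum>b'\<in>insert b I. c b' * (f(b := y)) b') = (\<Sum>b\<in>I. c b * f b) + c b * y" for y
    proof -
      have "(\<Sum>b'\<in>I. c b' * (f(b := y)) b') = (\<Sum>b\<in>I. c b * f b)"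
        using assms(2) by (intro sum.cong) auto
      then show ?thesis using assms(1,2) by simp
    qed
    show "(\<integral>y. (\<Prod>b'\<in>insert b I. indicator {-a<..<a} ((f(b := y)) b')) *
        h (\<Sum>b'\<in>insert b I. c b' * (f(b := y)) b') \<partial>lborel) =
      (\<Prod>b\<in>I. indicator {-a<..<a} (f b)) *
      (\<integral>y. indicator {-a<..<a} y * h ((\<Sum>b\<in>I. c b * f b) + c b * y) \<partial>lborel)"
      unfolding 1 2 mult.assoc by (rule integral_mult_right_zero)
  qed
  finally show ?thesis by (simp add: cubeint_def)
qed

lemma cubeint_empty: "cubeint a c {} h = h 0"
  by (simp add: cubeint_def PiM_empty lebesgue_integral_count_space_finite)

lemma integral_window:
  assumes "a > 0" and H: "\<And>x. (H has_real_derivative h x) (at x)" and cont: "continuous_on UNIV h" and "c \<noteq> 0"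
  shows "(\<integral>y. indicator {-a<..<a} y * h (s + c * y) \<partial>lborel) = (H (s + c * a) - H (s - c * a)) / c"
proof -
  have [measurable]: "h \<in> borel_measurable borel" by (rule borel_measurable_continuous_onI[OF cont])
  have "(\<integral>y. indicator {-a<..<a} y * h (s + c * y) \<partial>lborel) = (\<integral>y. h (s + c * y) * indicator {-a..a} y \<partial>lborel)"
  proof (rule integral_cong_AE)
    show "AE y in lborel. indicator {-a<..<a} y * h (s + c * y) = h (s + c * y) * indicator {-a..a} y"
      using AE_lborel_singleton[of "-a"] AE_lborel_singleton[of a]
      by eventually_elim (auto simp: indicator_def)
  qed measurable
  also have "\<dots> = H (s + c * a) / c - H (s + c * (-a)) / c"
  proof (rule integral_FTC_Icc_real)
    fix x
    have "((\<lambda>y. H (s + c * y) / c) has_real_derivative h (s + c * x) * c / c) (at x)"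
      by (rule DERIV_cdivide, rule DERIV_chain2[OF H]) (auto intro!: derivative_eq_intros)
    then show "((\<lambda>y. H (s + c * y) / c) has_real_derivative h (s + c * x)) (at x)" using assms by simp
    show "isCont (\<lambda>y. h (s + c * y)) x"
    proof (rule isCont_o2[where g = h])
      show "isCont (\<lambda>y. s + c * y) x" by (intro continuous_intros)
      show "isCont h (s + c * x)" using cont by (simp add: continuous_on_eq_continuous_at)
    qed
  qed (use assms in auto)
  finally show ?thesis by (simp add: diff_divide_distrib)
qed

lemma integral_window_const:
  assumes "a > 0"
  shows "(\<integral>y. indicator {-a<..<a} y * (C::real) \<partial>lborel) = 2 * a * C"
  using assms by simp

text \<open>
  A primitive \<open>H\<close> of the even function \<open>h\<close> is kept instead of \<open>h\<close>: oddness and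
  nonnegativity of \<open>H\<close> on the half line survive the averaging of \<open>h\<close> over a window.
\<close>

definition avg_cone :: "(real \<Rightarrow> real) \<Rightarrow> bool"
  where "avg_cone h \<longleftrightarrow> continuous_on UNIV h \<and> h 0 \<ge> 0 \<and>
    (\<exists>H. (\<forall>x. (H has_real_derivative h x) (at x)) \<and> (\<forall>x. H (- x) = - H x) \<and> (\<forall>x\<ge>0. H x \<ge> 0))"

text \<open>If \<open>H\<close> is the primitive of \<open>h\<close> and \<open>G\<close> a
  primitive of \<open>H\<close>, the window integral has the primitive
  \<open>(G (s + c * a) - G (s - c * a)) / c\<close>. As \<open>H\<close> is odd and nonnegative on
  the half line, \<open>G\<close> is even and increasing there, so comparing the absolute values of
  the two arguments gives the sign.\<close>

lemma avg_cone_window: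
  assumes "a > 0" and h: "avg_cone h"
  shows "avg_cone (\<lambda>s. \<integral>y. indicator {-a<..<a} y * h (s + c * y) \<partial>lborel)"
proof -
  from h obtain H where H: "\<And>x. (H has_real_derivative h x) (at x)" "\<And>x. H (- x) = - H x"
    "\<And>x. x \<ge> 0 \<Longrightarrow> H x \<ge> 0" and cont: "continuous_on UNIV h" and h0: "h 0 \<ge> 0"
    by (auto simp: avg_cone_def)
  show ?thesis
  proof (cases "c = 0")
    case True
    have "((\<lambda>x. 2 * a * H x) has_real_derivative 2 * a * h x) (at x)" for x
      by (rule DERIV_cmult[OF H(1)])
    then have "avg_cone (\<lambda>s. 2 * a * h s)"
      unfolding avg_cone_def using H cont h0 assms
      by (intro conjI exI[of _ "\<lambda>x. 2 * a * H x"]) (auto intro!: continuous_intros)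
    then show ?thesis using True assms by simp
  next
    case False
    have Hc: "isCont H x" for x using H(1) by (rule DERIV_isCont)
    obtain G where G: "\<And>x. (G has_real_derivative H x) (at x)"
      using einterval_antiderivative[of "-\<infinity>" \<infinity> H] Hc
      by (auto simp: has_real_derivative_iff_has_vector_derivative)
    have even: "G (- x) = G x" for x
    proof -
      have "((\<lambda>x. G (- x) - G x) has_real_derivative 0) (at x)" for x
      proof -
        have "((\<lambda>x. G (- x)) has_real_derivative H (- x) * (- 1)) (at x)"
          by (rule DERIV_chain2[OF G]) (auto intro!: derivative_eq_intros)
        from DERIV_diff[OF this G[of x]] show ?thesis by (simp add: H(2))
      qed
      then have "(\<lambda>x. G (- x) - G x) x = (\<lambda>x. G (- x) - G x) 0" by (rule DERIV_isconst_all[OF allI])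
      then show ?thesis by simp
    qed
    have mono: "G x \<le> G y" if "0 \<le> x" "x \<le> y" for x y
      using that by (intro DERIV_nonneg_imp_nondecreasing[OF that(2)]) (use G H(3) in force)
    have eq: "(\<lambda>s. \<integral>y. indicator {-a<..<a} y * h (s + c * y) \<partial>lborel) = (\<lambda>s. (H (s + c * a) - H (s - c * a)) / c)"
      using integral_window[OF \<open>a > 0\<close> H(1) cont False] by (intro ext)
    let ?N = "\<lambda>s. (G (s + c * a) - G (s - c * a)) / c"
    have der: "(?N has_real_derivative (H (s + c * a) - H (s - c * a)) / c) (at s)" for s
    proof (rule DERIV_cdivide, rule DERIV_diff)
      show "((\<lambda>s. G (s + c * a)) has_real_derivative H (s + c * a)) (at s)"
        using G[of "s + c * a"] by (simp add: DERIV_shift)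
      show "((\<lambda>s. G (s - c * a)) has_real_derivative H (s - c * a)) (at s)"
        using G[of "s - c * a"] DERIV_shift[of G _ s "- (c * a)"] by simp
    qed
    have odd: "?N (- s) = - ?N s" for s
      using even[of "s - c * a"] even[of "s + c * a"] by (simp add: divide_simps)
    have nonneg: "?N s \<ge> 0" if "s \<ge> 0" for s
    proof (cases "c > 0")
      case True
      then have "G \<bar>s - c * a\<bar> \<le> G \<bar>s + c * a\<bar>"
        using that assms(1) by (intro mono) (auto simp: abs_le_iff)
      then show ?thesis using True even[of "s - c * a"] even[of "s + c * a"] by (auto simp: abs_if split: if_splits)
    next
      case neg: False
      have "c * a < 0" using neg False assms(1) by (simp add: mult_less_0_iff)
      then have "G \<bar>s + c * a\<bar> \<le> G \<bar>s - c * a\<bar>"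
        using that by (intro mono) (auto simp: abs_le_iff)
      then show ?thesis using neg even[of "s - c * a"] even[of "s + c * a"]
        by (auto simp: abs_if divide_nonpos_nonpos split: if_splits)
    qed
    have z: "(H (0 + c * a) - H (0 - c * a)) / c \<ge> 0"
    proof (cases "c > 0")
      case True
      then show ?thesis using H(2)[of "c * a"] H(3)[of "c * a"] assms(1) by simp
    next
      case neg: False
      then have "c * a \<le> 0" using assms(1) by (simp add: mult_le_0_iff)
      then show ?thesis using H(2)[of "c * a"] H(3)[of "- (c * a)"] neg by (simp add: divide_nonpos_nonpos)
    qed
    show ?thesis
      unfolding eq avg_cone_def
    proof (intro conjI exI[of _ ?N] allI impI z der odd nonneg)
      show "continuous_on UNIV (\<lambda>s. (H (s + c * a) - H (s - c * a)) / c)"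
      proof -
        have cH: "continuous_on UNIV H" using Hc by (simp add: continuous_on_eq_continuous_at)
        have "continuous_on UNIV (\<lambda>s. H (s + c * a))" "continuous_on UNIV (\<lambda>s. H (s - c * a))"
          by (rule continuous_on_compose2[OF cH], intro continuous_intros, simp)+
        then show ?thesis using False by (intro continuous_on_divide continuous_on_diff) auto
      qed
    qed
  qed
qed

text \<open>Removing coordinates never leaves the cone, and after the last one only the value at 0
  remains, which the cone requires to be nonnegative.\<close>

lemma cubeint_nonneg:
  assumes "finite I" "a > 0" "avg_cone h"
  shows "cubeint a c I h \<ge> 0"
  using assms(1,3)
proof (induction I arbitrary: h)
  case empty
  then show ?case by (simp add: cubeint_empty avg_cone_def)
next
  case (insert b I)
  then show ?case
    using avg_cone_window[OF \<open>a > 0\<close>, of h "c b"] \<open>a > 0\<close>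
    by (subst cubeint_insert) (auto simp: avg_cone_def)
qed

text \<open>Quadratics without linear term are stable under window averaging. The number
  \<open>a\<^sup>2 / 3\<close> is the variance of the uniform distribution on the window, and
  variances of independent coordinates add.\<close>

lemma cubeint_quadratic:
  assumes "finite I" "a > 0"
  shows "cubeint a c I (\<lambda>x. \<alpha> + \<beta> * x\<^sup>2) = (2 * a) ^ card I * (\<alpha> + \<beta> * (\<Sum>b\<in>I. (c b)\<^sup>2) * a\<^sup>2 / 3)"
  using assms(1)
proof (induction I arbitrary: \<alpha> \<beta>)
  case empty
  then show ?case by (simp add: cubeint_empty)
next
  case (insert b I)
  have w: "(\<integral>y. indicator {-a<..<a} y * (\<alpha> + \<beta> * (s + c b * y)\<^sup>2) \<partial>lborel)
      = 2 * a * (\<alpha> + \<beta> * (c b)\<^sup>2 * a\<^sup>2 / 3) + (2 * a * \<beta>) * s\<^sup>2" for s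
  proof (cases "c b = 0")
    case True
    then show ?thesis using \<open>a > 0\<close> integral_window_const[of a "\<alpha> + \<beta> * s\<^sup>2"] by (simp add: algebra_simps)
  next
    case False
    have "((\<lambda>x. \<alpha> * x + \<beta> * x ^ 3 / 3) has_real_derivative \<alpha> + \<beta> * x\<^sup>2) (at x)" for x
      by (auto intro!: derivative_eq_intros)
    then have "(\<integral>y. indicator {-a<..<a} y * (\<alpha> + \<beta> * (s + c b * y)\<^sup>2) \<partial>lborel)
      = ((\<alpha> * (s + c b * a) + \<beta> * (s + c b * a) ^ 3 / 3) - (\<alpha> * (s - c b * a) + \<beta> * (s - c b * a) ^ 3 / 3)) / c b"
      by (rule integral_window[OF \<open>a > 0\<close> _ _ False]) (intro continuous_intros)
    also have "\<dots> = 2 * a * (\<alpha> + \<beta> * (c b)\<^sup>2 * a\<^sup>2 / 3) + (2 * a * \<beta>) * s\<^sup>2"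
      using False by (simp add: field_simps power2_eq_square power3_eq_cube)
    finally show ?thesis .
  qed
  have "cubeint a c (insert b I) (\<lambda>x. \<alpha> + \<beta> * x\<^sup>2)
     = cubeint a c I (\<lambda>s. 2 * a * (\<alpha> + \<beta> * (c b)\<^sup>2 * a\<^sup>2 / 3) + (2 * a * \<beta>) * s\<^sup>2)"
    using insert \<open>a > 0\<close> by (subst cubeint_insert) (auto simp: w intro!: continuous_intros)
  also have "\<dots> = (2 * a) ^ card I * (2 * a * (\<alpha> + \<beta> * (c b)\<^sup>2 * a\<^sup>2 / 3) + (2 * a * \<beta>) * (\<Sum>b\<in>I. (c b)\<^sup>2) * a\<^sup>2 / 3)"
    by (rule insert.IH)
  also have "\<dots> = (2 * a) ^ card (insert b I) * (\<alpha> + \<beta> * (\<Sum>b\<in>insert b I. (c b)\<^sup>2) * a\<^sup>2 / 3)"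
    using insert.hyps by (simp add: algebra_simps)
  finally show ?case .
qed

lemma cubeint_zero:
  assumes "finite I" "a > 0" "\<And>b. b \<in> I \<Longrightarrow> c b = 0"
  shows "cubeint a c I h = (2 * a) ^ card I * h 0"
proof -
  have "cubeint a c I h = cubeint a c I (\<lambda>x. h 0 + 0 * x\<^sup>2)"
    using assms(3) by (simp add: cubeint_def)
  also have "\<dots> = (2 * a) ^ card I * h 0"
    using assms by (subst cubeint_quadratic) auto
  finally show ?thesis .
qed

lemma has_real_derivative_abs_prim: "((\<lambda>x::real. x * \<bar>x\<bar> / 2) has_real_derivative \<bar>x\<bar>) (at x)"
proof -
  have 1: "((\<lambda>t::real. (max 0 t)\<^sup>2) has_real_derivative 2 * max 0 t) (at t)" for t
    using has_real_derivative_pos_part_sq[of t] by (simp add: has_field_derivative_def)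
  have "((\<lambda>x. ((max 0 x)\<^sup>2 - (max 0 (- x))\<^sup>2) / 2) has_real_derivative (2 * max 0 x - 2 * max 0 (- x) * (- 1)) / 2) (at x)"
    by (intro DERIV_cdivide DERIV_diff 1 DERIV_chain2[OF 1]) (auto intro!: derivative_eq_intros)
  moreover have "(\<lambda>x::real. ((max 0 x)\<^sup>2 - (max 0 (- x))\<^sup>2) / 2) = (\<lambda>x. x * \<bar>x\<bar> / 2)"
    by (auto simp: max_def power2_eq_square)
  moreover have "(2 * max 0 x - 2 * max 0 (- x) * (- 1)) / 2 = \<bar>x\<bar>" by (simp add: max_def)
  ultimately show ?thesis by (simp only:)
qed

text \<open>The absolute value is compared with the quadratic \<open>?q\<close>. Their difference
  takes both signs, but its primitive on the half line is
  \<open>x * (x - k)\<^sup>2 / (4 * k)\<close>, so the difference lies in \<open>avg_cone\<close>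
  and has a nonnegative integral over the cube. For quadratics the integral is explicit.\<close>

lemma cubeint_abs_le:
  assumes "finite I" "a > 0"
  shows "cubeint a c I abs \<le> (2 * a) ^ card I * (a * sqrt (\<Sum>b\<in>I. (c b)\<^sup>2) / 2)"
proof (cases "(\<Sum>b\<in>I. (c b)\<^sup>2) = 0")
  case True
  then have "\<And>b. b \<in> I \<Longrightarrow> c b = 0" using assms(1) by (simp add: sum_nonneg_eq_0_iff)
  then show ?thesis using assms by (simp add: cubeint_zero)
next
  case False
  define S where "S = (\<Sum>b\<in>I. (c b)\<^sup>2)"
  have "S > 0" using False by (simp add: S_def sum_nonneg less_le)
  define k where "k = a * sqrt S"
  have k: "k > 0" "k\<^sup>2 = a\<^sup>2 * S" using \<open>S > 0\<close> assms(2) by (auto simp: k_def power_mult_distrib)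
  \<comment> \<open>The coefficients give the primitive of \<open>?q - abs\<close> a double zero at
    \<open>k\<close>. Thus \<open>?q\<close> and the absolute value have the same mean
    \<open>k / 2\<close> over the window of half width \<open>k\<close>, which is the case of a
    single nonzero coefficient; there the bound is attained.\<close>
  let ?q = "\<lambda>x. k / 4 + (3 / (4 * k)) * x\<^sup>2"
  have cone: "avg_cone (\<lambda>x. ?q x - \<bar>x\<bar>)"
    unfolding avg_cone_def
  proof (intro conjI exI[of _ "\<lambda>x. (k / 4 * x + (1 / (4 * k)) * x ^ 3) - x * \<bar>x\<bar> / 2"] allI impI)
    fix x :: real
    show "((\<lambda>x. (k / 4 * x + (1 / (4 * k)) * x ^ 3) - x * \<bar>x\<bar> / 2) has_real_derivative ?q x - \<bar>x\<bar>) (at x)"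
      using k(1) by (intro DERIV_diff[OF _ has_real_derivative_abs_prim]) (auto intro!: derivative_eq_intros simp: field_simps)
    assume "x \<ge> 0"
    then have "(k / 4 * x + (1 / (4 * k)) * x ^ 3) - x * \<bar>x\<bar> / 2 = x * (x - k)\<^sup>2 / (4 * k)"
      using k(1) by (simp add: field_simps power2_eq_square power3_eq_cube)
    then show "(k / 4 * x + (1 / (4 * k)) * x ^ 3) - x * \<bar>x\<bar> / 2 \<ge> 0"
      using k(1) \<open>x \<ge> 0\<close> by simp
  qed (use k(1) in \<open>auto intro!: continuous_intros\<close>)
  have "0 \<le> cubeint a c I (\<lambda>x. ?q x - \<bar>x\<bar>)" by (rule cubeint_nonneg[OF assms cone])
  also have "\<dots> = cubeint a c I ?q - cubeint a c I abs"
    unfolding cubeint_def right_diff_distrib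
    using assms by (intro Bochner_Integration.integral_diff cubeint_integrable continuous_intros) auto
  finally have "cubeint a c I abs \<le> (2 * a) ^ card I * (k / 4 + (3 / (4 * k)) * S * a\<^sup>2 / 3)"
    using cubeint_quadratic[OF assms, of c "k / 4" "3 / (4 * k)"] by (simp add: S_def)
  also have "k / 4 + (3 / (4 * k)) * S * a\<^sup>2 / 3 = k / 2"
  proof -
    have "(3 / (4 * k)) * S * a\<^sup>2 / 3 = k\<^sup>2 / (4 * k)" by (simp add: k(2) mult.commute)
    also have "\<dots> = k / 4" using k(1) by (simp add: power2_eq_square)
    finally show ?thesis by simp
  qed
  finally show ?thesis by (simp add: k_def S_def)
qed

lemma integral_centered_box:
  assumes "a > 0" and cont: "continuous_on UNIV h"
  shows "(\<integral>x. indicator (box (\<chi> i. -a) (\<chi> i. a)) x * h (\<xi> \<bullet> (x :: real ^ 'n)) \<partial>lborel)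
    = cubeint a (\<lambda>b. \<xi> \<bullet> b) Basis h"
proof -
  have [measurable]: "h \<in> borel_measurable borel" by (rule borel_measurable_continuous_onI[OF cont])
  let ?B = "box (\<chi> i. -a) (\<chi> i. a) :: (real ^ 'n) set"
  let ?s = "\<lambda>f. \<Sum>b\<in>(Basis :: (real ^ 'n) set). f b *\<^sub>R b"
  have ind: "indicator ?B (?s f) = (\<Prod>b\<in>Basis. indicator {-a<..<a} (f b) :: real)" for f
  proof -
    have "?s f \<in> ?B \<longleftrightarrow> (\<forall>b\<in>Basis. \<bar>f b\<bar> < a)"
    proof -
      have "?s f \<in> ?B \<longleftrightarrow> (\<forall>b\<in>Basis. - a < ?s f \<bullet> b \<and> ?s f \<bullet> b < a)"
        by (auto simp: mem_box Basis_vec_def inner_axis)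
      also have "\<dots> \<longleftrightarrow> (\<forall>b\<in>Basis. \<bar>f b\<bar> < a)"
        by (intro ball_cong refl) (auto simp: inner_sum_left_Basis)
      finally show ?thesis .
    qed
    then show ?thesis unfolding prod_indicator_eq[OF finite_Basis] by (simp add: indicator_def)
  qed
  have inn: "\<xi> \<bullet> ?s f = (\<Sum>b\<in>Basis. (\<xi> \<bullet> b) * f b)" for f
    by (simp add: inner_sum_right mult.commute)
  have "(\<integral>x. indicator ?B x * h (\<xi> \<bullet> x) \<partial>lborel)
     = (\<integral>f. indicator ?B (?s f) * h (\<xi> \<bullet> ?s f) \<partial>(\<Pi>\<^sub>M b\<in>(Basis :: (real ^ 'n) set). lborel))"
    by (subst lborel_eq, subst integral_distr) auto
  then show ?thesis by (simp only: ind inn cubeint_def)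
qed

section \<open>Affine and C1 functions on rotated cubes\<close>

definition ctr :: "real ^ 'n \<Rightarrow> (real ^ 'n \<Rightarrow> real ^ 'n) \<Rightarrow> real \<Rightarrow> real ^ 'n"
  where "ctr a T \<delta> = a + T (\<chi> i. \<delta> / 2)"

lemma ctr_in_ocube: "\<delta> > 0 \<Longrightarrow> ctr a T \<delta> \<in> ocube a T \<delta>"
  by (auto simp: ctr_def ocube_def mem_box_cube intro!: imageI)

lemma inner_orthogonal_inv:
  fixes T :: "'a::euclidean_space \<Rightarrow> 'a"
  assumes T: "orthogonal_transformation T"
  shows "\<xi> \<bullet> T z = inv T \<xi> \<bullet> z"
proof -
  have "\<xi> = T (inv T \<xi>)" by (simp add: orthogonal_transformation_surj[OF T] surj_f_inv_f)
  then show ?thesis using T by (metis orthogonal_transformation_def)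
qed

lemma set_integral_ocube_centered:
  fixes \<xi> :: "real ^ 'n"
  assumes T: "orthogonal_transformation T" and "\<delta> > 0" and cont: "continuous_on UNIV h"
  shows "(LINT x:ocube a T \<delta>|lborel. h (\<xi> \<bullet> (x - ctr a T \<delta>))) = cubeint (\<delta> / 2) (\<lambda>b. inv T \<xi> \<bullet> b) Basis h"
proof -
  have [measurable]: "h \<in> borel_measurable borel" by (rule borel_measurable_continuous_onI[OF cont])
  let ?c = "(\<chi> i. \<delta> / 2) :: real ^ 'n"
  have lin: "T x - T ?c = T (x - ?c)" for x
    using orthogonal_transformation_linear[OF T] by (simp add: linear_diff)
  have "(LINT x:ocube a T \<delta>|lborel. h (\<xi> \<bullet> (x - ctr a T \<delta>)))
     = (LINT x:box 0 (\<chi> i. \<delta>)|lborel. h (\<xi> \<bullet> (a + T x - ctr a T \<delta>)))"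
    by (rule set_integral_ocube[OF T]) measurable
  also have "\<dots> = (\<integral>x. indicator (box 0 (\<chi> i. \<delta>)) x * h (inv T \<xi> \<bullet> (x - ?c)) \<partial>lborel)"
    by (simp add: set_lebesgue_integral_def ctr_def lin inner_orthogonal_inv[OF T])
  also have "\<dots> = (\<integral>x. indicator (box 0 (\<chi> i. \<delta>)) (?c + x) * h (inv T \<xi> \<bullet> (?c + x - ?c)) \<partial>lborel)"
    using integral_rigid[OF _ orthogonal_transformation_id, of "\<lambda>x. indicator (box 0 (\<chi> i. \<delta>)) x * h (inv T \<xi> \<bullet> (x - ?c))" ?c]
    by simp
  also have "\<dots> = (\<integral>x. indicator (box (\<chi> i. -(\<delta>/2)) (\<chi> i. \<delta>/2)) x * h (inv T \<xi> \<bullet> x) \<partial>lborel)"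
  proof (intro Bochner_Integration.integral_cong refl)
    fix x :: "real ^ 'n"
    have "?c + x \<in> box 0 (\<chi> i. \<delta>) \<longleftrightarrow> x \<in> box (\<chi> i. -(\<delta>/2)) (\<chi> i. \<delta>/2)"
      by (simp add: mem_box_cart) (smt (verit) field_sum_of_halves)
    then show "indicator (box 0 (\<chi> i. \<delta>)) (?c + x) * h (inv T \<xi> \<bullet> (?c + x - ?c))
       = indicator (box (\<chi> i. -(\<delta>/2)) (\<chi> i. \<delta>/2)) x * h (inv T \<xi> \<bullet> x)"
      by (simp add: indicator_def)
  qed
  also have "\<dots> = cubeint (\<delta> / 2) (\<lambda>b. inv T \<xi> \<bullet> b) Basis h"
    using \<open>\<delta> > 0\<close> by (intro integral_centered_box cont) auto
  finally show ?thesis .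
qed

lemma cubeint_odd:
  assumes "a > 0" and cont: "continuous_on UNIV h" and odd: "\<And>x. h (- x) = - h x"
  shows "cubeint a (\<lambda>b. \<xi> \<bullet> b) (Basis :: (real ^ 'n) set) h = 0"
proof -
  have [measurable]: "h \<in> borel_measurable borel" by (rule borel_measurable_continuous_onI[OF cont])
  let ?B = "box (\<chi> i. -a) (\<chi> i. a) :: (real ^ 'n) set"
  let ?g = "\<lambda>x. indicator ?B x * h (\<xi> \<bullet> x)"
  have orth: "orthogonal_transformation (\<lambda>x :: real ^ 'n. - x)"
    using orthogonal_transformation_neg[of "id :: real ^ 'n \<Rightarrow> real ^ 'n"] orthogonal_transformation_id
    by (simp add: id_def)
  have "(\<integral>x. ?g x \<partial>lborel) = (\<integral>x. ?g (0 + - x) \<partial>lborel)"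
    by (rule integral_rigid[OF _ orth, symmetric]) measurable
  also have "\<dots> = (\<integral>x. - ?g x \<partial>lborel)"
  proof (intro Bochner_Integration.integral_cong refl)
    fix x
    have "0 + - x \<in> ?B \<longleftrightarrow> x \<in> ?B" by (simp add: mem_box_cart) (smt (verit))
    then show "?g (0 + - x) = - ?g x" by (simp add: indicator_def odd)
  qed
  also have "\<dots> = - (\<integral>x. ?g x \<partial>lborel)" by simp
  finally show ?thesis using integral_centered_box[OF assms(1,2), of \<xi>] by simp
qed

text \<open>The linear part is odd about the centre, so its mean vanishes and the oscillation is a
  mean absolute value. In the frame of the cube \<xi> becomes \<open>inv T \<xi>\<close>.\<close>

lemma osc_affine:
  fixes \<xi> :: "real ^ 'n"
  assumes T: "orthogonal_transformation T" and "\<delta> > 0"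
  shows "osc (ocube a T \<delta>) (\<lambda>x. c + \<xi> \<bullet> (x - ctr a T \<delta>))
     = cubeint (\<delta> / 2) (\<lambda>b. inv T \<xi> \<bullet> b) Basis abs / \<delta> ^ CARD('n)"
proof -
  interpret avg_domain "ocube a T \<delta>" "\<delta> ^ CARD('n)" by (rule avg_domain_ocube[OF assms])
  let ?f = "\<lambda>x. \<xi> \<bullet> (x - ctr a T \<delta>)"
  have int: "set_integrable lborel (ocube a T \<delta>) ?f"
    unfolding set_integrable_def
  proof (rule Bochner_Integration.integrable_bound)
    show "integrable lborel (\<lambda>x. (norm \<xi> * (sqrt CARD('n) * \<delta>)) * indicator (ocube a T \<delta>) x)"
      using set_integrable_const[of 1] by (simp add: set_integrable_def)
    show "AE x in lborel. norm (indicator (ocube a T \<delta>) x *\<^sub>R ?f x) \<le> norm ((norm \<xi> * (sqrt CARD('n) * \<delta>)) * indicator (ocube a T \<delta>) x)"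
    proof (rule AE_I2)
      fix x
      show "norm (indicator (ocube a T \<delta>) x *\<^sub>R ?f x) \<le> norm ((norm \<xi> * (sqrt CARD('n) * \<delta>)) * indicator (ocube a T \<delta>) x)"
      proof (cases "x \<in> ocube a T \<delta>")
        case True
        have "\<bar>?f x\<bar> \<le> norm \<xi> * norm (x - ctr a T \<delta>)" by (rule Cauchy_Schwarz_ineq2)
        also have "\<dots> \<le> norm \<xi> * (sqrt CARD('n) * \<delta>)"
          by (intro mult_left_mono ocube_diam[OF T True ctr_in_ocube[OF assms(2)]]) auto
        finally show ?thesis using True \<open>\<delta> > 0\<close> by (simp add: abs_mult)
      qed simp
    qed
  qed measurable
  have z: "avg (ocube a T \<delta>) ?f = 0"
    using set_integral_ocube_centered[OF assms, of "\<lambda>x. x" a \<xi>] cubeint_odd[of "\<delta> / 2" "\<lambda>x. x" "inv T \<xi>"] \<open>\<delta> > 0\<close>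
    by (simp add: avg_eq)
  have "avg (ocube a T \<delta>) (\<lambda>x. c + ?f x) = c"
    by (subst avg_add) (use int set_integrable_const z in \<open>auto simp: avg_const\<close>)
  then have "osc (ocube a T \<delta>) (\<lambda>x. c + ?f x) = avg (ocube a T \<delta>) (\<lambda>x. \<bar>?f x\<bar>)"
    by (simp add: osc_def)
  also have "\<dots> = cubeint (\<delta> / 2) (\<lambda>b. inv T \<xi> \<bullet> b) Basis abs / \<delta> ^ CARD('n)"
    using set_integral_ocube_centered[OF assms, of abs a \<xi>] by (simp add: avg_eq continuous_intros)
  finally show ?thesis .
qed

text \<open>\<open>inv T\<close> preserves the length of \<xi>. With half side
  \<open>\<delta> / 2\<close> the bound of \<open>cubeint_abs_le\<close> becomes a quarter of
  \<delta> times that length.\<close>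

lemma osc_affine_le:
  fixes \<xi> :: "real ^ 'n"
  assumes T: "orthogonal_transformation T" and "\<delta> > 0"
  shows "osc (ocube a T \<delta>) (\<lambda>x. c + \<xi> \<bullet> (x - ctr a T \<delta>)) \<le> \<delta> / 4 * norm \<xi>"
proof -
  have "norm \<xi> = norm (inv T \<xi>)"
    using orthogonal_transformation_norm[OF orthogonal_transformation_inv[OF T]] by simp
  also have "\<dots> = sqrt (\<Sum>b\<in>Basis. (inv T \<xi> \<bullet> b)\<^sup>2)"
    by (simp add: norm_eq_sqrt_inner euclidean_inner[of "inv T \<xi>" "inv T \<xi>"] power2_eq_square)
  finally have n: "sqrt (\<Sum>b\<in>Basis. (inv T \<xi> \<bullet> b)\<^sup>2) = norm \<xi>" by simp
  have "cubeint (\<delta> / 2) (\<lambda>b. inv T \<xi> \<bullet> b) Basis abs \<le> \<delta> ^ CARD('n) * (\<delta> / 2 * norm \<xi> / 2)"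
    using cubeint_abs_le[OF finite_Basis, of "\<delta> / 2" "\<lambda>b. inv T \<xi> \<bullet> b"] \<open>\<delta> > 0\<close> by (simp add: n)
  then show ?thesis
    unfolding osc_affine[OF assms] using \<open>\<delta> > 0\<close> by (simp add: divide_le_eq mult.commute)
qed

text \<open>Only one coordinate meets the linear form; the others contribute their volume. The mean
  of \<open>\<bar>m * y\<bar>\<close> over a window of half width \<open>\<delta> / 2\<close> is
  \<open>m * \<delta> / 4\<close>.\<close>

lemma osc_affine_aligned:
  fixes T :: "real ^ 'n \<Rightarrow> real ^ 'n"
  assumes T: "orthogonal_transformation T" and "\<delta> > 0" and "m \<ge> 0"
  shows "osc (ocube a T \<delta>) (\<lambda>x. c + (m *\<^sub>R T (axis k 1)) \<bullet> (x - ctr a T \<delta>)) = \<delta> / 4 * m"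
proof -
  let ?e = "axis k 1 :: real ^ 'n"
  let ?a = "\<delta> / 2" and ?c = "\<lambda>b. m *\<^sub>R ?e \<bullet> b"
  have "T (m *\<^sub>R ?e) = m *\<^sub>R T ?e"
    using orthogonal_transformation_linear[OF T] by (simp add: linear_cmul)
  then have inv: "inv T (m *\<^sub>R T ?e) = m *\<^sub>R ?e"
    using orthogonal_transformation_inj[OF T] by (metis inv_f_f)
  have e: "?e \<in> Basis" by (auto simp: Basis_vec_def)
  have z: "?c b = 0" if "b \<in> Basis - {?e}" for b
    using that e by (auto simp: inner_Basis)
  have "cubeint ?a ?c Basis abs = cubeint ?a ?c (insert ?e (Basis - {?e})) abs"
    using e by (simp add: insert_absorb)
  also have "\<dots> = cubeint ?a ?c (Basis - {?e}) (\<lambda>s. \<integral>y. indicator {-?a<..<?a} y * \<bar>s + ?c ?e * y\<bar> \<partial>lborel)"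
    using \<open>\<delta> > 0\<close> by (intro cubeint_insert) (auto intro!: continuous_intros)
  also have "\<dots> = (2 * ?a) ^ card (Basis - {?e}) * (\<integral>y. indicator {-?a<..<?a} y * \<bar>m * y\<bar> \<partial>lborel)"
    by (subst cubeint_zero) (use z \<open>\<delta> > 0\<close> e in \<open>auto simp: inner_Basis\<close>)
  also have "(\<integral>y. indicator {-?a<..<?a} y * \<bar>m * y\<bar> \<partial>lborel) = m * ?a\<^sup>2"
  proof (cases "m = 0")
    case False
    have "(\<integral>y. indicator {-?a<..<?a} y * \<bar>0 + m * y\<bar> \<partial>lborel)
       = ((0 + m * ?a) * \<bar>0 + m * ?a\<bar> / 2 - (0 - m * ?a) * \<bar>0 - m * ?a\<bar> / 2) / m"
      using \<open>\<delta> > 0\<close> False by (intro integral_window has_real_derivative_abs_prim) (auto intro!: continuous_intros)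
    also have "\<dots> = m * ?a\<^sup>2" using False assms by (simp add: power2_eq_square abs_mult)
    finally show ?thesis by simp
  qed simp
  also have "card (Basis - {?e}) = CARD('n) - 1" using e by (simp add: card_Diff_singleton)
  also have "(2 * ?a) ^ (CARD('n) - 1) * (m * ?a\<^sup>2) = \<delta> ^ CARD('n) * (\<delta> / 4 * m)"
  proof -
    have "CARD('n) = Suc (CARD('n) - 1)" by (simp add: Suc_diff_1)
    then have "\<delta> ^ CARD('n) = \<delta> ^ (CARD('n) - 1) * \<delta>" by (metis power_Suc2)
    then show ?thesis by (simp add: power2_eq_square)
  qed
  finally have eq: "cubeint ?a ?c Basis abs = \<delta> ^ CARD('n) * (\<delta> / 4 * m)" .
  show ?thesis
    unfolding osc_affine[OF assms(1,2)] inv eq using \<open>\<delta> > 0\<close> by simp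
qed

text \<open>The cube is convex and the gradient of \<open>w\<close> stays within \<omega> of \<xi>,
  so \<open>w\<close> differs from its affine model by at most \<omega> times the diameter bound.
  The factor 2 is that of \<open>osc_le_osc_plus\<close>, used in both directions.\<close>

lemma osc_C1_affine:
  fixes w :: "real ^ 'n \<Rightarrow> real"
  assumes T: "orthogonal_transformation T" and "\<delta> > 0" and [measurable]: "w \<in> borel_measurable borel"
    and int: "set_integrable lborel (ocube a T \<delta>) w"
    and der: "\<And>x. x \<in> ocube a T \<delta> \<Longrightarrow> (w has_derivative (\<lambda>h. G x \<bullet> h)) (at x)"
    and G: "\<And>x. x \<in> ocube a T \<delta> \<Longrightarrow> norm (G x - \<xi>) \<le> \<omega>"
  shows "\<bar>osc (ocube a T \<delta>) w - osc (ocube a T \<delta>) (\<lambda>x. w (ctr a T \<delta>) + \<xi> \<bullet> (x - ctr a T \<delta>))\<bar>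
    \<le> 2 * (\<omega> * (sqrt CARD('n) * \<delta>))"
proof -
  interpret avg_domain "ocube a T \<delta>" "\<delta> ^ CARD('n)" by (rule avg_domain_ocube[OF T \<open>\<delta> > 0\<close>])
  let ?Q = "ocube a T \<delta>" and ?c = "ctr a T \<delta>"
  let ?W = "\<lambda>x. w ?c + \<xi> \<bullet> (x - ?c)"
  let ?e = "\<omega> * (sqrt CARD('n) * \<delta>)"
  have cQ: "?c \<in> ?Q" by (rule ctr_in_ocube[OF \<open>\<delta> > 0\<close>])
  have "\<omega> \<ge> 0" using G[OF cQ] norm_ge_zero order_trans by blast
  have close: "\<bar>w x - ?W x\<bar> \<le> ?e" if x: "x \<in> ?Q" for x
  proof -
    have "norm ((w x - \<xi> \<bullet> x) - (w ?c - \<xi> \<bullet> ?c)) \<le> \<omega> * norm (x - ?c)"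
    proof (rule differentiable_bound[OF convex_ocube[OF T, of a \<delta>]])
      show "((\<lambda>x. w x - \<xi> \<bullet> x) has_derivative (\<lambda>h. (G y - \<xi>) \<bullet> h)) (at y within ?Q)" if "y \<in> ?Q" for y
      proof -
        have "((\<lambda>x. \<xi> \<bullet> x) has_derivative (\<lambda>h. \<xi> \<bullet> h)) (at y)"
          by (rule bounded_linear_imp_has_derivative[OF bounded_linear_inner_right])
        from has_derivative_diff[OF der[OF that] this]
        have "((\<lambda>x. w x - \<xi> \<bullet> x) has_derivative (\<lambda>h. (G y - \<xi>) \<bullet> h)) (at y)"
          by (simp add: inner_diff_left)
        then show ?thesis by (rule has_derivative_at_withinI)
      qed
      show "onorm (\<lambda>h. (G y - \<xi>) \<bullet> h) \<le> \<omega>" if "y \<in> ?Q" for y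
        using onorm_inner_right[OF bounded_linear_ident, of "G y - \<xi>"] G[OF that] by (simp add: onorm_id)
    qed (use x cQ in auto)
    also have "\<dots> \<le> ?e"
      using \<open>\<omega> \<ge> 0\<close> by (intro mult_left_mono ocube_diam[OF T x cQ])
    finally show ?thesis by (simp add: inner_diff_right algebra_simps)
  qed
  \<comment> \<open>The affine model is integrable on the cube because it stays within
    \<open>?e\<close> of \<open>w\<close> there.\<close>
  have iW: "set_integrable lborel ?Q ?W"
  proof -
    have "set_integrable lborel ?Q (\<lambda>x. ?W x - w x)"
      unfolding set_integrable_def
    proof (rule Bochner_Integration.integrable_bound)
      show "integrable lborel (\<lambda>x. ?e * indicator ?Q x)"
        using set_integrable_const[of 1] by (simp add: set_integrable_def)
      show "AE x in lborel. norm (indicator ?Q x *\<^sub>R (?W x - w x)) \<le> norm (?e * indicator ?Q x)"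
      proof (rule AE_I2)
        fix x
        show "norm (indicator ?Q x *\<^sub>R (?W x - w x)) \<le> norm (?e * indicator ?Q x)"
          using close[of x] \<open>\<omega> \<ge> 0\<close> \<open>\<delta> > 0\<close> by (cases "x \<in> ?Q") (auto simp: abs_minus_commute)
      qed
    qed measurable
    from set_integral_add(1)[OF this int] show ?thesis by simp
  qed
  have "avg ?Q (\<lambda>x. \<bar>w x - ?W x\<bar>) \<le> avg ?Q (\<lambda>x. ?e)"
    by (rule avg_mono[OF _ _ set_integrable_abs_minus[OF int iW] set_integrable_const close]) measurable
  then have a: "avg ?Q (\<lambda>x. \<bar>w x - ?W x\<bar>) \<le> ?e" by (simp add: avg_const)
  have "osc ?Q w \<le> osc ?Q ?W + 2 * avg ?Q (\<lambda>x. \<bar>w x - ?W x\<bar>)"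
    by (rule osc_le_osc_plus[OF _ _ int iW]) measurable
  moreover have "osc ?Q ?W \<le> osc ?Q w + 2 * avg ?Q (\<lambda>x. \<bar>?W x - w x\<bar>)"
    by (rule osc_le_osc_plus[OF _ _ iW int]) measurable
  ultimately show ?thesis using a by (simp add: abs_minus_commute abs_le_iff)
qed

section \<open>Total variation\<close>

lemma Ck1_derivative:
  fixes \<phi> :: "real ^ 'n \<Rightarrow> real ^ 'n"
  assumes "Ck_on 1 UNIV \<phi>"
  shows "(\<phi> has_derivative frechet_derivative \<phi> (at x)) (at x)"
    and "continuous_on UNIV (\<lambda>x. frechet_derivative \<phi> (at x) v)"
  using assms by (auto simp: frechet_derivative_works)

lemma divergence_continuous:
  fixes \<phi> :: "real ^ 'n \<Rightarrow> real ^ 'n"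
  assumes "Ck_on 1 UNIV \<phi>"
  shows "continuous_on UNIV (divergence \<phi>)"
  unfolding divergence_def[abs_def] by (intro continuous_intros Ck1_derivative(2)[OF assms])

lemma divergence_outside_support:
  fixes \<phi> :: "real ^ 'n \<Rightarrow> real ^ 'n"
  assumes "x \<notin> closure {x. \<phi> x \<noteq> 0}"
  shows "divergence \<phi> x = 0"
proof -
  have o: "open (- closure {x. \<phi> x \<noteq> 0})" by (rule open_Compl[OF closed_closure])
  have "((\<lambda>x. 0) has_derivative (\<lambda>h. 0)) (at x)" by simp
  then have "(\<phi> has_derivative (\<lambda>h. 0)) (at x)"
  proof (rule has_derivative_transform_within_open[OF _ o])
    show "0 = \<phi> y" if "y \<in> - closure {x. \<phi> x \<noteq> 0}" for y
      using that closure_subset[of "{x. \<phi> x \<noteq> 0}"] by auto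
  qed (use assms in simp)
  then have "frechet_derivative \<phi> (at x) = (\<lambda>h. 0)" using frechet_derivative_at by metis
  then show ?thesis by (simp add: divergence_def)
qed

lemma divergence_bounded:
  assumes "\<phi> \<in> test_fields A"
  obtains B where "B > 0" "\<And>x. \<bar>divergence \<phi> x\<bar> \<le> B"
proof -
  have c: "continuous_on UNIV (divergence \<phi>)" using assms by (intro divergence_continuous) (auto simp: test_fields_def)
  have "bounded (closure {x. \<phi> x \<noteq> 0})" using assms by (auto simp: test_fields_def compact_imp_bounded)
  then obtain R where R: "\<And>x. x \<in> closure {x. \<phi> x \<noteq> 0} \<Longrightarrow> norm x \<le> R" by (auto simp: bounded_iff)
  have "divergence \<phi> x = 0" if "norm x \<ge> R + 1" for x
    using R[of x] that by (intro divergence_outside_support) auto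
  then show thesis using bounded_compact_support[OF c, of "R + 1"] that by (metis real_norm_def)
qed

lemma divergence_borel:
  assumes "\<phi> \<in> test_fields A"
  shows "divergence \<phi> \<in> borel_measurable borel"
  using assms by (intro borel_measurable_continuous_onI divergence_continuous) (auto simp: test_fields_def)

lemma divergence_times_integrable:
  assumes "\<phi> \<in> test_fields A" and V: "integrable lborel V"
  shows "integrable lborel (\<lambda>x. V x * divergence \<phi> x)"
proof -
  obtain B where B: "B > 0" "\<And>x. \<bar>divergence \<phi> x\<bar> \<le> B" using divergence_bounded[OF assms(1)] by metis
  note [measurable] = divergence_borel[OF assms(1)]
  have [measurable]: "V \<in> borel_measurable borel" using V by auto
  show ?thesis
  proof (rule Bochner_Integration.integrable_bound)
    show "integrable lborel (\<lambda>x. B * V x)" using V by simp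
    show "AE x in lborel. norm (V x * divergence \<phi> x) \<le> norm (B * V x)"
    proof (rule AE_I2)
      fix x
      show "norm (V x * divergence \<phi> x) \<le> norm (B * V x)"
        using mult_left_mono[OF B(2)[of x], of "\<bar>V x\<bar>"] B(1) by (simp add: abs_mult mult.commute)
    qed
  qed measurable
qed

text \<open>The divergence vanishes off the support, which lies in \<open>A\<close>. Hence the
  restriction to \<open>A\<close> drops out, and integrals for different sets \<open>A\<close>
  become directly comparable.\<close>

lemma test_integral_lborel:
  assumes \<phi>: "\<phi> \<in> test_fields A" and "open A" and [measurable]: "V \<in> borel_measurable borel"
  shows "(LINT x:A|lebesgue. V x * divergence \<phi> x) = (\<integral>x. V x * divergence \<phi> x \<partial>lborel)"
proof -
  note [measurable] = divergence_borel[OF \<phi>]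
  have "indicator A x *\<^sub>R (V x * divergence \<phi> x) = V x * divergence \<phi> x" for x
    using divergence_outside_support[of x \<phi>] \<phi> by (auto simp: indicator_def test_fields_def)
  then have "(LINT x:A|lebesgue. V x * divergence \<phi> x) = (\<integral>x. V x * divergence \<phi> x \<partial>lebesgue)"
    by (simp only: set_lebesgue_integral_def)
  also have "\<dots> = (\<integral>x. V x * divergence \<phi> x \<partial>lborel)" by (rule integral_completion) measurable
  finally show ?thesis .
qed

lemma TV_lborel:
  assumes "open A" and [measurable]: "V \<in> borel_measurable borel"
  shows "total_variation A V = (SUP \<phi>\<in>test_fields A. ennreal (\<integral>x. V x * divergence \<phi> x \<partial>lborel))"
  unfolding total_variation_def by (intro SUP_cong refl) (simp add: test_integral_lborel assms)

lemma zero_test_field: "(\<lambda>x. 0) \<in> test_fields A"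
proof -
  have "frechet_derivative (\<lambda>x::real^'n. 0::real^'n) (at x) = (\<lambda>h. 0)" for x
    using frechet_derivative_at[of "\<lambda>x. 0" "\<lambda>h. 0" x] by (metis has_derivative_const)
  then show ?thesis by (simp add: test_fields_def)
qed

lemma test_fields_mono: "A \<subseteq> B \<Longrightarrow> test_fields A \<subseteq> test_fields B"
  by (auto simp: test_fields_def)

lemma TV_mono:
  assumes "open A" "open B" "A \<subseteq> B" "V \<in> borel_measurable borel"
  shows "total_variation A V \<le> total_variation B V"
  using assms test_fields_mono[OF assms(3)] by (simp add: TV_lborel SUP_subset_mono)

text \<open>The supports are disjoint, so at each point at most one summand is nonzero and the bound
  1 on the norm is kept.\<close>

lemma test_field_add:
  assumes \<phi>: "\<phi> \<in> test_fields A" and \<psi>: "\<psi> \<in> test_fields B" and disj: "A \<inter> B = {}"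
  shows "(\<lambda>x. \<phi> x + \<psi> x) \<in> test_fields (A \<union> B)"
    and "divergence (\<lambda>x. \<phi> x + \<psi> x) x = divergence \<phi> x + divergence \<psi> x"
proof -
  let ?s = "\<lambda>x. \<phi> x + \<psi> x"
  have c: "Ck_on 1 UNIV \<phi>" "Ck_on 1 UNIV \<psi>" using \<phi> \<psi> by (auto simp: test_fields_def)
  have d: "(?s has_derivative (\<lambda>h. frechet_derivative \<phi> (at x) h + frechet_derivative \<psi> (at x) h)) (at x)" for x
    by (intro has_derivative_add Ck1_derivative c)
  have fd: "frechet_derivative ?s (at x) = (\<lambda>h. frechet_derivative \<phi> (at x) h + frechet_derivative \<psi> (at x) h)" for x
    using frechet_derivative_at[OF d] by (rule sym)
  show "divergence ?s x = divergence \<phi> x + divergence \<psi> x"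
    by (simp add: divergence_def fd sum.distrib)
  have sub: "closure {x. ?s x \<noteq> 0} \<subseteq> closure {x. \<phi> x \<noteq> 0} \<union> closure {x. \<psi> x \<noteq> 0}"
    unfolding closure_Un[symmetric] by (rule closure_mono) auto
  have cpt: "compact (closure {x. \<phi> x \<noteq> 0} \<union> closure {x. \<psi> x \<noteq> 0})"
    using \<phi> \<psi> by (auto simp: test_fields_def)
  have cpt': "compact (closure {x. ?s x \<noteq> 0})"
    using compact_Int_closed[OF cpt closed_closure[of "{x. ?s x \<noteq> 0}"]] sub by (simp add: Int_absorb1)
  have ck: "Ck_on 1 UNIV ?s"
    using d c by (auto simp: fd differentiable_def intro!: continuous_on_add)
  have "norm (?s x) \<le> 1" for x
  proof -
    have "x \<in> A" if "\<phi> x \<noteq> 0" using that \<phi> closure_subset[of "{x. \<phi> x \<noteq> 0}"] by (auto simp: test_fields_def)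
    moreover have "x \<in> B" if "\<psi> x \<noteq> 0" using that \<psi> closure_subset[of "{x. \<psi> x \<noteq> 0}"] by (auto simp: test_fields_def)
    ultimately have "\<phi> x = 0 \<or> \<psi> x = 0" using disj by blast
    then show ?thesis using \<phi> \<psi> by (auto simp: test_fields_def)
  qed
  then show "?s \<in> test_fields (A \<union> B)"
    using ck cpt' sub \<phi> \<psi> by (auto simp: test_fields_def)
qed

lemma TV_superadditive2:
  assumes A: "open A" "open B" "A \<inter> B = {}" and V: "integrable lborel V"
  shows "total_variation A V + total_variation B V \<le> total_variation (A \<union> B) V"
proof -
  have [measurable]: "V \<in> borel_measurable borel" using V by auto
  let ?I = "\<lambda>\<phi>. \<integral>x. V x * divergence \<phi> x \<partial>lborel"
  have ne: "test_fields A \<noteq> {}" for A :: "(real ^ 'n) set" using zero_test_field by blast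
  have U: "ennreal (?I \<phi>) \<le> total_variation (A \<union> B) V" if "\<phi> \<in> test_fields (A \<union> B)" for \<phi>
    using that A by (subst TV_lborel) (auto intro: SUP_upper)
  have "ennreal (?I \<phi>) + ennreal (?I \<psi>) \<le> total_variation (A \<union> B) V"
    if \<phi>: "\<phi> \<in> test_fields A" and \<psi>: "\<psi> \<in> test_fields B" for \<phi> \<psi>
  proof -
    have 1: "\<phi> \<in> test_fields (A \<union> B)" "\<psi> \<in> test_fields (A \<union> B)"
      using \<phi> \<psi> test_fields_mono[of A "A \<union> B"] test_fields_mono[of B "A \<union> B"] by auto
    show ?thesis
    \<comment> \<open>\<open>ennreal\<close> cuts negative integrals off at 0, so the two values add
      up only when both are nonnegative. Otherwise one of the two fields alone gives the
      bound.\<close>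
    proof (cases "?I \<phi> \<ge> 0 \<and> ?I \<psi> \<ge> 0")
      case True
      have "?I \<phi> + ?I \<psi> = ?I (\<lambda>x. \<phi> x + \<psi> x)"
        by (subst Bochner_Integration.integral_add[symmetric])
           (use divergence_times_integrable[OF _ V] \<phi> \<psi> test_field_add(2)[OF \<phi> \<psi> A(3)] in \<open>auto simp: distrib_left\<close>)
      then show ?thesis using True U[OF test_field_add(1)[OF \<phi> \<psi> A(3)]]
        by (simp add: ennreal_plus[symmetric] del: ennreal_plus)
    next
      case False
      then show ?thesis using U[OF 1(1)] U[OF 1(2)] by (auto simp: not_le ennreal_neg less_imp_le)
    qed
  qed
  then have "(SUP \<psi>\<in>test_fields B. ennreal (?I \<phi>) + ennreal (?I \<psi>)) \<le> total_variation (A \<union> B) V" if "\<phi> \<in> test_fields A" for \<phi>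
    using that by (intro SUP_least)
  then have "ennreal (?I \<phi>) + total_variation B V \<le> total_variation (A \<union> B) V" if "\<phi> \<in> test_fields A" for \<phi>
    using that A(2) by (simp add: TV_lborel ennreal_SUP_add_right[OF ne])
  then have "(SUP \<phi>\<in>test_fields A. ennreal (?I \<phi>) + total_variation B V) \<le> total_variation (A \<union> B) V"
    by (intro SUP_least)
  then show ?thesis using A(1) by (simp add: TV_lborel ennreal_SUP_add_left[OF ne])
qed

lemma TV_superadditive:
  assumes "finite I" and A: "\<And>i. i \<in> I \<Longrightarrow> open (A i)" "\<And>i. i \<in> I \<Longrightarrow> A i \<subseteq> B" and "open B"
    and disj: "\<And>i j. i \<in> I \<Longrightarrow> j \<in> I \<Longrightarrow> i \<noteq> j \<Longrightarrow> A i \<inter> A j = {}" and V: "integrable lborel V"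
  shows "(\<Sum>i\<in>I. total_variation (A i) V) \<le> total_variation B V"
proof -
  have [measurable]: "V \<in> borel_measurable borel" using V by auto
  have "(\<Sum>i\<in>J. total_variation (A i) V) \<le> total_variation (\<Union>i\<in>J. A i) V" if "J \<subseteq> I" for J
    using finite_subset[OF that assms(1)] that
  proof (induction J)
    case (insert i J)
    have "(\<Sum>i\<in>insert i J. total_variation (A i) V) \<le> total_variation (A i) V + total_variation (\<Union>i\<in>J. A i) V"
      using insert by (auto intro: add_left_mono)
    also have "\<dots> \<le> total_variation (A i \<union> (\<Union>i\<in>J. A i)) V"
      using insert.prems insert.hyps A(1) disj by (intro TV_superadditive2 V open_UN) auto
    finally show ?case by simp
  qed simp
  from this[OF subset_refl] show ?thesis
    using TV_mono[of "\<Union>i\<in>I. A i" B V] A \<open>open B\<close> by (force intro: order_trans)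
qed

section \<open>Mollified gradients against total variation\<close>

lemma grd_norm_bounded:
  fixes V :: "'a::euclidean_space \<Rightarrow> real"
  assumes "\<eta> > 0" and V: "integrable lborel V"
  obtains C where "\<And>x. norm (grd \<eta> V x) \<le> C"
proof -
  obtain B where B: "B > 0" "\<And>x::'a. norm (dmol \<eta> x) \<le> B"
    using dmol_bound[OF assms(1), where 'a='a] by metis
  have "norm (grd \<eta> V x) \<le> (\<integral>y. B * \<bar>V y\<bar> \<partial>lborel)" for x
  proof -
    have "norm (grd \<eta> V x) \<le> (\<integral>y. norm (V y *\<^sub>R dmol \<eta> (x - y)) \<partial>lborel)"
      unfolding grd_def[OF assms(1)] by (rule integral_norm_bound)
    also have "\<dots> \<le> (\<integral>y. B * \<bar>V y\<bar> \<partial>lborel)"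
    proof (rule integral_mono[OF integrable_norm[OF grd_integrable[OF assms]]])
      show "integrable lborel (\<lambda>y. B * \<bar>V y\<bar>)" using V by simp
      show "norm (V y *\<^sub>R dmol \<eta> (x - y)) \<le> B * \<bar>V y\<bar>" for y
        using mult_left_mono[OF B(2)[of "x - y"], of "\<bar>V y\<bar>"] by (simp add: mult.commute)
    qed
    finally show ?thesis .
  qed
  then show thesis using that by blast
qed

lemma integrable_bounded_set:
  fixes f :: "'a::euclidean_space \<Rightarrow> 'b::{banach, second_countable_topology}"
  assumes [measurable]: "f \<in> borel_measurable borel" "S \<in> sets borel" and "bounded S"
    and C: "\<And>x. norm (f x) \<le> C"
  shows "integrable lborel (\<lambda>x. indicator S x *\<^sub>R f x)"
proof (rule Bochner_Integration.integrable_bound)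
  show "integrable lborel (\<lambda>x. C * indicator S x)"
    using emeasure_bounded_finite[OF \<open>bounded S\<close>] by (intro integrable_mult_right integrable_real_indicator) auto
  have "0 \<le> C" using C[of 0] norm_ge_zero order_trans by blast
  then show "AE x in lborel. norm (indicator S x *\<^sub>R f x) \<le> norm (C * indicator S x)"
    using C by (intro AE_I2) (auto simp: indicator_def)
qed measurable

lemma sgn_inner_self: "sgn g \<bullet> g = norm (g :: 'a::real_inner)"
  by (cases "g = 0") (auto simp: sgn_div_norm dot_square_norm power2_eq_square)

text \<open>The mollified unit field in the direction of the gradient is an admissible test field.\<close>

lemma nn_integral_grd_le_TV:
  fixes V :: "real ^ 'n \<Rightarrow> real"
  assumes \<eta>: "0 < \<eta>" "\<eta> < \<eta>'" and V: "integrable lborel V" and "open A"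
    and [measurable]: "S \<in> sets borel" and "bounded S" and S: "\<And>x. x \<in> S \<Longrightarrow> ball x \<eta>' \<subseteq> A"
  shows "(\<integral>\<^sup>+x\<in>S. ennreal (norm (grd \<eta> V x)) \<partial>lborel) \<le> total_variation A V"
proof -
  let ?G = "grd \<eta> V"
  have [measurable]: "V \<in> borel_measurable borel" using V by auto
  have [measurable]: "?G \<in> borel_measurable borel"
    by (rule borel_measurable_continuous_onI[OF grd_continuous[OF \<eta>(1) V]])
  obtain C where C: "\<And>x. norm (?G x) \<le> C" using grd_norm_bounded[OF \<eta>(1) V] by metis
  \<comment> \<open>The minus sign cancels that of \<open>integral_grd_inner\<close>; the cut to
    \<open>S\<close> keeps the mollified field supported in \<open>A\<close>.\<close>
  define \<psi> where "\<psi> x = indicator S x *\<^sub>R (- sgn (?G x))" for x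
  have [measurable]: "(\<lambda>x. sgn (?G x)) \<in> borel_measurable borel"
    unfolding sgn_div_norm by measurable
  have i\<psi>: "integrable lborel \<psi>"
    unfolding \<psi>_def[abs_def] by (rule integrable_bounded_set[where C = 1]) (use assms in \<open>auto simp: norm_sgn\<close>)
  have n\<psi>: "norm (\<psi> x) \<le> 1" for x by (simp add: \<psi>_def norm_sgn indicator_def)
  let ?\<Phi> = "cnv (mol \<eta>) \<psi>"
  let ?D = "{y. \<exists>x\<in>S. norm (y - x) < \<eta>}"
  have supp: "{y. ?\<Phi> y \<noteq> 0} \<subseteq> ?D"
  proof
    fix y assume "y \<in> {y. ?\<Phi> y \<noteq> 0}"
    then obtain x where "\<psi> x \<noteq> 0" "norm (y - x) < \<eta>" using cnv_mol_supp[OF \<eta>(1)] by blast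
    then show "y \<in> ?D" by (auto simp: \<psi>_def indicator_def split: if_splits)
  qed
  have bD: "bounded ?D"
  proof -
    obtain R where R: "\<And>x. x \<in> S \<Longrightarrow> norm x \<le> R" using \<open>bounded S\<close> by (auto simp: bounded_iff)
    have "norm y \<le> R + \<eta>" if "y \<in> ?D" for y
    proof -
      obtain x where x: "x \<in> S" "norm (y - x) < \<eta>" using \<open>y \<in> ?D\<close> by auto
      then show ?thesis using R[of x] norm_triangle_sub[of y x] by linarith
    qed
    then show ?thesis by (auto simp: bounded_iff)
  qed
  \<comment> \<open>Points of \<open>S\<close> have a ball of radius \<eta>' inside
    \<open>A\<close>, while the field reaches only \<eta> beyond \<open>S\<close>. The gap
    \<open>\<eta>' - \<eta>\<close> absorbs the closure.\<close>
  have clD: "closure ?D \<subseteq> A"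
  proof
    fix y assume "y \<in> closure ?D"
    moreover have "\<eta>' - \<eta> > 0" using \<eta> by simp
    ultimately have "\<exists>y'\<in>?D. dist y' y < \<eta>' - \<eta>"
      unfolding closure_approachable by blast
    then obtain y' where "y' \<in> ?D" "dist y' y < \<eta>' - \<eta>" ..
    then obtain x where x: "x \<in> S" "norm (y' - x) < \<eta>" "norm (y' - y) < \<eta>' - \<eta>" by (auto simp: dist_norm)
    have "norm (x - y) \<le> norm (x - y') + norm (y' - y)" using norm_triangle_ineq[of "x - y'" "y' - y"] by simp
    then have "norm (x - y) < \<eta>'" using x by (simp add: norm_minus_commute)
    then show "y \<in> A" using S[OF x(1)] by (auto simp: dist_norm)
  qed
  have cl: "closure {y. ?\<Phi> y \<noteq> 0} \<subseteq> closure ?D" by (rule closure_mono[OF supp])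
  have cpt: "compact (closure {y. ?\<Phi> y \<noteq> 0})"
    using bounded_subset[OF bounded_closure[OF bD] cl] by (simp add: compact_eq_bounded_closed)
  have tf: "?\<Phi> \<in> test_fields A"
    unfolding test_fields_def
    using Ck1_cnv_mol(1)[OF \<eta>(1) i\<psi>] cpt order_trans[OF cl clD] cnv_mol_norm_le[OF \<eta>(1) i\<psi> n\<psi>]
    by (intro CollectI conjI allI)
  have "(\<integral>\<^sup>+x\<in>S. ennreal (norm (?G x)) \<partial>lborel) = (\<integral>\<^sup>+x. ennreal (- (\<psi> x \<bullet> ?G x)) \<partial>lborel)"
  proof (intro nn_integral_cong)
    fix x
    show "ennreal (norm (?G x)) * indicator S x = ennreal (- (\<psi> x \<bullet> ?G x))"
      by (simp add: \<psi>_def indicator_def sgn_inner_self)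
  qed
  also have "\<dots> = ennreal (\<integral>x. - (\<psi> x \<bullet> ?G x) \<partial>lborel)"
  proof (rule nn_integral_eq_integral)
    have "integrable lborel (\<lambda>x. indicator S x *\<^sub>R norm (?G x))"
      by (rule integrable_bounded_set) (use C assms in auto)
    moreover have "indicator S x *\<^sub>R norm (?G x) = - (\<psi> x \<bullet> ?G x)" for x
      by (simp add: \<psi>_def indicator_def sgn_inner_self)
    ultimately show "integrable lborel (\<lambda>x. - (\<psi> x \<bullet> ?G x))" by simp
    show "AE x in lborel. 0 \<le> - (\<psi> x \<bullet> ?G x)"
      by (intro AE_I2) (simp add: \<psi>_def indicator_def sgn_inner_self)
  qed
  also have "(\<integral>x. - (\<psi> x \<bullet> ?G x) \<partial>lborel) = (\<integral>y. V y * divergence ?\<Phi> y \<partial>lborel)"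
    using integral_grd_inner[OF \<eta>(1) i\<psi> V] by simp
  also have "ennreal \<dots> \<le> total_variation A V"
    using tf \<open>open A\<close> by (subst TV_lborel) (auto intro: SUP_upper)
  finally show ?thesis .
qed

text \<open>The fundamental theorem of calculus along the segment from \<open>x\<close> to
  \<open>h + x\<close>.\<close>

lemma cnv_shift_le:
  fixes V :: "'a::euclidean_space \<Rightarrow> real"
  assumes \<eta>: "\<eta> > 0" and V: "integrable lborel V"
  shows "ennreal \<bar>cnv (mol \<eta>) V (h + x) - cnv (mol \<eta>) V x\<bar>
    \<le> (\<integral>\<^sup>+t\<in>{0..1}. ennreal (norm h) * ennreal (norm (grd \<eta> V (x + t *\<^sub>R h))) \<partial>lborel)"
proof -
  let ?w = "cnv (mol \<eta>) V" and ?G = "grd \<eta> V"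
  have gc: "continuous_on UNIV ?G" by (rule grd_continuous[OF \<eta> V])
  have der: "((\<lambda>t. ?w (x + t *\<^sub>R h)) has_real_derivative ?G (x + t *\<^sub>R h) \<bullet> h) (at t)" for t
  proof -
    have "((\<lambda>t. x + t *\<^sub>R h) has_derivative (\<lambda>s. s *\<^sub>R h)) (at t)"
      by (auto intro!: derivative_eq_intros)
    from has_derivative_compose[OF this cnv_mol_derivative[OF \<eta> V]]
    show ?thesis
      unfolding has_field_derivative_def by (rule has_derivative_eq_rhs) (simp add: fun_eq_iff mult.commute)
  qed
  have cont: "isCont (\<lambda>t. ?G (x + t *\<^sub>R h) \<bullet> h) t" for t
  proof -
    have "isCont ?G (x + t *\<^sub>R h)" using gc by (simp add: continuous_on_eq_continuous_at)
    then have "isCont (\<lambda>t. ?G (x + t *\<^sub>R h)) t" by (rule isCont_o2[rotated]) (intro continuous_intros)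
    then show ?thesis by (intro continuous_intros)
  qed
  have hb: "has_bochner_integral lborel (\<lambda>t. (?G (x + t *\<^sub>R h) \<bullet> h) * indicator {0..1} t)
      (?w (x + 1 *\<^sub>R h) - ?w (x + 0 *\<^sub>R h))"
    by (rule has_bochner_integral_FTC_Icc_real[OF _ der cont]) simp
  then have int: "integrable lborel (\<lambda>t. (?G (x + t *\<^sub>R h) \<bullet> h) * indicator {0..1} t)"
    and val: "(\<integral>t. (?G (x + t *\<^sub>R h) \<bullet> h) * indicator {0..1} t \<partial>lborel) = ?w (h + x) - ?w x"
    by (auto simp: has_bochner_integral_iff add.commute)
  have "ennreal \<bar>?w (h + x) - ?w x\<bar> \<le> (\<integral>\<^sup>+t. ennreal (norm ((?G (x + t *\<^sub>R h) \<bullet> h) * indicator {0..1} t)) \<partial>lborel)"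
    using integral_norm_bound_ennreal[OF int] by (simp add: val)
  also have "\<dots> \<le> (\<integral>\<^sup>+t\<in>{0..1}. ennreal (norm h) * ennreal (norm (?G (x + t *\<^sub>R h))) \<partial>lborel)"
  proof (intro nn_integral_mono)
    fix t :: real
    have "\<bar>?G (x + t *\<^sub>R h) \<bullet> h\<bar> \<le> norm h * norm (?G (x + t *\<^sub>R h))"
      using Cauchy_Schwarz_ineq2[of "?G (x + t *\<^sub>R h)" h] by (simp add: mult.commute)
    then show "ennreal (norm ((?G (x + t *\<^sub>R h) \<bullet> h) * indicator {0..1} t))
       \<le> ennreal (norm h) * ennreal (norm (?G (x + t *\<^sub>R h))) * indicator {0..1} t"
      by (simp add: indicator_def ennreal_mult[symmetric] ennreal_leI)
  qed
  finally show ?thesis .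
qed

text \<open>An intersection of closed conditions, one for each point outside \<open>A\<close>. It
  supplies Borel measurability of the sets of points with room around them.\<close>

lemma closed_inner: "closed {x::'a::metric_space. ball x r \<subseteq> A}"
proof -
  have "{x. ball x r \<subseteq> A} = (\<Inter>q\<in>-A. {x. r \<le> dist x q})"
    by (auto simp: not_less[symmetric])
  then show ?thesis by (auto intro!: closed_Collect_le continuous_intros)
qed

text \<open>For the mollified function the difference is an integral of the gradient along the
  segment, which by convexity stays inside the set; translating the inner integral back leaves the
  integral of the gradient norm. The mollification is then removed.\<close>

lemma nn_integral_shift_le_TV:
  fixes V :: "real ^ 'n \<Rightarrow> real"
  assumes V: "integrable lborel V" and A: "open A" "convex A" "bounded A"
  shows "(\<integral>\<^sup>+x. ennreal \<bar>V (h + x) - V x\<bar> * (indicator A x * indicator A (h + x)) \<partial>lborel)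
    \<le> ennreal (norm h) * total_variation A V"
proof -
  have [measurable]: "V \<in> borel_measurable borel" using V by auto
  \<comment> \<open>The points of \<open>A\<close> that leave room \<open>r\<close> for the
    mollifying kernel. Convexity of \<open>A\<close> is inherited, so segments between two such
    points stay among them.\<close>
  define S where "S r = {x. ball x r \<subseteq> A} \<inter> A" for r :: real
  have mS[measurable]: "S r \<in> sets borel" for r
    unfolding S_def using A closed_inner by (intro sets.Int borel_closed borel_open)
  have [measurable]: "A \<in> sets borel" using A by simp
  have conv: "convex (S r)" if "r > 0" for r
  proof -
    have "convex {x. ball x r \<subseteq> A}"
    proof (rule convexI, clarify)
      fix x y z and u v :: real
      assume xy: "ball x r \<subseteq> A" "ball y r \<subseteq> A" and uv: "0 \<le> u" "0 \<le> v" "u + v = 1"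
        and z: "z \<in> ball (u *\<^sub>R x + v *\<^sub>R y) r"
      define d where "d = z - (u *\<^sub>R x + v *\<^sub>R y)"
      have "norm d < r" using z by (simp add: d_def dist_norm norm_minus_commute)
      then have "x + d \<in> A" "y + d \<in> A" using xy by (auto simp: dist_norm)
      then have "u *\<^sub>R (x + d) + v *\<^sub>R (y + d) \<in> A" using A(2) uv by (auto simp: convex_def)
      moreover have "u *\<^sub>R (x + d) + v *\<^sub>R (y + d) = u *\<^sub>R x + v *\<^sub>R y + (u + v) *\<^sub>R d"
        by (simp add: algebra_simps)
      ultimately show "z \<in> A" using uv by (simp add: d_def)
    qed
    then show ?thesis unfolding S_def using A by (intro convex_Int)
  qed
  have main: "(\<integral>\<^sup>+x. ennreal \<bar>V (h + x) - V x\<bar> * (indicator (S r) x * indicator (S r) (h + x)) \<partial>lborel)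
    \<le> ennreal (norm h) * total_variation A V" if r: "r > 0" for r
  proof (rule ennreal_le_epsilon)
    fix e :: real assume "e > 0"
    then obtain d where d: "d > 0" "\<And>\<eta>. 0 < \<eta> \<Longrightarrow> \<eta> < d \<Longrightarrow> (\<integral>\<^sup>+x. ennreal \<bar>cnv (mol \<eta>) V x - V x\<bar> \<partial>lborel) \<le> ennreal (e / 2)"
      using cnv_mol_L1[OF V, of "e / 2"] by auto
    define \<eta> where "\<eta> = min d r / 2"
    have \<eta>: "\<eta> > 0" "\<eta> < d" "\<eta> < r" using d r by (auto simp: \<eta>_def)
    let ?w = "cnv (mol \<eta>) V" and ?G = "grd \<eta> V"
    have [measurable]: "?w \<in> borel_measurable borel" by (rule cnv_mol_borel[OF \<eta>(1) V])
    have [measurable]: "?G \<in> borel_measurable borel"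
      by (rule borel_measurable_continuous_onI[OF grd_continuous[OF \<eta>(1) V]])
    let ?I = "\<lambda>x. indicator (S r) x * indicator (S r) (h + x) :: ennreal"
    let ?d = "\<lambda>x. ennreal \<bar>?w x - V x\<bar>"
    have TV: "(\<integral>\<^sup>+x\<in>S r. ennreal (norm (?G x)) \<partial>lborel) \<le> total_variation A V"
      by (rule nn_integral_grd_le_TV[OF \<eta>(1,3) V A(1) mS])
         (use bounded_subset[OF A(3), of "S r"] in \<open>auto simp: S_def\<close>)
    have "(\<integral>\<^sup>+x. ennreal \<bar>?w (h + x) - ?w x\<bar> * ?I x \<partial>lborel)
      \<le> (\<integral>\<^sup>+x. (\<integral>\<^sup>+t. (ennreal (norm h) * indicator {0..1} t) * (ennreal (norm (?G (t *\<^sub>R h + x))) * indicator (S r) (t *\<^sub>R h + x)) \<partial>lborel) \<partial>lborel)"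
    proof (intro nn_integral_mono)
      fix x
      have "ennreal \<bar>?w (h + x) - ?w x\<bar> * ?I x
         \<le> (\<integral>\<^sup>+t\<in>{0..1}. ennreal (norm h) * ennreal (norm (?G (x + t *\<^sub>R h))) \<partial>lborel) * ?I x"
        by (intro mult_right_mono cnv_shift_le \<eta> V) auto
      also have "\<dots> = (\<integral>\<^sup>+t. (ennreal (norm h) * ennreal (norm (?G (x + t *\<^sub>R h))) * indicator {0..1} t) * ?I x \<partial>lborel)"
        by (rule nn_integral_multc[symmetric]) measurable
      also have "\<dots> \<le> (\<integral>\<^sup>+t. (ennreal (norm h) * indicator {0..1} t) * (ennreal (norm (?G (t *\<^sub>R h + x))) * indicator (S r) (t *\<^sub>R h + x)) \<partial>lborel)"
      proof (intro nn_integral_mono)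
        fix t :: real
        have "t *\<^sub>R h + x \<in> S r" if "x \<in> S r" "h + x \<in> S r" "t \<in> {0..1}"
        proof -
          have "(1 - t) *\<^sub>R x + t *\<^sub>R (h + x) \<in> S r"
            using conv[OF r] that by (auto simp: convex_def)
          moreover have "(1 - t) *\<^sub>R x + t *\<^sub>R (h + x) = t *\<^sub>R h + x" by (simp add: algebra_simps)
          ultimately show ?thesis by simp
        qed
        then show "(ennreal (norm h) * ennreal (norm (?G (x + t *\<^sub>R h))) * indicator {0..1} t) * ?I x
          \<le> (ennreal (norm h) * indicator {0..1} t) * (ennreal (norm (?G (t *\<^sub>R h + x))) * indicator (S r) (t *\<^sub>R h + x))"
          by (auto simp: indicator_def add.commute)
      qed
      finally show "ennreal \<bar>?w (h + x) - ?w x\<bar> * ?I x \<le> (\<integral>\<^sup>+t. (ennreal (norm h) * indicator {0..1} t) * (ennreal (norm (?G (t *\<^sub>R h + x))) * indicator (S r) (t *\<^sub>R h + x)) \<partial>lborel)" .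
    qed
    also have "\<dots> = (\<integral>\<^sup>+t. (\<integral>\<^sup>+x. (ennreal (norm h) * indicator {0..1} t) * (ennreal (norm (?G (t *\<^sub>R h + x))) * indicator (S r) (t *\<^sub>R h + x)) \<partial>lborel) \<partial>lborel)"
      by (rule lborel_pair.Fubini') measurable
    also have "\<dots> = (\<integral>\<^sup>+t. (ennreal (norm h) * indicator {0..1} t) * (\<integral>\<^sup>+x\<in>S r. ennreal (norm (?G x)) \<partial>lborel) \<partial>(lborel :: real measure))"
    proof (intro nn_integral_cong)
      fix t :: real
      have "(\<integral>\<^sup>+x. (ennreal (norm h) * indicator {0..1} t) * (ennreal (norm (?G (t *\<^sub>R h + x))) * indicator (S r) (t *\<^sub>R h + x)) \<partial>lborel)
        = (ennreal (norm h) * indicator {0..1} t) * (\<integral>\<^sup>+x. ennreal (norm (?G (t *\<^sub>R h + x))) * indicator (S r) (t *\<^sub>R h + x) \<partial>lborel)"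
        by (rule nn_integral_cmult) measurable
      then show "(\<integral>\<^sup>+x. (ennreal (norm h) * indicator {0..1} t) * (ennreal (norm (?G (t *\<^sub>R h + x))) * indicator (S r) (t *\<^sub>R h + x)) \<partial>lborel)
        = (ennreal (norm h) * indicator {0..1} t) * (\<integral>\<^sup>+x\<in>S r. ennreal (norm (?G x)) \<partial>lborel)"
        using nn_integral_lborel_translate[of "\<lambda>x. ennreal (norm (?G x)) * indicator (S r) x" "t *\<^sub>R h"] by simp
    qed
    also have "\<dots> = ennreal (norm h) * (\<integral>\<^sup>+x\<in>S r. ennreal (norm (?G x)) \<partial>lborel)"
      by (simp add: nn_integral_multc nn_integral_cmult_indicator)
    also have "\<dots> \<le> ennreal (norm h) * total_variation A V" by (intro mult_left_mono TV) auto
    finally have w: "(\<integral>\<^sup>+x. ennreal \<bar>?w (h + x) - ?w x\<bar> * ?I x \<partial>lborel) \<le> ennreal (norm h) * total_variation A V" .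
    have "(\<integral>\<^sup>+x. ennreal \<bar>V (h + x) - V x\<bar> * ?I x \<partial>lborel)
       \<le> (\<integral>\<^sup>+x. ennreal \<bar>?w (h + x) - ?w x\<bar> * ?I x + (?d (h + x) + ?d x) \<partial>lborel)"
      by (intro nn_integral_mono) (auto simp: indicator_def ennreal_plus[symmetric] simp del: ennreal_plus intro!: ennreal_leI)
    also have "\<dots> = (\<integral>\<^sup>+x. ennreal \<bar>?w (h + x) - ?w x\<bar> * ?I x \<partial>lborel) + (\<integral>\<^sup>+x. ?d (h + x) + ?d x \<partial>lborel)"
      by (rule nn_integral_add) measurable
    also have "(\<integral>\<^sup>+x. ?d (h + x) + ?d x \<partial>lborel) = (\<integral>\<^sup>+x. ?d (h + x) \<partial>lborel) + (\<integral>\<^sup>+x. ?d x \<partial>lborel)"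
      by (rule nn_integral_add) measurable
    also have "(\<integral>\<^sup>+x. ?d (h + x) \<partial>lborel) = (\<integral>\<^sup>+x. ?d x \<partial>lborel)"
      using nn_integral_lborel_translate[of ?d h] by simp
    also have "(\<integral>\<^sup>+x. ennreal \<bar>?w (h + x) - ?w x\<bar> * ?I x \<partial>lborel) + ((\<integral>\<^sup>+x. ?d x \<partial>lborel) + (\<integral>\<^sup>+x. ?d x \<partial>lborel))
       \<le> ennreal (norm h) * total_variation A V + (ennreal (e / 2) + ennreal (e / 2))"
      by (intro add_mono w d(2) \<eta>)
    also have "ennreal (e / 2) + ennreal (e / 2) = ennreal e"
      using \<open>e > 0\<close> by (simp add: ennreal_plus[symmetric] del: ennreal_plus)
    finally show "(\<integral>\<^sup>+x. ennreal \<bar>V (h + x) - V x\<bar> * ?I x \<partial>lborel) \<le> ennreal (norm h) * total_variation A V + ennreal e" .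
  qed
  \<comment> \<open>The sets with room \<open>1 / (k + 1)\<close> increase to the open set
    \<open>A\<close>, and the bound is the same for all of them.\<close>
  let ?f = "\<lambda>k x. ennreal \<bar>V (h + x) - V x\<bar> * (indicator (S (1 / real (Suc k))) x * indicator (S (1 / real (Suc k))) (h + x))"
  have mono: "S (1 / real (Suc k)) \<subseteq> S (1 / real (Suc l))" if "k \<le> l" for k l
  proof -
    have "1 / real (Suc l) \<le> 1 / real (Suc k)" using that by (simp add: field_simps)
    then show ?thesis using subset_ball[of "1 / real (Suc l)" "1 / real (Suc k)"] by (auto simp: S_def)
  qed
  have ex: "\<exists>k. x \<in> S (1 / real (Suc k))" if xA: "x \<in> A" for x
  proof -
    obtain r where r: "r > 0" "ball x r \<subseteq> A" by (rule openE[OF A(1) xA])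
    obtain k where "1 / real (Suc k) < r" using nat_approx_posE[OF r(1)] by auto
    then have "x \<in> S (1 / real (Suc k))" using r xA subset_ball[of "1 / real (Suc k)" r x] by (auto simp: S_def)
    then show ?thesis ..
  qed
  have inc: "incseq ?f"
    unfolding incseq_def le_fun_def
  proof (intro allI impI)
    fix k l :: nat and x assume "k \<le> l"
    then show "?f k x \<le> ?f l x" using mono[OF \<open>k \<le> l\<close>] by (auto simp: indicator_def)
  qed
  have "(\<integral>\<^sup>+x. ennreal \<bar>V (h + x) - V x\<bar> * (indicator A x * indicator A (h + x)) \<partial>lborel)
     \<le> (\<integral>\<^sup>+x. (SUP k. ?f k x) \<partial>lborel)"
  proof (intro nn_integral_mono)
    fix x
    show "ennreal \<bar>V (h + x) - V x\<bar> * (indicator A x * indicator A (h + x)) \<le> (SUP k. ?f k x)"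
    proof (cases "x \<in> A \<and> h + x \<in> A")
      case True
      then obtain k l where "x \<in> S (1 / real (Suc k))" "h + x \<in> S (1 / real (Suc l))" using ex by blast
      then have "x \<in> S (1 / real (Suc (max k l)))" "h + x \<in> S (1 / real (Suc (max k l)))"
        using mono[of k "max k l"] mono[of l "max k l"] by auto
      then have "ennreal \<bar>V (h + x) - V x\<bar> * (indicator A x * indicator A (h + x)) \<le> ?f (max k l) x"
        using True by simp
      also have "\<dots> \<le> (SUP k. ?f k x)" by (rule SUP_upper) simp
      finally show ?thesis .
    qed auto
  qed
  also have "\<dots> = (SUP k. integral\<^sup>N lborel (?f k))"
    by (rule nn_integral_monotone_convergence_SUP[OF inc]) measurable
  also have "\<dots> \<le> ennreal (norm h) * total_variation A V"
    by (intro SUP_least main) simp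
  finally show ?thesis .
qed

text \<open>The volume of the box containing all differences of two points of a cube, times the
  largest length of such a difference, both for side 1. No sharpness is intended.\<close>

definition poincare_const :: "'n::finite itself \<Rightarrow> real"
  where "poincare_const _ = (2 * sqrt CARD('n)) ^ CARD('n) * sqrt CARD('n)"

text \<open>The Poincare inequality on a cube. In the double integral of
  \<open>osc_le_double\<close> the difference \<open>h = y - x\<close> becomes a variable; each
  shift costs its length times the total variation, and only shifts in the box \<open>B\<close>
  occur.\<close>

lemma osc_le_TV:
  fixes V :: "real ^ 'n \<Rightarrow> real"
  assumes V: "integrable lborel V" and T: "orthogonal_transformation T" and "\<delta> > 0"
  shows "ennreal (\<delta> ^ (CARD('n) - 1)) * ennreal (osc (ocube a T \<delta>) V)
    \<le> ennreal (poincare_const TYPE('n)) * total_variation (ocube a T \<delta>) V"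
proof -
  let ?Q = "ocube a T \<delta>" and ?R = "sqrt CARD('n) * \<delta>"
  interpret avg_domain ?Q "\<delta> ^ CARD('n)" by (rule avg_domain_ocube[OF T \<open>\<delta> > 0\<close>])
  have [measurable]: "V \<in> borel_measurable borel" using V by auto
  have Q: "open ?Q" "convex ?Q" by (rule open_ocube[OF T], rule convex_ocube[OF T])
  have bQ: "bounded ?Q"
  proof (rule boundedI)
    fix x assume "x \<in> ?Q"
    then show "norm x \<le> norm a + ?R"
      using ocube_near[OF T, of x a \<delta>] norm_triangle_sub[of x a] by linarith
  qed
  define B where "B = cbox (\<chi> i. - ?R) ((\<chi> i. ?R) :: real ^ 'n)"
  have [measurable]: "B \<in> sets borel" by (simp add: B_def)
  have "?R > 0" using \<open>\<delta> > 0\<close> by simp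
  have emB: "emeasure lborel B = ennreal ((2 * ?R) ^ CARD('n))"
  proof -
    have "emeasure lborel B = (\<Prod>b\<in>Basis. ((\<chi> i. ?R) - (\<chi> i. - ?R) :: real ^ 'n) \<bullet> b)"
      unfolding B_def using \<open>?R > 0\<close> by (intro emeasure_lborel_cbox) (auto simp: Basis_vec_def inner_axis)
    also have "(\<Prod>b\<in>Basis. ((\<chi> i. ?R) - (\<chi> i. - ?R) :: real ^ 'n) \<bullet> b) = (\<Prod>b\<in>(Basis :: (real ^ 'n) set). 2 * ?R)"
      by (rule prod.cong) (auto simp: Basis_vec_def inner_axis)
    finally show ?thesis by simp
  qed
  have "ennreal ((\<delta> ^ CARD('n))\<^sup>2) * ennreal (osc ?Q V)
     \<le> (\<integral>\<^sup>+x\<in>?Q. (\<integral>\<^sup>+y\<in>?Q. ennreal \<bar>V y - V x\<bar> \<partial>lborel) \<partial>lborel)"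
    by (rule osc_le_double) (use V in \<open>auto intro: integrable_imp_set_integrable\<close>)
  also have "\<dots> = (\<integral>\<^sup>+x. (\<integral>\<^sup>+h. ennreal \<bar>V (h + x) - V x\<bar> * (indicator ?Q x * indicator ?Q (h + x)) \<partial>lborel) \<partial>lborel)"
  proof (intro nn_integral_cong)
    fix x
    have "(\<integral>\<^sup>+y\<in>?Q. ennreal \<bar>V y - V x\<bar> \<partial>lborel) = (\<integral>\<^sup>+h. ennreal \<bar>V (h + x) - V x\<bar> * indicator ?Q (h + x) \<partial>lborel)"
      using nn_integral_lborel_translate[of "\<lambda>y. ennreal \<bar>V y - V x\<bar> * indicator ?Q y" x]
      by (simp add: add.commute)
    then show "(\<integral>\<^sup>+y\<in>?Q. ennreal \<bar>V y - V x\<bar> \<partial>lborel) * indicator ?Q x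
       = (\<integral>\<^sup>+h. ennreal \<bar>V (h + x) - V x\<bar> * (indicator ?Q x * indicator ?Q (h + x)) \<partial>lborel)"
      by (simp add: indicator_def)
  qed
  also have "\<dots> = (\<integral>\<^sup>+h. (\<integral>\<^sup>+x. ennreal \<bar>V (h + x) - V x\<bar> * (indicator ?Q x * indicator ?Q (h + x)) \<partial>lborel) \<partial>lborel)"
    by (rule lborel_pair.Fubini') measurable
  also have "\<dots> \<le> (\<integral>\<^sup>+h. (ennreal ?R * total_variation ?Q V) * indicator B h \<partial>lborel)"
  proof (intro nn_integral_mono)
    fix h :: "real ^ 'n"
    show "(\<integral>\<^sup>+x. ennreal \<bar>V (h + x) - V x\<bar> * (indicator ?Q x * indicator ?Q (h + x)) \<partial>lborel)
      \<le> (ennreal ?R * total_variation ?Q V) * indicator B h"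
    proof (cases "norm h \<le> ?R")
      case True
      have "\<bar>h $ i\<bar> \<le> ?R" for i using component_le_norm_cart[of h i] True by linarith
      then have hB: "h \<in> B" by (auto simp: B_def mem_box_cart abs_le_iff minus_le_iff)
      have "(\<integral>\<^sup>+x. ennreal \<bar>V (h + x) - V x\<bar> * (indicator ?Q x * indicator ?Q (h + x)) \<partial>lborel)
        \<le> ennreal (norm h) * total_variation ?Q V"
        by (rule nn_integral_shift_le_TV[OF V Q bQ])
      also have "\<dots> \<le> ennreal ?R * total_variation ?Q V"
        using True by (intro mult_right_mono ennreal_leI) auto
      finally show ?thesis using hB by simp
    next
      case False
      have z: "ennreal \<bar>V (h + x) - V x\<bar> * (indicator ?Q x * indicator ?Q (h + x)) = 0" for x
        using ocube_diam[OF T, of "h + x" a \<delta> x] False by (auto simp: indicator_def)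
      show ?thesis by (simp only: z) simp
    qed
  qed
  also have "\<dots> = (ennreal ?R * total_variation ?Q V) * ennreal ((2 * ?R) ^ CARD('n))"
    by (simp add: nn_integral_cmult_indicator emB)
  also have "\<dots> = ennreal (\<delta> ^ CARD('n) * \<delta>) * (ennreal (poincare_const TYPE('n)) * total_variation ?Q V)"
  proof -
    have "ennreal ?R * ennreal ((2 * ?R) ^ CARD('n)) = ennreal (\<delta> ^ CARD('n) * \<delta>) * ennreal (poincare_const TYPE('n))"
      using \<open>\<delta> > 0\<close> by (simp add: ennreal_mult[symmetric] poincare_const_def power_mult_distrib ac_simps)
    then have "(ennreal ?R * ennreal ((2 * ?R) ^ CARD('n))) * total_variation ?Q V
       = (ennreal (\<delta> ^ CARD('n) * \<delta>) * ennreal (poincare_const TYPE('n))) * total_variation ?Q V"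
      by (simp only:)
    then show ?thesis by (simp only: mult.assoc mult.commute[of "total_variation ?Q V"])
  qed
  finally have "ennreal ((\<delta> ^ CARD('n))\<^sup>2) * ennreal (osc ?Q V)
    \<le> ennreal (\<delta> ^ CARD('n) * \<delta>) * (ennreal (poincare_const TYPE('n)) * total_variation ?Q V)" .
  moreover have "ennreal ((\<delta> ^ CARD('n))\<^sup>2) = ennreal (\<delta> ^ CARD('n) * \<delta>) * ennreal (\<delta> ^ (CARD('n) - 1))"
  proof -
    have "CARD('n) = Suc (CARD('n) - 1)" by (simp add: Suc_diff_1)
    then have "\<delta> ^ CARD('n) = \<delta> * \<delta> ^ (CARD('n) - 1)" by (metis power_Suc)
    then have "(\<delta> ^ CARD('n))\<^sup>2 = (\<delta> ^ CARD('n) * \<delta>) * \<delta> ^ (CARD('n) - 1)"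
      by (simp add: power2_eq_square)
    then show ?thesis using \<open>\<delta> > 0\<close> by (simp add: ennreal_mult[symmetric] del: ennreal_mult')
  qed
  ultimately have "ennreal (\<delta> ^ CARD('n) * \<delta>) * (ennreal (\<delta> ^ (CARD('n) - 1)) * ennreal (osc ?Q V))
    \<le> ennreal (\<delta> ^ CARD('n) * \<delta>) * (ennreal (poincare_const TYPE('n)) * total_variation ?Q V)"
    by (simp add: mult.assoc)
  then show ?thesis
    using \<open>\<delta> > 0\<close> by (subst (asm) ennreal_mult_le_mult_iff) auto
qed

section \<open>Recovery functions\<close>

lemma sum_nn_integral_disjoint_le:
  fixes Q :: "'i \<Rightarrow> 'a::euclidean_space set" and f :: "'a \<Rightarrow> ennreal"
  assumes "finite I" and [measurable]: "f \<in> borel_measurable borel"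
    and Q: "\<And>i. i \<in> I \<Longrightarrow> Q i \<in> sets borel" "\<And>i. i \<in> I \<Longrightarrow> Q i \<subseteq> U"
    and disj: "\<And>i j. i \<in> I \<Longrightarrow> j \<in> I \<Longrightarrow> i \<noteq> j \<Longrightarrow> Q i \<inter> Q j = {}"
  shows "(\<Sum>i\<in>I. \<integral>\<^sup>+x\<in>Q i. f x \<partial>lborel) \<le> (\<integral>\<^sup>+x\<in>U. f x \<partial>lborel)"
proof -
  have "(\<Sum>i\<in>I. \<integral>\<^sup>+x\<in>Q i. f x \<partial>lborel) = (\<integral>\<^sup>+x. (\<Sum>i\<in>I. f x * indicator (Q i) x) \<partial>lborel)"
    using Q(1) by (subst nn_integral_sum) auto
  also have "\<dots> \<le> (\<integral>\<^sup>+x\<in>U. f x \<partial>lborel)"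
  proof (intro nn_integral_mono)
    fix x
    show "(\<Sum>i\<in>I. f x * indicator (Q i) x) \<le> f x * indicator U x"
    proof (cases "\<exists>i\<in>I. x \<in> Q i")
      case True
      then obtain i where i: "i \<in> I" "x \<in> Q i" by blast
      have "(\<Sum>j\<in>I. f x * indicator (Q j) x) = (\<Sum>j\<in>I. if j = i then f x else 0)"
        using i disj by (intro sum.cong refl) (auto simp: indicator_def)
      also have "\<dots> = f x" using i assms(1) by simp
      finally show ?thesis using i Q(2) by (auto simp: indicator_def)
    next
      case False
      then have "(\<Sum>i\<in>I. f x * indicator (Q i) x) = 0" by (intro sum.neutral) auto
      then show ?thesis by simp
    qed
  qed
  finally show ?thesis .
qed

lemma compl_bounded_nonempty:
  "bounded (\<Omega> :: (real ^ 'n) set) \<Longrightarrow> - \<Omega> \<noteq> {}"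
  using not_bounded_UNIV[where 'a="real ^ 'n"] by (metis Compl_eq_Diff_UNIV Diff_eq_empty_iff bounded_subset)

lemma infdist_ball_subset:
  assumes "r \<le> infdist x (- \<Omega>)"
  shows "ball x r \<subseteq> \<Omega>"
proof
  fix y assume y: "y \<in> ball x r"
  show "y \<in> \<Omega>"
  proof (rule ccontr)
    assume "y \<notin> \<Omega>"
    then have "infdist x (- \<Omega>) \<le> dist x y" by (intro infdist_le) auto
    then show False using y assms by simp
  qed
qed

lemma infdist_lipschitz: "infdist x A \<le> infdist y A + norm (x - y)"
  using infdist_triangle[of x A y] by (simp add: dist_norm)

lemma open_layer:
  fixes \<Omega> :: "'a::real_normed_vector set"
  assumes "open \<Omega>"
  shows "open {x \<in> \<Omega>. infdist x (- \<Omega>) < r}" "open {x \<in> \<Omega>. r < infdist x (- \<Omega>)}"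
proof -
  have "open {x. infdist x (- \<Omega>) < r}" "open {x. r < infdist x (- \<Omega>)}"
    by (intro open_Collect_less continuous_intros)+
  then show "open {x \<in> \<Omega>. infdist x (- \<Omega>) < r}" "open {x \<in> \<Omega>. r < infdist x (- \<Omega>)}"
    using assms by (simp_all add: Collect_conj_eq open_Int)
qed

text \<open>A test field that is optimal up to \<open>e\<close> has compact support in \<Omega>,
  hence stays at some distance \<open>R\<close> from the complement. It already exhausts the total
  variation of the inner set up to \<open>e\<close>, and superadditivity leaves at most
  \<open>e\<close> for the layer.\<close>

lemma TV_layer:
  fixes V :: "real ^ 'n \<Rightarrow> real"
  assumes \<Omega>: "open \<Omega>" "bounded \<Omega>" and V: "integrable lborel V" and fin: "total_variation \<Omega> V < \<infinity>" and "e > 0"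
  shows "\<exists>R>0. total_variation {x \<in> \<Omega>. infdist x (- \<Omega>) < R} V \<le> ennreal e"
proof -
  have [measurable]: "V \<in> borel_measurable borel" using V by auto
  let ?d = "\<lambda>x. infdist x (- \<Omega>)"
  let ?I = "\<lambda>\<phi>. ennreal (\<integral>x. V x * divergence \<phi> x \<partial>lborel)"
  have tv: "total_variation \<Omega> V = (SUP \<phi>\<in>test_fields \<Omega>. ?I \<phi>)" by (rule TV_lborel[OF \<Omega>(1)]) measurable
  have "\<exists>\<phi>\<in>test_fields \<Omega>. total_variation \<Omega> V < ?I \<phi> + ennreal e"
    by (rule SUP_approx_ennreal[OF \<open>e > 0\<close> _ tv]) (use zero_test_field[of \<Omega>] fin in auto)
  then obtain \<phi> where \<phi>: "\<phi> \<in> test_fields \<Omega>" "total_variation \<Omega> V < ?I \<phi> + ennreal e" by blast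
  let ?S = "closure {x. \<phi> x \<noteq> 0}"
  have S: "compact ?S" "?S \<subseteq> \<Omega>" using \<phi>(1) by (auto simp: test_fields_def)
  have ne: "- \<Omega> \<noteq> {}" "closed (- \<Omega>)" using compl_bounded_nonempty \<Omega> by auto
  have "\<exists>R>0. \<forall>x\<in>?S. R < ?d x"
  proof (cases "?S = {}")
    case False
    have "continuous_on ?S ?d" by (intro continuous_intros)
    then obtain x0 where x0: "x0 \<in> ?S" "\<And>x. x \<in> ?S \<Longrightarrow> ?d x0 \<le> ?d x"
      using continuous_attains_inf[OF S(1) False] by blast
    have "?d x0 > 0" using x0(1) S(2) infdist_pos_not_in_closed[OF ne(2,1), of x0] by auto
    moreover have "?d x0 / 2 < ?d x" if "x \<in> ?S" for x using x0(2)[OF that] \<open>?d x0 > 0\<close> by linarith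
    ultimately show ?thesis by (intro exI[of _ "?d x0 / 2"]) auto
  qed (auto intro: exI[of _ 1])
  then obtain R where R: "R > 0" "\<And>x. x \<in> ?S \<Longrightarrow> R < ?d x" by blast
  let ?A = "{x \<in> \<Omega>. R < ?d x}" and ?L = "{x \<in> \<Omega>. ?d x < R}"
  have o: "open ?A" "open ?L" using open_layer[OF \<Omega>(1)] by auto
  have "?S \<subseteq> ?A" using S R by auto
  then have "\<phi> \<in> test_fields ?A" using \<phi>(1) unfolding test_fields_def by blast
  then have IA: "?I \<phi> \<le> total_variation ?A V" using o by (subst TV_lborel) (auto intro: SUP_upper)
  have "total_variation ?A V + total_variation ?L V \<le> total_variation (?A \<union> ?L) V"
    by (rule TV_superadditive2[OF o _ V]) auto
  also have "\<dots> \<le> total_variation \<Omega> V" by (rule TV_mono) (use o \<Omega> in auto)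
  also have "\<dots> \<le> ?I \<phi> + ennreal e" using \<phi>(2) by simp
  also have "\<dots> \<le> total_variation ?A V + ennreal e" by (rule add_right_mono[OF IA])
  finally have le: "total_variation ?A V + total_variation ?L V \<le> total_variation ?A V + ennreal e" .
  have "total_variation ?A V \<le> total_variation \<Omega> V" by (rule TV_mono) (use o \<Omega> in auto)
  then have "total_variation ?A V \<noteq> top" using fin by (auto simp: top_unique)
  then have "total_variation ?L V \<le> ennreal e"
    using le by (simp add: ennreal_add_left_cancel_le)
  then show ?thesis using R(1) by blast
qed

text \<open>A mean value argument over \<open>r\<close>: each point lies in the shells of a set of
  radii of length \<open>2 * t\<close>, so the shell integrals sum to at most
  \<open>2 * t * k\<close> over an interval of length \<open>R\<close>. If all of them exceeded
  \<open>4 * t * k / R\<close>, their integral would be at least twice that.\<close>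

lemma good_radius:
  fixes g :: "'a::euclidean_space \<Rightarrow> ennreal" and d :: "'a \<Rightarrow> real"
  assumes [measurable]: "g \<in> borel_measurable borel" "d \<in> borel_measurable borel"
    and g: "(\<integral>\<^sup>+x. g x \<partial>lborel) \<le> ennreal k" and "k > 0" "R > 0" "t > 0"
  shows "\<exists>r\<in>{R..2*R}. (\<integral>\<^sup>+x. g x * indicator {x. \<bar>d x - r\<bar> \<le> t} x \<partial>lborel) \<le> ennreal (4 * t * k / R)"
proof (rule ccontr)
  assume "\<not> ?thesis"
  then have gt: "ennreal (4 * t * k / R) \<le> (\<integral>\<^sup>+x. g x * indicator {x. \<bar>d x - r\<bar> \<le> t} x \<partial>lborel)" if "r \<in> {R..2*R}" for r
    using that by (auto simp: not_le less_imp_le)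
  have "ennreal (4 * t * k) = (\<integral>\<^sup>+r. ennreal (4 * t * k / R) * indicator {R..2*R} r \<partial>lborel)"
    using assms by (simp add: nn_integral_cmult_indicator ennreal_mult[symmetric])
  also have "\<dots> \<le> (\<integral>\<^sup>+r. (\<integral>\<^sup>+x. g x * indicator {r. \<bar>d x - r\<bar> \<le> t} r \<partial>lborel) \<partial>lborel)"
  proof (intro nn_integral_mono)
    fix r :: real
    show "ennreal (4 * t * k / R) * indicator {R..2*R} r \<le> (\<integral>\<^sup>+x. g x * indicator {r. \<bar>d x - r\<bar> \<le> t} r \<partial>lborel)"
      using gt[of r] by (auto simp: indicator_def)
  qed
  also have "\<dots> = (\<integral>\<^sup>+x. (\<integral>\<^sup>+r. g x * indicator {r. \<bar>d x - r\<bar> \<le> t} r \<partial>lborel) \<partial>lborel)"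
    by (rule lborel_pair.Fubini') measurable
  also have "\<dots> = (\<integral>\<^sup>+x. g x * ennreal (2 * t) \<partial>lborel)"
  proof (intro nn_integral_cong)
    fix x
    have "{r. \<bar>d x - r\<bar> \<le> t} = {d x - t..d x + t}" by auto
    then show "(\<integral>\<^sup>+r. g x * indicator {r. \<bar>d x - r\<bar> \<le> t} r \<partial>lborel) = g x * ennreal (2 * t)"
      using \<open>t > 0\<close> by (simp add: nn_integral_cmult_indicator)
  qed
  also have "\<dots> = (\<integral>\<^sup>+x. g x \<partial>lborel) * ennreal (2 * t)" by (simp add: nn_integral_multc)
  also have "\<dots> \<le> ennreal k * ennreal (2 * t)" by (rule mult_right_mono[OF g]) simp
  also have "\<dots> = ennreal (2 * t * k)" using assms by (simp add: ennreal_mult[symmetric] ac_simps)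
  finally show False using assms by (simp add: ennreal_le_iff)
qed

section \<open>Cube estimates for the recovery function\<close>

lemma power_card_pred: "\<delta> ^ CARD('n::finite) = \<delta> * \<delta> ^ (CARD('n) - 1)"
proof -
  have "CARD('n) = Suc (CARD('n) - 1)" by (simp add: Suc_diff_1)
  then show ?thesis by (metis power_Suc)
qed

text \<open>The affine model at the centre contributes the sharp factor 1/4. Replacing the gradient
  at the centre by \<open>G x\<close> costs \<open>\<omega> / 4\<close>, and the linearisation error
  adds \<open>2 * sqrt CARD('n) * \<omega>\<close>.\<close>

lemma osc_C1_cube_le:
  fixes w :: "real ^ 'n \<Rightarrow> real"
  assumes T: "orthogonal_transformation T" and "\<delta> > 0" and [measurable]: "w \<in> borel_measurable borel"
    and int: "integrable lborel w"
    and der: "\<And>x. (w has_derivative (\<lambda>h. G x \<bullet> h)) (at x)" and [measurable]: "G \<in> borel_measurable borel"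
    and G: "\<And>x y. x \<in> ocube a T \<delta> \<Longrightarrow> y \<in> ocube a T \<delta> \<Longrightarrow> norm (G x - G y) \<le> \<omega>"
  shows "ennreal (\<delta> ^ (CARD('n) - 1)) * ennreal (osc (ocube a T \<delta>) w)
    \<le> (\<integral>\<^sup>+x\<in>ocube a T \<delta>. (ennreal (1/4) * ennreal (norm (G x)) + ennreal ((1/4 + 2 * sqrt CARD('n)) * \<omega>)) \<partial>lborel)"
proof -
  let ?Q = "ocube a T \<delta>" and ?c = "ctr a T \<delta>" and ?s = "sqrt CARD('n)"
  have cQ: "?c \<in> ?Q" by (rule ctr_in_ocube[OF \<open>\<delta> > 0\<close>])
  have "\<omega> \<ge> 0" using G[OF cQ cQ] by simp
  have [measurable]: "?Q \<in> sets borel" by (rule ocube_borel[OF T])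
  have "osc ?Q w \<le> osc ?Q (\<lambda>x. w ?c + G ?c \<bullet> (x - ?c)) + 2 * (\<omega> * (?s * \<delta>))"
    using osc_C1_affine[OF T \<open>\<delta> > 0\<close>, of w a G "G ?c" \<omega>] G[OF _ cQ] der int
    by (auto simp: abs_le_iff integrable_imp_set_integrable)
  also have "osc ?Q (\<lambda>x. w ?c + G ?c \<bullet> (x - ?c)) \<le> \<delta> / 4 * norm (G ?c)"
    by (rule osc_affine_le[OF T \<open>\<delta> > 0\<close>])
  finally have o: "osc ?Q w \<le> \<delta> * (norm (G ?c) / 4 + 2 * (\<omega> * ?s))" by (simp add: algebra_simps)
  have "ennreal (\<delta> ^ (CARD('n) - 1)) * ennreal (osc ?Q w)
     \<le> ennreal (\<delta> ^ (CARD('n) - 1)) * ennreal (\<delta> * (norm (G ?c) / 4 + 2 * (\<omega> * ?s)))"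
    by (intro mult_left_mono ennreal_leI o) simp
  also have "\<dots> = ennreal (\<delta> ^ (CARD('n) - 1) * (\<delta> * (norm (G ?c) / 4 + 2 * (\<omega> * ?s))))"
    using \<open>\<delta> > 0\<close> \<open>\<omega> \<ge> 0\<close> by (intro ennreal_mult[symmetric]) auto
  also have "\<dots> = ennreal ((norm (G ?c) / 4 + 2 * (\<omega> * ?s)) * \<delta> ^ CARD('n))"
    by (simp add: power_card_pred ac_simps)
  also have "\<dots> = ennreal (norm (G ?c) / 4 + 2 * (\<omega> * ?s)) * ennreal (\<delta> ^ CARD('n))"
    using \<open>\<delta> > 0\<close> \<open>\<omega> \<ge> 0\<close> by (intro ennreal_mult) auto
  also have "\<dots> = (\<integral>\<^sup>+x\<in>?Q. ennreal (norm (G ?c) / 4 + 2 * (\<omega> * ?s)) \<partial>lborel)"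
    using T \<open>\<delta> > 0\<close> by (simp add: nn_integral_cmult_indicator emeasure_ocube)
  also have "\<dots> \<le> (\<integral>\<^sup>+x\<in>?Q. (ennreal (1/4) * ennreal (norm (G x)) + ennreal ((1/4 + 2 * ?s) * \<omega>)) \<partial>lborel)"
  proof (intro nn_integral_mono)
    fix x
    show "ennreal (norm (G ?c) / 4 + 2 * (\<omega> * ?s)) * indicator ?Q x
      \<le> (ennreal (1/4) * ennreal (norm (G x)) + ennreal ((1/4 + 2 * ?s) * \<omega>)) * indicator ?Q x"
    proof (cases "x \<in> ?Q")
      case True
      have "norm (G ?c) \<le> norm (G x) + \<omega>"
        using G[OF cQ True] norm_triangle_sub[of "G ?c" "G x"] by linarith
      then have "norm (G ?c) / 4 + 2 * (\<omega> * ?s) \<le> 1/4 * norm (G x) + (1/4 + 2 * ?s) * \<omega>"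
        by (simp add: algebra_simps)
      then show ?thesis
        using True \<open>\<omega> \<ge> 0\<close> by (simp add: ennreal_mult[symmetric] ennreal_plus[symmetric] ennreal_leI del: ennreal_plus)
    qed simp
  qed
  finally show ?thesis .
qed

text \<open>Where \<open>V\<close> itself is used, the Poincare inequality takes the place of the
  affine model. The factor \<open>2 / \<delta>\<close> is the 2 of \<open>osc_le_osc_plus\<close>
  times the quotient of \<open>\<delta> ^ (CARD('n) - 1)\<close> by the volume of the cube.\<close>

lemma osc_perturbation_le:
  fixes V w :: "real ^ 'n \<Rightarrow> real"
  assumes T: "orthogonal_transformation T" and "\<delta> > 0"
    and V: "integrable lborel V" and w: "integrable lborel w"
  shows "ennreal (\<delta> ^ (CARD('n) - 1)) * ennreal (osc (ocube a T \<delta>) w)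
    \<le> ennreal (poincare_const TYPE('n)) * total_variation (ocube a T \<delta>) V
      + ennreal (2 / \<delta>) * (\<integral>\<^sup>+x\<in>ocube a T \<delta>. ennreal \<bar>w x - V x\<bar> \<partial>lborel)"
proof -
  let ?Q = "ocube a T \<delta>"
  interpret avg_domain ?Q "\<delta> ^ CARD('n)" by (rule avg_domain_ocube[OF T \<open>\<delta> > 0\<close>])
  have [measurable]: "V \<in> borel_measurable borel" "w \<in> borel_measurable borel" using V w by auto
  have i: "set_integrable lborel ?Q w" "set_integrable lborel ?Q V"
    using V w by (auto intro: integrable_imp_set_integrable)
  let ?a = "avg ?Q (\<lambda>x. \<bar>w x - V x\<bar>)" and ?c = "ennreal (\<delta> ^ (CARD('n) - 1))"
  have "osc ?Q w \<le> osc ?Q V + 2 * ?a" by (rule osc_le_osc_plus[OF _ _ i]) measurable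
  then have "?c * ennreal (osc ?Q w) \<le> ?c * (ennreal (osc ?Q V) + ennreal (2 * ?a))"
    by (intro mult_left_mono) (auto simp: ennreal_plus[symmetric] osc_nonneg avg_nonneg ennreal_leI simp del: ennreal_plus)
  also have "\<dots> = ?c * ennreal (osc ?Q V) + ?c * ennreal (2 * ?a)" by (rule distrib_left)
  also have "?c * ennreal (2 * ?a) = ennreal (2 / \<delta>) * (ennreal (\<delta> ^ CARD('n)) * ennreal ?a)"
    using \<open>\<delta> > 0\<close> by (simp add: power_card_pred ennreal_mult[symmetric] avg_nonneg ac_simps)
  also have "ennreal (\<delta> ^ CARD('n)) * ennreal ?a = (\<integral>\<^sup>+x\<in>?Q. ennreal \<bar>w x - V x\<bar> \<partial>lborel)"
    by (rule nn_avg[OF _ set_integrable_abs_minus[OF i]]) auto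
  also have "?c * ennreal (osc ?Q V) + ennreal (2 / \<delta>) * (\<integral>\<^sup>+x\<in>?Q. ennreal \<bar>w x - V x\<bar> \<partial>lborel)
    \<le> ennreal (poincare_const TYPE('n)) * total_variation ?Q V
      + ennreal (2 / \<delta>) * (\<integral>\<^sup>+x\<in>?Q. ennreal \<bar>w x - V x\<bar> \<partial>lborel)"
    by (intro add_right_mono osc_le_TV[OF V T \<open>\<delta> > 0\<close>])
  finally show ?thesis .
qed

lemma poincare_const_pos: "poincare_const TYPE('n::finite) > 0"
  by (simp add: poincare_const_def)

text \<open>
  The recovery function is the mollification of \<open>V\<close> well inside \<open>\<Omega>\<close> and \<open>V\<close> itself near the
  boundary. The interface is placed at a distance where the jump costs little, and near the
  boundary the Poincare inequality with a non-sharp constant suffices, since the total variation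
  of \<open>V\<close> there is small.
\<close>

lemma K_recovery:
  fixes V :: "real ^ 'n \<Rightarrow> real"
  assumes \<Omega>: "open \<Omega>" "bounded \<Omega>" and V: "integrable lborel V" and fin: "total_variation \<Omega> V < \<infinity>" and "\<kappa> > 0"
  shows "\<exists>d>0. \<forall>\<delta>. 0 < \<delta> \<longrightarrow> \<delta> < d \<longrightarrow> (\<exists>w. integrable lborel w \<and>
    K \<delta> \<Omega> w \<le> total_variation \<Omega> V / 4 + ennreal \<kappa> \<and> (\<integral>\<^sup>+x. ennreal \<bar>w x - V x\<bar> \<partial>lborel) \<le> ennreal \<kappa>)"
proof -
  have [measurable]: "V \<in> borel_measurable borel" using V by auto
  let ?d = "\<lambda>x. infdist x (- \<Omega>)" and ?s = "sqrt CARD('n)" and ?P = "poincare_const TYPE('n)"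
  have s: "?s > 0" by simp
  have P: "?P > 0" by (rule poincare_const_pos)
  have ne: "- \<Omega> \<noteq> {}" using compl_bounded_nonempty \<Omega> by auto
  have [measurable]: "?d \<in> borel_measurable borel" by (intro borel_measurable_continuous_onI continuous_intros)
  have "\<kappa> / 4 / ?P > 0" using \<open>\<kappa> > 0\<close> P by simp
  from TV_layer[OF \<Omega> V fin this] obtain R0 where R0: "R0 > 0"
    "total_variation {x \<in> \<Omega>. ?d x < R0} V \<le> ennreal (\<kappa> / 4 / ?P)" by blast
  \<comment> \<open>The interface will lie at distance at most \<open>2 * R\<close> and the cubes
    have diameter below \<open>R\<close>, so cubes that reach across it stay within distance
    \<open>R0\<close> of the complement.\<close>
  define R where "R = R0 / 4"
  have R: "R > 0" using R0 by (simp add: R_def)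
  let ?L = "{x \<in> \<Omega>. ?d x < R0}"
  have oL: "open ?L" by (rule open_layer(1)[OF \<Omega>(1)])
  \<comment> \<open>The second entry makes the cost of the interface,
    \<open>8 * ?s * k2 / R\<close>, at most \<open>\<kappa> / 4\<close>.\<close>
  define k2 where "k2 = min \<kappa> (\<kappa> * R / (32 * ?s))"
  have k2: "k2 > 0" "k2 \<le> \<kappa>" "k2 \<le> \<kappa> * R / (32 * ?s)" using \<open>\<kappa> > 0\<close> R s by (auto simp: k2_def)
  obtain d1 where d1: "d1 > 0" "\<And>\<eta>. 0 < \<eta> \<Longrightarrow> \<eta> < d1 \<Longrightarrow> (\<integral>\<^sup>+x. ennreal \<bar>cnv (mol \<eta>) V x - V x\<bar> \<partial>lborel) \<le> ennreal k2"
    using cnv_mol_L1[OF V k2(1)] by blast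
  define \<eta> where "\<eta> = min d1 R / 2"
  have \<eta>: "\<eta> > 0" "\<eta> < d1" "\<eta> < R" using d1 R by (auto simp: \<eta>_def)
  define v where "v = cnv (mol \<eta>) V"
  define G where "G = grd \<eta> V"
  have [measurable]: "v \<in> borel_measurable borel" unfolding v_def by (rule cnv_mol_borel[OF \<eta>(1) V])
  have Gc: "continuous_on UNIV G" unfolding G_def by (rule grd_continuous[OF \<eta>(1) V])
  have [measurable]: "G \<in> borel_measurable borel" by (rule borel_measurable_continuous_onI[OF Gc])
  have der: "(v has_derivative (\<lambda>h. G x \<bullet> h)) (at x)" for x
    unfolding v_def G_def by (rule cnv_mol_derivative[OF \<eta>(1) V])
  have vV: "(\<integral>\<^sup>+x. ennreal \<bar>v x - V x\<bar> \<partial>lborel) \<le> ennreal k2"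
    unfolding v_def by (rule d1(2)[OF \<eta>(1,2)])
  have ivV: "integrable lborel (\<lambda>x. v x - V x)"
    using le_less_trans[OF vV ennreal_less_top] by (intro integrableI_bounded) auto
  have iv: "integrable lborel v" using Bochner_Integration.integrable_add[OF ivV V] by simp
  define S where "S = {x. R \<le> ?d x}"
  have [measurable]: "S \<in> sets borel" unfolding S_def by measurable
  have S\<Omega>: "S \<subseteq> \<Omega>"
  proof
    fix x assume "x \<in> S"
    then have "ball x R \<subseteq> \<Omega>" by (intro infdist_ball_subset) (simp add: S_def)
    then show "x \<in> \<Omega>" using R by auto
  qed
  have SG: "(\<integral>\<^sup>+x\<in>S. ennreal (norm (G x)) \<partial>lborel) \<le> total_variation \<Omega> V"
    unfolding G_def using infdist_ball_subset[of R _ \<Omega>]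
    by (intro nn_integral_grd_le_TV[OF \<eta>(1,3) V \<Omega>(1)] bounded_subset[OF \<Omega>(2) S\<Omega>]) (auto simp: S_def)
  define m where "m = measure lborel \<Omega>"
  have [measurable]: "\<Omega> \<in> sets borel" using \<Omega> by simp
  have em: "emeasure lborel \<Omega> = ennreal m"
    using emeasure_bounded_finite[OF \<Omega>(2)] by (simp add: m_def emeasure_eq_ennreal_measure)
  have m0: "m \<ge> 0" by (simp add: m_def)
  \<comment> \<open>Chosen so that the gradient error, integrated over \<Omega>, is at most
    \<open>\<kappa> / 4\<close>; \<open>m + 1\<close> avoids division by 0.\<close>
  define \<omega> where "\<omega> = \<kappa> / 4 / ((1/4 + 2 * ?s) * (m + 1))"
  have \<omega>: "\<omega> > 0" unfolding \<omega>_def using \<open>\<kappa> > 0\<close> m0 s by (intro divide_pos_pos mult_pos_pos add_pos_pos add_nonneg_pos) auto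
  have \<omega>m: "((1/4 + 2 * ?s) * \<omega>) * m \<le> \<kappa> / 4"
  proof -
    have c: "(1/4 + 2 * ?s) > 0" using s by (intro add_pos_pos) auto
    have "((1/4 + 2 * ?s) * \<omega>) * m = \<kappa> / 4 * (m / (m + 1))" 
    proof -
      have "(c * (x / (c * y))) * z = x * (z / y)" if "c \<noteq> 0" for c x y z :: real using that by simp
      from this[of "1/4 + 2 * ?s" "\<kappa> / 4" "m + 1" m] show ?thesis unfolding \<omega>_def using c by simp
    qed
    also have "\<dots> \<le> \<kappa> / 4 * 1" using \<open>\<kappa> > 0\<close> m0 by (intro mult_left_mono) auto
    finally show ?thesis by simp
  qed
  have "uniformly_continuous_on (closure \<Omega>) G"
    using \<Omega>(2) by (intro compact_uniformly_continuous continuous_on_subset[OF Gc]) (auto simp: compact_eq_bounded_closed bounded_closure)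
  then obtain \<rho> where \<rho>: "\<rho> > 0" "\<And>x y. x \<in> closure \<Omega> \<Longrightarrow> y \<in> closure \<Omega> \<Longrightarrow> dist x y < \<rho> \<Longrightarrow> dist (G x) (G y) < \<omega>"
    using \<omega> unfolding uniformly_continuous_on_def by metis
  \<comment> \<open>Cubes of side below \<open>d\<close> have diameter below \<rho>, so
    \<open>G\<close> varies by less than \<omega> on them, and below \<open>R\<close>.\<close>
  define d where "d = min \<rho> R / ?s"
  have "d > 0" using \<rho> R s by (simp add: d_def)
  show ?thesis
  proof (intro exI[of _ d] conjI allI impI \<open>d > 0\<close>)
    fix \<delta> assume \<delta>: "0 < \<delta>" "\<delta> < d"
    have sd: "?s * \<delta> < \<rho>" "?s * \<delta> < R" "?s * \<delta> > 0"
      using \<delta> s by (auto simp: d_def pos_less_divide_eq mult.commute)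
    \<comment> \<open>The shell has half width \<open>?s * \<delta>\<close>, the diameter bound of
      the cubes, so it catches every place where a cube crossing the interface sees \<open>v\<close>
      instead of \<open>V\<close>.\<close>
    obtain r where r: "R \<le> r" "r \<le> 2 * R"
      and rg: "(\<integral>\<^sup>+x. ennreal \<bar>v x - V x\<bar> * indicator {x. \<bar>?d x - r\<bar> \<le> ?s * \<delta>} x \<partial>lborel) \<le> ennreal (4 * (?s * \<delta>) * k2 / R)"
      using good_radius[of "\<lambda>x. ennreal \<bar>v x - V x\<bar>" ?d k2 R "?s * \<delta>"] vV k2(1) R sd(3) by auto
    define w where "w x = (if r < ?d x then v x else V x)" for x
    have [measurable]: "w \<in> borel_measurable borel" unfolding w_def by measurable
    have wV: "\<bar>w x - V x\<bar> \<le> \<bar>v x - V x\<bar>" for x by (simp add: w_def)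
    have "integrable lborel (\<lambda>x. w x - V x)"
      by (rule Bochner_Integration.integrable_bound[OF ivV]) (use wV in auto)
    from Bochner_Integration.integrable_add[OF this V] have iw: "integrable lborel w" by simp
    have "(\<integral>\<^sup>+x. ennreal \<bar>w x - V x\<bar> \<partial>lborel) \<le> (\<integral>\<^sup>+x. ennreal \<bar>v x - V x\<bar> \<partial>lborel)"
      by (intro nn_integral_mono ennreal_leI wV)
    also have "\<dots> \<le> ennreal \<kappa>" using vV k2(2) by (auto intro: order_trans ennreal_leI)
    finally have L1: "(\<integral>\<^sup>+x. ennreal \<bar>w x - V x\<bar> \<partial>lborel) \<le> ennreal \<kappa>" .
    let ?f = "\<lambda>x. ennreal (1/4) * ennreal (norm (G x)) + ennreal ((1/4 + 2 * ?s) * \<omega>)"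
    let ?g = "\<lambda>x. ennreal \<bar>v x - V x\<bar> * indicator {x. \<bar>?d x - r\<bar> \<le> ?s * \<delta>} x"
    have "K \<delta> \<Omega> w \<le> total_variation \<Omega> V / 4 + ennreal \<kappa>"
    proof (rule K_le)
      fix \<G> assume \<G>: "finite \<G>" "\<G> \<in> cube_families \<delta> \<Omega>"
      have sub: "Q \<subseteq> \<Omega>" if "Q \<in> \<G>" for Q using that \<G>(2) by (auto simp: cube_families_def)
      have disj: "Q \<inter> Q' = {}" if "Q \<in> \<G>" "Q' \<in> \<G>" "Q \<noteq> Q'" for Q Q'
        using that \<G>(2) by (auto simp: cube_families_def pairwise_def disjnt_def)
      have cube: "\<exists>a T. Q = ocube a T \<delta> \<and> orthogonal_transformation T" if "Q \<in> \<G>" for Q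
        using that \<G>(2) by (auto simp: cube_families_def cubes_ocube)
      have bor: "Q \<in> sets borel" and op: "open Q" if "Q \<in> \<G>" for Q
        using cube[OF that] ocube_borel open_ocube by auto
      \<comment> \<open>On these cubes \<open>w\<close> is the smooth function \<open>v\<close>, and
        the sharp estimate applies. All other cubes lie in the boundary layer.\<close>
      define \<A> where "\<A> = {Q \<in> \<G>. Q \<subseteq> {x. r < ?d x}}"
      define \<B> where "\<B> = \<G> - \<A>"
      have AB: "\<G> = \<A> \<union> \<B>" "\<A> \<inter> \<B> = {}" "finite \<A>" "finite \<B>" "\<A> \<subseteq> \<G>" "\<B> \<subseteq> \<G>"
        using \<G>(1) by (auto simp: \<A>_def \<B>_def)
      let ?c = "ennreal (\<delta> ^ (CARD('n) - 1))"
      have A: "?c * ennreal (osc Q w) \<le> (\<integral>\<^sup>+x\<in>Q. ?f x \<partial>lborel)" if "Q \<in> \<A>" for Q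
      proof -
        have QG: "Q \<in> \<G>" using that AB by auto
        obtain a T where Q: "Q = ocube a T \<delta>" and T: "orthogonal_transformation T" using cube[OF QG] by blast
        have "osc Q w = osc Q v"
        proof -
          have wv: "w x = v x" if "x \<in> Q" for x using that \<open>Q \<in> \<A>\<close> by (auto simp: \<A>_def w_def)
          have cong: "avg Q f = avg Q g" if "\<And>x. x \<in> Q \<Longrightarrow> f x = g x" for f g
            unfolding avg_def set_lebesgue_integral_def
            using that by (intro arg_cong2[of _ _ _ _ "(/)"] Bochner_Integration.integral_cong refl) (auto simp: indicator_def)
          have "avg Q w = avg Q v" by (rule cong) (rule wv)
          then show ?thesis unfolding osc_def by (intro cong) (simp add: wv)
        qed
        moreover have "norm (G x - G y) \<le> \<omega>" if "x \<in> Q" "y \<in> Q" for x y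
          using \<rho>(2)[of x y] sub[OF QG] that closure_subset[of \<Omega>] ocube_diam[OF T, of x a \<delta> y] sd(1)
          by (force simp: Q dist_norm)
        ultimately show ?thesis
          unfolding Q using osc_C1_cube_le[OF T \<delta>(1), of v G a \<omega>] iv der by (simp add: Q)
      qed
      have B: "?c * ennreal (osc Q w) \<le> ennreal ?P * total_variation Q V + ennreal (2 / \<delta>) * (\<integral>\<^sup>+x\<in>Q. ?g x \<partial>lborel)"
        and BL: "Q \<subseteq> ?L" if "Q \<in> \<B>" for Q
      proof -
        have QG: "Q \<in> \<G>" using that AB by auto
        obtain a T where Q: "Q = ocube a T \<delta>" and T: "orthogonal_transformation T" using cube[OF QG] by blast
        have "\<not> Q \<subseteq> {x. r < ?d x}" using that QG by (auto simp: \<B>_def \<A>_def)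
        then obtain x0 where x0: "x0 \<in> Q" "?d x0 \<le> r" by (force simp: not_less)
        have near: "?d x \<le> r + ?s * \<delta>" if "x \<in> Q" for x
          using infdist_lipschitz[of x "- \<Omega>" x0] ocube_diam[OF T, of x a \<delta> x0] that x0 by (auto simp: Q)
        show "Q \<subseteq> ?L"
        proof
          fix x assume "x \<in> Q"
          then show "x \<in> ?L" using near[of x] sub[OF QG] r sd(2) by (auto simp: R_def)
        qed
        \<comment> \<open>On a cube that is not in \<open>\<A>\<close>, \<open>w\<close> differs
          from \<open>V\<close> only beyond distance \<open>r\<close>, and no point of the cube is
          farther than \<open>r + ?s * \<delta>\<close>; so the difference lives in the
          shell.\<close>
        have "(\<integral>\<^sup>+x\<in>Q. ennreal \<bar>w x - V x\<bar> \<partial>lborel) \<le> (\<integral>\<^sup>+x\<in>Q. ?g x \<partial>lborel)"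
        proof (intro nn_integral_mono)
          fix x
          show "ennreal \<bar>w x - V x\<bar> * indicator Q x \<le> ?g x * indicator Q x"
            using near[of x] sd(3) by (auto simp: w_def indicator_def)
        qed
        then show "?c * ennreal (osc Q w) \<le> ennreal ?P * total_variation Q V + ennreal (2 / \<delta>) * (\<integral>\<^sup>+x\<in>Q. ?g x \<partial>lborel)"
          using osc_perturbation_le[OF T \<delta>(1) V iw, of a] unfolding Q
          by (elim order_trans) (intro add_left_mono mult_left_mono, auto)
      qed
      have "?c * (\<Sum>Q\<in>\<G>. ennreal (osc Q w)) = (\<Sum>Q\<in>\<A>. ?c * ennreal (osc Q w)) + (\<Sum>Q\<in>\<B>. ?c * ennreal (osc Q w))"
        using AB by (simp add: sum_distrib_left sum.union_disjoint distrib_left)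
      also have "\<dots> \<le> (\<Sum>Q\<in>\<A>. \<integral>\<^sup>+x\<in>Q. ?f x \<partial>lborel)
         + (\<Sum>Q\<in>\<B>. ennreal ?P * total_variation Q V + ennreal (2 / \<delta>) * (\<integral>\<^sup>+x\<in>Q. ?g x \<partial>lborel))"
        by (intro add_mono sum_mono A B)
      also have "(\<Sum>Q\<in>\<A>. \<integral>\<^sup>+x\<in>Q. ?f x \<partial>lborel) \<le> (\<integral>\<^sup>+x\<in>S. ?f x \<partial>lborel)"
      proof (rule sum_nn_integral_disjoint_le)
        show "Q \<in> sets borel" if "Q \<in> \<A>" for Q using that AB bor by auto
        show "Q \<subseteq> S" if "Q \<in> \<A>" for Q using that r by (force simp: \<A>_def S_def)
        show "Q \<inter> Q' = {}" if "Q \<in> \<A>" "Q' \<in> \<A>" "Q \<noteq> Q'" for Q Q' using that AB disj by blast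
      qed (use AB in auto)
      also have "(\<integral>\<^sup>+x\<in>S. ?f x \<partial>lborel) = (\<integral>\<^sup>+x. ennreal (1/4) * (ennreal (norm (G x)) * indicator S x)
          + ennreal ((1/4 + 2 * ?s) * \<omega>) * indicator S x \<partial>lborel)"
        by (intro nn_integral_cong) (simp add: distrib_right mult.assoc)
      also have "\<dots> = ennreal (1/4) * (\<integral>\<^sup>+x\<in>S. ennreal (norm (G x)) \<partial>lborel) + ennreal ((1/4 + 2 * ?s) * \<omega>) * emeasure lborel S"
        by (subst nn_integral_add) (auto simp: nn_integral_cmult nn_integral_cmult_indicator)
      also have "\<dots> \<le> ennreal (1/4) * total_variation \<Omega> V + ennreal (\<kappa> / 4)"
      proof (intro add_mono mult_left_mono SG)
        have "ennreal ((1/4 + 2 * ?s) * \<omega>) * emeasure lborel S \<le> ennreal ((1/4 + 2 * ?s) * \<omega>) * ennreal m"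
          unfolding em[symmetric] by (intro mult_left_mono emeasure_mono S\<Omega>) auto
        also have "\<dots> = ennreal (((1/4 + 2 * ?s) * \<omega>) * m)"
          using m0 \<omega> s by (intro ennreal_mult[symmetric] mult_nonneg_nonneg add_nonneg_nonneg) auto
        also have "\<dots> \<le> ennreal (\<kappa> / 4)" by (rule ennreal_leI[OF \<omega>m])
        finally show "ennreal ((1/4 + 2 * ?s) * \<omega>) * emeasure lborel S \<le> ennreal (\<kappa> / 4)" .
      qed simp
      also have "(\<Sum>Q\<in>\<B>. ennreal ?P * total_variation Q V + ennreal (2 / \<delta>) * (\<integral>\<^sup>+x\<in>Q. ?g x \<partial>lborel))
        = ennreal ?P * (\<Sum>Q\<in>\<B>. total_variation Q V) + ennreal (2 / \<delta>) * (\<Sum>Q\<in>\<B>. \<integral>\<^sup>+x\<in>Q. ?g x \<partial>lborel)"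
        by (simp add: sum.distrib sum_distrib_left)
      also have "\<dots> \<le> ennreal ?P * ennreal (\<kappa> / 4 / ?P) + ennreal (2 / \<delta>) * ennreal (4 * (?s * \<delta>) * k2 / R)"
      proof (intro add_mono mult_left_mono)
        have "(\<Sum>Q\<in>\<B>. total_variation Q V) \<le> total_variation ?L V"
          by (rule TV_superadditive[OF AB(4) _ BL oL _ V]) (use AB op disj in auto)
        then show "(\<Sum>Q\<in>\<B>. total_variation Q V) \<le> ennreal (\<kappa> / 4 / ?P)" using R0(2) by (rule order_trans)
        have "(\<Sum>Q\<in>\<B>. \<integral>\<^sup>+x\<in>Q. ?g x \<partial>lborel) \<le> (\<integral>\<^sup>+x\<in>UNIV. ?g x \<partial>lborel)"
          by (rule sum_nn_integral_disjoint_le[OF AB(4)]) (use AB bor disj in auto)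
        then show "(\<Sum>Q\<in>\<B>. \<integral>\<^sup>+x\<in>Q. ?g x \<partial>lborel) \<le> ennreal (4 * (?s * \<delta>) * k2 / R)"
          using rg by simp
      qed auto
      also have "ennreal ?P * ennreal (\<kappa> / 4 / ?P) = ennreal (\<kappa> / 4)"
        using P \<open>\<kappa> > 0\<close> by (simp add: ennreal_mult[symmetric])
      also have "ennreal (2 / \<delta>) * ennreal (4 * (?s * \<delta>) * k2 / R) = ennreal (8 * ?s * k2 / R)"
        using \<delta> R k2 by (simp add: ennreal_mult[symmetric])
      also have "\<dots> \<le> ennreal (\<kappa> / 4)"
      proof (rule ennreal_leI)
        have "8 * ?s * k2 \<le> 8 * ?s * (\<kappa> * R / (32 * ?s))" using k2(3) s by (intro mult_left_mono) auto
        also have "\<dots> = \<kappa> / 4 * R" using s by simp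
        finally show "8 * ?s * k2 / R \<le> \<kappa> / 4" using R by (simp add: divide_le_eq)
      qed
      \<comment> \<open>Three errors of \<open>\<kappa> / 4\<close>: the variation of
        \<open>G\<close> on inner cubes, the total variation of the layer, and the
        interface.\<close>
      finally have "?c * (\<Sum>Q\<in>\<G>. ennreal (osc Q w))
        \<le> ennreal (1/4) * total_variation \<Omega> V + ennreal (\<kappa> / 4) + (ennreal (\<kappa> / 4) + ennreal (\<kappa> / 4))"
        by (simp add: add_mono)
      also have "\<dots> = ennreal (1/4) * total_variation \<Omega> V + ennreal (\<kappa> * 3 / 4)"
        using \<open>\<kappa> > 0\<close> by (simp add: ennreal_plus[symmetric] add.assoc del: ennreal_plus)
      also have "\<dots> \<le> ennreal (1/4) * total_variation \<Omega> V + ennreal \<kappa>"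
        using \<open>\<kappa> > 0\<close> by (intro add_left_mono ennreal_leI) auto
      also have "ennreal (1/4) * total_variation \<Omega> V = total_variation \<Omega> V / 4"
        using fin by (cases "total_variation \<Omega> V") (simp_all add: ennreal_mult[symmetric] ennreal_divide_numeral)
      finally show "?c * (\<Sum>Q\<in>\<G>. ennreal (osc Q w)) \<le> total_variation \<Omega> V / 4 + ennreal \<kappa>" .
    qed
    then show "\<exists>w. integrable lborel w \<and> K \<delta> \<Omega> w \<le> total_variation \<Omega> V / 4 + ennreal \<kappa> \<and>
        (\<integral>\<^sup>+x. ennreal \<bar>w x - V x\<bar> \<partial>lborel) \<le> ennreal \<kappa>"
      using iw L1 by blast
  qed
qed

section \<open>Compactness\<close>

lemma ocube_id_iff: "x \<in> ocube y (\<lambda>v. v) \<delta> \<longleftrightarrow> x - y \<in> box 0 (\<chi> i. \<delta>)"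
  using ocube_iff[of "\<lambda>v. v" y "x - y" \<delta>] by (simp add: orthogonal_transformation_id[unfolded id_def])

lemma orth_id: "orthogonal_transformation (\<lambda>v. v)"
  using orthogonal_transformation_id by (simp add: id_def)

text \<open>A cube with corner \<open>y\<close> contains both \<open>x\<close> and
  \<open>h + x\<close> for a box of positions \<open>y\<close> whose sides are \<delta> minus the
  components of \<open>h\<close> in absolute value, hence at least
  \<open>\<delta> / 2\<close>.\<close>

lemma nn_integral_common_cubes_ge:
  fixes h x :: "real ^ 'n"
  assumes "\<delta> > 0" and h: "\<And>i. \<bar>h $ i\<bar> \<le> \<delta> / 2"
  defines "B \<equiv> box 0 (\<chi> i. \<delta>) :: (real ^ 'n) set"
  shows "ennreal ((\<delta> / 2) ^ CARD('n)) \<le> (\<integral>\<^sup>+y. indicator B (x - y) * indicator B (h + x - y) \<partial>lborel)"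
proof -
  \<comment> \<open>Shifts the small cube upwards in the directions in which \<open>h\<close> points
    down, so that \<open>h + p\<close> stays positive.\<close>
  define m where "m = ((\<chi> i. max 0 (- h $ i)) :: real ^ 'n)"
  let ?C = "ocube m (\<lambda>v. v) (\<delta> / 2)"
  have [measurable]: "B \<in> sets borel" by (simp add: B_def)
  have sub: "p \<in> B \<and> h + p \<in> B" if "p \<in> ?C" for p
  proof -
    have "0 < p $ i - max 0 (- h $ i) \<and> p $ i - max 0 (- h $ i) < \<delta> / 2" for i
      using that by (simp add: ocube_id_iff mem_box_cube m_def)
    then have "0 < p $ i \<and> p $ i < \<delta> \<and> 0 < h $ i + p $ i \<and> h $ i + p $ i < \<delta>" for i
      using h[of i] by (smt (verit) field_sum_of_halves)
    then show ?thesis by (simp add: B_def mem_box_cube)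
  qed
  have "ennreal ((\<delta> / 2) ^ CARD('n)) = emeasure lborel ?C"
    using \<open>\<delta> > 0\<close> by (simp add: emeasure_ocube[OF orth_id])
  also have "\<dots> = (\<integral>\<^sup>+p. indicator ?C p \<partial>lborel)" using ocube_borel[OF orth_id, of m "\<delta> / 2"] by simp
  also have "\<dots> \<le> (\<integral>\<^sup>+p. indicator B p * indicator B (h + p) \<partial>lborel)"
    using sub by (intro nn_integral_mono) (auto simp: indicator_def)
  also have "\<dots> = (\<integral>\<^sup>+y. indicator B (x - y) * indicator B (h + (x - y)) \<partial>lborel)"
    using nn_integral_lborel_reflect[of "\<lambda>p. indicator B p * indicator B (h + p)" x] by simp
  finally show ?thesis by (simp add: add_diff_eq)
qed

text \<open>\<open>shift_le_osc\<close> is integrated over all positions of the cube. On the left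
  each \<open>x\<close> is counted with weight at least \<open>(\<delta> / 2) ^ CARD('n)\<close>; on
  the right stands the oscillation averaged over positions, which
  \<open>nn_integral_osc_le_K\<close> bounds.\<close>

lemma shift_small_le_K:
  fixes U :: "real ^ 'n \<Rightarrow> real"
  assumes U: "integrable lborel U" and "\<delta> > 0" and h: "\<And>i. \<bar>h $ i\<bar> \<le> \<delta> / 2"
    and [measurable]: "S \<in> sets borel" and S: "\<And>x. x \<in> S \<Longrightarrow> ball x (2 * (sqrt CARD('n) * \<delta>)) \<subseteq> A"
  shows "(\<integral>\<^sup>+x\<in>S. ennreal \<bar>U (h + x) - U x\<bar> \<partial>lborel) \<le> ennreal (2 ^ (CARD('n) + 1) * \<delta>) * K \<delta> A U"
proof -
  have [measurable]: "U \<in> borel_measurable borel" using U by auto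
  define B where "B = (box 0 (\<chi> i. \<delta>) :: (real ^ 'n) set)"
  have [measurable]: "B \<in> sets borel" by (simp add: B_def)
  let ?T = "\<lambda>v::real^'n. v"
  let ?Q = "\<lambda>y. ocube y ?T \<delta>"
  have QB: "indicator (?Q y) x = (indicator B (x - y) :: ennreal)" for x y
    by (simp add: indicator_def ocube_id_iff B_def)
  \<comment> \<open>The corners whose cube contains both ends of a shift starting in
    \<open>S\<close>. As a union of open sets, \<open>Y\<close> is open and hence
    measurable.\<close>
  define Y where "Y = (\<Union>x\<in>S. (\<lambda>y. x - y) -` B \<inter> (\<lambda>y. h + x - y) -` B)"
  have "open Y" unfolding Y_def B_def
    by (intro open_UN ballI open_Int open_vimage) (auto intro!: continuous_intros)
  then have [measurable]: "Y \<in> sets borel" by simp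
  have YA: "?Q y \<subseteq> A" if yY: "y \<in> Y" for y
  proof -
    obtain x where x: "x \<in> S" "x \<in> ?Q y" using yY by (auto simp: Y_def B_def ocube_id_iff)
    show ?thesis
    proof
      fix z assume "z \<in> ?Q y"
      then have "norm (z - x) \<le> sqrt CARD('n) * \<delta>" using x by (intro ocube_diam[OF orth_id])
      moreover have "sqrt CARD('n) * \<delta> > 0" using \<open>\<delta> > 0\<close> by simp
      ultimately have "z \<in> ball x (2 * (sqrt CARD('n) * \<delta>))" by (simp add: dist_norm norm_minus_commute)
      then show "z \<in> A" using S[OF x(1)] by blast
    qed
  qed
  let ?f = "\<lambda>x. ennreal \<bar>U (h + x) - U x\<bar>"
  have "ennreal ((\<delta> / 2) ^ CARD('n)) * (\<integral>\<^sup>+x\<in>S. ?f x \<partial>lborel)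
    = (\<integral>\<^sup>+x. (?f x * indicator S x) * ennreal ((\<delta> / 2) ^ CARD('n)) \<partial>lborel)"
    by (subst nn_integral_multc) (auto simp: mult.commute)
  also have "\<dots> \<le> (\<integral>\<^sup>+x. (?f x * indicator S x) * (\<integral>\<^sup>+y. indicator B (x - y) * indicator B (h + x - y) \<partial>lborel) \<partial>lborel)"
    unfolding B_def by (intro nn_integral_mono mult_left_mono nn_integral_common_cubes_ge h \<open>\<delta> > 0\<close>) auto
  also have "\<dots> = (\<integral>\<^sup>+x. (\<integral>\<^sup>+y. (?f x * indicator S x) * (indicator B (x - y) * indicator B (h + x - y)) \<partial>lborel) \<partial>lborel)"
    by (subst nn_integral_cmult) auto
  also have "\<dots> = (\<integral>\<^sup>+y. (\<integral>\<^sup>+x. (?f x * indicator S x) * (indicator B (x - y) * indicator B (h + x - y)) \<partial>lborel) \<partial>lborel)"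
    by (rule lborel_pair.Fubini') measurable
  also have "\<dots> \<le> (\<integral>\<^sup>+y. (2 * ennreal (\<delta> ^ CARD('n))) * (ennreal (osc (?Q y) U) * indicator Y y) \<partial>lborel)"
  proof (intro nn_integral_mono)
    fix y :: "real ^ 'n"
    interpret avg_domain "?Q y" "\<delta> ^ CARD('n)" by (rule avg_domain_ocube[OF orth_id \<open>\<delta> > 0\<close>])
    show "(\<integral>\<^sup>+x. (?f x * indicator S x) * (indicator B (x - y) * indicator B (h + x - y)) \<partial>lborel)
      \<le> (2 * ennreal (\<delta> ^ CARD('n))) * (ennreal (osc (?Q y) U) * indicator Y y)"
    proof (cases "y \<in> Y")
      case True
      have "(\<integral>\<^sup>+x. (?f x * indicator S x) * (indicator B (x - y) * indicator B (h + x - y)) \<partial>lborel)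
        \<le> (\<integral>\<^sup>+x. ?f x * (indicator (?Q y) x * indicator (?Q y) (h + x)) \<partial>lborel)"
        unfolding QB by (intro nn_integral_mono) (auto simp: indicator_def)
      also have "\<dots> \<le> 2 * (ennreal (\<delta> ^ CARD('n)) * ennreal (osc (?Q y) U))"
        by (rule shift_le_osc) (use U in \<open>auto intro: integrable_imp_set_integrable\<close>)
      finally show ?thesis using True by (simp add: mult.assoc)
    next
      case False
      then have z: "(?f x * indicator S x) * (indicator B (x - y) * indicator B (h + x - y)) = 0" for x
        by (auto simp: Y_def indicator_def)
      show ?thesis by (simp only: z) simp
    qed
  qed
  also have "\<dots> = (2 * ennreal (\<delta> ^ CARD('n))) * (\<integral>\<^sup>+y\<in>Y. ennreal (osc (?Q y) U) \<partial>lborel)"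
  proof -
    have [measurable]: "(\<lambda>y. osc (?Q y) U) \<in> borel_measurable borel"
      by (rule borel_measurable_osc[OF orth_id _ \<open>\<delta> > 0\<close>]) measurable
    show ?thesis by (rule nn_integral_cmult) measurable
  qed
  also have "\<dots> \<le> (2 * ennreal (\<delta> ^ CARD('n))) * (ennreal \<delta> * K \<delta> A U)"
    by (intro mult_left_mono nn_integral_osc_le_K orth_id \<open>\<delta> > 0\<close> YA) auto
  also have "\<dots> = ennreal ((\<delta> / 2) ^ CARD('n)) * (ennreal (2 ^ (CARD('n) + 1) * \<delta>) * K \<delta> A U)"
  proof -
    have "2 * \<delta> ^ CARD('n) * \<delta> = (\<delta> / 2) ^ CARD('n) * (2 ^ (CARD('n) + 1) * \<delta>)"
      by (simp add: power_divide)
    then have "ennreal (2 * \<delta> ^ CARD('n) * \<delta>) = ennreal ((\<delta> / 2) ^ CARD('n)) * ennreal (2 ^ (CARD('n) + 1) * \<delta>)"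
      using \<open>\<delta> > 0\<close> by (simp only:) (intro ennreal_mult, auto)
    moreover have "ennreal (2 * \<delta> ^ CARD('n) * \<delta>) = 2 * ennreal (\<delta> ^ CARD('n)) * ennreal \<delta>"
      using \<open>\<delta> > 0\<close> by (simp add: ennreal_mult)
    ultimately show ?thesis by (simp only: mult.assoc[symmetric])
  qed
  finally show ?thesis
    using \<open>\<delta> > 0\<close> by (subst (asm) ennreal_mult_le_mult_iff) auto
qed

text \<open>Telescoping along \<open>N\<close> equal steps. The step with number \<open>j\<close>
  starts in the translate of \<open>S\<close> by \<open>real j *\<^sub>R h\<close>, hence the
  preimages in the hypothesis.\<close>

lemma shift_multiple_le:
  fixes U :: "'a::euclidean_space \<Rightarrow> real" and h :: 'a
  assumes [measurable]: "U \<in> borel_measurable borel" "S \<in> sets borel"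
    and C: "\<And>j. j < N \<Longrightarrow> (\<integral>\<^sup>+x\<in>(\<lambda>x. x - real j *\<^sub>R h) -` S. ennreal \<bar>U (h + x) - U x\<bar> \<partial>lborel) \<le> C"
  shows "(\<integral>\<^sup>+x\<in>S. ennreal \<bar>U (real N *\<^sub>R h + x) - U x\<bar> \<partial>lborel) \<le> of_nat N * C"
  using C
proof (induction N)
  case (Suc N)
  let ?k = "real N *\<^sub>R h"
  have "(\<integral>\<^sup>+x\<in>S. ennreal \<bar>U (real (Suc N) *\<^sub>R h + x) - U x\<bar> \<partial>lborel)
     \<le> (\<integral>\<^sup>+x. ennreal \<bar>U (h + (?k + x)) - U (?k + x)\<bar> * indicator S x + ennreal \<bar>U (?k + x) - U x\<bar> * indicator S x \<partial>lborel)"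
  proof (intro nn_integral_mono)
    fix x
    have "real (Suc N) *\<^sub>R h + x = h + (?k + x)" by (simp add: algebra_simps)
    then show "ennreal \<bar>U (real (Suc N) *\<^sub>R h + x) - U x\<bar> * indicator S x
      \<le> ennreal \<bar>U (h + (?k + x)) - U (?k + x)\<bar> * indicator S x + ennreal \<bar>U (?k + x) - U x\<bar> * indicator S x"
      by (auto simp: indicator_def add.assoc ennreal_plus[symmetric] simp del: ennreal_plus intro!: ennreal_leI)
  qed
  also have "\<dots> = (\<integral>\<^sup>+x. ennreal \<bar>U (h + (?k + x)) - U (?k + x)\<bar> * indicator S x \<partial>lborel)
      + (\<integral>\<^sup>+x\<in>S. ennreal \<bar>U (?k + x) - U x\<bar> \<partial>lborel)"
    by (rule nn_integral_add) measurable
  also have "(\<integral>\<^sup>+x. ennreal \<bar>U (h + (?k + x)) - U (?k + x)\<bar> * indicator S x \<partial>lborel)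
    = (\<integral>\<^sup>+x\<in>(\<lambda>x. x - ?k) -` S. ennreal \<bar>U (h + x) - U x\<bar> \<partial>lborel)"
    using nn_integral_lborel_translate[of "\<lambda>x. ennreal \<bar>U (h + x) - U x\<bar> * indicator S (x - ?k)" ?k]
    by (simp add: indicator_def vimage_def)
  also have "\<dots> + (\<integral>\<^sup>+x\<in>S. ennreal \<bar>U (?k + x) - U x\<bar> \<partial>lborel) \<le> C + of_nat N * C"
    using Suc by (intro add_mono) auto
  finally show ?case by (simp add: distrib_right)
qed simp

text \<open>A shift of length up to \<open>s\<close> is cut into \<open>N\<close> steps with
  components at most \<open>\<delta> / 2\<close>. Each step costs a multiple of \<delta>, and
  \<open>\<delta> \<le> s\<close> gives \<open>N * \<delta> \<le> 3 * s\<close>, so the total no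
  longer depends on \<delta>.\<close>

lemma shift_le_K:
  fixes U :: "real ^ 'n \<Rightarrow> real"
  assumes U: "integrable lborel U" and "\<delta> > 0" "\<delta> \<le> s" and h: "norm h \<le> s"
    and [measurable]: "S \<in> sets borel" and S: "\<And>x. x \<in> S \<Longrightarrow> ball x (s + 2 * (sqrt CARD('n) * \<delta>)) \<subseteq> A"
  shows "(\<integral>\<^sup>+x\<in>S. ennreal \<bar>U (h + x) - U x\<bar> \<partial>lborel) \<le> ennreal (3 * 2 ^ (CARD('n) + 1) * s) * K \<delta> A U"
proof -
  have [measurable]: "U \<in> borel_measurable borel" using U by auto
  have s: "s > 0" using assms by simp
  define N where "N = nat \<lceil>2 * s / \<delta>\<rceil>"
  have N: "2 * s / \<delta> \<le> real N" "real N \<le> 2 * s / \<delta> + 1"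
    using s \<open>\<delta> > 0\<close> by (auto simp: N_def of_nat_nat intro: real_nat_ceiling_ge)
  have "2 * s / \<delta> > 0" using s \<open>\<delta> > 0\<close> by simp
  then have N0: "real N > 0" using N by linarith
  have N\<delta>: "2 * s \<le> real N * \<delta>" "real N * \<delta> \<le> 3 * s"
    using N \<open>\<delta> > 0\<close> \<open>\<delta> \<le> s\<close> by (auto simp: field_simps)
  define k where "k = h /\<^sub>R real N"
  have hk: "h = real N *\<^sub>R k" using N0 by (simp add: k_def)
  have nk: "norm k = norm h / real N" using N0 by (simp add: k_def divide_inverse)
  have comp: "\<bar>k $ i\<bar> \<le> \<delta> / 2" for i
  proof -
    have "\<bar>k $ i\<bar> \<le> norm k" by (rule component_le_norm_cart)
    also have "\<dots> \<le> s / real N" unfolding nk using h N0 by (intro divide_right_mono) auto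
    also have "\<dots> \<le> \<delta> / 2" using N\<delta>(1) N0 by (simp add: field_simps)
    finally show ?thesis .
  qed
  have step: "(\<integral>\<^sup>+x\<in>(\<lambda>x. x - real j *\<^sub>R k) -` S. ennreal \<bar>U (k + x) - U x\<bar> \<partial>lborel)
     \<le> ennreal (2 ^ (CARD('n) + 1) * \<delta>) * K \<delta> A U" if "j < N" for j
  proof (rule shift_small_le_K[OF U \<open>\<delta> > 0\<close> comp])
    show "(\<lambda>x. x - real j *\<^sub>R k) -` S \<in> sets borel"
      using measurable_sets_borel[of "\<lambda>x. x - real j *\<^sub>R k" borel S] by simp
    fix x assume "x \<in> (\<lambda>x. x - real j *\<^sub>R k) -` S"
    then have xS: "x - real j *\<^sub>R k \<in> S" by simp
    have "norm (real j *\<^sub>R k) = norm h * (real j / real N)" by (simp add: nk)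
    also have "\<dots> \<le> norm h * 1" using that N0 by (intro mult_left_mono) auto
    finally have jk: "norm (real j *\<^sub>R k) \<le> s" using h by simp
    show "ball x (2 * (sqrt CARD('n) * \<delta>)) \<subseteq> A"
    proof
      fix z assume "z \<in> ball x (2 * (sqrt CARD('n) * \<delta>))"
      then have "norm (x - z) < 2 * (sqrt CARD('n) * \<delta>)" by (simp add: dist_norm)
      moreover have "norm (x - real j *\<^sub>R k - z) \<le> norm (x - z) + norm (real j *\<^sub>R k)"
        using norm_triangle_ineq4[of "x - z" "real j *\<^sub>R k"] by (simp add: algebra_simps)
      ultimately have "z \<in> ball (x - real j *\<^sub>R k) (s + 2 * (sqrt CARD('n) * \<delta>))"
        using jk by (simp add: dist_norm)
      then show "z \<in> A" using S[OF xS] by blast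
    qed
  qed
  have "(\<integral>\<^sup>+x\<in>S. ennreal \<bar>U (h + x) - U x\<bar> \<partial>lborel) \<le> of_nat N * (ennreal (2 ^ (CARD('n) + 1) * \<delta>) * K \<delta> A U)"
    unfolding hk by (rule shift_multiple_le[OF _ _ step]) auto
  also have "of_nat N * (ennreal (2 ^ (CARD('n) + 1) * \<delta>) * K \<delta> A U) = ennreal (real N * (2 ^ (CARD('n) + 1) * \<delta>)) * K \<delta> A U"
    using \<open>\<delta> > 0\<close> by (simp add: ennreal_mult ennreal_of_nat_eq_real_of_nat mult.assoc)
  also have "\<dots> \<le> ennreal (3 * 2 ^ (CARD('n) + 1) * s) * K \<delta> A U"
  proof (intro mult_right_mono ennreal_leI)
    have "2 ^ (CARD('n) + 1) * (real N * \<delta>) \<le> 2 ^ (CARD('n) + 1) * (3 * s)" by (intro mult_left_mono N\<delta>) auto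
    then show "real N * (2 ^ (CARD('n) + 1) * \<delta>) \<le> 3 * 2 ^ (CARD('n) + 1) * s" by (simp add: ac_simps)
  qed simp
  finally show ?thesis .
qed

text \<open>The error is of order \<eta> and uniform over all \<open>\<delta> \<le> \<eta>\<close>.
  This replaces compactness in \<open>BV\<close>: the sequence is close to its mollifications at a
  fixed scale.\<close>

lemma mol_close_K:
  fixes U :: "real ^ 'n \<Rightarrow> real"
  assumes U: "integrable lborel U" and \<delta>: "\<delta> > 0" "\<delta> \<le> \<eta>"
    and S[measurable]: "S \<in> sets borel" and sub: "\<And>x. x \<in> S \<Longrightarrow> ball x (\<eta> + 2 * (sqrt CARD('n) * \<eta>)) \<subseteq> A"
  shows "(\<integral>\<^sup>+x\<in>S. ennreal \<bar>cnv (mol \<eta>) U x - U x\<bar> \<partial>lborel) \<le> ennreal (3 * 2 ^ (CARD('n) + 1) * \<eta>) * K \<delta> A U"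
proof (rule cnv_mol_L1_local[OF _ U S])
  show "\<eta> > 0" using \<delta> by simp
  fix h :: "real ^ 'n" assume "norm h < \<eta>"
  then show "(\<integral>\<^sup>+x\<in>S. ennreal \<bar>U (h + x) - U x\<bar> \<partial>lborel) \<le> ennreal (3 * 2 ^ (CARD('n) + 1) * \<eta>) * K \<delta> A U"
  proof (intro shift_le_K[OF U \<delta> _ S])
    fix x assume x: "x \<in> S"
    have "\<eta> + 2 * (sqrt CARD('n) * \<delta>) \<le> \<eta> + 2 * (sqrt CARD('n) * \<eta>)"
      using \<delta> by (intro add_left_mono mult_left_mono) auto
    then show "ball x (\<eta> + 2 * (sqrt CARD('n) * \<delta>)) \<subseteq> A" using sub[OF x] subset_ball by blast
  qed simp
qed

text \<open>The modulus comes from the kernel and the bound \<open>M\<close> alone, so it is common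
  to all members of a bounded sequence.\<close>

lemma cnv_equicontinuous:
  fixes \<kappa> :: "'a::euclidean_space \<Rightarrow> real"
  assumes cont: "continuous_on UNIV \<kappa>" and supp: "\<And>x. norm x \<ge> R \<Longrightarrow> \<kappa> x = 0" and "e > 0" "M > 0"
  shows "\<exists>d>0. \<forall>V x x'. integrable lborel V \<longrightarrow> (\<integral>y. \<bar>V y\<bar> \<partial>lborel) \<le> M \<longrightarrow> norm (x - x') < d \<longrightarrow>
     \<bar>cnv \<kappa> V x - cnv \<kappa> (V :: 'a \<Rightarrow> real) x'\<bar> \<le> e"
proof -
  have [measurable]: "\<kappa> \<in> borel_measurable borel" by (rule borel_measurable_continuous_onI[OF cont])
  obtain B where B: "\<And>x. norm (\<kappa> x) \<le> B" using bounded_compact_support[OF cont supp] by metis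
  have "e / M > 0" using assms by simp
  from uniformly_continuous_compact_support[OF cont supp this] obtain d where d: "d > 0"
    "\<And>x y. norm (x - y) < d \<Longrightarrow> norm (\<kappa> x - \<kappa> y) < e / M" by blast
  show ?thesis
  proof (intro exI[of _ d] conjI allI impI d(1))
    fix V :: "'a \<Rightarrow> real" and x x' :: 'a
    assume i: "integrable lborel V" and M: "(\<integral>y. \<bar>V y\<bar> \<partial>lborel) \<le> M" and x: "norm (x - x') < d"
    have int: "integrable lborel (\<lambda>y. \<kappa> (x - y) *\<^sub>R V y)" for x
      by (rule cnv_integrable[OF _ _ i, of _ B]) (use B in auto)
    have eq: "cnv \<kappa> V x - cnv \<kappa> V x' = (\<integral>y. (\<kappa> (x - y) - \<kappa> (x' - y)) *\<^sub>R V y \<partial>lborel)"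
      unfolding cnv_def scaleR_diff_left by (rule Bochner_Integration.integral_diff[symmetric, OF int int])
    have "norm (cnv \<kappa> V x - cnv \<kappa> V x') \<le> (\<integral>y. norm ((\<kappa> (x - y) - \<kappa> (x' - y)) *\<^sub>R V y) \<partial>lborel)"
      unfolding eq by (rule integral_norm_bound)
    also have "\<dots> \<le> (\<integral>y. (e / M) * \<bar>V y\<bar> \<partial>lborel)"
    proof (rule integral_mono)
      show "integrable lborel (\<lambda>y. norm ((\<kappa> (x - y) - \<kappa> (x' - y)) *\<^sub>R V y))"
        unfolding scaleR_diff_left by (intro integrable_norm Bochner_Integration.integrable_diff int)
      show "integrable lborel (\<lambda>y. (e / M) * \<bar>V y\<bar>)" using i by simp
      show "norm ((\<kappa> (x - y) - \<kappa> (x' - y)) *\<^sub>R V y) \<le> (e / M) * \<bar>V y\<bar>" for y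
      proof -
        have "\<bar>\<kappa> (x - y) - \<kappa> (x' - y)\<bar> \<le> e / M" using d(2)[of "x - y" "x' - y"] x by simp
        from mult_right_mono[OF this abs_ge_zero[of "V y"]] show ?thesis by (simp add: abs_mult)
      qed
    qed
    also have "\<dots> = (e / M) * (\<integral>y. \<bar>V y\<bar> \<partial>lborel)" by simp
    also have "\<dots> \<le> (e / M) * M" using \<open>e / M > 0\<close> by (intro mult_left_mono M) auto
    finally show "\<bar>cnv \<kappa> V x - cnv \<kappa> V x'\<bar> \<le> e" using \<open>M > 0\<close> by simp
  qed
qed

section \<open>Extraction of a convergent subsequence\<close>

lemma diagonal_convergent:
  fixes a :: "nat \<Rightarrow> nat \<Rightarrow> real"
  assumes b: "\<And>n. bounded (range (a n))"
  shows "\<exists>r. strict_mono r \<and> (\<forall>n. convergent (\<lambda>k. a n (r k)))"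
proof -
  interpret subseqs "\<lambda>n s. convergent (\<lambda>k. a n (s k))"
  proof
    fix n :: nat and s :: "nat \<Rightarrow> nat"
    have "bounded (range (\<lambda>k. a n (s k)))" using b[of n] by (rule bounded_subset) auto
    then obtain l r where "strict_mono r" "((\<lambda>k. a n (s k)) \<circ> r) \<longlonglongrightarrow> l"
      using bounded_imp_convergent_subsequence by blast
    then show "\<exists>r'. strict_mono r' \<and> convergent (\<lambda>k. a n ((s \<circ> r') k))"
      by (auto simp: convergent_def comp_def)
  qed
  have "convergent (\<lambda>k. a n (diagseq k))" for n
  proof -
    \<comment> \<open>The diagonal sequence refines the subsequence chosen for \<open>n\<close> only
      beyond index \<open>n\<close>; convergence is obtained for that tail first.\<close>
    have "convergent (\<lambda>k. a n ((diagseq \<circ> (+) (Suc n)) k))"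
    proof (rule diagseq_holds)
      fix r s :: "nat \<Rightarrow> nat" and n assume "strict_mono r" "convergent (\<lambda>k. a n (s k))"
      then show "convergent (\<lambda>k. a n ((s \<circ> r) k))"
        using convergent_subseq_convergent[of "\<lambda>k. a n (s k)" r] by (simp add: comp_def)
    qed
    then have "convergent (\<lambda>k. a n (diagseq (k + Suc n)))" by (simp add: add.commute comp_def)
    then show ?thesis by (subst (asm) convergent_ignore_initial_segment)
  qed
  then show ?thesis using subseq_diagseq by blast
qed

text \<open>The argument of Arzela and Ascoli: a diagonal subsequence settles all scales and all
  points of a countable dense set, and equicontinuity carries the convergence to every
  point.\<close>

lemma mol_subsequence:
  fixes U :: "nat \<Rightarrow> 'a::euclidean_space \<Rightarrow> real"
  assumes U: "\<And>k. integrable lborel (U k)" and M: "\<And>k. (\<integral>x. \<bar>U k x\<bar> \<partial>lborel) \<le> M" "M > 0"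
  shows "\<exists>r. strict_mono r \<and> (\<forall>m x. convergent (\<lambda>k. cnv (mol (1 / real (Suc m))) (U (r k)) x))"
proof -
  obtain D :: "'a set" where D: "countable D" "\<And>X. open X \<Longrightarrow> X \<noteq> {} \<Longrightarrow> \<exists>d\<in>D. d \<in> X"
    using countable_dense_setE[where 'a='a] by blast
  have "D \<noteq> {}" using D(2)[of UNIV] by auto
  let ?w = "\<lambda>m k. cnv (mol (1 / real (Suc m))) (U k)"
  let ?E = "D \<times> (UNIV :: nat set)"
  have E: "countable ?E" "?E \<noteq> {}" using D(1) \<open>D \<noteq> {}\<close> by auto
  define a where "a n k = ?w (snd (from_nat_into ?E n)) k (fst (from_nat_into ?E n))" for n k
  have bd: "\<exists>B. \<forall>k x. \<bar>?w m k x\<bar> \<le> B" for m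
  proof -
    have pos: "1 / real (Suc m) > 0" by simp
    obtain B where B: "B > 0" "\<And>x::'a. \<bar>mol (1 / real (Suc m)) x\<bar> \<le> B"
      using mol_bound[OF pos, where 'a='a] by metis
    have "\<bar>?w m k x\<bar> \<le> B * M" for k x
    proof -
      have "norm (?w m k x) \<le> (\<integral>y. norm (mol (1 / real (Suc m)) (x - y) *\<^sub>R U k y) \<partial>lborel)"
        unfolding cnv_def by (rule integral_norm_bound)
      also have "\<dots> \<le> (\<integral>y. B * \<bar>U k y\<bar> \<partial>lborel)"
      proof (rule integral_mono[OF integrable_norm[OF mol_kernel_integrable[OF pos U]]])
        show "integrable lborel (\<lambda>y. B * \<bar>U k y\<bar>)" using U by simp
        show "norm (mol (1 / real (Suc m)) (x - y) *\<^sub>R U k y) \<le> B * \<bar>U k y\<bar>" for y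
          using mult_right_mono[OF B(2)[of "x - y"] abs_ge_zero[of "U k y"]] by (simp add: abs_mult)
      qed
      also have "\<dots> = B * (\<integral>y. \<bar>U k y\<bar> \<partial>lborel)" by simp
      also have "\<dots> \<le> B * M" using B(1) M(1) by (intro mult_left_mono) auto
      finally show ?thesis by simp
    qed
    then show ?thesis by blast
  qed
  have "bounded (range (a n))" for n
    using bd[of "snd (from_nat_into ?E n)"] unfolding a_def bounded_iff by auto
  then obtain r where r: "strict_mono r" "\<And>n. convergent (\<lambda>k. a n (r k))"
    using diagonal_convergent[of a] by blast
  have q: "convergent (\<lambda>k. ?w m (r k) q)" if qD: "q \<in> D" for q m
  proof -
    obtain n where "from_nat_into ?E n = (q, m)"
      using from_nat_into_surj[OF E(1), of "(q, m)"] qD by auto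
    then show ?thesis using r(2)[of n] by (simp add: a_def)
  qed
  have "convergent (\<lambda>k. ?w m (r k) x)" for m x
  proof -
    have pos: "1 / real (Suc m) > 0" by simp
    have "Cauchy (\<lambda>k. ?w m (r k) x)"
      unfolding Cauchy_iff
    proof (intro allI impI)
      fix e :: real assume "e > 0"
      then have "e / 4 > 0" by simp
      from cnv_equicontinuous[OF mol_continuous[OF pos] mol_zero[OF pos] this M(2)]
      obtain d where d: "d > 0" "\<And>V x x'. integrable lborel V \<Longrightarrow> (\<integral>y. \<bar>V y\<bar> \<partial>lborel) \<le> M \<Longrightarrow> norm (x - x') < d \<Longrightarrow>
        \<bar>cnv (mol (1 / real (Suc m))) V x - cnv (mol (1 / real (Suc m))) (V :: 'a \<Rightarrow> real) x'\<bar> \<le> e / 4"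
        by blast
      obtain y where y: "y \<in> D" "y \<in> ball x d" using D(2)[of "ball x d"] d(1) by auto
      have "Cauchy (\<lambda>k. ?w m (r k) y)" using q[OF y(1)] by (rule convergent_Cauchy)
      then obtain N where N: "\<And>k l. k \<ge> N \<Longrightarrow> l \<ge> N \<Longrightarrow> norm (?w m (r k) y - ?w m (r l) y) < e / 4"
        unfolding Cauchy_iff using \<open>e / 4 > 0\<close> by blast
      have close: "\<bar>?w m (r k) x - ?w m (r k) y\<bar> \<le> e / 4" for k
        using y(2) by (intro d(2) U M(1)) (simp add: dist_norm)
      show "\<exists>N. \<forall>k\<ge>N. \<forall>l\<ge>N. norm (?w m (r k) x - ?w m (r l) x) < e"
      proof (intro exI[of _ N] allI impI)
        fix k l assume "N \<le> k" "N \<le> l"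
        then show "norm (?w m (r k) x - ?w m (r l) x) < e"
          using N[of k l] close[of k] close[of l] \<open>e > 0\<close> unfolding real_norm_def by linarith
      qed
    qed
    then show ?thesis by (rule Cauchy_convergent)
  qed
  then show ?thesis using r(1) by blast
qed

lemma bounded_convergence_Cauchy:
  fixes w :: "nat \<Rightarrow> 'a::euclidean_space \<Rightarrow> real"
  assumes [measurable]: "\<And>k. w k \<in> borel_measurable borel" "S \<in> sets borel" and "bounded S"
    and conv: "\<And>x. convergent (\<lambda>k. w k x)" and B: "\<And>k x. \<bar>w k x\<bar> \<le> B" and "e > 0"
  shows "\<exists>N. \<forall>k\<ge>N. \<forall>l\<ge>N. (\<integral>\<^sup>+x\<in>S. ennreal \<bar>w k x - w l x\<bar> \<partial>lborel) \<le> ennreal e"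
proof -
  define W where "W x = lim (\<lambda>k. w k x)" for x
  have W: "(\<lambda>k. w k x) \<longlonglongrightarrow> W x" for x using conv[of x] by (simp add: W_def convergent_LIMSEQ_iff)
  have [measurable]: "W \<in> borel_measurable borel" unfolding W_def by measurable
  have "B \<ge> 0" using B[of 0 0] by linarith
  let ?i = "\<lambda>x. indicator S x :: real"
  have "(\<lambda>k. \<integral>\<^sup>+x. norm (?i x * W x - ?i x * w k x) \<partial>lborel) \<longlonglongrightarrow> 0"
  proof (rule nn_integral_dominated_convergence_norm[where w = "\<lambda>x. B * ?i x"])
    show "AE x in lborel. norm (?i x * w k x) \<le> B * ?i x" for k
      using B \<open>B \<ge> 0\<close> by (intro AE_I2) (auto simp: indicator_def)
    have "(\<integral>\<^sup>+x. ennreal (B * ?i x) \<partial>lborel) = (\<integral>\<^sup>+x. ennreal B * indicator S x \<partial>lborel)"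
      by (intro nn_integral_cong) (auto simp: indicator_def)
    also have "\<dots> < \<infinity>"
      using emeasure_bounded_finite[OF \<open>bounded S\<close>] by (simp add: nn_integral_cmult_indicator ennreal_mult_less_top)
    finally show "(\<integral>\<^sup>+x. ennreal (B * ?i x) \<partial>lborel) < \<infinity>" .
    show "AE x in lborel. (\<lambda>k. ?i x * w k x) \<longlonglongrightarrow> ?i x * W x"
      by (intro AE_I2 tendsto_intros W)
  qed measurable
  moreover have "(0::ennreal) < ennreal (e / 2)" using \<open>e > 0\<close> by simp
  ultimately have "\<forall>\<^sub>F k in sequentially. (\<integral>\<^sup>+x. norm (?i x * W x - ?i x * w k x) \<partial>lborel) < ennreal (e / 2)"
    by (rule order_tendstoD(2))
  then obtain N where N: "\<And>k. k \<ge> N \<Longrightarrow> (\<integral>\<^sup>+x. norm (?i x * W x - ?i x * w k x) \<partial>lborel) < ennreal (e / 2)"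
    by (auto simp: eventually_sequentially)
  show ?thesis
  proof (intro exI[of _ N] allI impI)
    fix k l assume kl: "N \<le> k" "N \<le> l"
    have "(\<integral>\<^sup>+x\<in>S. ennreal \<bar>w k x - w l x\<bar> \<partial>lborel)
      \<le> (\<integral>\<^sup>+x. ennreal (norm (?i x * W x - ?i x * w k x)) + ennreal (norm (?i x * W x - ?i x * w l x)) \<partial>lborel)"
      by (intro nn_integral_mono) (auto simp: indicator_def ennreal_plus[symmetric] simp del: ennreal_plus intro!: ennreal_leI)
    also have "\<dots> = (\<integral>\<^sup>+x. norm (?i x * W x - ?i x * w k x) \<partial>lborel) + (\<integral>\<^sup>+x. norm (?i x * W x - ?i x * w l x) \<partial>lborel)"
      by (rule nn_integral_add) measurable
    also have "\<dots> \<le> ennreal (e / 2) + ennreal (e / 2)" using N kl by (intro add_mono) (auto intro: less_imp_le)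
    also have "\<dots> = ennreal e" using \<open>e > 0\<close> by (simp add: ennreal_plus[symmetric] del: ennreal_plus)
    finally show "(\<integral>\<^sup>+x\<in>S. ennreal \<bar>w k x - w l x\<bar> \<partial>lborel) \<le> ennreal e" .
  qed
qed

text \<open>Near the boundary the weight is small and the common bound \<open>M\<close> suffices.
  Farther inside, each function is compared with its mollification at a fixed scale \<eta>, and the
  mollifications are Cauchy in the mean by bounded convergence.\<close>

lemma K_bounded_Cauchy:
  fixes U :: "nat \<Rightarrow> real ^ 'n \<Rightarrow> real"
  assumes \<Omega>: "open \<Omega>" "bounded \<Omega>"
    and U: "\<And>k. integrable lborel (U k)" and M: "\<And>k. (\<integral>x. \<bar>U k x\<bar> \<partial>lborel) \<le> M" "M > 0"
    and \<delta>: "\<And>k. \<delta> k > 0" "\<delta> \<longlonglongrightarrow> 0" and c: "\<And>k. K (\<delta> k) \<Omega> (U k) \<le> ennreal c" "c > 0"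
    and conv: "\<And>m x. convergent (\<lambda>k. cnv (mol (1 / real (Suc m))) (U k) x)" and "e > 0"
  shows "\<exists>N. \<forall>k\<ge>N. \<forall>l\<ge>N. (\<integral>\<^sup>+x. ennreal (infdist x (- \<Omega>) * \<bar>U k x - U l x\<bar>) \<partial>lborel) \<le> ennreal e"
proof -
  have [measurable]: "U k \<in> borel_measurable borel" for k using U by auto
  let ?p = "\<lambda>x. infdist x (- \<Omega>)" and ?s = "sqrt CARD('n)"
  have [measurable]: "?p \<in> borel_measurable borel" by (intro borel_measurable_continuous_onI continuous_intros)
  have ne: "- \<Omega> \<noteq> {}" using compl_bounded_nonempty \<Omega> by auto
  then obtain z where z: "z \<in> - \<Omega>" by blast
  obtain R where R: "\<And>x. x \<in> \<Omega> \<Longrightarrow> norm x \<le> R" using \<Omega>(2) by (auto simp: bounded_iff)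
  define D where "D = \<bar>R\<bar> + norm z + 1"
  have D: "D > 0" by (simp add: D_def add_nonneg_pos)
  have pD: "?p x \<le> D" for x
  proof (cases "x \<in> \<Omega>")
    case True
    have "?p x \<le> dist x z" by (rule infdist_le[OF z])
    also have "\<dots> \<le> norm x + norm z" by (simp add: dist_norm norm_triangle_ineq4)
    finally show ?thesis using R[OF True] by (simp add: D_def)
  next
    case False
    then show ?thesis using D by (simp add: infdist_zero)
  qed
  have p0: "?p x \<ge> 0" for x by (rule infdist_nonneg)
  have p_out: "?p x = 0" if "x \<notin> \<Omega>" for x using that by (simp add: infdist_zero)
  \<comment> \<open>Where the weight is below \<open>t\<close>, the two functions together
    contribute at most \<open>2 * M * t = e / 2\<close>.\<close>
  define t where "t = e / (4 * M)"
  have t: "t > 0" using \<open>e > 0\<close> M(2) by (simp add: t_def)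
  define C where "C = 3 * 2 ^ (CARD('n) + 1) * c"
  have C: "C > 0" using c(2) by (simp add: C_def)
  \<comment> \<open>The first entry leaves room inside \<Omega> for the kernel and the cubes. The
    second bounds each of the two mollification errors by \<open>e / 8\<close>.\<close>
  define \<eta>0 where "\<eta>0 = min (t / (1 + 2 * ?s)) (e / (8 * D * C))"
  have s1: "1 + 2 * ?s > 0" by (intro add_pos_nonneg) auto
  have "\<eta>0 > 0" using t s1 \<open>e > 0\<close> D C by (simp add: \<eta>0_def)
  then obtain m where m: "1 / real (Suc m) < \<eta>0" using nat_approx_posE by blast
  define \<eta> where "\<eta> = 1 / real (Suc m)"
  have \<eta>: "\<eta> > 0" "\<eta> \<le> t / (1 + 2 * ?s)" "\<eta> \<le> e / (8 * D * C)" using m by (auto simp: \<eta>_def \<eta>0_def)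
  have \<eta>t: "\<eta> + 2 * (?s * \<eta>) \<le> t" using \<eta>(2) s1 by (simp add: pos_le_divide_eq algebra_simps)
  have \<eta>C: "D * (C * \<eta>) \<le> e / 8" using \<eta>(3) D C by (simp add: pos_le_divide_eq algebra_simps)
  define S where "S = {x. t \<le> ?p x}"
  have [measurable]: "S \<in> sets borel" unfolding S_def by measurable
  have Sball: "ball x (\<eta> + 2 * (?s * \<eta>)) \<subseteq> \<Omega>" if "x \<in> S" for x
    using that \<eta>t by (intro infdist_ball_subset) (auto simp: S_def)
  have "S \<subseteq> \<Omega>"
  proof
    fix x assume "x \<in> S"
    then have "?p x \<noteq> 0" using t by (auto simp: S_def)
    then show "x \<in> \<Omega>" using p_out[of x] by blast
  qed
  then have bS: "bounded S" using \<Omega>(2) bounded_subset by blast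
  let ?w = "\<lambda>k. cnv (mol \<eta>) (U k)"
  have wm[measurable]: "?w k \<in> borel_measurable borel" for k by (rule cnv_mol_borel[OF \<eta>(1) U])
  have Sm: "S \<in> sets borel" by measurable
  have "\<exists>B. \<forall>k x. \<bar>?w k x\<bar> \<le> B"
  proof -
    obtain B where B: "B > 0" "\<And>x::real^'n. \<bar>mol \<eta> x\<bar> \<le> B"
      using mol_bound[OF \<eta>(1), where 'a="real^'n"] by metis
    have "\<bar>?w k x\<bar> \<le> B * M" for k x
    proof -
      have "norm (?w k x) \<le> (\<integral>y. norm (mol \<eta> (x - y) *\<^sub>R U k y) \<partial>lborel)"
        unfolding cnv_def by (rule integral_norm_bound)
      also have "\<dots> \<le> (\<integral>y. B * \<bar>U k y\<bar> \<partial>lborel)"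
      proof (rule integral_mono[OF integrable_norm[OF mol_kernel_integrable[OF \<eta>(1) U]]])
        show "integrable lborel (\<lambda>y. B * \<bar>U k y\<bar>)" using U by simp
        show "norm (mol \<eta> (x - y) *\<^sub>R U k y) \<le> B * \<bar>U k y\<bar>" for y
          using mult_right_mono[OF B(2)[of "x - y"] abs_ge_zero[of "U k y"]] by (simp add: abs_mult)
      qed
      also have "\<dots> = B * (\<integral>y. \<bar>U k y\<bar> \<partial>lborel)" by simp
      also have "\<dots> \<le> B * M" using B(1) M(1) by (intro mult_left_mono) auto
      finally show ?thesis by simp
    qed
    then show ?thesis by blast
  qed
  then obtain B where B: "\<And>k x. \<bar>?w k x\<bar> \<le> B" by blast
  have "e / (4 * D) > 0" using \<open>e > 0\<close> D by simp
  then have "\<exists>N. \<forall>k\<ge>N. \<forall>l\<ge>N. (\<integral>\<^sup>+x\<in>S. ennreal \<bar>?w k x - ?w l x\<bar> \<partial>lborel) \<le> ennreal (e / (4 * D))"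
    by (rule bounded_convergence_Cauchy[where w = ?w, OF wm Sm bS conv[of m, folded \<eta>_def] B])
  then obtain N1 where N1: "\<And>k l. k \<ge> N1 \<Longrightarrow> l \<ge> N1 \<Longrightarrow> (\<integral>\<^sup>+x\<in>S. ennreal \<bar>?w k x - ?w l x\<bar> \<partial>lborel) \<le> ennreal (e / (4 * D))"
    by blast
  have "\<forall>\<^sub>F k in sequentially. \<delta> k < \<eta>" by (rule order_tendstoD(2)[OF \<delta>(2) \<eta>(1)])
  then obtain N2 where N2: "\<And>k. k \<ge> N2 \<Longrightarrow> \<delta> k < \<eta>" by (auto simp: eventually_sequentially)
  have close: "(\<integral>\<^sup>+x\<in>S. ennreal \<bar>?w k x - U k x\<bar> \<partial>lborel) \<le> ennreal (C * \<eta>)" if "k \<ge> N2" for k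
  proof -
    have "(\<integral>\<^sup>+x\<in>S. ennreal \<bar>?w k x - U k x\<bar> \<partial>lborel) \<le> ennreal (3 * 2 ^ (CARD('n) + 1) * \<eta>) * K (\<delta> k) \<Omega> (U k)"
      using N2[OF that] Sball by (intro mol_close_K U \<delta>(1)) auto
    also have "\<dots> \<le> ennreal (3 * 2 ^ (CARD('n) + 1) * \<eta>) * ennreal c" by (intro mult_left_mono c) auto
    also have "\<dots> = ennreal (C * \<eta>)" using \<eta>(1) c(2) by (simp add: C_def ennreal_mult[symmetric] ac_simps)
    finally show ?thesis .
  qed
  have U1: "(\<integral>\<^sup>+x. ennreal \<bar>U k x\<bar> \<partial>lborel) \<le> ennreal M" for k
    using nn_integral_eq_integral[of lborel "\<lambda>x. \<bar>U k x\<bar>"] U[of k] M(1)[of k] by (simp add: ennreal_leI)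
  show ?thesis
  proof (intro exI[of _ "max N1 N2"] allI impI)
    fix k l assume kl: "max N1 N2 \<le> k" "max N1 N2 \<le> l"
    let ?a = "\<lambda>k x. ennreal \<bar>?w k x - U k x\<bar> * indicator S x"
    let ?b = "\<lambda>x. ennreal \<bar>?w k x - ?w l x\<bar> * indicator S x"
    have "(\<integral>\<^sup>+x. ennreal (?p x * \<bar>U k x - U l x\<bar>) \<partial>lborel)
      \<le> (\<integral>\<^sup>+x. (ennreal D * ((?a k x + ?a l x) + ?b x)) + ennreal t * (ennreal \<bar>U k x\<bar> + ennreal \<bar>U l x\<bar>) \<partial>lborel)"
    proof (intro nn_integral_mono)
      fix x
      show "ennreal (?p x * \<bar>U k x - U l x\<bar>)
        \<le> (ennreal D * ((?a k x + ?a l x) + ?b x)) + ennreal t * (ennreal \<bar>U k x\<bar> + ennreal \<bar>U l x\<bar>)"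
      proof (cases "x \<in> S")
        case True
        have "?p x * \<bar>U k x - U l x\<bar> \<le> D * ((\<bar>?w k x - U k x\<bar> + \<bar>?w l x - U l x\<bar>) + \<bar>?w k x - ?w l x\<bar>)"
          using D p0 by (intro mult_mono pD) auto
        then have "ennreal (?p x * \<bar>U k x - U l x\<bar>) \<le> ennreal D * ((?a k x + ?a l x) + ?b x)"
          using True D by (simp add: ennreal_mult[symmetric] ennreal_plus[symmetric] ennreal_leI del: ennreal_plus)
        then show ?thesis by (rule order_trans) simp
      next
        case False
        then have "?p x * \<bar>U k x - U l x\<bar> \<le> t * (\<bar>U k x\<bar> + \<bar>U l x\<bar>)"
          using t p0[of x] by (intro mult_mono) (auto simp: S_def)
        then have "ennreal (?p x * \<bar>U k x - U l x\<bar>) \<le> ennreal t * (ennreal \<bar>U k x\<bar> + ennreal \<bar>U l x\<bar>)"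
          using t by (simp add: ennreal_mult[symmetric] ennreal_plus[symmetric] ennreal_leI del: ennreal_plus)
        then show ?thesis by (rule order_trans) simp
      qed
    qed
    also have "\<dots> = ennreal D * (((\<integral>\<^sup>+x. ?a k x \<partial>lborel) + (\<integral>\<^sup>+x. ?a l x \<partial>lborel)) + (\<integral>\<^sup>+x. ?b x \<partial>lborel))
        + ennreal t * ((\<integral>\<^sup>+x. ennreal \<bar>U k x\<bar> \<partial>lborel) + (\<integral>\<^sup>+x. ennreal \<bar>U l x\<bar> \<partial>lborel))"
      by (simp add: nn_integral_add nn_integral_cmult)
    also have "\<dots> \<le> ennreal D * ((ennreal (C * \<eta>) + ennreal (C * \<eta>)) + ennreal (e / (4 * D))) + ennreal t * (ennreal M + ennreal M)"
      using kl by (intro add_mono mult_left_mono close N1 U1) auto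
    also have "\<dots> = ennreal (D * ((C * \<eta> + C * \<eta>) + e / (4 * D)) + t * (M + M))"
    proof -
      have "0 \<le> C * \<eta>" "0 \<le> e / (4 * D)" "0 \<le> D" "0 \<le> t" "0 \<le> M" using C \<eta> \<open>e > 0\<close> D t M by auto
      then show ?thesis by (simp add: ennreal_plus[symmetric] ennreal_mult[symmetric] del: ennreal_plus)
    qed
    also have "\<dots> \<le> ennreal e"
    proof (rule ennreal_leI)
      have "D * (e / (4 * D)) = e / 4" using D by simp
      moreover have "t * M = e / 4" using M(2) by (simp add: t_def)
      ultimately show "D * ((C * \<eta> + C * \<eta>) + e / (4 * D)) + t * (M + M) \<le> e"
        using \<eta>C \<open>e > 0\<close> by (simp add: distrib_left)
    qed
    finally show "(\<integral>\<^sup>+x. ennreal (?p x * \<bar>U k x - U l x\<bar>) \<partial>lborel) \<le> ennreal e" .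
  qed
qed

text \<open>Being Cauchy for the weighted distance gives almost everywhere convergence along a
  further subsequence, and the weight can be divided out since it is positive in \<Omega>. The limit
  is integrable by Fatou, and Fatou in one index of the Cauchy estimate gives weighted
  convergence.\<close>

lemma K_bounded_compact:
  fixes U :: "nat \<Rightarrow> real ^ 'n \<Rightarrow> real"
  assumes \<Omega>: "open \<Omega>" "bounded \<Omega>"
    and U: "\<And>k. integrable lborel (U k)" and M: "\<And>k. (\<integral>x. \<bar>U k x\<bar> \<partial>lborel) \<le> M" "M > 0"
    and \<delta>: "\<And>k. \<delta> k > 0" "\<delta> \<longlonglongrightarrow> 0" and c: "\<And>k. K (\<delta> k) \<Omega> (U k) \<le> ennreal c" "c > 0"
  shows "\<exists>r u. strict_mono r \<and> integrable lborel u \<and> (AE x in lborel. x \<in> \<Omega> \<longrightarrow> (\<lambda>k. U (r k) x) \<longlonglongrightarrow> u x) \<and>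
    (\<lambda>k. \<integral>\<^sup>+x. ennreal (infdist x (- \<Omega>) * \<bar>U (r k) x - u x\<bar>) \<partial>lborel) \<longlonglongrightarrow> 0"
proof -
  have [measurable]: "U k \<in> borel_measurable borel" for k using U by auto
  have [measurable]: "\<Omega> \<in> sets borel" using \<Omega> by simp
  let ?p = "\<lambda>x. infdist x (- \<Omega>)"
  have [measurable]: "?p \<in> borel_measurable borel" by (intro borel_measurable_continuous_onI continuous_intros)
  have ne: "- \<Omega> \<noteq> {}" "closed (- \<Omega>)" using compl_bounded_nonempty \<Omega> by auto
  obtain r1 where r1: "strict_mono r1" "\<And>m x. convergent (\<lambda>k. cnv (mol (1 / real (Suc m))) (U (r1 k)) x)"
    using mol_subsequence[of U M, OF U M] by blast
  have \<delta>1: "(\<lambda>k. \<delta> (r1 k)) \<longlonglongrightarrow> 0" using LIMSEQ_subseq_LIMSEQ[OF \<delta>(2) r1(1)] by (simp add: comp_def)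
  have Cau: "\<exists>N. \<forall>k\<ge>N. \<forall>l\<ge>N. (\<integral>\<^sup>+x. ennreal (?p x * \<bar>U (r1 k) x - U (r1 l) x\<bar>) \<partial>lborel) \<le> ennreal e" if "e > 0" for e
    by (rule K_bounded_Cauchy[OF \<Omega> U M \<delta>(1) \<delta>1 c r1(2) that])
  let ?V = "\<lambda>k x. ?p x * U (r1 k) x"
  have pB: "\<exists>D. \<forall>x. ?p x \<le> D"
  proof -
    obtain z where z: "z \<in> - \<Omega>" using ne by blast
    obtain R where R: "\<And>x. x \<in> \<Omega> \<Longrightarrow> norm x \<le> R" using \<Omega>(2) by (auto simp: bounded_iff)
    have "?p x \<le> \<bar>R\<bar> + norm z" for x
    proof (cases "x \<in> \<Omega>")
      case True
      have "?p x \<le> dist x z" by (rule infdist_le[OF z])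
      also have "\<dots> \<le> norm x + norm z" by (simp add: dist_norm norm_triangle_ineq4)
      finally show ?thesis using R[OF True] by simp
    qed (simp add: infdist_zero)
    then show ?thesis by blast
  qed
  then obtain D where D: "\<And>x. ?p x \<le> D" by blast
  have iV: "integrable lborel (?V k)" for k
  proof (rule Bochner_Integration.integrable_bound)
    show "integrable lborel (\<lambda>x. D * U (r1 k) x)" using U by simp
    have "D \<ge> 0" using D[of 0] infdist_nonneg order_trans by blast
    then show "AE x in lborel. norm (?V k x) \<le> norm (D * U (r1 k) x)"
      using D by (intro AE_I2) (auto simp: abs_mult infdist_nonneg intro!: mult_right_mono)
  qed measurable
  obtain r2 where r2: "strict_mono r2" "AE x in lborel. Cauchy (\<lambda>i. ?V (r2 i) x)"
  proof (rule cauchy_L1_AE_cauchy_subseq[of lborel ?V])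
    show "integrable lborel (?V n)" for n by (rule iV)
    fix e :: real assume "e > 0"
    then obtain N where N: "\<And>k l. k \<ge> N \<Longrightarrow> l \<ge> N \<Longrightarrow> (\<integral>\<^sup>+x. ennreal (?p x * \<bar>U (r1 k) x - U (r1 l) x\<bar>) \<partial>lborel) \<le> ennreal (e / 2)"
      using Cau[of "e / 2"] by auto
    have "(LINT x|lborel. norm (?V i x - ?V j x)) < e" if "i \<ge> N" "j \<ge> N" for i j
    proof -
      have n: "norm (?V i x - ?V j x) = ?p x * \<bar>U (r1 i) x - U (r1 j) x\<bar>" for x
        using infdist_nonneg[of x "- \<Omega>"] by (simp add: abs_mult right_diff_distrib[symmetric])
      have "ennreal (LINT x|lborel. norm (?V i x - ?V j x)) = (\<integral>\<^sup>+x. ennreal (norm (?V i x - ?V j x)) \<partial>lborel)"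
        by (rule nn_integral_eq_integral[symmetric]) (use iV in auto)
      also have "\<dots> \<le> ennreal (e / 2)" unfolding n by (rule N[OF that])
      finally have "(LINT x|lborel. norm (?V i x - ?V j x)) \<le> e / 2" using \<open>e > 0\<close> by (simp add: ennreal_le_iff)
      then show ?thesis using \<open>e > 0\<close> by simp
    qed
    then show "\<exists>N. \<forall>i\<ge>N. \<forall>j\<ge>N. (LINT x|lborel. norm (?V i x - ?V j x)) < e" by blast
  qed (use that in blast)
  define r where "r k = r1 (r2 k)" for k
  have r: "strict_mono r" using r1(1) r2(1) by (simp add: r_def strict_mono_def)
  \<comment> \<open>The indicator makes the limit 0 outside \<Omega>, where nothing is known about
    the sequence.\<close>
  define u where "u x = lim (\<lambda>k. indicator \<Omega> x * U (r k) x)" for x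
  have [measurable]: "u \<in> borel_measurable borel" unfolding u_def by measurable
  have ae: "AE x in lborel. x \<in> \<Omega> \<longrightarrow> (\<lambda>k. U (r k) x) \<longlonglongrightarrow> u x"
    using r2(2)
  proof eventually_elim
    case (elim x)
    show ?case
    proof
      assume x: "x \<in> \<Omega>"
      have p: "?p x > 0" using infdist_pos_not_in_closed[OF ne(2,1), of x] x by simp
      have "convergent (\<lambda>i. ?p x * U (r i) x)"
        unfolding r_def using elim by (rule Cauchy_convergent)
      then have "convergent (\<lambda>i. U (r i) x)" using p by (subst (asm) convergent_mult_const_iff) auto
      then show "(\<lambda>k. U (r k) x) \<longlonglongrightarrow> u x" using x by (simp add: u_def convergent_LIMSEQ_iff)
    qed
  qed
  have U1: "(\<integral>\<^sup>+x. ennreal \<bar>U k x\<bar> \<partial>lborel) \<le> ennreal M" for k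
    using nn_integral_eq_integral[of lborel "\<lambda>x. \<bar>U k x\<bar>"] U[of k] M(1)[of k] by (simp add: ennreal_leI)
  have uz: "u x = 0" if "x \<notin> \<Omega>" for x using that by (simp add: u_def)
  have "(\<integral>\<^sup>+x. ennreal \<bar>u x\<bar> \<partial>lborel) \<le> (\<integral>\<^sup>+x. liminf (\<lambda>k. ennreal \<bar>U (r k) x\<bar>) \<partial>lborel)"
  proof (rule nn_integral_mono_AE)
    show "AE x in lborel. ennreal \<bar>u x\<bar> \<le> liminf (\<lambda>k. ennreal \<bar>U (r k) x\<bar>)"
      using ae
    proof eventually_elim
      case (elim x)
      show ?case
      proof (cases "x \<in> \<Omega>")
        case True
        then have "(\<lambda>k. ennreal \<bar>U (r k) x\<bar>) \<longlonglongrightarrow> ennreal \<bar>u x\<bar>" using elim by (intro tendsto_intros) auto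
        from lim_imp_Liminf[OF sequentially_bot this] show ?thesis by simp
      qed (simp add: uz)
    qed
  qed
  also have "\<dots> \<le> liminf (\<lambda>k. \<integral>\<^sup>+x. ennreal \<bar>U (r k) x\<bar> \<partial>lborel)" by (rule nn_integral_liminf) measurable
  also have "\<dots> \<le> liminf (\<lambda>k::nat. ennreal M)" by (intro Liminf_mono always_eventually allI U1)
  also have "\<dots> = ennreal M" by (simp add: Liminf_const)
  finally have iu: "integrable lborel u" by (intro integrableI_bounded) (auto simp: le_less_trans[OF _ ennreal_less_top])
  have "(\<lambda>k. \<integral>\<^sup>+x. ennreal (?p x * \<bar>U (r k) x - u x\<bar>) \<partial>lborel) \<longlonglongrightarrow> 0"
  proof (rule order_tendstoI)
    fix a :: ennreal assume "0 < a"
    then obtain b where b: "0 < b" "b < a" using dense by blast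
    then have "b < top" by (auto simp: top.not_eq_extremum[symmetric])
    then obtain e where "b = ennreal e" by (cases b) auto
    with b have e: "0 < ennreal e" "ennreal e < a" by auto
    then have "e > 0" by simp
    obtain N where N: "\<And>k l. k \<ge> N \<Longrightarrow> l \<ge> N \<Longrightarrow> (\<integral>\<^sup>+x. ennreal (?p x * \<bar>U (r1 k) x - U (r1 l) x\<bar>) \<partial>lborel) \<le> ennreal e"
      using Cau[OF \<open>e > 0\<close>] by blast
    have "(\<integral>\<^sup>+x. ennreal (?p x * \<bar>U (r k) x - u x\<bar>) \<partial>lborel) < a" if k: "k \<ge> N" for k
    proof -
      have r2k: "r2 k \<ge> N" using seq_suble[OF r2(1), of k] k by linarith
      have "(\<integral>\<^sup>+x. ennreal (?p x * \<bar>U (r k) x - u x\<bar>) \<partial>lborel)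
        \<le> (\<integral>\<^sup>+x. liminf (\<lambda>l. ennreal (?p x * \<bar>U (r k) x - U (r l) x\<bar>)) \<partial>lborel)"
      proof (rule nn_integral_mono_AE)
        show "AE x in lborel. ennreal (?p x * \<bar>U (r k) x - u x\<bar>) \<le> liminf (\<lambda>l. ennreal (?p x * \<bar>U (r k) x - U (r l) x\<bar>))"
          using ae
        proof eventually_elim
          case (elim x)
          show ?case
          proof (cases "x \<in> \<Omega>")
            case True
            then have "(\<lambda>l. ennreal (?p x * \<bar>U (r k) x - U (r l) x\<bar>)) \<longlonglongrightarrow> ennreal (?p x * \<bar>U (r k) x - u x\<bar>)"
              using elim by (intro tendsto_intros) auto
            from lim_imp_Liminf[OF sequentially_bot this] show ?thesis by simp
          qed (simp add: infdist_zero)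
        qed
      qed
      also have "\<dots> \<le> liminf (\<lambda>l. \<integral>\<^sup>+x. ennreal (?p x * \<bar>U (r k) x - U (r l) x\<bar>) \<partial>lborel)"
        by (rule nn_integral_liminf) measurable
      also have "\<dots> \<le> liminf (\<lambda>l::nat. ennreal e)"
      proof (rule Liminf_mono)
        show "\<forall>\<^sub>F l in sequentially. (\<integral>\<^sup>+x. ennreal (?p x * \<bar>U (r k) x - U (r l) x\<bar>) \<partial>lborel) \<le> ennreal e"
        proof (rule eventually_sequentiallyI[of N])
          fix l assume "N \<le> l"
          then have "r2 l \<ge> N" using seq_suble[OF r2(1), of l] by linarith
          then show "(\<integral>\<^sup>+x. ennreal (?p x * \<bar>U (r k) x - U (r l) x\<bar>) \<partial>lborel) \<le> ennreal e"
            unfolding r_def by (intro N r2k)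
        qed
      qed
      also have "\<dots> = ennreal e" by (simp add: Liminf_const)
      finally show ?thesis using e(2) by simp
    qed
    then show "\<forall>\<^sub>F k in sequentially. (\<integral>\<^sup>+x. ennreal (?p x * \<bar>U (r k) x - u x\<bar>) \<partial>lborel) < a"
      by (auto simp: eventually_sequentially)
  qed simp
  then show ?thesis using r iu ae by blast
qed

section \<open>Lower semicontinuity\<close>

lemma cnv_mol_alt:
  fixes U :: "'a::euclidean_space \<Rightarrow> real"
  assumes \<eta>: "\<eta> > 0" and U: "integrable lborel U"
  shows "integrable lborel (\<lambda>z. mol \<eta> z * U (x - z))" and "cnv (mol \<eta>) U x = (\<integral>z. mol \<eta> z * U (x - z) \<partial>lborel)"
proof -
  note [measurable] = mol_borel[OF \<eta>]
  have [measurable]: "U \<in> borel_measurable borel" using U by auto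
  have d: "distr lborel borel (\<lambda>y. x - y) = (lborel :: 'a measure)"
    using lborel_affine[of "-1" x] by (simp add: density_1)
  have i: "integrable lborel (\<lambda>y. mol \<eta> (x - y) * U y)" using mol_kernel_integrable[OF \<eta> U, of x] by simp
  have "integrable (distr lborel borel (\<lambda>y. x - y)) (\<lambda>y. mol \<eta> (x - y) * U y)" unfolding d by (rule i)
  then show "integrable lborel (\<lambda>z. mol \<eta> z * U (x - z))" by (subst (asm) integrable_distr_eq) auto
  have "cnv (mol \<eta>) U x = (\<integral>y. mol \<eta> (x - y) * U y \<partial>distr lborel borel (\<lambda>y. x - y))"
    unfolding d cnv_def by simp
  also have "\<dots> = (\<integral>z. mol \<eta> z * U (x - z) \<partial>lborel)" by (subst integral_distr) auto
  finally show "cnv (mol \<eta>) U x = (\<integral>z. mol \<eta> z * U (x - z) \<partial>lborel)" .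
qed

lemma integrable_translate:
  fixes U :: "'a::euclidean_space \<Rightarrow> 'b::{banach, second_countable_topology}"
  shows "integrable lborel U \<Longrightarrow> integrable lborel (\<lambda>x. U (a + x))"
  using integrable_rigid[OF _ orthogonal_transformation_id, of U a] by simp

lemma nn_integral_abs_rigid:
  fixes U :: "'a::euclidean_space \<Rightarrow> real" and T :: "'a \<Rightarrow> 'a"
  assumes [measurable]: "U \<in> borel_measurable borel" and T: "orthogonal_transformation T"
  shows "(\<integral>\<^sup>+p. ennreal \<bar>U (a + T p - z)\<bar> \<partial>lborel) = (\<integral>\<^sup>+x. ennreal \<bar>U x\<bar> \<partial>lborel)"
  using nn_integral_rigid[OF _ T, of "\<lambda>x. ennreal \<bar>U x\<bar>" "a - z"] by (simp add: algebra_simps)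

text \<open>The mollification is a weighted mean of translates, and oscillation is convex. The
  oscillation of a translate on a cube is that of \<open>U\<close> on the cube moved by
  \<open>- z\<close>.\<close>

lemma osc_cnv_le:
  fixes U :: "real ^ 'n \<Rightarrow> real"
  assumes \<eta>: "\<eta> > 0" and U: "integrable lborel U" and T: "orthogonal_transformation T" and "\<delta> > 0"
  shows "ennreal (osc (ocube a T \<delta>) (cnv (mol \<eta>) U)) \<le> (\<integral>\<^sup>+z. ennreal (mol \<eta> z) * ennreal (osc (ocube (a - z) T \<delta>) U) \<partial>lborel)"
proof -
  note [measurable] = mol_borel[OF \<eta>] borel_measurable_rigid[OF T]
  have [measurable]: "U \<in> borel_measurable borel" using U by auto
  let ?w = "cnv (mol \<eta>) U" and ?n = "\<delta> ^ CARD('n)"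
  have [measurable]: "?w \<in> borel_measurable borel" by (rule cnv_mol_borel[OF \<eta> U])
  have n0: "?n > 0" using \<open>\<delta> > 0\<close> by simp
  define B where "B = (box 0 (\<chi> i. \<delta>) :: (real ^ 'n) set)"
  have [measurable]: "B \<in> sets borel" by (simp add: B_def)
  \<comment> \<open>The mean of \<open>U\<close> over the translated cube, which is Borel in
    \<open>z\<close>. By Fubini the mean of the mollification is the weighted mean of
    \<open>b\<close>, so both can be subtracted under one integral.\<close>
  define b where "b z = (\<integral>p. indicator B p * U (a + T p - z) \<partial>lborel) / ?n" for z
  have [measurable]: "b \<in> borel_measurable borel" unfolding b_def by measurable
  have b: "avg (ocube (a - z) T \<delta>) U = b z" for z
    by (subst avg_ocube) (use T \<open>\<delta> > 0\<close> in \<open>auto simp: b_def B_def set_lebesgue_integral_def algebra_simps\<close>)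
  let ?f = "\<lambda>p z. indicator B p * (mol \<eta> z * U (a + T p - z))"
  have "integrable (lborel \<Otimes>\<^sub>M lborel) (\<lambda>(z, p). ?f p z)"
  proof (rule integrableI_bounded)
    have "(\<integral>\<^sup>+q. ennreal (norm (case q of (z, p) \<Rightarrow> ?f p z)) \<partial>(lborel \<Otimes>\<^sub>M lborel))
       = (\<integral>\<^sup>+z. (\<integral>\<^sup>+p. ennreal \<bar>?f p z\<bar> \<partial>lborel) \<partial>lborel)"
      by (subst lborel.nn_integral_fst[symmetric]) auto
    also have "\<dots> \<le> (\<integral>\<^sup>+z. (\<integral>\<^sup>+p. ennreal (mol \<eta> z) * ennreal \<bar>U (a + T p - z)\<bar> \<partial>lborel) \<partial>lborel)"
      by (intro nn_integral_mono)
         (auto simp: indicator_def abs_mult mol_nonneg[OF \<eta>] ennreal_mult[symmetric])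
    also have "\<dots> = (\<integral>\<^sup>+z. ennreal (mol \<eta> z) * (\<integral>\<^sup>+x. ennreal \<bar>U x\<bar> \<partial>lborel) \<partial>(lborel :: (real ^ 'n) measure))"
      by (subst nn_integral_cmult) (auto simp: nn_integral_abs_rigid[OF _ T])
    also have "\<dots> = (\<integral>\<^sup>+x. ennreal \<bar>U x\<bar> \<partial>lborel)"
      by (simp add: nn_integral_multc nn_integral_mol[OF \<eta>])
    also have "\<dots> < \<infinity>" using U by (simp add: integrable_iff_bounded)
    finally show "(\<integral>\<^sup>+q. ennreal (norm (case q of (z, p) \<Rightarrow> ?f p z)) \<partial>(lborel \<Otimes>\<^sub>M lborel)) < \<infinity>" .
  qed measurable
  note int = this
  have "avg (ocube a T \<delta>) ?w = (\<integral>p. indicator B p * ?w (a + T p) \<partial>lborel) / ?n"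
    by (subst avg_ocube) (use T \<open>\<delta> > 0\<close> in \<open>auto simp: B_def set_lebesgue_integral_def\<close>)
  also have "(\<integral>p. indicator B p * ?w (a + T p) \<partial>lborel) = (\<integral>p. (\<integral>z. ?f p z \<partial>lborel) \<partial>lborel)"
    by (intro Bochner_Integration.integral_cong refl) (simp add: cnv_mol_alt(2)[OF \<eta> U])
  also have "\<dots> = (\<integral>z. (\<integral>p. ?f p z \<partial>lborel) \<partial>lborel)"
    by (rule lborel_pair.Fubini_integral[OF int])
  also have "\<dots> = (\<integral>z. mol \<eta> z * b z * ?n \<partial>lborel)"
  proof (intro Bochner_Integration.integral_cong refl)
    fix z
    have "(\<integral>p. ?f p z \<partial>lborel) = (\<integral>p. mol \<eta> z * (indicator B p * U (a + T p - z)) \<partial>lborel)"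
      by (intro Bochner_Integration.integral_cong refl) (simp add: ac_simps)
    then show "(\<integral>p. ?f p z \<partial>lborel) = mol \<eta> z * b z * ?n" using \<open>\<delta> > 0\<close> by (simp add: b_def)
  qed
  also have "\<dots> = (\<integral>z. mol \<eta> z * b z \<partial>lborel) * ?n" by simp
  finally have wQ: "avg (ocube a T \<delta>) ?w = (\<integral>z. mol \<eta> z * b z \<partial>lborel)" using \<open>\<delta> > 0\<close> by simp
  have ib: "integrable lborel (\<lambda>z. mol \<eta> z * b z)"
  proof (rule Bochner_Integration.integrable_bound)
    show "integrable lborel (\<lambda>z. mol \<eta> z * ((\<integral>x. \<bar>U x\<bar> \<partial>lborel) / ?n))"
      by (rule integrable_mult_left[OF mol_integrable[OF \<eta>]])
    have "\<bar>b z\<bar> \<le> (\<integral>x. \<bar>U x\<bar> \<partial>lborel) / ?n" for z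
    proof -
      have i: "integrable lborel (\<lambda>p. U (a - z + T p))" by (rule integrable_rigid[OF U T])
      have "\<bar>\<integral>p. indicator B p * U (a + T p - z) \<partial>lborel\<bar> \<le> (\<integral>p. norm (indicator B p * U (a + T p - z)) \<partial>lborel)"
        using integral_norm_bound[of lborel "\<lambda>p. indicator B p * U (a + T p - z)"] by simp
      also have "\<dots> \<le> (\<integral>p. \<bar>U (a - z + T p)\<bar> \<partial>lborel)"
      proof (rule integral_mono)
        have "integrable lborel (\<lambda>p. indicator B p *\<^sub>R U (a - z + T p))"
          by (rule integrable_mult_indicator[OF _ i]) simp
        then have "integrable lborel (\<lambda>p. indicator B p * U (a + T p - z))" by (simp add: algebra_simps)
        then show "integrable lborel (\<lambda>p. norm (indicator B p * U (a + T p - z)))" by (rule integrable_norm)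
        show "integrable lborel (\<lambda>p. \<bar>U (a - z + T p)\<bar>)" using i by simp
      qed (auto simp: indicator_def algebra_simps)
      also have "\<dots> = (\<integral>x. \<bar>U x\<bar> \<partial>lborel)" by (rule integral_rigid[OF _ T]) measurable
      finally show ?thesis using n0 by (simp add: b_def abs_divide divide_right_mono)
    qed
    then show "AE z in lborel. norm (mol \<eta> z * b z) \<le> norm (mol \<eta> z * ((\<integral>x. \<bar>U x\<bar> \<partial>lborel) / ?n))"
    proof (intro AE_I2)
      fix z assume le: "\<And>z. \<bar>b z\<bar> \<le> (\<integral>x. \<bar>U x\<bar> \<partial>lborel) / ?n"
      have "0 \<le> (\<integral>x. \<bar>U x\<bar> \<partial>lborel) / ?n" using n0 by (intro divide_nonneg_pos integral_nonneg_AE) auto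
      then show "norm (mol \<eta> z * b z) \<le> norm (mol \<eta> z * ((\<integral>x. \<bar>U x\<bar> \<partial>lborel) / ?n))"
        using mult_left_mono[OF le[of z], of "\<bar>mol \<eta> z\<bar>"]
        unfolding real_norm_def abs_mult by (simp only: abs_of_nonneg)
    qed
  qed measurable
  have pt: "ennreal \<bar>?w x - avg (ocube a T \<delta>) ?w\<bar> \<le> (\<integral>\<^sup>+z. ennreal (mol \<eta> z) * ennreal \<bar>U (x - z) - b z\<bar> \<partial>lborel)" for x
  proof -
    have i: "integrable lborel (\<lambda>z. mol \<eta> z * U (x - z) - mol \<eta> z * b z)"
      by (rule Bochner_Integration.integrable_diff[OF cnv_mol_alt(1)[OF \<eta> U] ib])
    have "?w x - avg (ocube a T \<delta>) ?w = (\<integral>z. mol \<eta> z * U (x - z) - mol \<eta> z * b z \<partial>lborel)"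
      unfolding wQ cnv_mol_alt(2)[OF \<eta> U] by (rule Bochner_Integration.integral_diff[symmetric, OF cnv_mol_alt(1)[OF \<eta> U] ib])
    then have "ennreal \<bar>?w x - avg (ocube a T \<delta>) ?w\<bar> \<le> (\<integral>\<^sup>+z. ennreal (norm (mol \<eta> z * U (x - z) - mol \<eta> z * b z)) \<partial>lborel)"
      using integral_norm_bound_ennreal[OF i] by simp
    also have "\<dots> = (\<integral>\<^sup>+z. ennreal (mol \<eta> z) * ennreal \<bar>U (x - z) - b z\<bar> \<partial>lborel)"
      by (intro nn_integral_cong)
         (simp add: right_diff_distrib[symmetric] abs_mult mol_nonneg[OF \<eta>] ennreal_mult[symmetric])
    finally show ?thesis .
  qed
  interpret Q: avg_domain "ocube a T \<delta>" ?n by (rule avg_domain_ocube[OF T \<open>\<delta> > 0\<close>])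
  have iw: "set_integrable lborel (ocube a T \<delta>) ?w"
  proof -
    have "integrable (lborel \<Otimes>\<^sub>M lborel) (\<lambda>(p, z). ?f p z)"
      using lborel_pair.integrable_product_swap[OF int] by (simp add: case_prod_unfold)
    from lborel_pair.integrable_fst[OF this]
    have i: "integrable lborel (\<lambda>p. indicator B p * ?w (a + T p))" by (simp add: cnv_mol_alt(2)[OF \<eta> U])
    have "integrable (distr lborel borel (\<lambda>p. a + T p)) (\<lambda>x. indicator (ocube a T \<delta>) x * ?w x)"
    proof (subst integrable_distr_eq)
      have "indicator (ocube a T \<delta>) (a + T p) = (indicator B p :: real)" for p
        by (simp add: indicator_def ocube_iff[OF T] B_def)
      then show "integrable lborel (\<lambda>p. indicator (ocube a T \<delta>) (a + T p) * ?w (a + T p))" using i by simp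
    qed measurable
    then show ?thesis by (simp add: distr_lborel_rigid[OF T] set_integrable_def)
  qed
  have [measurable]: "(\<lambda>y. osc (ocube y T \<delta>) U) \<in> borel_measurable borel"
    by (rule borel_measurable_osc[OF T _ \<open>\<delta> > 0\<close>]) measurable
  have "ennreal ?n * ennreal (osc (ocube a T \<delta>) ?w) = (\<integral>\<^sup>+x\<in>ocube a T \<delta>. ennreal \<bar>?w x - avg (ocube a T \<delta>) ?w\<bar> \<partial>lborel)"
    by (rule Q.nn_osc[OF _ iw]) measurable
  also have "\<dots> = (\<integral>\<^sup>+p\<in>B. ennreal \<bar>?w (a + T p) - avg (ocube a T \<delta>) ?w\<bar> \<partial>lborel)"
    unfolding B_def by (rule set_nn_integral_ocube[OF T]) measurable
  also have "\<dots> \<le> (\<integral>\<^sup>+p. (\<integral>\<^sup>+z. ennreal (mol \<eta> z) * (ennreal \<bar>U (a + T p - z) - b z\<bar> * indicator B p) \<partial>lborel) \<partial>lborel)"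
  proof (intro nn_integral_mono)
    fix p
    have "ennreal \<bar>?w (a + T p) - avg (ocube a T \<delta>) ?w\<bar> * indicator B p
      \<le> (\<integral>\<^sup>+z. ennreal (mol \<eta> z) * ennreal \<bar>U (a + T p - z) - b z\<bar> \<partial>lborel) * indicator B p"
      by (intro mult_right_mono pt) auto
    also have "\<dots> = (\<integral>\<^sup>+z. ennreal (mol \<eta> z) * (ennreal \<bar>U (a + T p - z) - b z\<bar> * indicator B p) \<partial>lborel)"
      by (subst nn_integral_multc[symmetric]) (auto simp: mult.assoc)
    finally show "ennreal \<bar>?w (a + T p) - avg (ocube a T \<delta>) ?w\<bar> * indicator B p
      \<le> (\<integral>\<^sup>+z. ennreal (mol \<eta> z) * (ennreal \<bar>U (a + T p - z) - b z\<bar> * indicator B p) \<partial>lborel)" .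
  qed
  also have "\<dots> = (\<integral>\<^sup>+z. (\<integral>\<^sup>+p. ennreal (mol \<eta> z) * (ennreal \<bar>U (a + T p - z) - b z\<bar> * indicator B p) \<partial>lborel) \<partial>lborel)"
    by (rule lborel_pair.Fubini') measurable
  also have "\<dots> = (\<integral>\<^sup>+z. ennreal ?n * (ennreal (mol \<eta> z) * ennreal (osc (ocube (a - z) T \<delta>) U)) \<partial>lborel)"
  proof (intro nn_integral_cong)
    fix z
    interpret Z: avg_domain "ocube (a - z) T \<delta>" ?n by (rule avg_domain_ocube[OF T \<open>\<delta> > 0\<close>])
    have "(\<integral>\<^sup>+p. ennreal \<bar>U (a + T p - z) - b z\<bar> * indicator B p \<partial>lborel)
       = (\<integral>\<^sup>+x\<in>ocube (a - z) T \<delta>. ennreal \<bar>U x - b z\<bar> \<partial>lborel)"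
      unfolding B_def using set_nn_integral_ocube[OF T, of "\<lambda>x. ennreal \<bar>U x - b z\<bar>" "a - z" \<delta>]
      by (simp add: algebra_simps)
    also have "\<dots> = ennreal ?n * ennreal (osc (ocube (a - z) T \<delta>) U)"
      using Z.nn_osc[OF _ integrable_imp_set_integrable[OF U]] by (simp add: b)
    finally have eq: "(\<integral>\<^sup>+p. ennreal \<bar>U (a + T p - z) - b z\<bar> * indicator B p \<partial>lborel)
       = ennreal ?n * ennreal (osc (ocube (a - z) T \<delta>) U)" .
    show "(\<integral>\<^sup>+p. ennreal (mol \<eta> z) * (ennreal \<bar>U (a + T p - z) - b z\<bar> * indicator B p) \<partial>lborel)
      = ennreal ?n * (ennreal (mol \<eta> z) * ennreal (osc (ocube (a - z) T \<delta>) U))"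
    proof -
      have "(\<integral>\<^sup>+p. ennreal (mol \<eta> z) * (ennreal \<bar>U (a + T p - z) - b z\<bar> * indicator B p) \<partial>lborel)
        = ennreal (mol \<eta> z) * (\<integral>\<^sup>+p. ennreal \<bar>U (a + T p - z) - b z\<bar> * indicator B p \<partial>lborel)"
        by (rule nn_integral_cmult) measurable
      with eq show ?thesis by (simp only: mult.left_commute)
    qed
  qed
  also have "\<dots> = ennreal ?n * (\<integral>\<^sup>+z. ennreal (mol \<eta> z) * ennreal (osc (ocube (a - z) T \<delta>) U) \<partial>lborel)"
    by (rule nn_integral_cmult) measurable
  finally show ?thesis using \<open>\<delta> > 0\<close> by (subst (asm) ennreal_mult_le_mult_iff) auto
qed

text \<open>For each \<open>z\<close> shorter than \<eta> the whole family, moved by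
  \<open>- z\<close>, is an admissible family in \<Omega>, hence bounded by \<open>K\<close>; the
  weights integrate to 1.\<close>

lemma K_cnv_le:
  fixes U :: "real ^ 'n \<Rightarrow> real"
  assumes \<eta>: "\<eta> > 0" and U: "integrable lborel U" and "\<delta> > 0" and S: "\<And>x. x \<in> S \<Longrightarrow> ball x \<eta> \<subseteq> \<Omega>"
  shows "K \<delta> S (cnv (mol \<eta>) U) \<le> K \<delta> \<Omega> U"
proof (rule K_le)
  note [measurable] = mol_borel[OF \<eta>]
  have [measurable]: "U \<in> borel_measurable borel" using U by auto
  fix \<G> assume \<G>: "finite \<G>" "\<G> \<in> cube_families \<delta> S"
  have sub: "Q \<subseteq> S" if "Q \<in> \<G>" for Q using that \<G>(2) by (auto simp: cube_families_def)
  have disj: "Q \<inter> Q' = {}" if "Q \<in> \<G>" "Q' \<in> \<G>" "Q \<noteq> Q'" for Q Q'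
    using that \<G>(2) by (auto simp: cube_families_def pairwise_def disjnt_def)
  have "\<forall>Q\<in>\<G>. \<exists>a T. Q = ocube a T \<delta> \<and> orthogonal_transformation T"
    using \<G>(2) by (auto simp: cube_families_def cubes_ocube)
  then obtain a T where aT: "\<And>Q. Q \<in> \<G> \<Longrightarrow> Q = ocube (a Q) (T Q) \<delta>" "\<And>Q. Q \<in> \<G> \<Longrightarrow> orthogonal_transformation (T Q)"
    by metis
  let ?c = "ennreal (\<delta> ^ (CARD('n) - 1))" and ?w = "cnv (mol \<eta>) U"
  let ?Q = "\<lambda>z Q. ocube (a Q - z) (T Q) \<delta>"
  have m: "(\<lambda>z. ennreal (osc (?Q z Q) U)) \<in> borel_measurable borel" if "Q \<in> \<G>" for Q
  proof -
    have [measurable]: "(\<lambda>y. osc (ocube y (T Q) \<delta>) U) \<in> borel_measurable borel"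
      by (rule borel_measurable_osc[OF aT(2)[OF that] _ \<open>\<delta> > 0\<close>]) measurable
    show ?thesis by measurable
  qed
  have shift: "x + z \<in> Q" if "x \<in> ?Q z Q" "Q \<in> \<G>" for x z Q
  proof -
    have "x + z \<in> ocube (a Q) (T Q) \<delta>" using that(1) by (auto simp: ocube_def)
    then show ?thesis using aT(1)[OF that(2)] by simp
  qed
  have "?c * (\<Sum>Q\<in>\<G>. ennreal (osc Q ?w)) \<le> ?c * (\<Sum>Q\<in>\<G>. \<integral>\<^sup>+z. ennreal (mol \<eta> z) * ennreal (osc (?Q z Q) U) \<partial>lborel)"
  proof (intro mult_left_mono sum_mono)
    fix Q assume "Q \<in> \<G>"
    then show "ennreal (osc Q ?w) \<le> (\<integral>\<^sup>+z. ennreal (mol \<eta> z) * ennreal (osc (?Q z Q) U) \<partial>lborel)"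
      using osc_cnv_le[OF \<eta> U aT(2) \<open>\<delta> > 0\<close>, of Q "a Q"] aT(1)[of Q] by simp
  qed simp
  also have "\<dots> = ?c * (\<integral>\<^sup>+z. (\<Sum>Q\<in>\<G>. ennreal (mol \<eta> z) * ennreal (osc (?Q z Q) U)) \<partial>lborel)"
    using m by (subst nn_integral_sum) auto
  also have "\<dots> = (\<integral>\<^sup>+z. ?c * (\<Sum>Q\<in>\<G>. ennreal (mol \<eta> z) * ennreal (osc (?Q z Q) U)) \<partial>lborel)"
    using m by (intro nn_integral_cmult[symmetric]) auto
  also have "\<dots> \<le> (\<integral>\<^sup>+z. ennreal (mol \<eta> z) * K \<delta> \<Omega> U \<partial>(lborel :: (real ^ 'n) measure))"
  proof (intro nn_integral_mono)
    fix z :: "real ^ 'n"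
    show "?c * (\<Sum>Q\<in>\<G>. ennreal (mol \<eta> z) * ennreal (osc (?Q z Q) U)) \<le> ennreal (mol \<eta> z) * K \<delta> \<Omega> U"
    proof (cases "norm z < \<eta>")
      case True
      have "?c * (\<Sum>Q\<in>\<G>. ennreal (mol \<eta> z) * ennreal (osc (?Q z Q) U)) = ennreal (mol \<eta> z) * (?c * (\<Sum>Q\<in>\<G>. ennreal (osc (?Q z Q) U)))"
        by (simp add: sum_distrib_left ac_simps)
      also have "\<dots> \<le> ennreal (mol \<eta> z) * K \<delta> \<Omega> U"
      proof (intro mult_left_mono K_ge_family[OF \<G>(1) \<open>\<delta> > 0\<close>])
        show "?Q z Q \<in> cubes \<delta>" if "Q \<in> \<G>" for Q using aT(2)[OF that] by (auto simp: cubes_ocube)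
        show "?Q z Q \<subseteq> \<Omega>" if "Q \<in> \<G>" for Q
        proof
          fix x assume "x \<in> ?Q z Q"
          then have "x + z \<in> S" using shift sub that by blast
          then have "ball (x + z) \<eta> \<subseteq> \<Omega>" by (rule S)
          moreover have "x \<in> ball (x + z) \<eta>" using True by (simp add: dist_norm)
          ultimately show "x \<in> \<Omega>" by blast
        qed
        show "?Q z Q \<inter> ?Q z Q' = {}" if "Q \<in> \<G>" "Q' \<in> \<G>" "Q \<noteq> Q'" for Q Q'
          using shift disj[OF that] that by blast
      qed simp
      finally show ?thesis .
    next
      case False
      then show ?thesis using mol_zero[OF \<eta>, of z] by simp
    qed
  qed
  also have "\<dots> = K \<delta> \<Omega> U" by (simp add: nn_integral_multc nn_integral_mol[OF \<eta>])
  finally show "?c * (\<Sum>Q\<in>\<G>. ennreal (osc Q ?w)) \<le> K \<delta> \<Omega> U" .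
qed

section \<open>Integration by parts for mollified functions\<close>

lemma integral_derivative_zero:
  fixes g :: "'a::euclidean_space \<Rightarrow> real"
  assumes der: "\<And>x. (g has_derivative D x) (at x)" and cont: "continuous_on UNIV (\<lambda>x. D x e)"
    and supp: "\<And>x. norm x \<ge> R \<Longrightarrow> g x = 0"
  shows "(\<integral>x. D x e \<partial>lborel) = 0"
proof -
  have cg: "continuous_on UNIV g" using der by (meson continuous_at_imp_continuous_on has_derivative_continuous)
  have [measurable]: "g \<in> borel_measurable borel" "(\<lambda>x. D x e) \<in> borel_measurable borel"
    using cg cont by (auto intro: borel_measurable_continuous_onI)
  have dline: "((\<lambda>t. g (x + t *\<^sub>R e)) has_real_derivative D (x + t *\<^sub>R e) e) (at t)" for x t
  proof -
    have "((\<lambda>t. x + t *\<^sub>R e) has_derivative (\<lambda>s. s *\<^sub>R e)) (at t)"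
      by (auto intro!: derivative_eq_intros)
    from has_derivative_compose[OF this der]
    have "((\<lambda>t. g (x + t *\<^sub>R e)) has_derivative (\<lambda>s. D (x + t *\<^sub>R e) (s *\<^sub>R e))) (at t)" .
    moreover have "D (x + t *\<^sub>R e) (s *\<^sub>R e) = D (x + t *\<^sub>R e) e * s" for s
      using linear_cmul[OF has_derivative_linear[OF der]] by (simp add: mult.commute)
    ultimately show ?thesis by (simp add: has_field_derivative_def)
  qed
  obtain B where B: "B > 0" "\<And>x. x \<in> cball 0 (R + 2 * norm e + 1) \<Longrightarrow> \<bar>D x e\<bar> \<le> B"
  proof -
    have "compact ((\<lambda>x. D x e) ` cball 0 (R + 2 * norm e + 1))"
      by (intro compact_continuous_image continuous_on_subset[OF cont]) auto
    then have "bounded ((\<lambda>x. D x e) ` cball 0 (R + 2 * norm e + 1))" by (rule compact_imp_bounded)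
    then show thesis using that unfolding bounded_pos by (metis image_eqI real_norm_def)
  qed
  let ?t = "\<lambda>k::nat. 1 / real (Suc k)"
  let ?f = "\<lambda>k x. (g (?t k *\<^sub>R e + x) - g x) / ?t k"
  \<comment> \<open>Since \<open>?t k\<close> is at most 1, outside this ball both \<open>x\<close>
    and \<open>?t k *\<^sub>R e + x\<close> lie where \<open>g\<close> vanishes.\<close>
  let ?C = "cball 0 (R + norm e) :: 'a set"
  have C: "integrable lborel (indicator ?C :: 'a \<Rightarrow> real)"
    using emeasure_lborel_cball_finite[of "0::'a" "R + norm e"] by (intro integrable_real_indicator) (auto simp: less_top)
  obtain G where G: "\<And>x. norm (g x) \<le> G" using bounded_compact_support[OF cg supp] by metis
  have ig: "integrable lborel g"
  proof (rule Bochner_Integration.integrable_bound)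
    show "integrable lborel (\<lambda>x. G * indicator ?C x)" using C by simp
    show "AE x in lborel. norm (g x) \<le> norm (G * indicator ?C x)"
    proof (rule AE_I2)
      fix x show "norm (g x) \<le> norm (G * indicator ?C x)"
      proof (cases "norm x \<le> R + norm e")
        case True
        then show ?thesis using G[of x] by simp
      next
        case False
        then have "R \<le> norm x" using norm_ge_zero[of e] by linarith
        then show ?thesis using supp[of x] by simp
      qed
    qed
  qed measurable
  \<comment> \<open>By translation invariance a difference quotient of an integrable function has
    integral 0; dominated convergence hands this on to the derivative.\<close>
  have z: "(\<integral>x. ?f k x \<partial>lborel) = 0" for k
  proof -
    have "(\<integral>x. g (?t k *\<^sub>R e + x) \<partial>lborel) = (\<integral>x. g x \<partial>lborel)"
      using integral_rigid[OF _ orthogonal_transformation_id, of g "?t k *\<^sub>R e"] by simp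
    then show ?thesis
      by (subst integral_divide_zero, subst Bochner_Integration.integral_diff[OF integrable_translate[OF ig] ig]) simp
  qed
  have le: "\<bar>?f k x\<bar> \<le> B * indicator ?C x" for k x
  proof (cases "norm x \<le> R + norm e")
    case True
    have t: "?t k > 0" "?t k \<le> 1" by auto
    have "\<exists>s>0. s < ?t k \<and> g (x + ?t k *\<^sub>R e) - g (x + 0 *\<^sub>R e) = (?t k - 0) * D (x + s *\<^sub>R e) e"
      by (rule MVT2[OF t(1)]) (use dline in auto)
    then obtain s where s: "0 < s" "s < ?t k" "g (?t k *\<^sub>R e + x) - g x = ?t k * D (x + s *\<^sub>R e) e"
      by (auto simp: add.commute)
    have "norm (x + s *\<^sub>R e) \<le> norm x + s * norm e" using norm_triangle_ineq[of x "s *\<^sub>R e"] s(1) by simp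
    also have "s * norm e \<le> 1 * norm e"
      by (intro mult_right_mono less_imp_le[OF less_le_trans[OF s(2) t(2)]]) simp
    finally have "\<bar>D (x + s *\<^sub>R e) e\<bar> \<le> B" using True by (intro B(2)) simp
    moreover have "?f k x = D (x + s *\<^sub>R e) e" using s(3) by simp
    ultimately show ?thesis using True by simp
  next
    case False
    have "?t k * norm e \<le> 1 * norm e" by (intro mult_right_mono) auto
    then have "norm (?t k *\<^sub>R e) \<le> norm e" by simp
    then have "norm (?t k *\<^sub>R e + x) \<ge> norm x - norm e"
      using norm_triangle_ineq4[of "?t k *\<^sub>R e + x" "?t k *\<^sub>R e"] by simp
    then have "R \<le> norm (?t k *\<^sub>R e + x)" "R \<le> norm x" using False norm_ge_zero[of e] by linarith+
    then have "g (?t k *\<^sub>R e + x) = 0" "g x = 0" by (auto intro!: supp)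
    then show ?thesis using B(1) by (simp add: indicator_def)
  qed
  have "(\<lambda>k. \<integral>x. ?f k x \<partial>lborel) \<longlonglongrightarrow> (\<integral>x. D x e \<partial>lborel)"
  proof (rule integral_dominated_convergence[where w = "\<lambda>x. B * indicator ?C x"])
    show "AE x in lborel. (\<lambda>k. ?f k x) \<longlonglongrightarrow> D x e"
    proof (rule AE_I2)
      fix x
      have "(\<lambda>t. (g (x + (0 + t) *\<^sub>R e) - g (x + 0 *\<^sub>R e)) / t) \<midarrow>0\<rightarrow> D (x + 0 *\<^sub>R e) e"
        using dline[of x 0] unfolding DERIV_def .
      then have "(\<lambda>t. (g (t *\<^sub>R e + x) - g x) / t) \<midarrow>0\<rightarrow> D x e" by (simp add: add.commute)
      moreover have "filterlim ?t (at 0) sequentially"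
        using LIMSEQ_inverse_real_of_nat by (auto simp: filterlim_at inverse_eq_divide)
      ultimately show "(\<lambda>k. ?f k x) \<longlonglongrightarrow> D x e" by (rule filterlim_compose)
    qed
    show "integrable lborel (\<lambda>x. B * indicator ?C x)" using C by simp
    show "AE x in lborel. norm (?f k x) \<le> B * indicator ?C x" for k using le by (intro AE_I2) simp
  qed measurable
  then show ?thesis unfolding z by (simp add: LIMSEQ_const_iff)
qed

text \<open>\<open>integral_derivative_zero\<close> is applied to the product of \<open>w\<close>
  with each component of \<phi>, in the direction of that component, and the results are
  summed.\<close>

lemma integral_divergence_by_parts:
  fixes w :: "real ^ 'n \<Rightarrow> real"
  assumes \<phi>: "\<phi> \<in> test_fields A" and der: "\<And>x. (w has_derivative (\<lambda>h. G x \<bullet> h)) (at x)" and G: "continuous_on UNIV G"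
    and w: "integrable lborel w"
  shows "(\<integral>x. w x * divergence \<phi> x \<partial>lborel) = - (\<integral>x. G x \<bullet> \<phi> x \<partial>lborel)" and "integrable lborel (\<lambda>x. G x \<bullet> \<phi> x)"
proof -
  have c1: "Ck_on 1 UNIV \<phi>" and cS: "compact (closure {x. \<phi> x \<noteq> 0})" using \<phi> by (auto simp: test_fields_def)
  have cw: "continuous_on UNIV w" using der by (meson continuous_at_imp_continuous_on has_derivative_continuous)
  have c\<phi>: "continuous_on UNIV \<phi>" using Ck1_derivative(1)[OF c1] by (meson continuous_at_imp_continuous_on has_derivative_continuous)
  obtain R where R: "\<And>x. x \<in> closure {x. \<phi> x \<noteq> 0} \<Longrightarrow> norm x < R"
    using compact_imp_bounded[OF cS] unfolding bounded_pos_less by blast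
  have z: "\<phi> x = 0" if "norm x \<ge> R" for x
    using R[of x] that closure_subset[of "{x. \<phi> x \<noteq> 0}"] by force
  let ?F = "\<lambda>x. frechet_derivative \<phi> (at x)"
  define D where "D i x h = (G x \<bullet> h) * \<phi> x $ i + w x * ?F x h $ i" for i x h
  have dD: "((\<lambda>x. w x * \<phi> x $ i) has_derivative D i x) (at x)" for i x
  proof -
    have "((\<lambda>x. \<phi> x $ i) has_derivative (\<lambda>h. ?F x h $ i)) (at x)"
      by (rule bounded_linear.has_derivative[OF bounded_linear_vec_nth Ck1_derivative(1)[OF c1]])
    from has_derivative_mult[OF der this] show ?thesis by (simp add: D_def[abs_def] add.commute)
  qed
  have cD: "continuous_on UNIV (\<lambda>x. D i x (axis i 1))" for i
    unfolding D_def by (intro continuous_intros G c\<phi> cw Ck1_derivative(2)[OF c1])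
  have zero: "(\<integral>x. D i x (axis i 1) \<partial>lborel) = 0" for i
    by (rule integral_derivative_zero[OF dD cD, of R]) (simp add: z)
  have Fz: "?F x h = 0" if "norm x \<ge> R" for x h
  proof -
    have "x \<notin> closure {x. \<phi> x \<noteq> 0}" using R[of x] that by auto
    then have "(\<phi> has_derivative (\<lambda>h. 0)) (at x)"
      by (intro has_derivative_transform_within_open[OF has_derivative_const[of 0] open_Compl[OF closed_closure[of "{x. \<phi> x \<noteq> 0}"]]])
         (use closure_subset[of "{x. \<phi> x \<noteq> 0}"] in auto)
    then have "?F x = (\<lambda>h. 0)" using frechet_derivative_at by metis
    then show ?thesis by simp
  qed
  have cpt_int: "integrable lborel f" if f: "continuous_on UNIV f" "\<And>x. norm x \<ge> R \<Longrightarrow> f x = 0" for f :: "real ^ 'n \<Rightarrow> real"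
  proof -
    obtain B where B: "\<And>x. norm (f x) \<le> B" using bounded_compact_support[OF f] by metis
    have "integrable lborel (\<lambda>x. indicator (cball 0 R) x *\<^sub>R f x)"
      by (rule integrable_bounded_set[OF _ _ _ B]) (use f in \<open>auto intro: borel_measurable_continuous_onI\<close>)
    moreover have "(\<lambda>x. indicator (cball 0 R) x *\<^sub>R f x) = f"
    proof
      fix x show "indicator (cball 0 R) x *\<^sub>R f x = f x"
        using f(2)[of x] by (cases "norm x \<le> R") auto
    qed
    ultimately show ?thesis by (simp only:)
  qed
  show iG: "integrable lborel (\<lambda>x. G x \<bullet> \<phi> x)"
    by (rule cpt_int) (auto simp: z intro!: continuous_intros G c\<phi>)
  have iD: "integrable lborel (\<lambda>x. D i x (axis i 1))" for i
    by (rule cpt_int[OF cD]) (simp add: D_def z Fz)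
  have iw: "integrable lborel (\<lambda>x. w x * divergence \<phi> x)" by (rule divergence_times_integrable[OF \<phi> w])
  have "(\<integral>x. w x * divergence \<phi> x + G x \<bullet> \<phi> x \<partial>lborel) = (\<integral>x. (\<Sum>i\<in>UNIV. D i x (axis i 1)) \<partial>lborel)"
  proof (intro Bochner_Integration.integral_cong refl)
    fix x
    have "(\<Sum>i\<in>UNIV. D i x (axis i 1)) = (\<Sum>i\<in>UNIV. G x $ i * \<phi> x $ i) + w x * divergence \<phi> x"
      by (simp add: D_def sum.distrib divergence_def sum_distrib_left inner_axis)
    then show "w x * divergence \<phi> x + G x \<bullet> \<phi> x = (\<Sum>i\<in>UNIV. D i x (axis i 1))"
      by (simp add: inner_vec_def)
  qed
  also have "\<dots> = 0" by (simp add: Bochner_Integration.integral_sum[OF iD] zero)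
  finally have "(\<integral>x. w x * divergence \<phi> x \<partial>lborel) + (\<integral>x. G x \<bullet> \<phi> x \<partial>lborel) = 0"
    by (simp add: Bochner_Integration.integral_add[OF iw iG])
  then show "(\<integral>x. w x * divergence \<phi> x \<partial>lborel) = - (\<integral>x. G x \<bullet> \<phi> x \<partial>lborel)" by simp
qed

section \<open>Lower bound for \<open>K\<close> on grid cells\<close>

lemma finite_cells:
  fixes S :: "(real ^ 'n) set"
  assumes "bounded S" "s > 0"
  shows "finite {z. cell s z \<inter> S \<noteq> {}}"
proof -
  obtain R where R: "\<And>x. x \<in> S \<Longrightarrow> norm x \<le> R" using \<open>bounded S\<close> by (auto simp: bounded_iff)
  let ?I = "{\<lfloor>- R / s\<rfloor>..\<lfloor>R / s\<rfloor>}"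
  have "{z. cell s z \<inter> S \<noteq> {}} \<subseteq> (\<lambda>f. \<chi> i. f i) ` (PiE UNIV (\<lambda>_::'n. ?I))"
  proof
    fix z assume "z \<in> {z. cell s z \<inter> S \<noteq> {}}"
    then obtain x where x: "x \<in> cell s z" "x \<in> S" by blast
    have "z $ i \<in> ?I" for i
    proof -
      have zi: "z $ i = \<lfloor>x $ i / s\<rfloor>" using x(1) cell_unique[OF \<open>s > 0\<close>, of x z] by simp
      have "\<bar>x $ i\<bar> \<le> R" using component_le_norm_cart[of x i] R[OF x(2)] by linarith
      then have "- R \<le> x $ i" "x $ i \<le> R" by linarith+
      then have "- R / s \<le> x $ i / s" "x $ i / s \<le> R / s" using \<open>s > 0\<close> by (intro divide_right_mono; simp)+
      then show ?thesis by (auto simp: zi intro: floor_mono)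
    qed
    then have "(\<lambda>i. z $ i) \<in> PiE UNIV (\<lambda>_. ?I)" by auto
    moreover have "z = (\<chi> i. z $ i)" by simp
    ultimately show "z \<in> (\<lambda>f. \<chi> i. f i) ` (PiE UNIV (\<lambda>_. ?I))" by (metis (no_types, lifting) imageI)
  qed
  moreover have "finite ((\<lambda>f. (\<chi> i. f i) :: int ^ 'n) ` (PiE UNIV (\<lambda>_::'n. ?I)))"
    by (intro finite_imageI finite_PiE) auto
  ultimately show ?thesis by (rule finite_subset)
qed

lemma emeasure_cell_translate:
  assumes "s > 0"
  shows "emeasure lborel (cell s z :: (real ^ 'n) set) = ennreal (s ^ CARD('n))"
proof -
  have "emeasure lborel (cell s z) = (\<integral>\<^sup>+x. indicator (cell s z) (lattice_point s z + x) \<partial>lborel)"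
    using nn_integral_lborel_translate[of "indicator (cell s z)" "lattice_point s z"] by simp
  also have "\<dots> = (\<integral>\<^sup>+x. indicator (cell s 0) (x :: real ^ 'n) \<partial>lborel)"
    by (intro nn_integral_cong) (simp add: indicator_def cell_translate)
  finally show ?thesis using assms by (simp add: emeasure_cell)
qed

lemma cell_diam:
  fixes x y :: "real ^ 'n"
  assumes "x \<in> cell s z" "y \<in> cell s z"
  shows "norm (x - y) \<le> sqrt CARD('n) * s"
proof (rule norm_vec_le_sqrt)
  fix i
  have "s * of_int (z $ i) \<le> x $ i" "x $ i < s * of_int (z $ i) + s" "s * of_int (z $ i) \<le> y $ i" "y $ i < s * of_int (z $ i) + s"
    using assms by (auto simp: cell_def)
  then show "\<bar>(x - y) $ i\<bar> \<le> s" by (simp add: abs_le_iff)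
qed

lemma open_cell_subset: "ocube (lattice_point s z) (\<lambda>v. v) s \<subseteq> cell s z"
proof
  fix x assume "x \<in> ocube (lattice_point s z) (\<lambda>v. v) s"
  then have "\<And>i. 0 < (x - lattice_point s z) $ i \<and> (x - lattice_point s z) $ i < s"
    by (simp add: ocube_id_iff mem_box_cube)
  then have "s * of_int (z $ i) < x $ i \<and> x $ i < s * of_int (z $ i) + s" for i
    by (simp add: lattice_point_def less_diff_eq diff_less_eq add.commute)
  then show "x \<in> cell s z" by (auto simp: cell_def intro: less_imp_le)
qed

lemma emeasure_inner_cell_ge:
  fixes p :: "real ^ 'n"
  assumes "t > 0" "2 * t < s"
  shows "ennreal ((s - 2 * t) ^ CARD('n)) \<le> emeasure lborel {y. ball y t \<subseteq> ocube p (\<lambda>v. v) s}"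
proof -
  let ?C = "ocube (p + (\<chi> i. t)) (\<lambda>v. v) (s - 2 * t)"
  have "?C \<subseteq> {y. ball y t \<subseteq> ocube p (\<lambda>v. v) s}"
  proof (intro subsetI CollectI)
    fix y x assume y: "y \<in> ?C" and x: "x \<in> ball y t"
    have "0 < (x - p) $ i \<and> (x - p) $ i < s" for i
    proof -
      have "0 < (y - (p + (\<chi> i. t))) $ i \<and> (y - (p + (\<chi> i. t))) $ i < s - 2 * t"
        using y by (simp add: ocube_id_iff mem_box_cube)
      moreover have "\<bar>(y - x) $ i\<bar> < t"
        using x component_le_norm_cart[of "y - x" i] by (simp add: dist_norm)
      ultimately show ?thesis by (simp add: abs_less_iff)
    qed
    then show "x \<in> ocube p (\<lambda>v. v) s" by (simp add: ocube_id_iff mem_box_cube)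
  qed
  then have "emeasure lborel ?C \<le> emeasure lborel {y. ball y t \<subseteq> ocube p (\<lambda>v. v) s}"
    using closed_inner[of t "ocube p (\<lambda>v. v) s"] by (intro emeasure_mono) auto
  then show ?thesis using assms by (simp add: emeasure_ocube[OF orth_id])
qed

text \<open>
  On a grid cell the gradient \<open>G\<close> is nearly constant, so cubes aligned with its value
  at the centre detect it with the sharp factor \<open>1/4\<close>.
\<close>

lemma K_ge_cell:
  fixes w :: "real ^ 'n \<Rightarrow> real"
  assumes "\<delta> > 0" "s > 0" and w: "integrable lborel w"
    and der: "\<And>x. (w has_derivative (\<lambda>h. G x \<bullet> h)) (at x)"
    and G: "\<And>x. x \<in> ocube p (\<lambda>v. v) s \<Longrightarrow> norm (G x - \<xi>) \<le> \<omega>" and "0 \<le> \<omega>"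
    and small: "4 * (sqrt CARD('n) * \<delta>) < s"
  shows "ennreal ((s - 4 * (sqrt CARD('n) * \<delta>)) ^ CARD('n)) * ennreal (norm \<xi> / 4 - 2 * (\<omega> * sqrt CARD('n)))
    \<le> K \<delta> (ocube p (\<lambda>v. v) s) w"
proof -
  let ?A = "ocube p (\<lambda>v. v) s" and ?s = "sqrt CARD('n)"
  have [measurable]: "w \<in> borel_measurable borel" using w by auto
  \<comment> \<open>An arbitrary coordinate axis, to be rotated onto the direction of \<xi>.\<close>
  obtain k :: 'n where True by simp
  obtain T :: "real ^ 'n \<Rightarrow> real ^ 'n"
    where T: "orthogonal_transformation T" "\<xi> = norm \<xi> *\<^sub>R T (axis k 1)"
  proof (cases "\<xi> = 0")
    case True
    then show thesis using that[OF orth_id] by simp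
  next
    case False
    have n1: "norm (axis k 1 :: real ^ 'n) = 1" "norm (\<xi> /\<^sub>R norm \<xi>) = 1" using False by (simp_all add: norm_axis_1)
    show thesis
    proof (rule orthogonal_transformation_exists_1[OF n1])
      fix f :: "real ^ 'n \<Rightarrow> real ^ 'n"
      assume f: "orthogonal_transformation f" "f (axis k 1) = \<xi> /\<^sub>R norm \<xi>"
      show thesis by (rule that[OF f(1)]) (use f(2) False in simp)
    qed
  qed
  \<comment> \<open>Larger than the distance from a corner to any point of its cube, so cubes with
    corner in \<open>Y\<close> stay in the cell.\<close>
  define t where "t = 2 * (?s * \<delta>)"
  have t: "t > 0" "2 * t < s" using small \<open>\<delta> > 0\<close> by (auto simp: t_def)
  define Y where "Y = {y. ball y t \<subseteq> ?A}"
  have Ym[measurable]: "Y \<in> sets borel" unfolding Y_def by (rule borel_closed[OF closed_inner])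
  have YQ: "ocube y T \<delta> \<subseteq> ?A" if "y \<in> Y" for y
  proof
    fix x assume "x \<in> ocube y T \<delta>"
    then have "norm (x - y) \<le> ?s * \<delta>" by (rule ocube_near[OF T(1)])
    then have "norm (x - y) < t" using t(1) unfolding t_def by linarith
    then have "x \<in> ball y t" by (simp add: dist_norm norm_minus_commute)
    then show "x \<in> ?A" using that by (auto simp: Y_def)
  qed
  let ?v = "norm \<xi> / 4 - 2 * (\<omega> * ?s)"
  have lower: "\<delta> * ?v \<le> osc (ocube y T \<delta>) w" if "y \<in> Y" for y
  proof -
    have "\<bar>osc (ocube y T \<delta>) w - osc (ocube y T \<delta>) (\<lambda>x. w (ctr y T \<delta>) + \<xi> \<bullet> (x - ctr y T \<delta>))\<bar> \<le> 2 * (\<omega> * (?s * \<delta>))"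
    proof (rule osc_C1_affine[OF T(1) \<open>\<delta> > 0\<close> _ _ der])
      show "set_integrable lborel (ocube y T \<delta>) w"
        by (rule integrable_imp_set_integrable[OF w]) (simp add: ocube_borel[OF T(1)])
      show "norm (G x - \<xi>) \<le> \<omega>" if "x \<in> ocube y T \<delta>" for x
        using YQ[OF \<open>y \<in> Y\<close>] that by (intro G) auto
    qed measurable
    moreover have "osc (ocube y T \<delta>) (\<lambda>x. w (ctr y T \<delta>) + \<xi> \<bullet> (x - ctr y T \<delta>)) = \<delta> / 4 * norm \<xi>"
      using osc_affine_aligned[OF T(1) \<open>\<delta> > 0\<close>, of "norm \<xi>" y "w (ctr y T \<delta>)" k] T(2) by simp
    ultimately show ?thesis by (simp add: abs_le_iff algebra_simps)
  qed
  have "ennreal \<delta> * (ennreal ((s - 2 * t) ^ CARD('n)) * ennreal ?v) \<le> ennreal \<delta> * (emeasure lborel Y * ennreal ?v)"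
    unfolding Y_def by (intro mult_left_mono mult_right_mono emeasure_inner_cell_ge t) auto
  also have "\<dots> = (\<integral>\<^sup>+y\<in>Y. ennreal (\<delta> * ?v) \<partial>lborel)"
  proof -
    have "(\<integral>\<^sup>+y\<in>Y. ennreal (\<delta> * ?v) \<partial>lborel) = ennreal (\<delta> * ?v) * emeasure lborel Y"
      by (rule nn_integral_cmult_indicator) simp
    also have "\<dots> = (ennreal \<delta> * ennreal ?v) * emeasure lborel Y"
      using \<open>\<delta> > 0\<close> by (subst ennreal_mult') auto
    finally show ?thesis by (simp only: ac_simps)
  qed
  also have "\<dots> \<le> (\<integral>\<^sup>+y\<in>Y. ennreal (osc (ocube y T \<delta>) w) \<partial>lborel)"
    using lower by (intro nn_integral_mono) (auto simp: indicator_def intro: ennreal_leI)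
  also have "\<dots> \<le> ennreal \<delta> * K \<delta> ?A w"
    by (rule nn_integral_osc_le_K[OF T(1) _ \<open>\<delta> > 0\<close> Ym YQ]) auto
  finally show ?thesis
    using \<open>\<delta> > 0\<close> by (subst (asm) ennreal_mult_le_mult_iff) (auto simp: t_def)
qed

section \<open>Passage to the limit in the gradients\<close>

lemma cnv_mol_integrable:
  fixes U :: "'a::euclidean_space \<Rightarrow> real"
  assumes \<eta>: "\<eta> > 0" and U: "integrable lborel U"
  shows "integrable lborel (cnv (mol \<eta>) U)"
proof -
  have [measurable]: "U \<in> borel_measurable borel" using U by auto
  have [measurable]: "cnv (mol \<eta>) U \<in> borel_measurable borel" by (rule cnv_mol_borel[OF \<eta> U])
  let ?u = "\<integral>\<^sup>+x. ennreal \<bar>U x\<bar> \<partial>lborel"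
  have "(\<integral>\<^sup>+x\<in>UNIV. ennreal \<bar>cnv (mol \<eta>) U x - U x\<bar> \<partial>lborel) \<le> ?u + ?u"
  proof (rule cnv_mol_L1_local[OF \<eta> U])
    fix h :: 'a
    have "(\<integral>\<^sup>+x\<in>UNIV. ennreal \<bar>U (h + x) - U x\<bar> \<partial>lborel) \<le> (\<integral>\<^sup>+x. ennreal \<bar>U (h + x)\<bar> + ennreal \<bar>U x\<bar> \<partial>lborel)"
      by (intro nn_integral_mono) (simp add: ennreal_plus[symmetric] ennreal_leI del: ennreal_plus)
    also have "\<dots> = (\<integral>\<^sup>+x. ennreal \<bar>U (h + x)\<bar> \<partial>lborel) + ?u"
      by (rule nn_integral_add) measurable
    also have "(\<integral>\<^sup>+x. ennreal \<bar>U (h + x)\<bar> \<partial>lborel) = ?u"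
      using nn_integral_lborel_translate[of "\<lambda>x. ennreal \<bar>U x\<bar>" h] by simp
    finally show "(\<integral>\<^sup>+x\<in>UNIV. ennreal \<bar>U (h + x) - U x\<bar> \<partial>lborel) \<le> ?u + ?u" .
  qed simp
  moreover have "?u + ?u < \<infinity>" using U by (simp add: integrable_iff_bounded)
  ultimately have "(\<integral>\<^sup>+x. ennreal \<bar>cnv (mol \<eta>) U x - U x\<bar> \<partial>lborel) < \<infinity>" by (simp add: le_less_trans)
  then have "integrable lborel (\<lambda>x. cnv (mol \<eta>) U x - U x)" by (intro integrableI_bounded) auto
  from Bochner_Integration.integrable_add[OF this U] show ?thesis by simp
qed

text \<open>If the ball of radius \<open>2 * \<eta>\<close> lies in \<Omega>, the weight is at least
  \<eta> on the ball of radius \<eta>. The weighted distance therefore controls the mean distance on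
  all such balls at once, and \<open>grd_diff_le\<close> applies.\<close>

lemma grd_uniform_limit:
  fixes U :: "nat \<Rightarrow> real ^ 'n \<Rightarrow> real"
  assumes \<eta>: "\<eta> > 0" and U: "\<And>k. integrable lborel (U k)" and u: "integrable lborel u" and "e > 0"
    and lim: "(\<lambda>k. \<integral>\<^sup>+x. ennreal (infdist x (- \<Omega>) * \<bar>U k x - u x\<bar>) \<partial>lborel) \<longlonglongrightarrow> 0"
    and ne: "- \<Omega> \<noteq> {}"
  shows "\<forall>\<^sub>F k in sequentially. \<forall>x. ball x (2 * \<eta>) \<subseteq> \<Omega> \<longrightarrow> norm (grd \<eta> (U k) x - grd \<eta> u x) \<le> e"
proof -
  have [measurable]: "U k \<in> borel_measurable borel" "u \<in> borel_measurable borel" for k using U u by auto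
  obtain B where B: "B > 0" "\<And>x::real^'n. norm (dmol \<eta> x) \<le> B"
    using dmol_bound[OF \<eta>, where 'a="real^'n"] by metis
  have "(0::ennreal) < ennreal (e * \<eta> / B)" using \<open>e > 0\<close> \<eta> B by simp
  from order_tendstoD(2)[OF lim this] show ?thesis
  proof eventually_elim
    case (elim k)
    show ?case
    proof (intro allI impI)
      fix x assume x: "ball x (2 * \<eta>) \<subseteq> \<Omega>"
      have p: "\<eta> \<le> infdist y (- \<Omega>)" if "y \<in> ball x \<eta>" for y
      proof (rule ccontr)
        assume "\<not> ?thesis"
        then have "infdist y (- \<Omega>) < \<eta>" by simp
        then obtain a where a: "a \<in> - \<Omega>" "dist y a < \<eta>"
          using ne by (metis infdist_notempty cINF_less_iff bdd_below_image_dist infdist_def)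
        have "dist x a < 2 * \<eta>" using dist_triangle[of x a y] a(2) that by simp
        then show False using x a(1) by auto
      qed
      let ?i = "\<integral>y. indicator (ball x \<eta>) y * \<bar>U k y - u y\<bar> \<partial>lborel"
      have int: "integrable lborel (\<lambda>y. indicator (ball x \<eta>) y * \<bar>U k y - u y\<bar>)"
        using integrable_mult_indicator[of "ball x \<eta>" lborel "\<lambda>y. \<bar>U k y - u y\<bar>"] U u by simp
      have "ennreal (\<eta> * ?i) = ennreal \<eta> * (\<integral>\<^sup>+y. ennreal (indicator (ball x \<eta>) y * \<bar>U k y - u y\<bar>) \<partial>lborel)"
        using \<eta> by (subst nn_integral_eq_integral[OF int]) (auto simp: ennreal_mult')
      also have "\<dots> = (\<integral>\<^sup>+y. ennreal \<eta> * ennreal (indicator (ball x \<eta>) y * \<bar>U k y - u y\<bar>) \<partial>lborel)"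
        by (rule nn_integral_cmult[symmetric]) (use int in auto)
      also have "\<dots> \<le> (\<integral>\<^sup>+x. ennreal (infdist x (- \<Omega>) * \<bar>U k x - u x\<bar>) \<partial>lborel)"
      proof (intro nn_integral_mono)
        fix y
        have "\<eta> * (indicator (ball x \<eta>) y * \<bar>U k y - u y\<bar>) \<le> infdist y (- \<Omega>) * \<bar>U k y - u y\<bar>"
          using p[of y] infdist_nonneg[of y "- \<Omega>"] by (auto simp: indicator_def intro: mult_right_mono)
        then show "ennreal \<eta> * ennreal (indicator (ball x \<eta>) y * \<bar>U k y - u y\<bar>) \<le> ennreal (infdist y (- \<Omega>) * \<bar>U k y - u y\<bar>)"
          using \<eta> by (simp add: ennreal_mult[symmetric] ennreal_leI)
      qed
      also have "\<dots> \<le> ennreal (e * \<eta> / B)" using elim by simp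
      finally have "\<eta> * ?i \<le> e * \<eta> / B" using \<open>e > 0\<close> \<eta> B by (subst (asm) ennreal_le_iff) auto
      then have "\<eta> * (B * ?i) \<le> \<eta> * e" using B(1) by (simp add: field_simps)
      then have "B * ?i \<le> e" using \<eta> by simp
      then show "norm (grd \<eta> (U k) x - grd \<eta> u x) \<le> e"
        using grd_diff_le[OF \<eta> U u B(2), of k x] by simp
    qed
  qed
qed

text \<open>The grid is fixed first, fine enough for the limit gradient to be constant up to
  \<epsilon> on each cell. Each cell bounds \<open>K\<close> of the mollification from below, the
  cells add up by superadditivity, and mollification has not increased \<open>K\<close>. For a fixed
  grid \<delta> tends to 0, and only then does \<epsilon>.\<close>

lemma nn_integral_grd_le_liminf:
  fixes U :: "nat \<Rightarrow> real ^ 'n \<Rightarrow> real"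
  assumes \<Omega>: "open \<Omega>" "bounded \<Omega>" and U: "\<And>k. integrable lborel (U k)" and u: "integrable lborel u"
    and lim: "(\<lambda>k. \<integral>\<^sup>+x. ennreal (infdist x (- \<Omega>) * \<bar>U k x - u x\<bar>) \<partial>lborel) \<longlonglongrightarrow> 0"
    and \<delta>: "\<And>k. \<delta> k > 0" "\<delta> \<longlonglongrightarrow> 0" and c: "\<And>k. K (\<delta> k) \<Omega> (U k) \<le> ennreal c" "c \<ge> 0"
    and \<eta>: "\<eta> > 0" and S[measurable]: "S \<in> sets borel" and sub: "\<And>x. x \<in> S \<Longrightarrow> ball x (4 * \<eta>) \<subseteq> \<Omega>"
  shows "(\<integral>\<^sup>+x\<in>S. ennreal (norm (grd \<eta> u x)) \<partial>lborel) \<le> ennreal (4 * c)"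
proof -
  let ?G = "grd \<eta> u" and ?s = "sqrt CARD('n)" and ?n = "CARD('n)"
  have ne: "- \<Omega> \<noteq> {}" using compl_bounded_nonempty \<Omega> by auto
  have s0: "?s > 0" by simp
  have Gc: "continuous_on UNIV ?G" by (rule grd_continuous[OF \<eta> u])
  have [measurable]: "?G \<in> borel_measurable borel" by (rule borel_measurable_continuous_onI[OF Gc])
  define m where "m = measure lborel \<Omega>"
  have m0: "m \<ge> 0" by (simp add: m_def)
  have em: "emeasure lborel \<Omega> = ennreal m"
    using emeasure_bounded_finite[OF \<Omega>(2)] by (simp add: m_def emeasure_eq_ennreal_measure)
  have [measurable]: "\<Omega> \<in> sets borel" using \<Omega> by simp
  have S\<Omega>: "S \<subseteq> \<Omega>" using sub \<eta> by (meson centre_in_ball mult_pos_pos subsetD subsetI zero_less_numeral)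
  have bS: "bounded S" using \<Omega>(2) S\<Omega> bounded_subset by blast
  have main: "(\<integral>\<^sup>+x\<in>S. ennreal (norm (?G x)) \<partial>lborel) \<le> ennreal (4 * c + (16 * ?s + 1) * \<epsilon> * m)" if \<epsilon>: "\<epsilon> > 0" for \<epsilon>
  proof -
    have "uniformly_continuous_on (closure \<Omega>) ?G"
      using \<Omega>(2) by (intro compact_uniformly_continuous continuous_on_subset[OF Gc]) (auto simp: compact_eq_bounded_closed bounded_closure)
    then obtain \<rho> where \<rho>: "\<rho> > 0" "\<And>x y. x \<in> closure \<Omega> \<Longrightarrow> y \<in> closure \<Omega> \<Longrightarrow> dist x y < \<rho> \<Longrightarrow> dist (?G x) (?G y) < \<epsilon>"
      using \<epsilon> unfolding uniformly_continuous_on_def by metis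
    \<comment> \<open>Makes the diameter of a cell smaller than \<rho>, for the gradient, and
      smaller than \<eta>, so that every cell meeting \<open>S\<close> keeps room inside
      \<Omega>.\<close>
    define s where "s = min \<rho> \<eta> / (2 * ?s)"
    have s: "s > 0" using \<rho> \<eta> s0 by (simp add: s_def)
    have "?s * s = min \<rho> \<eta> / 2" using s0 by (simp add: s_def)
    then have ss: "?s * s < \<rho>" "?s * s < \<eta>" using \<rho> \<eta> by auto
    define Z where "Z = {z. cell s z \<inter> S \<noteq> {}}"
    have fZ: "finite Z" unfolding Z_def by (rule finite_cells[OF bS s])
    let ?A = "\<lambda>z. ocube (lattice_point s z) (\<lambda>v. v) s"
    define y where "y z = ctr (lattice_point s z) (\<lambda>v. v) s" for z :: "int ^ 'n"
    have yA: "y z \<in> ?A z" for z unfolding y_def by (rule ctr_in_ocube[OF s])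
    have yc: "y z \<in> cell s z" for z using yA open_cell_subset by blast
    have cell_ball: "ball x (3 * \<eta>) \<subseteq> \<Omega>" if z: "z \<in> Z" and x: "x \<in> cell s z" for x z
    proof
      fix q assume q: "q \<in> ball x (3 * \<eta>)"
      obtain x0 where x0: "x0 \<in> cell s z" "x0 \<in> S" using z by (auto simp: Z_def)
      have "dist x0 x < \<eta>" using cell_diam[OF x0(1) x] ss by (simp add: dist_norm)
      then have "q \<in> ball x0 (4 * \<eta>)" using dist_triangle[of x0 q x] q by simp
      then show "q \<in> \<Omega>" using sub[OF x0(2)] by blast
    qed
    have cell\<Omega>: "cell s z \<subseteq> \<Omega>" if "z \<in> Z" for z
      using cell_ball[OF that] \<eta> by (meson centre_in_ball mult_pos_pos subsetD subsetI zero_less_numeral)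
    have Gy: "norm (?G x - ?G (y z)) \<le> \<epsilon>" if z: "z \<in> Z" and x: "x \<in> cell s z" for x z
    proof -
      have "dist x (y z) < \<rho>" using cell_diam[OF x yc] ss by (simp add: dist_norm)
      then have "dist (?G x) (?G (y z)) < \<epsilon>"
        using cell\<Omega>[OF z] x yc[of z] closure_subset[of \<Omega>] by (intro \<rho>(2)) auto
      then show ?thesis by (simp add: dist_norm)
    qed
    \<comment> \<open>The lower bound of \<open>K_ge_cell\<close> per unit volume. Its tolerance is
      \<open>2 * \<epsilon>\<close>: one \<epsilon> for the variation of the limit gradient on the
      cell, one for the distance from the gradient of index \<open>k\<close>.\<close>
    define a where "a z = max 0 (norm (?G (y z)) / 4 - 2 * (2 * \<epsilon> * ?s))" for z
    have ev1: "\<forall>\<^sub>F k in sequentially. \<forall>x. ball x (2 * \<eta>) \<subseteq> \<Omega> \<longrightarrow> norm (grd \<eta> (U k) x - ?G x) \<le> \<epsilon>"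
      by (rule grd_uniform_limit[OF \<eta> U u \<epsilon> lim ne])
    have "s / (4 * ?s) > 0" using s s0 by simp
    then have ev2: "\<forall>\<^sub>F k in sequentially. \<delta> k < s / (4 * ?s)" by (rule order_tendstoD(2)[OF \<delta>(2)])
    have ev: "\<forall>\<^sub>F k in sequentially. (s - 4 * (?s * \<delta> k)) ^ ?n * (\<Sum>z\<in>Z. a z) \<le> c"
      using ev1 ev2
    proof eventually_elim
      case (elim k)
      let ?w = "cnv (mol \<eta>) (U k)" and ?t = "(s - 4 * (?s * \<delta> k)) ^ ?n"
      have small: "4 * (?s * \<delta> k) < s" using elim(2) s0 by (simp add: pos_less_divide_eq ac_simps)
      have t0: "?t \<ge> 0" using small by simp
      have cellK: "ennreal ?t * ennreal (a z) \<le> K (\<delta> k) (?A z) ?w" if z: "z \<in> Z" for z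
      proof -
        have "ennreal ?t * ennreal (norm (?G (y z)) / 4 - 2 * (2 * \<epsilon> * ?s)) \<le> K (\<delta> k) (?A z) ?w"
        proof (rule K_ge_cell[OF \<delta>(1) s _ cnv_mol_derivative[OF \<eta> U] _ _ small])
          show "integrable lborel ?w" by (rule cnv_mol_integrable[OF \<eta> U])
          show "0 \<le> 2 * \<epsilon>" using \<epsilon> by simp
          fix x assume "x \<in> ?A z"
          then have x: "x \<in> cell s z" using open_cell_subset by blast
          have "ball x (2 * \<eta>) \<subseteq> \<Omega>" using cell_ball[OF z x] subset_ball[of "2 * \<eta>" "3 * \<eta>" x] \<eta> by auto
          then have "norm (grd \<eta> (U k) x - ?G x) \<le> \<epsilon>" using elim(1) by blast
          then show "norm (grd \<eta> (U k) x - ?G (y z)) \<le> 2 * \<epsilon>"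
            using Gy[OF z x] norm_triangle_ineq[of "grd \<eta> (U k) x - ?G x" "?G x - ?G (y z)"] by simp
        qed
        then show ?thesis by (simp add: a_def ennreal_max_0 max_def split: if_splits)
      qed
      have "ennreal (?t * (\<Sum>z\<in>Z. a z)) = (\<Sum>z\<in>Z. ennreal ?t * ennreal (a z))"
        using t0 by (simp add: ennreal_mult sum_nonneg a_def sum_ennreal[symmetric] sum_distrib_left del: sum_ennreal)
      also have "\<dots> \<le> (\<Sum>z\<in>Z. K (\<delta> k) (?A z) ?w)" by (intro sum_mono cellK)
      also have "\<dots> \<le> K (\<delta> k) (\<Union>z\<in>Z. ?A z) ?w"
      proof (rule K_superadditive[OF fZ \<delta>(1)])
        show "?A z \<inter> ?A z' = {}" if "z \<in> Z" "z' \<in> Z" "z \<noteq> z'" for z z'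
        proof -
          have "cell s z \<inter> cell s z' = {}" using that(3) by (auto simp: cell_unique[OF s])
          then show ?thesis using open_cell_subset[of s z] open_cell_subset[of s z'] by blast
        qed
      qed auto
      also have "\<dots> \<le> K (\<delta> k) \<Omega> (U k)"
      proof (rule K_cnv_le[OF \<eta> U \<delta>(1)])
        fix x assume "x \<in> (\<Union>z\<in>Z. ?A z)"
        then obtain z where "z \<in> Z" "x \<in> cell s z" using open_cell_subset by blast
        then show "ball x \<eta> \<subseteq> \<Omega>" using cell_ball[of z x] subset_ball[of \<eta> "3 * \<eta>" x] \<eta> by auto
      qed
      also have "\<dots> \<le> ennreal c" by (rule c)
      finally show ?case using c(2) by (simp add: ennreal_le_iff)
    qed
    have "(\<lambda>k. (s - 4 * (?s * \<delta> k)) ^ ?n * (\<Sum>z\<in>Z. a z)) \<longlonglongrightarrow> (s - 4 * (?s * 0)) ^ ?n * (\<Sum>z\<in>Z. a z)"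
      by (intro tendsto_intros \<delta>)
    then have le: "s ^ ?n * (\<Sum>z\<in>Z. a z) \<le> c"
      using tendsto_upperbound[OF _ ev] by simp
    \<comment> \<open>The cells are disjoint and lie in \<Omega>, so the errors of size \<epsilon>
      add up to a multiple of the measure of \<Omega>, however fine the grid.\<close>
    have count: "real (card Z) * s ^ ?n \<le> m"
    proof -
      have "ennreal (real (card Z) * s ^ ?n) = (\<Sum>z\<in>Z. emeasure lborel (cell s z :: (real ^ 'n) set))"
        using s by (simp add: emeasure_cell_translate ennreal_mult ennreal_of_nat_eq_real_of_nat)
      also have "\<dots> = (\<Sum>z\<in>Z. \<integral>\<^sup>+x\<in>cell s z. 1 \<partial>lborel)" by simp
      also have "\<dots> \<le> (\<integral>\<^sup>+x\<in>\<Omega>. 1 \<partial>lborel)"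
      proof (rule sum_nn_integral_disjoint_le[OF fZ])
        fix z j assume "z \<in> Z" "j \<in> Z" "z \<noteq> j"
        then show "cell s z \<inter> cell s j = {}" by (metis cell_unique[OF s] disjoint_iff)
      qed (use cell\<Omega> in auto)
      also have "\<dots> = ennreal m" by (simp add: em)
      finally show ?thesis using m0 by (simp add: ennreal_le_iff)
    qed
    have "(\<integral>\<^sup>+x\<in>S. ennreal (norm (?G x)) \<partial>lborel) \<le> (\<integral>\<^sup>+x. (\<Sum>z\<in>Z. ennreal (norm (?G (y z)) + \<epsilon>) * indicator (cell s z) x) \<partial>lborel)"
    proof (intro nn_integral_mono)
      fix x
      show "ennreal (norm (?G x)) * indicator S x \<le> (\<Sum>z\<in>Z. ennreal (norm (?G (y z)) + \<epsilon>) * indicator (cell s z) x)"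
      proof (cases "x \<in> S")
        case True
        define z where "z = ((\<chi> i. \<lfloor>x $ i / s\<rfloor>) :: int ^ 'n)"
        have xz: "x \<in> cell s z" using cell_unique[OF s, of x z] by (simp add: z_def)
        then have z: "z \<in> Z" using True by (auto simp: Z_def)
        have "norm (?G x) \<le> norm (?G (y z)) + \<epsilon>"
          using Gy[OF z xz] norm_triangle_sub[of "?G x" "?G (y z)"] by linarith
        then have "ennreal (norm (?G x)) * indicator S x \<le> ennreal (norm (?G (y z)) + \<epsilon>) * indicator (cell s z) x"
          using True xz by (simp add: ennreal_leI)
        also have "\<dots> \<le> (\<Sum>z\<in>Z. ennreal (norm (?G (y z)) + \<epsilon>) * indicator (cell s z) x)"
          using z fZ by (intro member_le_sum) auto
        finally show ?thesis .
      qed simp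
    qed
    also have "\<dots> = (\<Sum>z\<in>Z. ennreal (norm (?G (y z)) + \<epsilon>) * ennreal (s ^ ?n))"
      by (subst nn_integral_sum) (auto simp: nn_integral_cmult_indicator emeasure_cell_translate[OF s])
    also have "\<dots> = ennreal (\<Sum>z\<in>Z. (norm (?G (y z)) + \<epsilon>) * s ^ ?n)"
      using s \<epsilon> by (simp add: ennreal_mult[symmetric] del: ennreal_plus)
    also have "\<dots> \<le> ennreal (4 * c + (16 * ?s + 1) * \<epsilon> * m)"
    proof (rule ennreal_leI)
      \<comment> \<open>Solving the definition of \<open>a\<close> for the gradient gives
        \<open>4 * a z + 16 * \<epsilon> * ?s\<close>; the last \<epsilon> is the variation within
        the cell.\<close>
      have "(\<Sum>z\<in>Z. (norm (?G (y z)) + \<epsilon>) * s ^ ?n) \<le> (\<Sum>z\<in>Z. (4 * a z + (16 * ?s + 1) * \<epsilon>) * s ^ ?n)"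
        using s by (intro sum_mono mult_right_mono) (auto simp: a_def max_def algebra_simps)
      also have "\<dots> = 4 * (s ^ ?n * (\<Sum>z\<in>Z. a z)) + (16 * ?s + 1) * \<epsilon> * (real (card Z) * s ^ ?n)"
        by (simp add: sum.distrib distrib_right sum_distrib_left sum_distrib_right algebra_simps)
      also have "\<dots> \<le> 4 * c + (16 * ?s + 1) * \<epsilon> * m"
        using le count \<epsilon> s0 by (intro add_mono mult_left_mono mult_nonneg_nonneg add_nonneg_nonneg) auto
      finally show "(\<Sum>z\<in>Z. (norm (?G (y z)) + \<epsilon>) * s ^ ?n) \<le> 4 * c + (16 * ?s + 1) * \<epsilon> * m" .
    qed
    finally show ?thesis .
  qed
  show ?thesis
  proof (rule ennreal_le_epsilon)
    fix e :: real assume "e > 0"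
    define \<epsilon> where "\<epsilon> = e / ((16 * ?s + 1) * (m + 1))"
    have p: "(16 * ?s + 1) > 0" "m + 1 > 0" using s0 m0 by linarith+
    have "\<epsilon> > 0" using \<open>e > 0\<close> p by (simp add: \<epsilon>_def)
    have "(16 * ?s + 1) * \<epsilon> * m \<le> (16 * ?s + 1) * \<epsilon> * (m + 1)" using p \<open>\<epsilon> > 0\<close> by (intro mult_left_mono) auto
    also have "\<dots> = e" using p by (simp add: \<epsilon>_def)
    finally have "(16 * ?s + 1) * \<epsilon> * m \<le> e" .
    then have "(\<integral>\<^sup>+x\<in>S. ennreal (norm (?G x)) \<partial>lborel) \<le> ennreal (4 * c + e)"
      by (intro order_trans[OF main[OF \<open>\<epsilon> > 0\<close>]] ennreal_leI) simp
    then show "(\<integral>\<^sup>+x\<in>S. ennreal (norm (?G x)) \<partial>lborel) \<le> ennreal (4 * c) + ennreal e"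
      using c(2) \<open>e > 0\<close> by simp
  qed
qed

text \<open>For one test field, \<open>u\<close> is replaced by a mollification so fine that the
  support of the field keeps room inside \<Omega>. Integration by parts then leaves the integral of
  the gradient norm over the support, bounded at fixed scale.\<close>

lemma TV_le_liminf_K:
  fixes U :: "nat \<Rightarrow> real ^ 'n \<Rightarrow> real"
  assumes \<Omega>: "open \<Omega>" "bounded \<Omega>" and U: "\<And>k. integrable lborel (U k)" and u: "integrable lborel u"
    and lim: "(\<lambda>k. \<integral>\<^sup>+x. ennreal (infdist x (- \<Omega>) * \<bar>U k x - u x\<bar>) \<partial>lborel) \<longlonglongrightarrow> 0"
    and \<delta>: "\<And>k. \<delta> k > 0" "\<delta> \<longlonglongrightarrow> 0" and c: "\<And>k. K (\<delta> k) \<Omega> (U k) \<le> ennreal c" "c \<ge> 0"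
  shows "total_variation \<Omega> u \<le> ennreal (4 * c)"
proof -
  have [measurable]: "u \<in> borel_measurable borel" using u by auto
  show ?thesis
    unfolding TV_lborel[OF \<Omega>(1) \<open>u \<in> _\<close>]
  proof (rule SUP_least, rule ennreal_leI, rule field_le_epsilon)
    fix \<phi> and e :: real assume \<phi>: "\<phi> \<in> test_fields \<Omega>" and "e > 0"
    let ?S = "closure {x. \<phi> x \<noteq> 0}"
    have S: "compact ?S" "?S \<subseteq> \<Omega>" and n\<phi>: "\<And>x. norm (\<phi> x) \<le> 1" using \<phi> by (auto simp: test_fields_def)
    have z: "\<phi> x = 0" if "x \<notin> ?S" for x using that closure_subset[of "{x. \<phi> x \<noteq> 0}"] by auto
    obtain r where r: "r > 0" "(\<Union>x\<in>?S. ball x r) \<subseteq> \<Omega>"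
      using compact_subset_open_imp_ball_epsilon_subset[OF S(1) \<Omega>(1) S(2)] .
    obtain B where B: "B > 0" "\<And>x. \<bar>divergence \<phi> x\<bar> \<le> B" using divergence_bounded[OF \<phi>] by metis
    note [measurable] = divergence_borel[OF \<phi>]
    have "e / B > 0" using \<open>e > 0\<close> B by simp
    from cnv_mol_L1[OF u this] obtain d where d: "d > 0"
      "\<And>\<eta>. 0 < \<eta> \<Longrightarrow> \<eta> < d \<Longrightarrow> (\<integral>\<^sup>+x. ennreal \<bar>cnv (mol \<eta>) u x - u x\<bar> \<partial>lborel) \<le> ennreal (e / B)" by blast
    define \<eta> where "\<eta> = min d r / 5"
    have \<eta>: "\<eta> > 0" "\<eta> < d" "4 * \<eta> \<le> r" using d r by (auto simp: \<eta>_def)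
    let ?w = "cnv (mol \<eta>) u" and ?G = "grd \<eta> u"
    have iw: "integrable lborel ?w" by (rule cnv_mol_integrable[OF \<eta>(1) u])
    have Gc: "continuous_on UNIV ?G" by (rule grd_continuous[OF \<eta>(1) u])
    note parts = integral_divergence_by_parts[OF \<phi> cnv_mol_derivative[OF \<eta>(1) u] Gc iw]
    have Sb: "?S \<in> sets borel" by simp
    have "(\<integral>\<^sup>+x\<in>?S. ennreal (norm (?G x)) \<partial>lborel) \<le> ennreal (4 * c)"
    proof (rule nn_integral_grd_le_liminf[OF \<Omega> U u lim \<delta> c \<eta>(1) Sb])
      fix x assume "x \<in> ?S"
      then show "ball x (4 * \<eta>) \<subseteq> \<Omega>" using r(2) \<eta>(3) by (meson SUP_le_iff subset_ball order_trans)
    qed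
    moreover have "ennreal \<bar>\<integral>x. ?G x \<bullet> \<phi> x \<partial>lborel\<bar> \<le> (\<integral>\<^sup>+x\<in>?S. ennreal (norm (?G x)) \<partial>lborel)"
    proof -
      have "ennreal \<bar>\<integral>x. ?G x \<bullet> \<phi> x \<partial>lborel\<bar> \<le> (\<integral>\<^sup>+x. ennreal (norm (?G x \<bullet> \<phi> x)) \<partial>lborel)"
        using integral_norm_bound_ennreal[OF parts(2)] by simp
      also have "\<dots> \<le> (\<integral>\<^sup>+x\<in>?S. ennreal (norm (?G x)) \<partial>lborel)"
      proof (intro nn_integral_mono)
        fix x
        have "\<bar>?G x \<bullet> \<phi> x\<bar> \<le> norm (?G x) * norm (\<phi> x)" by (rule Cauchy_Schwarz_ineq2)
        also have "\<dots> \<le> norm (?G x) * 1" by (intro mult_left_mono n\<phi>) auto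
        finally show "ennreal (norm (?G x \<bullet> \<phi> x)) \<le> ennreal (norm (?G x)) * indicator ?S x"
          using z[of x] by (cases "x \<in> ?S") (auto intro: ennreal_leI)
      qed
      finally show ?thesis .
    qed
    ultimately have "ennreal \<bar>\<integral>x. ?G x \<bullet> \<phi> x \<partial>lborel\<bar> \<le> ennreal (4 * c)" by (rule order_trans[rotated])
    then have G: "\<bar>\<integral>x. ?G x \<bullet> \<phi> x \<partial>lborel\<bar> \<le> 4 * c" using c(2) by (simp add: ennreal_le_iff)
    have id: "integrable lborel (\<lambda>x. u x - ?w x)" by (rule Bochner_Integration.integrable_diff[OF u iw])
    have "(\<integral>x. u x * divergence \<phi> x \<partial>lborel) - (\<integral>x. ?w x * divergence \<phi> x \<partial>lborel) = (\<integral>x. (u x - ?w x) * divergence \<phi> x \<partial>lborel)"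
      unfolding left_diff_distrib
      by (rule Bochner_Integration.integral_diff[symmetric]) (rule divergence_times_integrable[OF \<phi>] u iw)+
    also have "\<dots> \<le> (\<integral>x. B * \<bar>u x - ?w x\<bar> \<partial>lborel)"
    proof (rule integral_mono[OF divergence_times_integrable[OF \<phi> id]])
      show "integrable lborel (\<lambda>x. B * \<bar>u x - ?w x\<bar>)" using id by simp
      show "(u x - ?w x) * divergence \<phi> x \<le> B * \<bar>u x - ?w x\<bar>" for x
      proof -
        have "(u x - ?w x) * divergence \<phi> x \<le> \<bar>u x - ?w x\<bar> * \<bar>divergence \<phi> x\<bar>" by (simp add: abs_mult[symmetric])
        also have "\<dots> \<le> \<bar>u x - ?w x\<bar> * B" by (intro mult_left_mono B) auto
        finally show ?thesis by (simp add: mult.commute)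
      qed
    qed
    also have "\<dots> = B * (\<integral>x. \<bar>u x - ?w x\<bar> \<partial>lborel)" by simp
    also have "(\<integral>x. \<bar>u x - ?w x\<bar> \<partial>lborel) \<le> e / B"
    proof -
      have "ennreal (\<integral>x. \<bar>u x - ?w x\<bar> \<partial>lborel) = (\<integral>\<^sup>+x. ennreal \<bar>?w x - u x\<bar> \<partial>lborel)"
        by (subst nn_integral_eq_integral[symmetric]) (use id in \<open>auto simp: abs_minus_commute\<close>)
      also have "\<dots> \<le> ennreal (e / B)" by (rule d(2)[OF \<eta>(1,2)])
      finally show ?thesis using \<open>e / B > 0\<close> by (simp add: ennreal_le_iff)
    qed
    finally have "(\<integral>x. u x * divergence \<phi> x \<partial>lborel) - (\<integral>x. ?w x * divergence \<phi> x \<partial>lborel) \<le> e"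
      using B(1) by simp
    then show "(\<integral>x. u x * divergence \<phi> x \<partial>lborel) \<le> 4 * c + e"
      using G parts(1) by linarith
  qed
qed

section \<open>Convergence of near-minimizers\<close>

lemma L1_borel_representative:
  fixes v :: "real ^ 'n \<Rightarrow> real"
  assumes "open \<Omega>" and v: "v \<in> L1 \<Omega>"
  shows "\<exists>V. integrable lborel V \<and> (AE x in lborel. x \<in> \<Omega> \<longrightarrow> v x = V x)"
proof -
  have \<Omega>[measurable]: "\<Omega> \<in> sets borel" using assms by simp
  have i: "integrable lebesgue (\<lambda>x. indicator \<Omega> x *\<^sub>R v x)" using v by (simp add: L1_def set_integrable_def)
  then obtain V where V: "V \<in> borel_measurable lborel" "AE x in lborel. indicator \<Omega> x *\<^sub>R v x = V x"
    using completion_ex_borel_measurable_real[of "\<lambda>x. indicator \<Omega> x *\<^sub>R v x" lborel] by auto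
  have "integrable lebesgue V"
    using i V(2) measurable_completion[OF V(1)]
    by (subst integrable_cong_AE[of V _ "\<lambda>x. indicator \<Omega> x *\<^sub>R v x"]) (auto intro!: AE_completion elim: AE_mp)
  then have "integrable lborel V" by (subst (asm) integrable_completion[OF V(1)])
  moreover have "AE x in lborel. x \<in> \<Omega> \<longrightarrow> v x = V x" using V(2) by eventually_elim (auto simp: indicator_def)
  ultimately show ?thesis by blast
qed

lemma integrable_imp_L1:
  assumes "open \<Omega>" "integrable lborel V"
  shows "V \<in> L1 \<Omega>"
proof -
  have "integrable lebesgue V" using assms(2) by (subst integrable_completion) auto
  then show ?thesis using assms(1) by (simp add: L1_def integrable_imp_set_integrable borel_open)
qed

lemma set_integral_lebesgue_cong:
  fixes f g :: "real ^ 'n \<Rightarrow> real"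
  assumes [measurable]: "(\<lambda>x. indicator Q x * f x) \<in> borel_measurable lebesgue" "(\<lambda>x. indicator Q x * g x) \<in> borel_measurable lebesgue"
    and ae: "AE x in lborel. x \<in> Q \<longrightarrow> f x = g x"
  shows "(LINT x:Q|lebesgue. f x) = (LINT x:Q|lebesgue. g x)"
  unfolding set_lebesgue_integral_def real_scaleR_def
proof (rule integral_cong_AE)
  show "AE x in lebesgue. indicator Q x * f x = indicator Q x * g x"
    using AE_completion[OF ae] by eventually_elim (auto simp: indicator_def)
qed measurable

lemma L1_measurable_on:
  fixes v :: "real ^ 'n \<Rightarrow> real"
  assumes v: "v \<in> L1 \<Omega>" and Q: "Q \<in> sets borel" "Q \<subseteq> \<Omega>"
  shows "(\<lambda>x. indicator Q x * v x) \<in> borel_measurable lebesgue"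
proof -
  have Ql[measurable]: "Q \<in> sets lebesgue" using Q(1) by simp
  have [measurable]: "(\<lambda>x. indicator \<Omega> x * v x) \<in> borel_measurable lebesgue"
    using v by (auto simp: L1_def set_integrable_def)
  have "(\<lambda>x. indicator Q x * (indicator \<Omega> x * v x)) \<in> borel_measurable lebesgue" by measurable
  moreover have "(\<lambda>x. indicator Q x * (indicator \<Omega> x * v x)) = (\<lambda>x. indicator Q x * v x)"
    using Q(2) by (intro ext) (auto simp: indicator_def)
  ultimately show ?thesis by simp
qed

lemma K_cong:
  fixes v V :: "real ^ 'n \<Rightarrow> real"
  assumes v: "v \<in> L1 \<Omega>" "V \<in> L1 \<Omega>" and ae: "AE x in lborel. x \<in> \<Omega> \<longrightarrow> v x = V x"
  shows "K \<delta> \<Omega> v = K \<delta> \<Omega> V"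
proof -
  have "osc Q v = osc Q V" if Q: "Q \<in> cubes \<delta>" "Q \<subseteq> \<Omega>" for Q
  proof -
    have Qb: "Q \<in> sets borel" using Q(1) by (auto simp: cubes_ocube ocube_borel)
    have aeQ: "AE x in lborel. x \<in> Q \<longrightarrow> v x = V x" using ae by eventually_elim (use Q(2) in auto)
    note m = L1_measurable_on[OF v(1) Qb Q(2)] L1_measurable_on[OF v(2) Qb Q(2)]
    have [measurable]: "Q \<in> sets lebesgue" using Qb by simp
    have m': "(\<lambda>x. indicator Q x * \<bar>f x - a\<bar>) \<in> borel_measurable lebesgue"
      if [measurable]: "(\<lambda>x. indicator Q x * f x) \<in> borel_measurable lebesgue" for f :: "real ^ 'n \<Rightarrow> real" and a
    proof -
      have "(\<lambda>x. indicator Q x * \<bar>indicator Q x * f x - a\<bar>) \<in> borel_measurable lebesgue" by measurable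
      moreover have "(\<lambda>x. indicator Q x * \<bar>indicator Q x * f x - a\<bar>) = (\<lambda>x. indicator Q x * \<bar>f x - a\<bar>)"
        by (auto simp: indicator_def)
      ultimately show ?thesis by simp
    qed
    have eq: "avg Q v = avg Q V" unfolding avg_def by (simp add: set_integral_lebesgue_cong[OF m aeQ])
    have "AE x in lborel. x \<in> Q \<longrightarrow> \<bar>v x - avg Q V\<bar> = \<bar>V x - avg Q V\<bar>" using aeQ by eventually_elim auto
    then show ?thesis
      unfolding osc_def eq unfolding avg_def
      by (subst set_integral_lebesgue_cong[OF m'[OF m(1)] m'[OF m(2)]]) (auto simp: avg_def)
  qed
  then have "(\<Sum>\<^sub>\<infinity>Q\<in>G. ennreal (osc Q v)) = (\<Sum>\<^sub>\<infinity>Q\<in>G. ennreal (osc Q V))" if "G \<in> cube_families \<delta> \<Omega>" for G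
    using that by (intro infsum_cong) (auto simp: cube_families_def)
  then show ?thesis unfolding K_osc by (auto intro!: arg_cong2[of _ _ _ _ "(*)"] SUP_cong)
qed

lemma TV_cong:
  fixes v V :: "real ^ 'n \<Rightarrow> real"
  assumes "open \<Omega>" and v: "v \<in> L1 \<Omega>" "V \<in> L1 \<Omega>" and ae: "AE x in lborel. x \<in> \<Omega> \<longrightarrow> v x = V x"
  shows "total_variation \<Omega> v = total_variation \<Omega> V"
  unfolding total_variation_def
proof (intro SUP_cong refl arg_cong[of _ _ ennreal] set_integral_lebesgue_cong)
  fix \<phi> assume \<phi>: "\<phi> \<in> test_fields \<Omega>"
  have [measurable]: "divergence \<phi> \<in> borel_measurable lebesgue"
    using divergence_borel[OF \<phi>] by (simp add: measurable_completion)
  have \<Omega>: "\<Omega> \<in> sets borel" using assms by simp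
  have "(\<lambda>x. indicator \<Omega> x * (f x * divergence \<phi> x)) \<in> borel_measurable lebesgue" if "f \<in> L1 \<Omega>" for f
  proof -
    have [measurable]: "(\<lambda>x. indicator \<Omega> x * f x) \<in> borel_measurable lebesgue" by (rule L1_measurable_on[OF that \<Omega>]) simp
    have "(\<lambda>x. (indicator \<Omega> x * f x) * divergence \<phi> x) \<in> borel_measurable lebesgue" by measurable
    then show ?thesis by (simp add: mult.assoc)
  qed
  then show "(\<lambda>x. indicator \<Omega> x * (v x * divergence \<phi> x)) \<in> borel_measurable lebesgue"
    "(\<lambda>x. indicator \<Omega> x * (V x * divergence \<phi> x)) \<in> borel_measurable lebesgue" using v by auto
  show "AE x in lborel. x \<in> \<Omega> \<longrightarrow> v x * divergence \<phi> x = V x * divergence \<phi> x"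
    using ae by eventually_elim auto
qed

lemma L1_dist_lborel:
  fixes f v F V :: "real ^ 'n \<Rightarrow> real"
  assumes "open \<Omega>" and L: "f \<in> L1 \<Omega>" "v \<in> L1 \<Omega>" and F: "integrable lborel F" and V: "integrable lborel V"
    and ae: "AE x in lborel. x \<in> \<Omega> \<longrightarrow> f x = F x" "AE x in lborel. x \<in> \<Omega> \<longrightarrow> v x = V x"
  shows "L1_dist \<Omega> f v = (\<integral>x. indicator \<Omega> x * \<bar>F x - V x\<bar> \<partial>lborel)"
proof -
  have \<Omega>[measurable]: "\<Omega> \<in> sets borel" using assms by simp
  then have [measurable]: "\<Omega> \<in> sets lebesgue" by simp
  have [measurable]: "F \<in> borel_measurable borel" "V \<in> borel_measurable borel" using F V by auto
  have [measurable]: "(\<lambda>x. indicator \<Omega> x * f x) \<in> borel_measurable lebesgue" "(\<lambda>x. indicator \<Omega> x * v x) \<in> borel_measurable lebesgue"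
    using L1_measurable_on[OF L(1) \<Omega>] L1_measurable_on[OF L(2) \<Omega>] by auto
  have "(\<lambda>x. \<bar>indicator \<Omega> x * f x - indicator \<Omega> x * v x\<bar>) \<in> borel_measurable lebesgue" by measurable
  moreover have "(\<lambda>x. \<bar>indicator \<Omega> x * f x - indicator \<Omega> x * v x\<bar>) = (\<lambda>x. indicator \<Omega> x * \<bar>f x - v x\<bar>)"
    by (auto simp: indicator_def)
  ultimately have m1: "(\<lambda>x. indicator \<Omega> x * \<bar>f x - v x\<bar>) \<in> borel_measurable lebesgue" by simp
  have m2: "(\<lambda>x. indicator \<Omega> x * \<bar>F x - V x\<bar>) \<in> borel_measurable lborel" by measurable
  have "AE x in lborel. x \<in> \<Omega> \<longrightarrow> \<bar>f x - v x\<bar> = \<bar>F x - V x\<bar>" using ae by eventually_elim auto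
  then have "L1_dist \<Omega> f v = (LINT x:\<Omega>|lebesgue. \<bar>F x - V x\<bar>)"
    unfolding L1_dist_def by (rule set_integral_lebesgue_cong[OF m1 measurable_completion[OF m2]])
  also have "\<dots> = (\<integral>x. indicator \<Omega> x * \<bar>F x - V x\<bar> \<partial>lborel)"
    unfolding set_lebesgue_integral_def real_scaleR_def by (rule integral_completion[OF m2])
  finally show ?thesis .
qed

section \<open>The limit of near-minimizers\<close>

lemma K_zero: "K \<delta> \<Omega> (\<lambda>x :: real ^ 'n. 0) = 0"
proof -
  have 0: "osc Q (\<lambda>x. 0) = 0" for Q :: "(real ^ 'n) set"
    by (simp add: osc_def avg_def set_lebesgue_integral_def)
  have "(SUP G\<in>cube_families \<delta> \<Omega>. \<Sum>\<^sub>\<infinity>Q\<in>G. ennreal (osc Q (\<lambda>x. 0))) \<le> 0"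
    by (intro SUP_least) (simp add: 0)
  then show ?thesis unfolding K_osc by simp
qed

text \<open>Stated for Borel functions \<open>U k\<close> vanishing outside \<Omega>, so that the
  fidelity term is an integral over the whole space. Minimality follows from comparing with recovery
  functions of an arbitrary competitor. Strong convergence follows from the same comparison with the
  limit itself as the competitor.\<close>

lemma near_minimizers_subconverge:
  fixes U :: "nat \<Rightarrow> real ^ 'n \<Rightarrow> real" and f :: "real ^ 'n \<Rightarrow> real" and \<delta> \<tau> :: "nat \<Rightarrow> real"
  defines "D \<equiv> \<lambda>v. \<integral>x. \<bar>f x - v x\<bar> \<partial>lborel"
  assumes \<Omega>: "open \<Omega>" "bounded \<Omega>" and "\<Lambda> > 0" and f: "integrable lborel f"
    and U: "\<And>k. integrable lborel (U k)" "\<And>k x. x \<notin> \<Omega> \<Longrightarrow> U k x = 0"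
    and M: "\<And>k. (\<integral>x. \<bar>U k x\<bar> \<partial>lborel) \<le> M"
    and \<delta>: "\<And>k. \<delta> k > 0" "\<delta> \<longlonglongrightarrow> 0" and \<tau>: "\<And>k. \<tau> k > 0" "\<tau> \<longlonglongrightarrow> 0"
    and near: "\<And>k w. integrable lborel w \<Longrightarrow>
      K (\<delta> k) \<Omega> (U k) + ennreal (\<Lambda> * D (U k)) \<le> K (\<delta> k) \<Omega> w + ennreal (\<Lambda> * D w) + ennreal (\<tau> k)"
  shows "\<exists>r u. strict_mono r \<and> integrable lborel u \<and> (\<forall>x. x \<notin> \<Omega> \<longrightarrow> u x = 0) \<and>
    total_variation \<Omega> u < \<infinity> \<and> (\<lambda>k. \<integral>x. \<bar>U (r k) x - u x\<bar> \<partial>lborel) \<longlonglongrightarrow> 0 \<and>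
    (\<forall>V. integrable lborel V \<longrightarrow> total_variation \<Omega> V < \<infinity> \<longrightarrow>
      total_variation \<Omega> u / 4 + ennreal (\<Lambda> * D u) \<le> total_variation \<Omega> V / 4 + ennreal (\<Lambda> * D V))"
proof -
  have Ub[measurable]: "U k \<in> borel_measurable borel" for k using U by auto
  have fb[measurable]: "f \<in> borel_measurable borel" using f by auto
  have \<Omega>b[measurable]: "\<Omega> \<in> sets borel" using \<Omega> by simp
  have D0: "D v \<ge> 0" for v by (simp add: D_def)
  have Dnn: "ennreal (D v) = (\<integral>\<^sup>+x. ennreal \<bar>f x - v x\<bar> \<partial>lborel)" if "integrable lborel v" for v
    unfolding D_def using f that by (subst nn_integral_eq_integral) auto
  have Dtri: "D w \<le> D V + b" if w: "integrable lborel w" "integrable lborel V" "(\<integral>\<^sup>+x. ennreal \<bar>w x - V x\<bar> \<partial>lborel) \<le> ennreal b" "b \<ge> 0"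
    for w V b
  proof -
    have [measurable]: "w \<in> borel_measurable borel" "V \<in> borel_measurable borel" using w by auto
    have "ennreal (D w) \<le> (\<integral>\<^sup>+x. ennreal \<bar>f x - V x\<bar> + ennreal \<bar>w x - V x\<bar> \<partial>lborel)"
      unfolding Dnn[OF w(1)] by (intro nn_integral_mono) (simp add: ennreal_plus[symmetric] ennreal_leI del: ennreal_plus)
    also have "\<dots> = ennreal (D V) + (\<integral>\<^sup>+x. ennreal \<bar>w x - V x\<bar> \<partial>lborel)"
      unfolding Dnn[OF w(2)] by (rule nn_integral_add) measurable
    also have "\<dots> \<le> ennreal (D V) + ennreal b" by (intro add_left_mono w)
    also have "\<dots> = ennreal (D V + b)" using D0 \<open>b \<ge> 0\<close> by simp
    finally show ?thesis using D0[of V] \<open>b \<ge> 0\<close> by (subst (asm) ennreal_le_iff) auto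
  qed
  obtain B where B: "B > 0" "\<And>k. \<tau> k \<le> B"
    using convergent_imp_Bseq[OF convergentI[OF \<tau>(2)]] unfolding Bseq_def real_norm_def by (metis abs_le_D1)
  \<comment> \<open>The competitor 0, for which \<open>K\<close> vanishes, bounds \<open>K\<close>
    along the whole sequence.\<close>
  define c where "c = \<Lambda> * D (\<lambda>x. 0) + B"
  have c: "c > 0" using B D0 \<open>\<Lambda> > 0\<close> by (simp add: c_def add_nonneg_pos)
  have Kc: "K (\<delta> k) \<Omega> (U k) \<le> ennreal c" for k
  proof -
    have "K (\<delta> k) \<Omega> (U k) \<le> K (\<delta> k) \<Omega> (U k) + ennreal (\<Lambda> * D (U k))" by simp
    also have "\<dots> \<le> ennreal (\<Lambda> * D (\<lambda>x. 0)) + ennreal (\<tau> k)" using near[of "\<lambda>x. 0" k] by (simp add: K_zero)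
    also have "\<dots> \<le> ennreal (\<Lambda> * D (\<lambda>x. 0)) + ennreal B" by (intro add_left_mono ennreal_leI B)
    also have "\<dots> = ennreal c" using B D0 \<open>\<Lambda> > 0\<close> by (simp add: c_def)
    finally show ?thesis .
  qed
  have M': "(\<integral>x. \<bar>U k x\<bar> \<partial>lborel) \<le> max M 1" for k using M[of k] by simp
  have max1: "max M 1 > 0" by simp
  obtain r u' where r: "strict_mono r" and u': "integrable lborel u'"
    and ae: "AE x in lborel. x \<in> \<Omega> \<longrightarrow> (\<lambda>k. U (r k) x) \<longlonglongrightarrow> u' x"
    and lim: "(\<lambda>k. \<integral>\<^sup>+x. ennreal (infdist x (- \<Omega>) * \<bar>U (r k) x - u' x\<bar>) \<partial>lborel) \<longlonglongrightarrow> 0"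
    using K_bounded_compact[OF \<Omega> U(1) M' max1 \<delta> Kc c] by blast
  \<comment> \<open>Since all \<open>U k\<close> vanish outside \<Omega>, this cut gives almost
    everywhere convergence on the whole space, as Scheffe's lemma requires.\<close>
  define u where "u = (\<lambda>x. indicator \<Omega> x * u' x)"
  have u: "integrable lborel u" unfolding u_def using integrable_mult_indicator[OF _ u', of \<Omega>] by simp
  have ub[measurable]: "u \<in> borel_measurable borel" using u by auto
  have ae: "AE x in lborel. (\<lambda>k. U (r k) x) \<longlonglongrightarrow> u x"
    using ae by eventually_elim (auto simp: u_def indicator_def U(2))
  have "infdist x (- \<Omega>) * \<bar>U k x - u' x\<bar> = infdist x (- \<Omega>) * \<bar>U k x - u x\<bar>" for k x
    by (cases "x \<in> \<Omega>") (auto simp: u_def)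
  with lim have lim: "(\<lambda>k. \<integral>\<^sup>+x. ennreal (infdist x (- \<Omega>) * \<bar>U (r k) x - u x\<bar>) \<partial>lborel) \<longlonglongrightarrow> 0" by simp
  have \<delta>r: "(\<delta> \<circ> r) \<longlonglongrightarrow> 0" and \<tau>r: "(\<tau> \<circ> r) \<longlonglongrightarrow> 0"
    using \<delta> \<tau> r by (auto intro: LIMSEQ_subseq_LIMSEQ)
  define a where "a k = enn2real (K (\<delta> (r k)) \<Omega> (U (r k)))" for k
  have a: "K (\<delta> (r k)) \<Omega> (U (r k)) = ennreal (a k)" "a k \<ge> 0" for k
    unfolding a_def using order.strict_trans1[OF Kc ennreal_less_top] by (auto simp: less_top)
  have upper: "\<forall>\<^sub>F k in sequentially. a k + \<Lambda> * D (U (r k)) \<le> T / 4 + \<Lambda> * D V + \<kappa>"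
    if V: "integrable lborel V" and T: "total_variation \<Omega> V = ennreal T" "T \<ge> 0" and \<kappa>: "\<kappa> > 0" for V T \<kappa>
  proof -
    \<comment> \<open>A recovery function errs by \<open>k'\<close> in \<open>K\<close> and by
      \<open>\<Lambda> * k'\<close> in the fidelity term, together half of \<kappa>; the other half
      is left for \<tau>.\<close>
    define k' where "k' = \<kappa> / 2 / (1 + \<Lambda>)"
    have "1 + \<Lambda> \<noteq> 0" using \<open>\<Lambda> > 0\<close> by simp
    then have k': "k' > 0" "(1 + \<Lambda>) * k' = \<kappa> / 2"
      using \<kappa> \<open>\<Lambda> > 0\<close> unfolding k'_def by (simp, metis nonzero_mult_div_cancel_left times_divide_eq_right)
    obtain d where d: "d > 0" "\<And>\<delta>. 0 < \<delta> \<Longrightarrow> \<delta> < d \<Longrightarrow> \<exists>w. integrable lborel w \<and>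
        K \<delta> \<Omega> w \<le> total_variation \<Omega> V / 4 + ennreal k' \<and> (\<integral>\<^sup>+x. ennreal \<bar>w x - V x\<bar> \<partial>lborel) \<le> ennreal k'"
      using K_recovery[OF \<Omega> V _ k'(1)] T by auto
    have "\<forall>\<^sub>F k in sequentially. \<delta> (r k) < d" "\<forall>\<^sub>F k in sequentially. \<tau> (r k) < \<kappa> / 2"
      using order_tendstoD(2)[OF \<delta>r, of d] order_tendstoD(2)[OF \<tau>r, of "\<kappa> / 2"] d \<kappa> by auto
    then show ?thesis
    proof eventually_elim
      case (elim k)
      obtain w where w: "integrable lborel w" "K (\<delta> (r k)) \<Omega> w \<le> total_variation \<Omega> V / 4 + ennreal k'"
        "(\<integral>\<^sup>+x. ennreal \<bar>w x - V x\<bar> \<partial>lborel) \<le> ennreal k'"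
        using d(2)[OF \<delta>(1) elim(1)] by auto
      have Kw: "K (\<delta> (r k)) \<Omega> w \<le> ennreal (T / 4 + k')"
        using w(2) T(2) k'(1) by (simp add: T(1) ennreal_divide_numeral)
      have Dw: "D w \<le> D V + k'" using Dtri[OF w(1) V w(3)] k'(1) by simp
      have "ennreal (a k + \<Lambda> * D (U (r k))) \<le> ennreal (T / 4 + k') + ennreal (\<Lambda> * D w) + ennreal (\<tau> (r k))"
        using order_trans[OF near[OF w(1), of "r k"] add_right_mono[OF add_right_mono[OF Kw]]] a D0 \<open>\<Lambda> > 0\<close> by simp
      also have "\<dots> = ennreal (T / 4 + k' + \<Lambda> * D w + \<tau> (r k))"
        using T(2) k'(1) D0 \<open>\<Lambda> > 0\<close> \<tau>(1)[of "r k"] by simp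
      finally have "a k + \<Lambda> * D (U (r k)) \<le> T / 4 + k' + \<Lambda> * D w + \<tau> (r k)"
        using T(2) k'(1) D0[of w] \<open>\<Lambda> > 0\<close> \<tau>(1)[of "r k"] by (subst (asm) ennreal_le_iff) auto
      moreover have "\<Lambda> * D w \<le> \<Lambda> * (D V + k')" using Dw \<open>\<Lambda> > 0\<close> by simp
      ultimately show ?case using k'(2) elim(2) by (simp add: algebra_simps)
    qed
  qed
  have fatou: "\<forall>\<^sub>F k in sequentially. D u \<le> D (U (r k)) + \<kappa>" if "\<kappa> > 0" for \<kappa>
  \<comment> \<open>The strict inequality between \<open>ennreal (D u - \<kappa>)\<close> and
    \<open>ennreal (D u)\<close> used below needs \<open>D u > 0\<close>, because
    \<open>ennreal\<close> cuts negative numbers off at 0.\<close>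
  proof (cases "D u = 0")
    case True
    then show ?thesis using D0 that by (simp add: add_nonneg_nonneg)
  next
    case False
    then have "D u > 0" using D0[of u] by linarith
    have "ennreal (D u) = (\<integral>\<^sup>+x. liminf (\<lambda>k. ennreal \<bar>f x - U (r k) x\<bar>) \<partial>lborel)"
      unfolding Dnn[OF u]
    proof (rule nn_integral_cong_AE)
      show "AE x in lborel. ennreal \<bar>f x - u x\<bar> = liminf (\<lambda>k. ennreal \<bar>f x - U (r k) x\<bar>)"
        using ae
      proof eventually_elim
        case (elim x)
        then have "(\<lambda>k. ennreal \<bar>f x - U (r k) x\<bar>) \<longlonglongrightarrow> ennreal \<bar>f x - u x\<bar>" by (intro tendsto_intros)
        then show ?case by (rule lim_imp_Liminf[OF sequentially_bot, symmetric])
      qed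
    qed
    also have "\<dots> \<le> liminf (\<lambda>k. \<integral>\<^sup>+x. ennreal \<bar>f x - U (r k) x\<bar> \<partial>lborel)"
      by (rule nn_integral_liminf) measurable
    also have "\<dots> = liminf (\<lambda>k. ennreal (D (U (r k))))" by (simp add: Dnn U)
    finally have le: "ennreal (D u) \<le> liminf (\<lambda>k. ennreal (D (U (r k))))" .
    have "ennreal (D u - \<kappa>) < ennreal (D u)" using that \<open>D u > 0\<close> by (simp add: ennreal_lessI)
    then have "\<forall>\<^sub>F k in sequentially. ennreal (D (U (r k))) > ennreal (D u - \<kappa>)"
      using le by (intro less_LiminfD) (rule order.strict_trans2)
    then show ?thesis
    proof eventually_elim
      case (elim k)
      then show ?case using D0[of "U (r k)"] by (cases "D u - \<kappa> \<ge> 0") (auto simp: ennreal_less_iff)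
    qed
  qed
  have TV: "total_variation \<Omega> u \<le> ennreal (4 * c')" if c': "c' \<ge> 0" "\<And>N. \<exists>k\<ge>N. a k \<le> c'" for c'
  proof -
    \<comment> \<open>Infinitely many small values form a subsequence on which \<open>K\<close> is
      bounded by \<open>c'\<close> throughout, as \<open>TV_le_liminf_K\<close> requires.\<close>
    have "infinite {k. a k \<le> c'}" using c'(2) by (auto simp: infinite_nat_iff_unbounded_le)
    from infinite_enumerate[OF this] obtain s :: "nat \<Rightarrow> nat" where s: "strict_mono s" "\<And>k. a (s k) \<le> c'" unfolding mem_Collect_eq by blast
    show ?thesis
    proof (rule TV_le_liminf_K[where U = "\<lambda>k. U (r (s k))" and \<delta> = "\<lambda>k. \<delta> (r (s k))", OF \<Omega> U(1) u _ \<delta>(1) _ _ c'(1)])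
      show "(\<lambda>k. \<integral>\<^sup>+x. ennreal (infdist x (- \<Omega>) * \<bar>U (r (s k)) x - u x\<bar>) \<partial>lborel) \<longlonglongrightarrow> 0"
        using LIMSEQ_subseq_LIMSEQ[OF lim s(1)] by (simp add: o_def)
      show "(\<lambda>k. \<delta> (r (s k))) \<longlonglongrightarrow> 0" using LIMSEQ_subseq_LIMSEQ[OF \<delta>r s(1)] by (simp add: o_def)
      show "K (\<delta> (r (s k))) \<Omega> (U (r (s k))) \<le> ennreal c'" for k unfolding a(1) by (rule ennreal_leI[OF s(2)])
    qed
  qed
  have "a k \<le> c" for k using Kc[of "r k"] c unfolding a(1) by (simp add: ennreal_le_iff)
  then have "total_variation \<Omega> u \<le> ennreal (4 * c)" using TV[of c] c by auto
  then have fin: "total_variation \<Omega> u < \<infinity>" by (simp add: order.strict_trans1)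
  then obtain T0 where T0: "total_variation \<Omega> u = ennreal T0" "T0 \<ge> 0" by (cases "total_variation \<Omega> u") auto
  have lower: "\<forall>\<^sub>F k in sequentially. T0 / 4 - \<kappa> \<le> a k" if "\<kappa> > 0" for \<kappa>
  proof (rule ccontr)
    assume "\<not> ?thesis"
    \<comment> \<open>Otherwise \<open>a\<close> falls below \<open>T0 / 4 - \<kappa>\<close>
      infinitely often, and the total variation of \<open>u\<close> would be at most
      \<open>T0 - 4 * \<kappa>\<close>.\<close>
    then have e: "\<exists>k\<ge>N. a k < T0 / 4 - \<kappa>" for N unfolding eventually_sequentially not_ex not_all by (metis not_le)
    then have n: "T0 / 4 - \<kappa> \<ge> 0" using a(2) by (metis less_imp_le order.trans)
    have "total_variation \<Omega> u \<le> ennreal (4 * (T0 / 4 - \<kappa>))" using TV[OF n] e by (meson less_imp_le)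
    then show False using n that by (simp add: T0(1) ennreal_le_iff)
  qed
  have min: "total_variation \<Omega> u / 4 + ennreal (\<Lambda> * D u) \<le> total_variation \<Omega> V / 4 + ennreal (\<Lambda> * D V)"
    if V: "integrable lborel V" "total_variation \<Omega> V < \<infinity>" for V
  proof -
    obtain T where T: "total_variation \<Omega> V = ennreal T" "T \<ge> 0" using V(2) by (cases "total_variation \<Omega> V") auto
    have "T0 / 4 + \<Lambda> * D u \<le> T / 4 + \<Lambda> * D V"
    proof (rule field_le_epsilon)
      fix e :: real assume "e > 0"
      \<comment> \<open>The upper and the lower bound cost \<kappa> each, and Fatou costs
        \<open>\<Lambda> * \<kappa>\<close>.\<close>
      define \<kappa> where "\<kappa> = e / (2 + \<Lambda>)"
      have "2 + \<Lambda> \<noteq> 0" using \<open>\<Lambda> > 0\<close> by simp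
      then have \<kappa>: "\<kappa> > 0" "(2 + \<Lambda>) * \<kappa> = e" using \<open>e > 0\<close> \<open>\<Lambda> > 0\<close> by (simp_all add: \<kappa>_def)
      from eventually_conj[OF upper[OF V(1) T \<kappa>(1)] eventually_conj[OF fatou[OF \<kappa>(1)] lower[OF \<kappa>(1)]]]
      obtain k where k: "a k + \<Lambda> * D (U (r k)) \<le> T / 4 + \<Lambda> * D V + \<kappa>" "D u \<le> D (U (r k)) + \<kappa>" "T0 / 4 - \<kappa> \<le> a k"
        by (auto dest: eventually_happens)
      have "\<Lambda> * D u \<le> \<Lambda> * (D (U (r k)) + \<kappa>)" using k(2) \<open>\<Lambda> > 0\<close> by simp
      then show "T0 / 4 + \<Lambda> * D u \<le> T / 4 + \<Lambda> * D V + e" using k \<kappa>(2) by (simp add: algebra_simps)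
    qed
    then have "ennreal (T0 / 4 + \<Lambda> * D u) \<le> ennreal (T / 4 + \<Lambda> * D V)" by (rule ennreal_leI)
    then show ?thesis using T T0 D0 \<open>\<Lambda> > 0\<close> by (simp add: ennreal_divide_numeral)
  qed
  \<comment> \<open>With \<open>u\<close> as its own competitor, the lower bound for
    \<open>K\<close> leaves the fidelity term no room to exceed its value at \<open>u\<close>. The
    two errors of \<open>\<Lambda> * e / 2\<close> add up to \<open>\<Lambda> * e\<close>.\<close>
  have "limsup (\<lambda>k. ennreal (D (U (r k)))) \<le> ennreal (D u)"
  proof (rule ennreal_le_epsilon)
    fix e :: real assume "e > 0"
    define \<kappa> where "\<kappa> = \<Lambda> * e / 2"
    have \<kappa>: "\<kappa> > 0" using \<open>e > 0\<close> \<open>\<Lambda> > 0\<close> by (simp add: \<kappa>_def)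
    have "\<forall>\<^sub>F k in sequentially. ennreal (D (U (r k))) \<le> ennreal (D u) + ennreal e"
      using upper[OF u T0 \<kappa>] lower[OF \<kappa>]
    proof eventually_elim
      case (elim k)
      then have "\<Lambda> * D (U (r k)) \<le> \<Lambda> * (D u + e)" by (simp add: \<kappa>_def algebra_simps)
      then have "D (U (r k)) \<le> D u + e" using \<open>\<Lambda> > 0\<close> by simp
      then show ?case using D0 \<open>e > 0\<close> by (simp add: ennreal_leI flip: ennreal_plus)
    qed
    then show "limsup (\<lambda>k. ennreal (D (U (r k)))) \<le> ennreal (D u) + ennreal e" by (rule Limsup_bounded)
  qed
  moreover have "AE x in lborel. (\<lambda>k. f x - U (r k) x) \<longlonglongrightarrow> f x - u x"
    using ae by eventually_elim (intro tendsto_intros)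
  ultimately have "(\<lambda>k. \<integral>\<^sup>+x. norm ((f x - U (r k) x) - (f x - u x)) \<partial>lborel) \<longlonglongrightarrow> 0"
    by (intro Scheffe_lemma1) (auto simp: Dnn U u f)
  then have "(\<lambda>k. \<integral>\<^sup>+x. ennreal \<bar>U (r k) x - u x\<bar> \<partial>lborel) \<longlonglongrightarrow> 0" by (simp add: abs_minus_commute)
  then have "(\<lambda>k. ennreal (\<integral>x. \<bar>U (r k) x - u x\<bar> \<partial>lborel)) \<longlonglongrightarrow> ennreal 0"
    using U u by (subst (asm) nn_integral_eq_integral) auto
  then have "(\<lambda>k. \<integral>x. \<bar>U (r k) x - u x\<bar> \<partial>lborel) \<longlonglongrightarrow> 0" by (subst (asm) tendsto_ennreal_iff) auto
  with r u fin min show ?thesis by (intro exI[of _ r] exI[of _ u]) (auto simp: u_def)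
qed

lemma L1_representative_supported:
  fixes v :: "real ^ 'n \<Rightarrow> real"
  assumes "open \<Omega>" "v \<in> L1 \<Omega>"
  shows "\<exists>V. integrable lborel V \<and> (\<forall>x. x \<notin> \<Omega> \<longrightarrow> V x = 0) \<and> (AE x in lborel. x \<in> \<Omega> \<longrightarrow> v x = V x)"
proof -
  obtain V where V: "integrable lborel V" "AE x in lborel. x \<in> \<Omega> \<longrightarrow> v x = V x"
    using L1_borel_representative[OF assms] by blast
  have "integrable lborel (\<lambda>x. indicator \<Omega> x * V x)"
    using integrable_mult_indicator[OF _ V(1), of \<Omega>] assms by simp
  moreover have "AE x in lborel. x \<in> \<Omega> \<longrightarrow> v x = indicator \<Omega> x * V x" using V(2) by eventually_elim auto
  ultimately show ?thesis by (intro exI[of _ "\<lambda>x. indicator \<Omega> x * V x"]) auto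
qed

lemma L1_dist_supported:
  fixes f v F V :: "real ^ 'n \<Rightarrow> real"
  assumes "open \<Omega>" "f \<in> L1 \<Omega>" "v \<in> L1 \<Omega>" "integrable lborel F" "integrable lborel V"
    and "AE x in lborel. x \<in> \<Omega> \<longrightarrow> f x = F x" "AE x in lborel. x \<in> \<Omega> \<longrightarrow> v x = V x"
    and supp: "\<And>x. x \<notin> \<Omega> \<Longrightarrow> F x = 0" "\<And>x. x \<notin> \<Omega> \<Longrightarrow> V x = 0"
  shows "L1_dist \<Omega> f v = (\<integral>x. \<bar>F x - V x\<bar> \<partial>lborel)"
  unfolding L1_dist_lborel[OF assms(1-7)]
  by (rule Bochner_Integration.integral_cong) (use supp in \<open>auto simp: indicator_def\<close>)

text \<open>\<open>K\<close>, the total variation and \<open>L1_dist\<close> depend only on the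
  almost everywhere class on \<Omega>, so all functions may be replaced by Borel representatives
  vanishing outside \<Omega>.\<close>

lemma L1_near_minimizers_subconverge:
  fixes v :: "nat \<Rightarrow> real ^ 'n \<Rightarrow> real"
  assumes \<Omega>: "open \<Omega>" "bounded \<Omega>" and "\<Lambda> > 0" and f: "f \<in> L1 \<Omega>"
    and \<delta>: "\<And>k. \<delta> k > 0" "\<delta> \<longlonglongrightarrow> 0" and \<tau>: "\<And>k. \<tau> k > 0" "\<tau> \<longlonglongrightarrow> 0"
    and v: "\<And>k. v k \<in> L1 \<Omega>" and M: "\<And>k. (LINT x:\<Omega>|lebesgue. \<bar>v k x\<bar>) \<le> M"
    and near: "\<And>k. F\<^sub>\<delta> \<Lambda> f (\<delta> k) \<Omega> (v k) \<le> (INF w\<in>L1 \<Omega>. F\<^sub>\<delta> \<Lambda> f (\<delta> k) \<Omega> w) + ennreal (\<tau> k)"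
  shows "\<exists>r u. strict_mono r \<and> u \<in> BV \<Omega> \<and> (\<lambda>k. L1_dist \<Omega> (v (r k)) u) \<longlonglongrightarrow> 0 \<and>
    (\<forall>w\<in>BV \<Omega>. F \<Lambda> f \<Omega> u \<le> F \<Lambda> f \<Omega> w)"
proof -
  obtain G where G: "integrable lborel G" "\<And>x. x \<notin> \<Omega> \<Longrightarrow> G x = 0" "AE x in lborel. x \<in> \<Omega> \<longrightarrow> f x = G x"
    using L1_representative_supported[OF \<Omega>(1) f] by blast
  obtain U where U: "\<And>k. integrable lborel (U k)" "\<And>k x. x \<notin> \<Omega> \<Longrightarrow> U k x = 0" "\<And>k. AE x in lborel. x \<in> \<Omega> \<longrightarrow> v k x = U k x"
    using L1_representative_supported[OF \<Omega>(1) v] by metis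
  let ?D = "\<lambda>w. \<integral>x. \<bar>G x - w x\<bar> \<partial>lborel"
  have UL: "U k \<in> L1 \<Omega>" for k by (rule integrable_imp_L1[OF \<Omega>(1) U(1)])
  have distU: "L1_dist \<Omega> f (v k) = ?D (U k)" for k
    by (rule L1_dist_supported[OF \<Omega>(1) f v G(1) U(1) G(3) U(3) G(2) U(2)])
  have zL: "(\<lambda>x. 0) \<in> L1 \<Omega>" by (rule integrable_imp_L1[OF \<Omega>(1)]) simp
  have MU: "(\<integral>x. \<bar>U k x\<bar> \<partial>lborel) \<le> M" for k
    using M[of k] L1_dist_supported[OF \<Omega>(1) v zL U(1) _ U(3) _ U(2), of "\<lambda>x. 0" k] by (simp add: L1_dist_def)
  have near': "K (\<delta> k) \<Omega> (U k) + ennreal (\<Lambda> * ?D (U k)) \<le> K (\<delta> k) \<Omega> w + ennreal (\<Lambda> * ?D w) + ennreal (\<tau> k)"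
    if w: "integrable lborel w" for k w
  proof -
    have wL: "w \<in> L1 \<Omega>" by (rule integrable_imp_L1[OF \<Omega>(1) w])
    have "K (\<delta> k) \<Omega> (U k) + ennreal (\<Lambda> * ?D (U k)) = F\<^sub>\<delta> \<Lambda> f (\<delta> k) \<Omega> (v k)"
      by (simp add: F\<^sub>\<delta>_def distU K_cong[OF v UL U(3)])
    also have "\<dots> \<le> F\<^sub>\<delta> \<Lambda> f (\<delta> k) \<Omega> w + ennreal (\<tau> k)"
      by (rule order_trans[OF near]) (intro add_right_mono INF_lower wL)
    also have "\<dots> \<le> K (\<delta> k) \<Omega> w + ennreal (\<Lambda> * ?D w) + ennreal (\<tau> k)"
    proof -
      \<comment> \<open>The competitor \<open>w\<close> may be nonzero outside \<Omega>. Then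
        \<open>?D w\<close> only grows, which is the harmless direction.\<close>
      have "L1_dist \<Omega> f w = (\<integral>x. indicator \<Omega> x * \<bar>G x - w x\<bar> \<partial>lborel)"
        by (rule L1_dist_lborel[OF \<Omega>(1) f wL G(1) w G(3)]) simp
      also have "\<dots> \<le> ?D w"
        using G(1) w \<Omega>(1) integrable_mult_indicator[of \<Omega> lborel "\<lambda>x. \<bar>G x - w x\<bar>"]
        by (intro integral_mono) (auto simp: indicator_def)
      finally show ?thesis unfolding F\<^sub>\<delta>_def using \<open>\<Lambda> > 0\<close> by (intro add_mono ennreal_leI) auto
    qed
    finally show ?thesis .
  qed
  obtain r u where r: "strict_mono r" and u: "integrable lborel u" "\<And>x. x \<notin> \<Omega> \<Longrightarrow> u x = 0"
    and fin: "total_variation \<Omega> u < \<infinity>" and lim: "(\<lambda>k. \<integral>x. \<bar>U (r k) x - u x\<bar> \<partial>lborel) \<longlonglongrightarrow> 0"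
    and min: "\<And>V. integrable lborel V \<Longrightarrow> total_variation \<Omega> V < \<infinity> \<Longrightarrow>
      total_variation \<Omega> u / 4 + ennreal (\<Lambda> * ?D u) \<le> total_variation \<Omega> V / 4 + ennreal (\<Lambda> * ?D V)"
    using near_minimizers_subconverge[OF \<Omega> \<open>\<Lambda> > 0\<close> G(1) U(1,2) MU \<delta> \<tau> near'] by blast
  have uL: "u \<in> L1 \<Omega>" by (rule integrable_imp_L1[OF \<Omega>(1) u(1)])
  have "F \<Lambda> f \<Omega> u \<le> F \<Lambda> f \<Omega> w" if w: "w \<in> BV \<Omega>" for w
  proof -
    have wL: "w \<in> L1 \<Omega>" and wf: "total_variation \<Omega> w < \<infinity>" using w by (auto simp: BV_def)
    obtain V where V: "integrable lborel V" "\<And>x. x \<notin> \<Omega> \<Longrightarrow> V x = 0" "AE x in lborel. x \<in> \<Omega> \<longrightarrow> w x = V x"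
      using L1_representative_supported[OF \<Omega>(1) wL] by blast
    have tv: "total_variation \<Omega> w = total_variation \<Omega> V"
      by (rule TV_cong[OF \<Omega>(1) wL integrable_imp_L1[OF \<Omega>(1) V(1)] V(3)])
    have "L1_dist \<Omega> f w = ?D V" by (rule L1_dist_supported[OF \<Omega>(1) f wL G(1) V(1) G(3) V(3) G(2) V(2)])
    moreover have "L1_dist \<Omega> f u = ?D u" by (rule L1_dist_supported[OF \<Omega>(1) f uL G(1) u(1) G(3) _ G(2) u(2)]) simp
    ultimately show ?thesis using min[OF V(1)] wf by (simp add: F_def tv)
  qed
  moreover have "L1_dist \<Omega> (v k) u = (\<integral>x. \<bar>U k x - u x\<bar> \<partial>lborel)" for k
    by (rule L1_dist_supported[OF \<Omega>(1) v uL U(1) u(1) U(3) _ U(2) u(2)]) simp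
  ultimately show ?thesis using r lim fin uL by (intro exI[of _ r] exI[of _ u]) (auto simp: BV_def)
qed

text \<open>The parameter \<epsilon> ranges over a set \<open>E\<close> accumulating at 0. A
  sequence in \<open>E\<close> tending to 0 is fixed first, and the convergent subsequence is taken
  from it.\<close>

theorem theorem4p1:
  fixes \<Omega> :: "(real ^ 'n) set" and \<Lambda> :: real and f :: "real ^ 'n \<Rightarrow> real"
    and E :: "real set" and \<delta> \<tau> :: "real \<Rightarrow> real" and u :: "real \<Rightarrow> real ^ 'n \<Rightarrow> real"
  assumes "open \<Omega>" and "bounded \<Omega>" and "smooth_boundary \<Omega>"
    and "\<Lambda> > 0" and "f \<in> L1 \<Omega>"
    and "E \<subseteq> {0<..}" and "0 islimpt E"
    and "\<And>\<epsilon>. \<epsilon> \<in> E \<Longrightarrow> \<delta> \<epsilon> > 0" and "(\<delta> \<longlongrightarrow> 0) (at 0 within E)"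
    and "\<And>\<epsilon>. \<epsilon> \<in> E \<Longrightarrow> \<tau> \<epsilon> > 0" and "(\<tau> \<longlongrightarrow> 0) (at 0 within E)"
    and "\<And>\<epsilon>. \<epsilon> \<in> E \<Longrightarrow> u \<epsilon> \<in> L1 \<Omega>"
    and "\<exists>M. \<forall>\<epsilon>\<in>E. (LINT x:\<Omega>|lebesgue. \<bar>u \<epsilon> x\<bar>) \<le> M"
    and "\<And>\<epsilon>. \<epsilon> \<in> E \<Longrightarrow>
           F\<^sub>\<delta> \<Lambda> f (\<delta> \<epsilon>) \<Omega> (u \<epsilon>) \<le> (INF v\<in>L1 \<Omega>. F\<^sub>\<delta> \<Lambda> f (\<delta> \<epsilon>) \<Omega> v) + ennreal (\<tau> \<epsilon>)"
  shows "\<exists>e u0. (\<forall>k::nat. e k \<in> E) \<and> e \<longlonglongrightarrow> 0 \<and>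
           u0 \<in> L1 \<Omega> \<and> (\<lambda>k. L1_dist \<Omega> (u (e k)) u0) \<longlonglongrightarrow> 0 \<and>
           u0 \<in> BV \<Omega> \<and> (\<forall>v\<in>BV \<Omega>. F \<Lambda> f \<Omega> u0 \<le> F \<Lambda> f \<Omega> v)"
proof -
  obtain e where e: "\<And>k. e k \<in> E - {0}" "e \<longlonglongrightarrow> 0" using assms(7) unfolding islimpt_sequential by blast
  then have eE: "e k \<in> E" for k by auto
  \<comment> \<open>The filter excludes 0 itself; this is why the sequence was taken in
    \<open>E - {0}\<close>.\<close>
  have fl: "filterlim e (at 0 within E) sequentially" using e by (auto simp: filterlim_at)
  obtain M where M: "\<And>\<epsilon>. \<epsilon> \<in> E \<Longrightarrow> (LINT x:\<Omega>|lebesgue. \<bar>u \<epsilon> x\<bar>) \<le> M" using assms(13) by blast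
  obtain r u0 where r: "strict_mono r" "u0 \<in> BV \<Omega>" "(\<lambda>k. L1_dist \<Omega> (u (e (r k))) u0) \<longlonglongrightarrow> 0"
    "\<forall>w\<in>BV \<Omega>. F \<Lambda> f \<Omega> u0 \<le> F \<Lambda> f \<Omega> w"
    using L1_near_minimizers_subconverge[where v = "\<lambda>k. u (e k)" and \<delta> = "\<lambda>k. \<delta> (e k)" and \<tau> = "\<lambda>k. \<tau> (e k)",
        OF assms(1,2,4,5) assms(8)[OF eE] filterlim_compose[OF assms(9) fl] assms(10)[OF eE]
          filterlim_compose[OF assms(11) fl] assms(12)[OF eE] M[OF eE] assms(14)[OF eE]]
    by blast
  moreover have "(\<lambda>k. e (r k)) \<longlonglongrightarrow> 0" using LIMSEQ_subseq_LIMSEQ[OF e(2) r(1)] by (simp add: o_def)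
  ultimately show ?thesis using eE by (intro exI[of _ "\<lambda>k. e (r k)"] exI[of _ u0]) (auto simp: BV_def)
qed

end
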